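(* The coefficients $g^{\alpha\beta}$ of the intersection form and its Christoffel symbols $\Gamma_\gamma^{\alpha\beta}$ in the coordinates $t^0,t^1,\dots,t^n,v_{n+1},\tau$ belong to the ring $\widetilde E_{\bullet,\bullet}\left[t^0,t^1,\dots,t^n,\frac1{t^n}\right]$.
   Context: Let $n\ge 1$ and let $\mathbb H$ be the upper half-plane. Put $V=\{(v_0,\dots,v_n,v_{n+1})\in\mathbb C^{n+2}:\sum_{i=0}^n v_i=0\}\cong\mathbb C^{n+1}$ (coordinates $v_0,\dots,v_{n-1},v_{n+1}$), $L=V\cap\mathbb Z^{n+2}$, $\langle v,w\rangle=\sum_{i=0}^n v_iw_i-n(n+1)v_{n+1}w_{n+1}$, $\Omega=\mathbb C\times V\times\mathbb H\ni(u,v,\tau)$. Transformations of $\Omega$: (i) $w\in A_n=S_{n+1}$ permutes $v_0,\dots,v_n$; (ii) $t=(\lambda,\mu)\in L\times L$: $t(u,v,\tau)=(u-\langle\lambda,v\rangle-\tfrac12\langle\lambda,\lambda\rangle\tau,v+\lambda\tau+\mu,\tau)$; (iii) $\gamma=\begin{pmatrix}a&b\\c&d\end{pmatrix}\in SL_2(\mathbb Z)$: $\gamma(u,v,\tau)=\left(u+\frac{c\langle v,v\rangle}{2(c\tau+d)},\frac v{c\tau+d},\frac{a\tau+b}{c\tau+d}\right)$. A weak Jacobi form of weight $k$, order $l$, index $m$ is a function $\varphi$ on $\Omega$ invariant under (i),(ii), with $\varphi(\gamma(x))=(c\tau+d)^k\varphi(x)$ and $-\frac1{2\pi i}\partial_u\varphi=m\varphi$,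 such that (1) $\varphi$ is locally bounded in $v'=(v_0,\dots,v_{n-1})$ as $\operatorname{Im}\tau\to+\infty$; (2) for fixed $u,v',\tau$ it is meromorphic in $v_{n+1}$ with poles of order at most $l+2m$ on $(n+1)v_{n+1}\in\mathbb Z+\tau\mathbb Z$; (3) away from this divisor it is holomorphic in each $v_i$ ($i\le n-1$) and in $\tau$. $E_{\bullet,\bullet}=J_{\bullet,\bullet,0}$ is the ring of Jacobi forms of index $0$ (all weights and orders). $\theta_1(z,\tau)=2\sum_{m\ge0}(-1)^me^{\pi i\tau(m+1/2)^2}\sin((2m+1)\pi z)$; $\wp,\zeta$ are the Weierstrass functions of $\mathbb Z+\tau\mathbb Z$; $\theta_1'=\partial_z\theta_1$; $g_1=\eta'/\eta$ with $\eta$ the Dedekind eta function. $\widetilde E_{\bullet,\bullet}$ is the extension of $E_{\bullet,\bullet}$ generated by adjoining $g_1(\tau)$ and $\frac{\theta_1'((n+1)v_{n+1},\tau)}{\theta_1((n+1)v_{n+1},\tau)}$. The functions $\varphi_0,\dots,\varphi_n$ are defined by the identity in $z$: $e^{-2\pi iu}\frac{\prod_{i=0}^n\theta_1(z-v_i+v_{n+1},\tau)}{\theta_1^n(z,\tau)\theta_1(z+(n+1)v_{n+1},\tau)}=\sum_{k=2}^n\frac{(-1)^k}{(k-1)!}\varphi_k\wp^{(k-2)}(z)+\varphi_1[\zeta(z)-\zeta(z+(n+1)v_{n+1})+\zeta((n+1)v_{n+1})]+\varphi_0$, with $\varphi_k=0$ for $k>n$. Then $t^\alpha=\frac{n}{n+1-\alpha}\varphi_n^{\frac{n+1-\alpha}n}\sum_{d\ge0}\binom{\frac{n+1-\alpha}n}{d}\sum_{i_1+\dots+i_d=n-\alpha,\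 i_j\ge1}\frac{\varphi_{n-i_1}}{\varphi_n}\cdots\frac{\varphi_{n-i_d}}{\varphi_n}$ for $1\le\alpha\le n$ (for a chosen branch of $\varphi_n^{1/n}$) and $t^0=\varphi_0+\frac{\theta_1'((n+1)v_{n+1})}{\theta_1((n+1)v_{n+1})}\varphi_1+4\pi ig_1(\tau)\varphi_2$. The intersection form is $g^*=\sum_{i,j=0}^{n-1}(A^{-1})_{ij}\partial_{v_i}\otimes\partial_{v_j}-\frac1{n(n+1)}\partial_{v_{n+1}}\otimes\partial_{v_{n+1}}+\partial_u\otimes\partial_\tau+\partial_\tau\otimes\partial_u$, with $A$ the $n\times n$ matrix with $2$ on the diagonal and $1$ elsewhere. In coordinates $x$, $g^{\alpha\beta}=g^*(dx^\alpha,dx^\beta)$, and the (contravariant) Christoffel symbols are $\Gamma^{\alpha\beta}_\gamma=-g^{\alpha\sigma}\Gamma^\beta_{\sigma\gamma}$ with $\Gamma^\beta_{\sigma\gamma}$ those of the Levi-Civita connection of $g$. *)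

theory Defs
  imports "HOL-Complex_Analysis.Complex_Analysis" "HOL-Combinatorics.Permutations"
begin

text \<open>The natural number n of the text is \<open>CARD('n)\<close>, and the indices 0, ..., n-1 are represented by the
  elements of the finite type \<open>'n\<close>.\<close>

datatype 'n ambient = Low 'n | Vn | Vlast  \<comment> \<open>\<open>Vn\<close> is the index n, \<open>Vlast\<close> the index n+1\<close>
datatype 'n flat = Cu | Cv 'n | Cw | Ctau  \<comment> \<open>the coordinates u, \<open>v_i\<close> (i < n), \<open>v_{n+1}\<close>, \<tau> of \<Omega>\<close>
datatype 'n coord = XT "'n option" | XV | XTau
  \<comment> \<open>the coordinates \<open>t^0, ..., t^n\<close> (indexed by the (n+1)-element type \<open>'n option\<close>), \<open>v_{n+1}\<close>, \<tau>\<close>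

lemma UNIV_ambient: "(UNIV :: 'n ambient set) = range Low \<union> {Vn, Vlast}"
  by (rule UNIV_eq_I, rename_tac x, case_tac x) auto

lemma UNIV_flat: "(UNIV :: 'n flat set) = range Cv \<union> {Cu, Cw, Ctau}"
  by (rule UNIV_eq_I, rename_tac x, case_tac x) auto

lemma UNIV_coord: "(UNIV :: 'n coord set) = range XT \<union> {XV, XTau}"
  by (rule UNIV_eq_I, rename_tac x, case_tac x) auto

instance ambient :: (finite) finite
  by standard (simp add: UNIV_ambient)

instance flat :: (finite) finite
  by standard (simp add: UNIV_flat)

instance coord :: (finite) finite
  by standard (simp add: UNIV_coord)

type_synonym 'n point = "complex ^ 'n flat"


subsection \<open>Classical functions\<close>

definition lattice :: "complex \<Rightarrow> complex set" where
  "lattice \<tau> = {of_int a + of_int b * \<tau> | a b. True}"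

definition theta1 :: "complex \<Rightarrow> complex \<Rightarrow> complex" where
  "theta1 z \<tau> = 2 * (\<Sum>m. (-1) ^ m * exp (of_real pi * \<i> * \<tau> * (of_nat m + 1/2)\<^sup>2)
                            * sin ((2 * of_nat m + 1) * of_real pi * z))"

definition theta1' :: "complex \<Rightarrow> complex \<Rightarrow> complex" where
  "theta1' z \<tau> = deriv (\<lambda>w. theta1 w \<tau>) z"

definition wp :: "complex \<Rightarrow> complex \<Rightarrow> complex" where
  "wp z \<tau> = 1 / z\<^sup>2 + (\<Sum>\<^sub>\<infinity>\<omega>\<in>lattice \<tau> - {0}. 1 / (z - \<omega>)\<^sup>2 - 1 / \<omega>\<^sup>2)"

definition wzeta :: "complex \<Rightarrow> complex \<Rightarrow> complex" where
  "wzeta z \<tau> = 1 / z + (\<Sum>\<^sub>\<infinity>\<omega>\<in>lattice \<tau> - {0}. 1 / (z - \<omega>) + 1 / \<omega> + z / \<omega>\<^sup>2)"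

definition dedekind_eta :: "complex \<Rightarrow> complex" where
  "dedekind_eta \<tau> = exp (of_real pi * \<i> * \<tau> / 12)
                      * (\<Prod>m. 1 - exp (2 * of_real pi * \<i> * of_nat (Suc m) * \<tau>))"

definition g1 :: "complex \<Rightarrow> complex" where
  "g1 \<tau> = deriv dedekind_eta \<tau> / dedekind_eta \<tau>"


subsection \<open>The space \<Omega> and the transformations acting on it\<close>

definition Vspace :: "(complex ^ ('n::finite) ambient) set" where
  "Vspace = {v. (\<Sum>i\<in>UNIV - {Vlast}. v $ i) = 0}"

definition Lat :: "(complex ^ ('n::finite) ambient) set" where
  "Lat = {v \<in> Vspace. \<forall>i. v $ i \<in> \<int>}"

definition pairing :: "complex ^ ('n::finite) ambient \<Rightarrow> complex ^ 'n ambient \<Rightarrow> complex" where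
  "pairing v w = (\<Sum>i\<in>UNIV - {Vlast}. v $ i * w $ i)
                 - of_nat (CARD('n) * (CARD('n) + 1)) * v $ Vlast * w $ Vlast"

text \<open>\<open>vpart\<close> and \<open>mk_point\<close> translate between the coordinates \<open>v_0, ..., v_{n-1}, v_{n+1}\<close> and elements
  of \<open>V\<close>; on \<open>V\<close> the component \<open>v_n\<close> is determined by the others.\<close>

definition vpart :: "('n::finite) point \<Rightarrow> complex ^ 'n ambient" where
  "vpart x = (\<chi> i. case i of Low j \<Rightarrow> x $ Cv j | Vn \<Rightarrow> - (\<Sum>j\<in>UNIV. x $ Cv j) | Vlast \<Rightarrow> x $ Cw)"

definition mk_point :: "complex \<Rightarrow> complex ^ ('n::finite) ambient \<Rightarrow> complex \<Rightarrow> 'n point" where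
  "mk_point u v \<tau> = (\<chi> c. case c of Cu \<Rightarrow> u | Cv j \<Rightarrow> v $ Low j | Cw \<Rightarrow> v $ Vlast | Ctau \<Rightarrow> \<tau>)"

definition perm_act :: "('n ambient \<Rightarrow> 'n ambient) \<Rightarrow> ('n::finite) point \<Rightarrow> 'n point" where
  "perm_act w x = mk_point (x $ Cu) (\<chi> i. vpart x $ w i) (x $ Ctau)"

definition lat_act ::
  "complex ^ 'n ambient \<Rightarrow> complex ^ 'n ambient \<Rightarrow> ('n::finite) point \<Rightarrow> 'n point" where
  "lat_act p q x =
     mk_point (x $ Cu - pairing p (vpart x) - 1/2 * pairing p p * x $ Ctau)
              (vpart x + x $ Ctau *s p + q)
              (x $ Ctau)"

definition sl2_act :: "int \<Rightarrow> int \<Rightarrow> int \<Rightarrow> int \<Rightarrow> ('n::finite) point \<Rightarrow> 'n point" where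
  "sl2_act a b c d x =
     (let \<tau> = x $ Ctau; j = of_int c * \<tau> + of_int d in
      mk_point (x $ Cu + of_int c * pairing (vpart x) (vpart x) / (2 * j))
               ((1 / j) *s vpart x)
               ((of_int a * \<tau> + of_int b) / j))"

definition Omega :: "('n::finite) point set" where
  "Omega = {x. Im (x $ Ctau) > 0}"

text \<open>\<open>Vscaled\<close> is \<open>(n+1) v_{n+1}\<close>; the forms may have poles where it is a lattice point.\<close>

definition Vscaled :: "('n::finite) point \<Rightarrow> complex" where
  "Vscaled x = of_nat (CARD('n) + 1) * x $ Cw"

definition Omega_reg :: "('n::finite) point set" where
  "Omega_reg = {x \<in> Omega. Vscaled x \<notin> lattice (x $ Ctau)}"

definition upd :: "('n::finite) point \<Rightarrow> 'n flat \<Rightarrow> complex \<Rightarrow> 'n point" where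
  "upd x c z = (\<chi> c'. if c' = c then z else x $ c')"

definition partial :: "'n flat \<Rightarrow> (('n::finite) point \<Rightarrow> complex) \<Rightarrow> 'n point \<Rightarrow> complex" where
  "partial c f x = deriv (\<lambda>z. f (upd x c z)) (x $ c)"


subsection \<open>Jacobi forms\<close>

text \<open>A form is a total function whose values outside \<open>Omega_reg\<close> carry no information. In the
  boundedness condition, u and \<open>v_{n+1}\<close> are fixed and \<open>v_0, ..., v_{n-1}\<close> vary in a small polydisc.
  In the meromorphy condition, the order of a pole is read off from \<open>zorder\<close>, which is meaningless
  for a function vanishing identically near the point.\<close>

definition weak_jacobi_form :: "int \<Rightarrow> int \<Rightarrow> int \<Rightarrow> (('n::finite) point \<Rightarrow> complex) \<Rightarrow> bool" where
  "weak_jacobi_form k l m \<phi> \<longleftrightarrow>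
     (\<forall>x\<in>Omega_reg. \<forall>w. w permutes (UNIV - {Vlast}) \<longrightarrow> \<phi> (perm_act w x) = \<phi> x)
   \<and> (\<forall>x\<in>Omega_reg. \<forall>p\<in>Lat. \<forall>q\<in>Lat. \<phi> (lat_act p q x) = \<phi> x)
   \<and> (\<forall>x\<in>Omega_reg. \<forall>a b c d. a * d - b * c = 1 \<longrightarrow>
        \<phi> (sl2_act a b c d x) = (of_int c * x $ Ctau + of_int d) powi k * \<phi> x)
   \<and> (\<forall>x\<in>Omega_reg. (\<lambda>z. \<phi> (upd x Cu z)) field_differentiable at (x $ Cu)
        \<and> - (1 / (2 * of_real pi * \<i>)) * partial Cu \<phi> x = of_int m * \<phi> x)
   \<and> (\<forall>x0. \<exists>\<epsilon>>0. \<exists>B T. \<forall>x\<in>Omega_reg.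
        x $ Cu = x0 $ Cu \<and> x $ Cw = x0 $ Cw \<and> (\<forall>i. dist (x $ Cv i) (x0 $ Cv i) < \<epsilon>)
          \<and> Im (x $ Ctau) > T \<longrightarrow> norm (\<phi> x) \<le> B)
   \<and> (\<forall>x\<in>Omega. let f = (\<lambda>z. \<phi> (upd x Cw z)) in
        f meromorphic_on UNIV
        \<and> (\<forall>z. if Vscaled (upd x Cw z) \<in> lattice (x $ Ctau)
               then (\<exists>\<^sub>F y in at z. f y \<noteq> 0) \<longrightarrow> zorder f z \<ge> - (l + 2 * m)
               else f analytic_on {z}))
   \<and> (\<forall>x\<in>Omega_reg. \<forall>c\<in>range Cv \<union> {Ctau}.
        (\<lambda>z. \<phi> (upd x c z)) field_differentiable at (x $ c))"

inductive_set ring_gen :: "('a \<Rightarrow> complex) set \<Rightarrow> ('a \<Rightarrow> complex) set" for G where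
  gen: "f \<in> G \<Longrightarrow> f \<in> ring_gen G"
| one: "(\<lambda>x. 1) \<in> ring_gen G"
| diff: "\<lbrakk>f \<in> ring_gen G; h \<in> ring_gen G\<rbrakk> \<Longrightarrow> (\<lambda>x. f x - h x) \<in> ring_gen G"
| mult: "\<lbrakk>f \<in> ring_gen G; h \<in> ring_gen G\<rbrakk> \<Longrightarrow> (\<lambda>x. f x * h x) \<in> ring_gen G"

text \<open>A product of forms of index 0 is again one (weights and orders add up), so \<open>Ering\<close> consists
  of the finite sums of forms of index 0 of various weights and orders.\<close>

definition Ering :: "(('n::finite) point \<Rightarrow> complex) set" where
  "Ering = ring_gen {\<phi>. \<exists>k l. weak_jacobi_form k l 0 \<phi>}"

definition theta_quot :: "('n::finite) point \<Rightarrow> complex" where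
  "theta_quot x = theta1' (Vscaled x) (x $ Ctau) / theta1 (Vscaled x) (x $ Ctau)"

definition Etilde :: "(('n::finite) point \<Rightarrow> complex) set" where
  "Etilde = ring_gen (Ering \<union> {\<lambda>x. g1 (x $ Ctau), theta_quot})"


subsection \<open>The functions \<open>\<phi>_k\<close> and \<open>t^\<alpha>\<close>\<close>

definition phi_identity :: "(nat \<Rightarrow> ('n::finite) point \<Rightarrow> complex) \<Rightarrow> bool" where
  "phi_identity \<phi> \<longleftrightarrow>
     (\<forall>k>CARD('n). \<forall>x. \<phi> k x = 0)
   \<and> (\<forall>x\<in>Omega_reg. \<forall>z. let \<tau> = x $ Ctau; n = CARD('n) in
        z \<notin> lattice \<tau> \<and> z + Vscaled x \<notin> lattice \<tau> \<longrightarrow>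
        exp (- 2 * of_real pi * \<i> * x $ Cu)
          * (\<Prod>i\<in>UNIV - {Vlast}. theta1 (z - vpart x $ i + x $ Cw) \<tau>)
          / (theta1 z \<tau> ^ n * theta1 (z + Vscaled x) \<tau>)
        = (\<Sum>k=2..n. (-1) ^ k / fact (k - 1) * \<phi> k x * (deriv ^^ (k - 2)) (\<lambda>w. wp w \<tau>) z)
          + \<phi> 1 x * (wzeta z \<tau> - wzeta (z + Vscaled x) \<tau> + wzeta (Vscaled x) \<tau>)
          + \<phi> 0 x)"

text \<open>The \<open>d\<close>-tuples \<open>(i_1, ..., i_d)\<close> of positive integers with sum \<open>s\<close>.\<close>

definition compositions :: "nat \<Rightarrow> nat \<Rightarrow> nat list set" where
  "compositions d s = {is. length is = d \<and> sum_list is = s \<and> (\<forall>i\<in>set is. 1 \<le> i)}"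

text \<open>\<open>r\<close> is the chosen branch of the n-th root of \<open>\<phi>_n\<close>. The sum over \<open>d\<close> stops at \<open>n - \<alpha>\<close> because
  \<open>compositions d (n - \<alpha>)\<close> is empty for larger \<open>d\<close>.\<close>

definition tfun ::
  "(nat \<Rightarrow> ('n::finite) point \<Rightarrow> complex) \<Rightarrow> ('n point \<Rightarrow> complex) \<Rightarrow> nat \<Rightarrow> 'n point \<Rightarrow> complex" where
  "tfun \<phi> r \<alpha> x = (let n = CARD('n); e = of_nat (n + 1 - \<alpha>) / of_nat n in
     if \<alpha> = 0 then \<phi> 0 x + theta_quot x * \<phi> 1 x + 4 * of_real pi * \<i> * g1 (x $ Ctau) * \<phi> 2 x
     else of_nat n / of_nat (n + 1 - \<alpha>) * r x ^ (n + 1 - \<alpha>)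
          * (\<Sum>d=0..n - \<alpha>. (e gchoose d)
               * (\<Sum>is\<in>compositions d (n - \<alpha>). \<Prod>i\<leftarrow>is. \<phi> (n - i) x / \<phi> n x)))"

definition Tring ::
  "(nat \<Rightarrow> ('n::finite) point \<Rightarrow> complex) \<Rightarrow> ('n point \<Rightarrow> complex) \<Rightarrow> ('n point \<Rightarrow> complex) set" where
  "Tring \<phi> r = ring_gen (Etilde \<union> tfun \<phi> r ` {0..CARD('n)} \<union> {\<lambda>x. 1 / tfun \<phi> r CARD('n) x})"


subsection \<open>The intersection form and its Christoffel symbols\<close>

definition Amat :: "complex ^ ('n::finite) ^ 'n" where
  "Amat = (\<chi> i j. if i = j then 2 else 1)"

definition gstar :: "complex ^ ('n::finite) flat ^ 'n flat" where
  "gstar = (\<chi> a b. case (a, b) of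
       (Cv i, Cv j) \<Rightarrow> matrix_inv Amat $ i $ j
     | (Cw, Cw) \<Rightarrow> - 1 / of_nat (CARD('n) * (CARD('n) + 1))
     | (Cu, Ctau) \<Rightarrow> 1
     | (Ctau, Cu) \<Rightarrow> 1
     | _ \<Rightarrow> 0)"

text \<open>In the following a system of functions \<open>X\<close> on \<Omega>, indexed by \<open>'n coord\<close>, serves as local
  coordinate system wherever its Jacobian matrix is invertible.\<close>

definition jac :: "('n coord \<Rightarrow> ('n::finite) point \<Rightarrow> complex) \<Rightarrow> 'n point \<Rightarrow> complex ^ 'n flat ^ 'n coord" where
  "jac X x = (\<chi> \<alpha> a. partial a (X \<alpha>) x)"

definition gcon ::
  "('n coord \<Rightarrow> ('n::finite) point \<Rightarrow> complex) \<Rightarrow> 'n point \<Rightarrow> complex ^ 'n coord ^ 'n coord" where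
  "gcon X x = (\<chi> \<alpha> \<beta>. \<Sum>a\<in>UNIV. \<Sum>b\<in>UNIV. gstar $ a $ b * partial a (X \<alpha>) x * partial b (X \<beta>) x)"

definition gcov ::
  "('n coord \<Rightarrow> ('n::finite) point \<Rightarrow> complex) \<Rightarrow> 'n point \<Rightarrow> complex ^ 'n coord ^ 'n coord" where
  "gcov X x = matrix_inv (gcon X x)"

text \<open>The coordinate vector field of \<open>X \<sigma>\<close>, applied to a function \<open>f\<close>.\<close>

definition dcoord ::
  "('n coord \<Rightarrow> ('n::finite) point \<Rightarrow> complex) \<Rightarrow> 'n coord \<Rightarrow> ('n point \<Rightarrow> complex) \<Rightarrow> 'n point \<Rightarrow> complex" where
  "dcoord X \<sigma> f x = (\<Sum>a\<in>UNIV. matrix_inv (jac X x) $ a $ \<sigma> * partial a f x)"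

text \<open>\<open>levi_civita X \<beta> \<sigma> \<gamma>\<close> has upper index \<open>\<beta>\<close> and lower indices \<open>\<sigma>\<close>, \<open>\<gamma>\<close>.\<close>

definition levi_civita ::
  "('n coord \<Rightarrow> ('n::finite) point \<Rightarrow> complex) \<Rightarrow> 'n coord \<Rightarrow> 'n coord \<Rightarrow> 'n coord \<Rightarrow> 'n point \<Rightarrow> complex" where
  "levi_civita X \<beta> \<sigma> \<gamma> x =
     1/2 * (\<Sum>\<delta>\<in>UNIV. gcon X x $ \<beta> $ \<delta>
        * (dcoord X \<sigma> (\<lambda>y. gcov X y $ \<delta> $ \<gamma>) x + dcoord X \<gamma> (\<lambda>y. gcov X y $ \<delta> $ \<sigma>) x
           - dcoord X \<delta> (\<lambda>y. gcov X y $ \<sigma> $ \<gamma>) x))"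

text \<open>\<open>christoffel X \<alpha> \<beta> \<gamma>\<close> has upper indices \<open>\<alpha>\<close>, \<open>\<beta>\<close> and lower index \<open>\<gamma>\<close>.\<close>

definition christoffel ::
  "('n coord \<Rightarrow> ('n::finite) point \<Rightarrow> complex) \<Rightarrow> 'n coord \<Rightarrow> 'n coord \<Rightarrow> 'n coord \<Rightarrow> 'n point \<Rightarrow> complex" where
  "christoffel X \<alpha> \<beta> \<gamma> x = - (\<Sum>\<sigma>\<in>UNIV. gcon X x $ \<alpha> $ \<sigma> * levi_civita X \<beta> \<sigma> \<gamma> x)"

text \<open>The bijection \<open>num\<close> from \<open>'n option\<close> onto 0, ..., n fixes which index carries which \<open>t^\<alpha>\<close>.\<close>

definition tcoord ::
  "('n option \<Rightarrow> nat) \<Rightarrow> (nat \<Rightarrow> ('n::finite) point \<Rightarrow> complex) \<Rightarrow> ('n point \<Rightarrow> complex)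
     \<Rightarrow> 'n coord \<Rightarrow> 'n point \<Rightarrow> complex" where
  "tcoord num \<phi> r c x = (case c of XT i \<Rightarrow> tfun \<phi> r (num i) x | XV \<Rightarrow> x $ Cw | XTau \<Rightarrow> x $ Ctau)"

end

theory Submission
 imports Defs
begin

text \<open>The generating quotient is \<open>\<Lambda>(z) = t\<^sup>0 + \<Sum>\<^sub>k \<phi>\<^sub>k c\<^sub>k(z)\<close>, the \<open>c\<^sub>k\<close> built from \<open>Z = \<theta>'/\<theta>\<close>. The heat equation and
 the addition theorem for \<open>Z\<close> give closed forms for the intersection form and the Christoffel
 pairing of \<open>\<Lambda>(z)\<close> and \<open>\<Lambda>(w)\<close>. Laurent coefficients in \<open>w\<close>, then \<open>z\<close>, put the pairings of the
 \<open>\<phi>\<^sub>k\<close> in the ring; the Leibniz rule passes to the \<open>t\<^sup>\<alpha>\<close>.\<close>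

text \<open>Modular forms enter at few places. The derivatives of the Weierstrass function at
  \<open>v = (n + 1) v\<^sub>n\<^sub>+\<^sub>1\<close> and the Taylor coefficients of order at least
  2 of \<open>Z(z) - 1/z\<close> are forms of index 0; what is only quasi-modular or quasi-periodic,
  the first Taylor coefficient and \<open>Z(v)\<close>, gives exactly the two generators adjoined in
  \<open>Etilde\<close>. In the pairing of two logarithmic gradients the heat constant and the
  factor \<open>- 2 pi i\<close> from u combine to -1/2, the coefficient that the addition theorem
  asks for, and its constant term cancels because numerator and denominator have n + 1 theta factors
  each. The metric is constant in the flat coordinates, so a Christoffel symbol is the pairing of a
  gradient with a Hessian contracted with a coordinate field. That field is never computed: the ring
  arguments use only its values on the coordinates, which are 0 or 1. Expansion arguments are run
  over several rings: functions differentiable in \<open>\<tau>\<close>, twice differentiable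
  functions on \<open>Omega_reg\<close>, and the target ring itself.\<close>

notation has_field_derivative (infix "hfd" 50)
notation holomorphic_on (infixl "holo" 50)
notation has_fps_expansion (infixl "hfps" 60)

section \<open>The theta series: convergence, heat equation, quasi-periodicity\<close>

definition kappa :: complex where "kappa = 1 / (4 * of_real pi * \<i>)"

definition theta_freq :: "nat => complex" where "theta_freq m = (2 * of_nat m + 1) * of_real pi * \<i>"

text \<open>The k-th z-derivative of the m-th summand of \<open>theta1\<close>, with the sine split
  into exponentials. In this form a tau-derivative multiplies by
  \<open>kappa * (theta_freq m)\<^sup>2\<close>, which is \<open>kappa\<close> times the effect of
  two z-derivatives, so the heat equation holds term by term. Accordingly \<open>theta k\<close> is
  the k-th z-derivative of \<open>theta1\<close>.\<close>

definition theta_term :: "nat => nat => complex => complex => complex" where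
 "theta_term k m z tau = (-1) ^ m * exp (kappa * (theta_freq m)\<^sup>2 * tau) / \<i>
   * (theta_freq m ^ k * exp (theta_freq m * z) - (- theta_freq m) ^ k * exp (- theta_freq m * z))"

definition theta :: "nat => complex => complex => complex" where
 "theta k z tau = (\<Sum>m. theta_term k m z tau)"

lemma kappa_freq: "kappa * (theta_freq m)\<^sup>2 = of_real pi * \<i> * (of_nat m + 1/2)\<^sup>2"
 unfolding kappa_def theta_freq_def by (simp add: field_simps power2_eq_square)

lemma theta_term_0:
 "theta_term 0 m z tau = 2 * ((-1) ^ m * exp (of_real pi * \<i> * tau * (of_nat m + 1/2)\<^sup>2)
              * sin ((2 * of_nat m + 1) * of_real pi * z))"
proof -
 have e: "\<i> * ((2 * of_nat m + 1) * of_real pi * z) = theta_freq m * z" "- (\<i> * ((2 * of_nat m + 1) * of_real pi * z)) = - theta_freq m * z"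
  by (auto simp: theta_freq_def)
 show ?thesis
  unfolding theta_term_def kappa_freq sin_exp_eq e
  by (simp add: field_simps)
qed

text \<open>Majorant for \<open>norm z <= R\<close> and \<open>Im tau >= y\<close>. The factorial
  and the extra 1 in \<open>R + 1\<close> absorb the factor \<open>a ^ k <= fact k * exp a\<close>
  produced by k derivatives, where \<open>a = (2 m + 1) pi\<close> is the frequency.\<close>

definition theta_bound :: "nat => real => real => nat => real" where
 "theta_bound k R y m = 2 * fact k * exp (- (pi * y * (real m + 1/2)\<^sup>2) + (2 * real m + 1) * pi * (R + 1))"

lemma summable_theta_bound: "y > 0 ==> summable (theta_bound k R y)"
proof -
 assume y: "y > 0"
 have "(%m. exp (- (pi * y * (real m + 1/2)\<^sup>2) + (2 * real m + 1) * pi * (R + 1))) : O(%m. 1 / (real m)\<^sup>2)"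
 proof -
  \<comment> \<open>The quadratic part of the exponent wins over the linear one: with the common
    factor \<open>m + 1/2\<close> pulled out, the exponent is eventually at most
    \<open>- pi * m\<close>.\<close>
  have "eventually (%m. (real m + 1/2) * (y * (real m + 1/2) - 2 * (R+1)) >= real m) sequentially"
  proof -
   have "eventually (%m. real m >= (1 + 2 * \<bar>R+1\<bar>) / y) sequentially"
    using eventually_ge_at_top[of "nat \<lceil>(1 + 2 * \<bar>R+1\<bar>) / y\<rceil>"] by eventually_elim linarith
   thus ?thesis
   proof eventually_elim
    case (elim m)
    hence "1 + 2 * \<bar>R+1\<bar> <= y * real m" using y by (simp add: field_simps)
    moreover have "2 * (R+1) <= 2 * \<bar>R+1\<bar>" using abs_ge_self[of "R+1"] by simp
    moreover have "y * (real m + 1/2) = y * real m + y / 2" by (simp add: algebra_simps)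
    ultimately have "1 <= y * (real m + 1/2) - 2 * (R+1)" using y by linarith
    hence "(real m + 1/2) * 1 <= (real m + 1/2) * (y * (real m + 1/2) - 2 * (R+1))"
     by (intro mult_left_mono) auto
    thus ?case by (rule order.trans[rotated]) simp
   qed
  qed
  moreover have "eventually (%m. exp (- pi * real m) <= 1 / (real m)\<^sup>2) sequentially"
  proof (rule eventually_mono[OF eventually_gt_at_top[of 0]])
   fix m :: nat assume m: "m > 0"
   have "(real m)\<^sup>2 / fact 2 <= exp (real m)"
    using exp_lower_Taylor_quadratic[of "real m"] by (simp add: field_simps)
   hence "(real m)\<^sup>2 <= 2 * exp (real m)" by (simp add: fact_2)
   also have "... <= exp 1 * exp (real m)"
    by (intro mult_right_mono) (use exp_ge_add_one_self[of 1] in auto)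
   also have "... = exp (1 + real m)" by (simp add: exp_add)
   also have "... <= exp (pi * real m)"
   proof -
    have "1 + real m <= 2 * real m" using m by simp
    also have "... <= pi * real m" using pi_ge_two by (intro mult_right_mono) auto
    finally show ?thesis by simp
   qed
   finally show "exp (- pi * real m) <= 1 / (real m)\<^sup>2"
    using m by (simp add: exp_minus field_simps)
  qed
  ultimately have "eventually (%m. exp (- (pi * y * (real m + 1/2)\<^sup>2) + (2 * real m + 1) * pi * (R + 1)) <= 1 / (real m)\<^sup>2) sequentially"
  proof eventually_elim
   case (elim m)
   have "- (pi * y * (real m + 1/2)\<^sup>2) + (2 * real m + 1) * pi * (R + 1)
     = - (pi * ((real m + 1/2) * (y * (real m + 1/2) - 2 * (R+1))))"
    by (simp add: power2_eq_square algebra_simps)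
   also have "... <= - (pi * real m)" using elim(1) by simp
   finally have "exp (- (pi * y * (real m + 1/2)\<^sup>2) + (2 * real m + 1) * pi * (R + 1)) <= exp (- (pi * real m))"
    by (simp only: exp_le_cancel_iff)
   thus ?case by (rule order.trans) (use elim(2) in simp)
  qed
  thus ?thesis
   by (intro bigoI[of _ 1]) (auto elim!: eventually_mono)
 qed
 moreover have "summable (%m. norm (1 / (real m)\<^sup>2))"
  using inverse_power_summable[of 2, where ?'a=real] by (simp add: inverse_eq_divide norm_divide norm_power)
 ultimately have "summable (%m. exp (- (pi * y * (real m + 1/2)\<^sup>2) + (2 * real m + 1) * pi * (R + 1)))"
  by (rule summable_comparison_test_bigo[rotated])
 thus ?thesis
  unfolding theta_bound_def by (intro summable_mult)
qed

lemma norm_theta_term_le: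
 assumes "norm z <= R" "Im tau >= y"
 shows "norm (theta_term k m z tau) <= theta_bound k R y m"
proof -
 let ?a = "(2 * real m + 1) * pi"
 have na: "norm (theta_freq m) = ?a"
 proof -
  have "theta_freq m = of_real ?a * \<i>" by (simp add: theta_freq_def)
  hence "norm (theta_freq m) = \<bar>?a\<bar>" by (metis norm_mult norm_of_real norm_ii mult.right_neutral)
  thus ?thesis by simp
 qed
 have a0: "?a >= 0" by simp
 have pk: "?a ^ k <= fact k * exp ?a"
 proof -
  have "(\<Sum>n\<in>{k}. ?a ^ n /\<^sub>R fact n) <= (\<Sum>n. ?a ^ n /\<^sub>R fact n)"
   by (rule sum_le_suminf[OF summable_exp_generic]) (use a0 in auto)
  thus ?thesis by (simp add: exp_def field_simps)
 qed
 have e: "norm (exp (s * z)) <= exp (?a * R)" if "norm s = ?a" for s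
 proof -
  have "norm (exp (s * z)) = exp (Re (s * z))" by (simp add: norm_exp_eq_Re)
  also have "Re (s * z) <= norm (s * z)" by (rule complex_Re_le_cmod)
  also have "... <= ?a * R" using that assms(1) a0 by (simp only: norm_mult) (intro mult_left_mono)
  finally show ?thesis by simp
 qed
 have n1: "norm (theta_freq m ^ k * exp (theta_freq m * z) - (- theta_freq m) ^ k * exp (- theta_freq m * z))
  <= ?a ^ k * exp (?a * R) + ?a ^ k * exp (?a * R)"
  by (rule order.trans[OF norm_triangle_ineq4])
   (intro add_mono; simp only: norm_mult norm_power norm_minus_cancel na; intro mult_left_mono e; simp add: na)
 have n2: "norm (exp (kappa * (theta_freq m)\<^sup>2 * tau)) <= exp (- (pi * y * (real m + 1/2)\<^sup>2))"
 proof -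
  have "kappa * (theta_freq m)\<^sup>2 * tau = of_real (pi * (real m + 1/2)\<^sup>2) * (\<i> * tau)"
   unfolding kappa_freq by simp
  hence "Re (kappa * (theta_freq m)\<^sup>2 * tau) = - (pi * (real m + 1/2)\<^sup>2 * Im tau)"
   by (metis Re_complex_of_real Re_i_times mult_minus_right scaleR_conv_of_real scaleR_complex.sel(1))
  also have "... <= - (pi * y * (real m + 1/2)\<^sup>2)"
   using mult_left_mono[OF assms(2), of "pi * (real m + 1/2)\<^sup>2"] by (simp add: algebra_simps)
  finally show ?thesis by (simp add: norm_exp_eq_Re)
 qed
 have "norm (theta_term k m z tau) = norm (exp (kappa * (theta_freq m)\<^sup>2 * tau)) * norm (theta_freq m ^ k * exp (theta_freq m * z) - (- theta_freq m) ^ k * exp (- theta_freq m * z))"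
  unfolding theta_term_def by (simp add: norm_mult norm_divide norm_power)
 also have "... <= exp (- (pi * y * (real m + 1/2)\<^sup>2)) * (?a ^ k * exp (?a * R) + ?a ^ k * exp (?a * R))"
  by (intro mult_mono n1 n2) auto
 also have "... <= exp (- (pi * y * (real m + 1/2)\<^sup>2)) * (fact k * exp ?a * exp (?a * R) + fact k * exp ?a * exp (?a * R))"
  by (intro mult_left_mono add_mono mult_right_mono pk) auto
 also have "... = theta_bound k R y m"
  unfolding theta_bound_def by (simp add: exp_add[symmetric] algebra_simps)
 finally show ?thesis .
qed

lemma summable_theta: "Im tau > 0 ==> summable (%m. theta_term k m z tau)"
 by (rule summable_comparison_test'[OF summable_theta_bound[of "Im tau" k "norm z"]])
  (auto intro: norm_theta_term_le)

lemma theta_deriv_z: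
 assumes "Im tau > 0"
 shows "((%w. theta k w tau) hfd theta (Suc k) z tau) (at z)"
 unfolding theta_def
proof (rule has_field_derivative_series'(2)[where S="cball 0 (norm z + 1)" and ?x0.0=z])
 show "((%w. theta_term k n w tau) hfd theta_term (Suc k) n x tau) (at x within cball 0 (norm z + 1))" for n x
  unfolding theta_term_def by (auto intro!: derivative_eq_intros simp: algebra_simps)
 show "uniformly_convergent_on (cball 0 (norm z + 1)) (%n x. \<Sum>i<n. theta_term (Suc k) i x tau)"
  by (rule Weierstrass_m_test'[OF _ summable_theta_bound[OF assms]])
   (auto intro: norm_theta_term_le)
qed (use summable_theta[OF assms] in auto)

text \<open>The heat equation. Differentiation under the sum is justified on the disc of radius
  \<open>Im tau / 2\<close>, where the imaginary part stays above \<open>Im tau / 2\<close> and one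
  majorant serves all points.\<close>

lemma theta_deriv_tau:
 assumes "Im tau > 0"
 shows "((%t. theta k z t) hfd kappa * theta (Suc (Suc k)) z tau) (at tau)"
proof -
 have "((%t. theta k z t) hfd (\<Sum>m. kappa * theta_term (Suc (Suc k)) m z tau)) (at tau)"
 unfolding theta_def
 proof (rule has_field_derivative_series'(2)[where S="cball tau (Im tau / 2)" and ?x0.0=tau])
  have im: "Im x >= Im tau / 2" if "x : cball tau (Im tau / 2)" for x
   using that abs_Im_le_cmod[of "tau - x"] by (auto simp: dist_norm)
  show "((%t. theta_term k n z t) hfd kappa * theta_term (Suc (Suc k)) n z x) (at x within cball tau (Im tau / 2))" for n x
   unfolding theta_term_def by (auto intro!: derivative_eq_intros simp: algebra_simps power2_eq_square)
  have "uniformly_convergent_on (cball tau (Im tau / 2)) (%n x. \<Sum>i<n. kappa * theta_term (Suc (Suc k)) i z x)"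
  proof (rule Weierstrass_m_test'[where M="%m. norm kappa * theta_bound (Suc (Suc k)) (norm z) (Im tau / 2) m"])
   show "summable (%m. norm kappa * theta_bound (Suc (Suc k)) (norm z) (Im tau / 2) m)"
    using assms by (intro summable_mult summable_theta_bound) auto
   show "norm (kappa * theta_term (Suc (Suc k)) n z x) <= norm kappa * theta_bound (Suc (Suc k)) (norm z) (Im tau / 2) n"
    if "x : cball tau (Im tau / 2)" for n x
    unfolding norm_mult by (intro mult_left_mono norm_theta_term_le) (use im that in auto)
  qed
  thus "uniformly_convergent_on (cball tau (Im tau / 2)) (%n x. \<Sum>i<n. kappa * theta_term (Suc (Suc k)) i z x)" .
 qed (use summable_theta[OF assms] assms in auto)
 thus ?thesis
  unfolding theta_def using suminf_mult[OF summable_theta[OF assms, of "Suc (Suc k)" z]] by simp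
qed

lemma theta1_eq: "Im tau > 0 ==> theta1 z tau = theta 0 z tau"
 unfolding theta1_def theta_def
 using suminf_mult[OF summable_theta[of tau 0 z], of "1/2"] by (simp add: theta_term_0 mult.commute)

lemma theta1'_eq: "Im tau > 0 ==> theta1' z tau = theta 1 z tau"
 unfolding theta1'_def using theta_deriv_z[of tau 0 z]
 by (simp add: theta1_eq DERIV_imp_deriv)

lemma theta_holomorphic: "Im tau > 0 ==> (%z. theta k z tau) holo A"
 by (auto simp: holomorphic_on_def field_differentiable_def intro: has_field_derivative_at_within theta_deriv_z)

lemma theta_holomorphic_compose [holomorphic_intros]:
 "Im tau > 0 ==> f holo A ==> (%z. theta k (f z) tau) holo A"
 using holomorphic_on_compose[of f A "%z. theta k z tau"] theta_holomorphic[of tau k] by (simp add: o_def)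

lemma theta_odd: "theta k (- z) tau = (-1) ^ Suc k * theta k z tau" if "Im tau > 0"
proof -
 have "theta_term k m (- z) tau = (-1) ^ Suc k * theta_term k m z tau" for m
  unfolding theta_term_def by (cases "even k") (simp_all add: algebra_simps)
 thus ?thesis
  unfolding theta_def using suminf_mult[OF summable_theta[OF that, of k z], of "(-1) ^ Suc k"] by simp
qed

lemma exp_theta_freq: "exp (theta_freq m) = -1"
proof -
 have "theta_freq m = of_real pi * \<i> + of_nat m * (2 * of_real pi * \<i>)" by (simp add: theta_freq_def algebra_simps)
 thus ?thesis
  by (simp add: exp_add exp_of_nat_mult mult.commute)
qed

lemma theta_plus_1: "theta k (z + 1) tau = - theta k z tau" if "Im tau > 0"
proof -
 have "exp (- theta_freq m) = -1" for m by (simp add: exp_minus exp_theta_freq)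
 hence "exp (theta_freq m * (z + 1)) = - exp (theta_freq m * z)"
      "exp (- theta_freq m * (z + 1)) = - exp (- theta_freq m * z)" for m
  using exp_theta_freq[of m] by (simp_all only: ring_distribs exp_add mult_1_right mult_minus_right)
 hence "theta_term k m (z + 1) tau = - theta_term k m z tau" for m
  unfolding theta_term_def by (simp add: field_simps)
 thus ?thesis
  unfolding theta_def using suminf_minus[OF summable_theta[OF that, of k z]] by simp
qed

text \<open>Splitting the sine gives two half-infinite sums \<open>a\<close> and \<open>b\<close>,
  and \<open>z + tau\<close> shifts their indices by one in opposite directions. The term
  \<open>a 0\<close> that is lost from the first sum reappears as the new initial term of the second
  (\<open>b0\<close>), so the whole series is multiplied by one factor.\<close>

lemma theta_plus_tau: "theta 0 (z + tau) tau = - exp (- of_real pi * \<i> * tau - 2 * of_real pi * \<i> * z) * theta 0 z tau"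
 if "Im tau > 0"
proof -
 define F where "F = exp (- of_real pi * \<i> * tau - 2 * of_real pi * \<i> * z)"
 define a where "a m z = (-1) ^ m * exp (kappa * (theta_freq m)\<^sup>2 * tau + theta_freq m * z) / \<i>" for m z
 define b where "b m z = (-1) ^ m * exp (kappa * (theta_freq m)\<^sup>2 * tau - theta_freq m * z) / \<i>" for m z
 have t: "theta_term 0 m z tau = a m z - b m z" for m z
  unfolding theta_term_def a_def b_def by (simp add: exp_add exp_diff exp_minus field_simps)
 have sa: "summable (%m. a m z)" for z
 proof (rule summable_comparison_test'[OF summable_theta_bound[OF that, of 0 "norm z"]])
  fix m :: nat
  have "theta_term 0 m 0 tau = 0" by (simp add: theta_term_def)
  have "Re (theta_freq m * z) <= norm (theta_freq m * z)" by (rule complex_Re_le_cmod)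
  also have "... = (2 * real m + 1) * pi * norm z"
  proof -
   have "theta_freq m = of_real ((2 * real m + 1) * pi) * \<i>" by (simp add: theta_freq_def)
   hence "norm (theta_freq m) = \<bar>(2 * real m + 1) * pi\<bar>" by (metis norm_mult norm_of_real norm_ii mult.right_neutral)
   thus ?thesis by (simp add: norm_mult)
  qed
  finally have 1: "Re (theta_freq m * z) <= (2 * real m + 1) * pi * (norm z + 1)"
   by (smt (verit) mult_left_mono pi_gt_zero of_nat_0_le_iff mult_nonneg_nonneg)
  have "Re (kappa * (theta_freq m)\<^sup>2 * tau) = - (pi * Im tau * (real m + 1/2)\<^sup>2)"
  proof -
   have "kappa * (theta_freq m)\<^sup>2 * tau = of_real (pi * (real m + 1/2)\<^sup>2) * (\<i> * tau)"
    unfolding kappa_freq by simp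
   hence "Re (kappa * (theta_freq m)\<^sup>2 * tau) = - (pi * (real m + 1/2)\<^sup>2 * Im tau)"
    by (metis Re_complex_of_real Re_i_times mult_minus_right scaleR_conv_of_real scaleR_complex.sel(1))
   thus ?thesis by simp
  qed
  with 1 have "norm (a m z) <= exp (- (pi * Im tau * (real m + 1/2)\<^sup>2) + (2 * real m + 1) * pi * (norm z + 1))"
   unfolding a_def by (simp add: norm_mult norm_divide norm_power norm_exp_eq_Re)
  also have "... <= theta_bound 0 (norm z) (Im tau) m" by (simp add: theta_bound_def)
  finally show "norm (a m z) <= theta_bound 0 (norm z) (Im tau) m" .
 qed
 have sb: "summable (%m. b m z)" for z
  using sa[of "-z"] by (simp add: a_def b_def)
 have tab: "theta 0 z tau = (\<Sum>m. a m z) - (\<Sum>m. b m z)" for z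
  unfolding theta_def t using suminf_diff[OF sa sb] by simp
 have hs: "kappa * (theta_freq (Suc m))\<^sup>2 = kappa * (theta_freq m)\<^sup>2 + theta_freq m + of_real pi * \<i>" for m
  unfolding kappa_freq by (simp add: theta_freq_def field_simps power2_eq_square)
 have fs: "theta_freq (Suc m) = theta_freq m + 2 * of_real pi * \<i>" for m
  by (simp add: theta_freq_def algebra_simps)
 have a1: "a m (z + tau) = - F * a (Suc m) z" for m
 proof -
  have "kappa * (theta_freq m)\<^sup>2 * tau + theta_freq m * (z + tau)
    = (- of_real pi * \<i> * tau - 2 * of_real pi * \<i> * z) + (kappa * (theta_freq (Suc m))\<^sup>2 * tau + theta_freq (Suc m) * z)"
   unfolding hs unfolding fs by (simp add: algebra_simps)
  thus ?thesis unfolding a_def F_def by (simp add: exp_add)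
 qed
 have b1: "b (Suc m) (z + tau) = - F * b m z" for m
 proof -
  have "kappa * (theta_freq (Suc m))\<^sup>2 * tau - theta_freq (Suc m) * (z + tau)
    = (- of_real pi * \<i> * tau - 2 * of_real pi * \<i> * z) + (kappa * (theta_freq m)\<^sup>2 * tau - theta_freq m * z)"
   unfolding hs unfolding fs by (simp add: algebra_simps)
  thus ?thesis unfolding b_def F_def by (simp add: exp_add exp_diff)
 qed
 have b0: "b 0 (z + tau) = F * a 0 z"
 proof -
  have "kappa * (theta_freq 0)\<^sup>2 * tau - theta_freq 0 * (z + tau)
    = (- of_real pi * \<i> * tau - 2 * of_real pi * \<i> * z) + (kappa * (theta_freq 0)\<^sup>2 * tau + theta_freq 0 * z)"
   unfolding theta_freq_def by (simp add: algebra_simps)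
  thus ?thesis unfolding b_def a_def F_def by (simp only: power_0 mult_1_left exp_add times_divide_eq_right)
 qed
 have A: "(\<Sum>m. a m (z + tau)) = - F * ((\<Sum>m. a m z) - a 0 z)"
  unfolding a1 using suminf_split_head[OF sa[of z]] suminf_mult[of "%m. a (Suc m) z" "-F"] sa[of z] summable_Suc_iff[of "%m. a m z"]
  by simp
 have B: "(\<Sum>m. b m (z + tau)) = F * a 0 z - F * (\<Sum>m. b m z)"
  using suminf_split_head[OF sb[of "z + tau"]] suminf_mult[OF sb[of z], of "-F"] unfolding b1 b0
  by (simp add: algebra_simps)
 show ?thesis
  unfolding tab A B F_def[symmetric] by (simp add: algebra_simps)
qed

section \<open>The period lattice and Liouville's theorem for doubly periodic functions\<close>

lemma lattice_0 [simp]: "0 : lattice tau"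
 unfolding lattice_def by (rule CollectI, rule exI[of _ 0], rule exI[of _ 0]) simp

lemma lattice_add: "x : lattice tau ==> y : lattice tau ==> x + y : lattice tau"
proof -
 assume "x : lattice tau" "y : lattice tau"
 then obtain a b c d where "x = of_int a + of_int b * tau" "y = of_int c + of_int d * tau"
  unfolding lattice_def by auto
 hence "x + y = of_int (a + c) + of_int (b + d) * tau" by (simp add: algebra_simps)
 thus ?thesis unfolding lattice_def by blast
qed

lemma lattice_uminus: "x : lattice tau ==> - x : lattice tau"
proof -
 assume "x : lattice tau"
 then obtain a b where "x = of_int a + of_int b * tau" unfolding lattice_def by auto
 hence "- x = of_int (- a) + of_int (- b) * tau" by (simp add: algebra_simps)
 thus ?thesis unfolding lattice_def by blast
qed

lemma lattice_uminus_iff [simp]: "- x : lattice tau \<longleftrightarrow> x : lattice tau"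
 using lattice_uminus[of x tau] lattice_uminus[of "-x" tau] by auto

lemma lattice_diff: "x : lattice tau ==> y : lattice tau ==> x - y : lattice tau"
 using lattice_add[of x tau "-y"] by simp

lemma lattice_of_int [simp]: "of_int a : lattice tau"
 unfolding lattice_def by (rule CollectI, rule exI[of _ a], rule exI[of _ 0]) simp

lemma lattice_1 [simp]: "1 : lattice tau"
 using lattice_of_int[of 1] by simp

lemma lattice_of_int_mult [simp]: "of_int a * tau : lattice tau"
 unfolding lattice_def by (rule CollectI, rule exI[of _ 0], rule exI[of _ a]) simp

lemma lattice_tau [simp]: "tau : lattice tau"
 using lattice_of_int_mult[of 1] by simp

lemma lattice_add_iff: "y : lattice tau ==> x + y : lattice tau \<longleftrightarrow> x : lattice tau"
 using lattice_add[of x tau y] lattice_diff[of "x + y" tau y] by auto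

lemma finite_lattice_cball:
 assumes "Im tau > 0"
 shows "finite (lattice tau \<inter> cball 0 r)"
proof -
 define B where "B = \<lceil>\<bar>r\<bar> / Im tau\<rceil>"
 define A where "A = \<lceil>\<bar>r\<bar> + real_of_int B * \<bar>Re tau\<bar>\<rceil>"
 have "lattice tau \<inter> cball 0 r \<subseteq> (%(a, b). of_int a + of_int b * tau) ` ({-A..A} \<times> {-B..B})"
 proof
  fix x assume "x : lattice tau \<inter> cball 0 r"
  then obtain a b :: int where x: "x = of_int a + of_int b * tau" and nx: "norm x <= \<bar>r\<bar>"
   unfolding lattice_def by auto
  have "\<bar>of_int b * Im tau\<bar> <= \<bar>r\<bar>" using abs_Im_le_cmod[of x] nx by (simp add: x)
  hence b': "\<bar>real_of_int b\<bar> <= \<bar>r\<bar> / Im tau" using assms by (simp add: abs_mult field_simps)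
  hence b: "\<bar>real_of_int b\<bar> <= of_int B" unfolding B_def by linarith
  have "\<bar>of_int a + of_int b * Re tau\<bar> <= \<bar>r\<bar>" using abs_Re_le_cmod[of x] nx by (simp add: x)
  hence "\<bar>real_of_int a\<bar> <= \<bar>r\<bar> + \<bar>of_int b * Re tau\<bar>" by linarith
  also have "\<bar>of_int b * Re tau\<bar> <= of_int B * \<bar>Re tau\<bar>"
   unfolding abs_mult using b by (intro mult_right_mono) auto
  finally have "\<bar>real_of_int a\<bar> <= of_int A" unfolding A_def by linarith
  hence "(a, b) : {-A..A} \<times> {-B..B}" using b by (auto simp: abs_le_iff)
  thus "x : (%(a, b). of_int a + of_int b * tau) ` ({-A..A} \<times> {-B..B})" unfolding x by force
 qed
 thus ?thesis by (rule finite_subset) simp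
qed

lemma lattice_not_islimpt: "Im tau > 0 ==> \<not> z islimpt lattice tau"
proof -
 assume t: "Im tau > 0"
 have "lattice tau \<inter> ball z 1 \<subseteq> lattice tau \<inter> cball 0 (norm z + 1)"
 proof
  fix y assume "y : lattice tau \<inter> ball z 1"
  hence "y : lattice tau" "norm (z - y) < 1" by (auto simp: dist_norm)
  moreover have "norm y <= norm z + norm (z - y)" using norm_triangle_ineq4[of z "z - y"] by simp
  ultimately show "y : lattice tau \<inter> cball 0 (norm z + 1)" by auto
 qed
 hence "finite (lattice tau \<inter> ball z 1)" using finite_lattice_cball[OF t] finite_subset by blast
 thus ?thesis unfolding islimpt_eq_infinite_ball using zero_less_one by blast
qed

lemma closed_lattice: "Im tau > 0 ==> closed (lattice tau)"
 using lattice_not_islimpt by (auto simp: closed_limpt)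

lemma eventually_not_lattice: "Im tau > 0 ==> \<forall>\<^sub>F z in at a. z ~: lattice tau"
 using lattice_not_islimpt[of tau a] by (simp add: islimpt_iff_eventually)

lemma eventually_not_lattice_nhds: "Im tau > 0 ==> a ~: lattice tau ==> \<forall>\<^sub>F z in nhds a. z ~: lattice tau"
 using closed_lattice[of tau] eventually_nhds_in_open[of "- lattice tau" a] by (auto simp: closed_def)

text \<open>The local bounds make every point of \<open>S\<close> a removable singularity, so
  \<open>f\<close> extends to an entire function, whose values are all taken on a compact period
  parallelogram; Liouville's theorem applies. \<open>S\<close> is kept general so that singularities
  at several points modulo the lattice can be treated.\<close>

lemma elliptic_constant:
 fixes f :: "complex => complex"
 assumes tau: "Im tau > 0" and holo: "f holo - S" and limpt: "!!z. \<not> z islimpt S"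
  and S1: "!!z. z + 1 : S \<longleftrightarrow> z : S" and St: "!!z. z + tau : S \<longleftrightarrow> z : S"
  and f1: "!!z. z ~: S ==> f (z + 1) = f z" and ft: "!!z. z ~: S ==> f (z + tau) = f z"
  and bdd: "!!s. s : S ==> \<exists>B. \<forall>\<^sub>F z in at s. norm (f z) <= B"
 shows "\<exists>c. \<forall>z. z ~: S --> f z = c"
proof -
 define g where "g z = (if z : S then Lim (at z) f else f z)" for z
 have clS: "closed S" using limpt by (auto simp: closed_limpt)
 have evS: "\<forall>\<^sub>F z in at a. z ~: S" for a using limpt[of a] by (simp add: islimpt_iff_eventually)
 have loc: "\<exists>e h. e > 0 & h holo ball a e & (\<forall>z\<in>ball a e. g z = h z)" for a
 proof -
  from evS[of a] obtain e where e: "e > 0" "!!z. z : ball a e ==> z ~= a ==> z ~: S"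
   unfolding eventually_at by (auto simp: dist_commute)
  show ?thesis
  proof (cases "a : S")
   case False
   with e have e': "z ~: S" if "z : ball a e" for z using that by (cases "z = a") auto
   hence "f holo ball a e" by (intro holomorphic_on_subset[OF holo]) auto
   moreover have "\<forall>z\<in>ball a e. g z = f z" using e' by (auto simp: g_def)
   ultimately show ?thesis using e(1) by blast
  next
   case True
   have "f holo ball a e - {a}" using e by (intro holomorphic_on_subset[OF holo]) auto
   from holomorphic_on_extend_bounded[OF this] e(1) bdd[OF True]
   obtain h where h: "h holo ball a e" "!!z. z : ball a e - {a} ==> h z = f z"
    by auto
   have "isCont h a"
    using h(1) e(1) by (metis centre_in_ball continuous_on_eq_continuous_at holomorphic_on_imp_continuous_on open_ball)
   hence "(h \<longlongrightarrow> h a) (at a)" by (simp add: isCont_def)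
   moreover have "\<forall>\<^sub>F z in at a. h z = f z"
    unfolding eventually_at using h(2) e(1) by (auto simp: dist_commute intro!: exI[of _ e])
   ultimately have "(f \<longlongrightarrow> h a) (at a)" by (rule Lim_transform_eventually)
   hence "Lim (at a) f = h a" by (rule tendsto_Lim[rotated]) simp
   hence "g z = h z" if "z : ball a e" for z
    using h(2)[of z] e(2)[of z] True that by (cases "z = a") (auto simp: g_def)
   thus ?thesis using h e by blast
  qed
 qed
 have gh: "g holo UNIV"
 proof -
  have "g field_differentiable at a" for a
  proof -
   obtain e h where e: "e > 0" "h holo ball a e" "\<forall>z\<in>ball a e. g z = h z" using loc by blast
   hence "g holo ball a e" by (metis holomorphic_transform)
   thus ?thesis using e(1) by (simp add: holomorphic_on_imp_differentiable_at)
  qed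
  thus ?thesis by (simp add: holomorphic_on_def)
 qed
 \<comment> \<open>Periodicity of \<open>f\<close> is known only off \<open>S\<close>; it passes to
   the extension \<open>g\<close> by continuity, since \<open>S\<close> has no limit points.\<close>
 have per: "g (z + w) = g z" if w: "!!z. z ~: S ==> f (z + w) = f z" "!!z. z + w : S \<longleftrightarrow> z : S" for z w
 proof -
  have c: "isCont g x" for x
   using gh continuous_on_eq_continuous_at[OF open_UNIV] holomorphic_on_imp_continuous_on by blast
  have "((%y. g (y + w) - g y) \<longlongrightarrow> g (z + w) - g z) (at z)"
   using c[of z] c[of "z + w"] by (intro tendsto_intros isCont_tendsto_compose[where g=g]) (auto simp: isCont_def)
  moreover have "\<forall>\<^sub>F y in at z. g (y + w) - g y = 0"
   using evS[of z] by eventually_elim (use w in \<open>auto simp: g_def\<close>)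
  ultimately have "((%y. 0) \<longlongrightarrow> g (z + w) - g z) (at z)" by (rule Lim_transform_eventually)
  hence "g (z + w) - g z = 0" using tendsto_const_iff[of "at z" "0::complex"] by auto
  thus ?thesis by simp
 qed
 have pern: "g (z + of_nat n * w) = g z" if "!!z. g (z + w) = g z" for z w n
 proof (induction n)
  case (Suc n)
  have "z + of_nat (Suc n) * w = (z + of_nat n * w) + w" by (simp add: algebra_simps)
  thus ?case using that[of "z + of_nat n * w"] Suc by metis
 qed simp
 have peri: "g (z + of_int k * w) = g z" if "!!z. g (z + w) = g z" for z w k
 proof (cases k)
  case (nonneg n)
  thus ?thesis using pern[OF that, of z n] by simp
 next
  case (neg n)
  have "g ((z + of_int k * w) + of_nat (Suc n) * w) = g (z + of_int k * w)" by (rule pern[OF that])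
  moreover have "(z + of_int k * w) + of_nat (Suc n) * w = z" unfolding neg by (simp add: algebra_simps)
  ultimately show ?thesis by metis
 qed
 define K where "K = (%(s, t). of_real s + of_real t * tau) ` ({0..1} \<times> {0..1::real})"
 have "compact K" unfolding K_def
  by (intro compact_continuous_image continuous_intros compact_Times compact_Icc)
   (auto simp: case_prod_unfold intro!: continuous_intros)
 hence bK: "bounded (g ` K)"
  by (intro compact_imp_bounded compact_continuous_image)
   (use gh holomorphic_on_imp_continuous_on continuous_on_subset in blast)+
 have "range g \<subseteq> g ` K"
 proof
  fix y assume "y : range g"
  then obtain z where y: "y = g z" by auto
  define t where "t = Im z / Im tau"
  define s where "s = Re z - t * Re tau"
  have z: "z = of_real s + of_real t * tau" using tau by (simp add: complex_eq_iff s_def t_def)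
  define z' where "z' = of_real (frac s) + of_real (frac t) * tau"
  have "z' : K" unfolding K_def z'_def using frac_ge_0 frac_lt_1
   by (intro image_eqI[of _ _ "(frac s, frac t)"]) (auto intro: less_imp_le)
  moreover have "z = (z' + of_int \<lfloor>s\<rfloor> * 1) + of_int \<lfloor>t\<rfloor> * tau"
   unfolding z z'_def frac_def by (simp add: algebra_simps)
  hence "g z = g z'"
   using peri[OF per[OF f1 S1]] peri[OF per[OF ft St]] by metis
  ultimately show "y : g ` K" using y by auto
 qed
 hence "bounded (range g)" using bK bounded_subset by blast
 hence "g constant_on UNIV" using Liouville_theorem gh by blast
 then obtain c where "!!z. g z = c" by (auto simp: constant_on_def)
 hence "\<forall>z. z ~: S --> f z = c" by (metis g_def)
 thus ?thesis by blast
qed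

text \<open>Translation by 1 and by tau generates all lattice translations, and the complement of
  the lattice is invariant under each step, so the two hypotheses can be iterated. Negative
  multiples are reached by translating back.\<close>

lemma lattice_periodic:
 assumes f1: "!!z. z ~: lattice tau ==> f (z + 1) = f z"
  and ft: "!!z. z ~: lattice tau ==> f (z + tau) = f z"
  and s: "s : lattice tau" and z: "z ~: lattice tau"
 shows "f (z + s) = f z"
proof -
 have pern: "f (z + of_nat n * w) = f z"
  if "!!z. z ~: lattice tau ==> f (z + w) = f z" "w : lattice tau" "z ~: lattice tau" for z w n
 proof (induction n)
  case (Suc n)
  have "of_nat n * w : lattice tau" by (induction n) (use that in \<open>auto simp: algebra_simps intro: lattice_add\<close>)
  hence "z + of_nat n * w ~: lattice tau" using that by (simp add: lattice_add_iff)
  from that(1)[OF this] Suc show ?case by (simp add: algebra_simps)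
 qed simp
 have peri: "f (z + of_int k * w) = f z"
  if "!!z. z ~: lattice tau ==> f (z + w) = f z" "w : lattice tau" "z ~: lattice tau" "of_int k * w : lattice tau" for z w k
 proof (cases k)
  case (nonneg n)
  thus ?thesis using pern[OF that(1-3), of n] by simp
 next
  case (neg n)
  have "f ((z + of_int k * w) + of_nat (Suc n) * w) = f (z + of_int k * w)"
   by (rule pern[OF that(1,2)]) (use that in \<open>simp_all add: lattice_add_iff\<close>)
  moreover have "(z + of_int k * w) + of_nat (Suc n) * w = z" unfolding neg by (simp add: algebra_simps)
  ultimately show ?thesis by metis
 qed
 obtain a b where "s = of_int a + of_int b * tau" using s by (auto simp: lattice_def)
 hence "z + s = (z + of_int a * 1) + of_int b * tau" by simp
 also have "f ... = f (z + of_int a * 1)" by (rule peri[OF ft]) (use z in \<open>auto simp: lattice_add_iff\<close>)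
 also have "... = f z" by (rule peri[OF f1]) (use z in auto)
 finally show ?thesis .
qed

text \<open>By periodicity the bound near 0 is a bound near every lattice point.\<close>

lemma elliptic_constant_lattice:
 fixes f :: "complex => complex"
 assumes tau: "Im tau > 0" and holo: "f holo - lattice tau"
  and f1: "!!z. z ~: lattice tau ==> f (z + 1) = f z"
  and ft: "!!z. z ~: lattice tau ==> f (z + tau) = f z"
  and bdd: "\<forall>\<^sub>F z in at 0. norm (f z) <= B"
 shows "\<exists>c. \<forall>z. z ~: lattice tau --> f z = c"
proof (rule elliptic_constant[OF tau holo])
 fix s assume s: "s : lattice tau"
 have "\<forall>\<^sub>F z in at 0. norm (f (z + s)) <= B"
  using bdd eventually_not_lattice[OF tau, of 0]
  by eventually_elim (use lattice_periodic[of tau f, OF f1 ft s] in auto)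
 thus "\<exists>B. \<forall>\<^sub>F z in at s. norm (f z) <= B"
  by (subst at_to_0) (auto simp: eventually_filtermap)
qed (use lattice_not_islimpt[OF tau] f1 ft in \<open>auto simp: lattice_add_iff\<close>)

section \<open>The product formula of theta, its zeros, and its third Taylor coefficient\<close>

lemma prodinf_Mtest:
 fixes f :: "nat => complex => complex"
 assumes holo: "!!k. f k holo cball z r"
  and le: "!!k x. x : cball z r ==> norm (f k x - 1) <= M k" and M: "summable M" and r: "r > 0"
 shows prodinf_Mtest_uniform_limit:
   "uniform_limit (cball z r) (%n x. \<Prod>k<n. f k x) (%x. \<Prod>k. f k x) sequentially"
  and prodinf_Mtest_holomorphic: "(%x. \<Prod>k. f k x) holo ball z r"
  and prodinf_Mtest_nonzero: "(!!k. f k z ~= 0) ==> (\<Prod>k. f k z) ~= 0"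
  and prodinf_Mtest_logderiv: "(!!k. f k z ~= 0) ==>
   (%k. deriv (f k) z / f k z) sums (deriv (%x. \<Prod>k. f k x) z / (\<Prod>k. f k z))"
proof -
 have cp: "convergent_prod (%k. f k x)" if "x : cball z r" for x
 proof -
  have "summable (%k. norm (f k x - 1))"
   by (rule summable_comparison_test'[OF M]) (use le that in auto)
  hence "abs_convergent_prod (%k. f k x)" by (simp add: abs_convergent_prod_conv_summable)
  thus ?thesis by (rule abs_convergent_prod_imp_convergent_prod)
 qed
 have uc: "uniformly_convergent_on (cball z r) (%n x. \<Prod>k<n. f k x)"
 proof (rule uniformly_convergent_on_prod')
  show "uniformly_convergent_on (cball z r) (%N x. \<Sum>n<N. norm (f n x - 1))"
   by (rule Weierstrass_m_test'[OF _ M]) (use le in auto)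
 qed (use holo holomorphic_on_imp_continuous_on in auto)
 have lim: "(%n. \<Prod>k<n. f k x) \<longlonglongrightarrow> (\<Prod>k. f k x)" if "x : cball z r" for x
  using has_prod_imp_tendsto'[OF convergent_prod_has_prod[OF cp[OF that]]] .
 show ul: "uniform_limit (cball z r) (%n x. \<Prod>k<n. f k x) (%x. \<Prod>k. f k x) sequentially"
 proof -
  from uc obtain l where l: "uniform_limit (cball z r) (%n x. \<Prod>k<n. f k x) l sequentially"
   by (auto simp: uniformly_convergent_on_def)
  have "l x = (\<Prod>k. f k x)" if "x : cball z r" for x
   using tendsto_uniform_limitI[OF l that] lim[OF that] LIMSEQ_unique by blast
  with l show ?thesis by (subst uniform_limit_cong') auto
 qed
 have ulb: "uniform_limit (ball z r) (%n x. \<Prod>k<n. f k x) (%x. \<Prod>k. f k x) sequentially"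
  by (rule uniform_limit_on_subset[OF ul]) auto
 have hb: "f k holo ball z r" for k by (rule holomorphic_on_subset[OF holo]) auto
 show "(%x. \<Prod>k. f k x) holo ball z r"
  by (rule conjunct2[OF holomorphic_uniform_limit[OF _ ul]])
   (use hb holo in \<open>auto intro!: always_eventually continuous_intros holomorphic_intros holomorphic_on_imp_continuous_on\<close>)
 show nz: "(\<Prod>k. f k z) ~= 0" if "!!k. f k z ~= 0"
  using prodinf_nonzero[OF cp, of z] that r by simp
 show "(%k. deriv (f k) z / f k z) sums (deriv (%x. \<Prod>k. f k x) z / (\<Prod>k. f k z))" if "!!k. f k z ~= 0"
  by (rule logderiv_prodinf_complex_uniform_limit[OF ulb hb nz[OF that]]) (use r in auto)
qed

text \<open>At the cusp the summand \<open>m = 0\<close> dominates: without its factor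
  \<open>exp (pi i tau / 4)\<close> it is exactly \<open>2 sin (pi z)\<close>. For the other
  summands \<open>(m + 1/2)\<^sup>2\<close> exceeds 1/4 by at least 2, which gives the decay rate;
  measuring them against their majorant at \<open>Im tau = 1\<close> makes the constant independent
  of tau.\<close>

lemma theta_asymptotic:
 assumes "norm z <= R" "Im tau >= 1"
 shows "norm (theta 0 z tau * exp (- (of_real pi * \<i> * tau / 4)) - 2 * sin (of_real pi * z))
  <= exp (pi / 4) * suminf (theta_bound 0 R 1) * exp (- 2 * pi * (Im tau - 1))"
proof -
 let ?y = "Im tau"
 have t: "?y > 0" using assms by simp
 have b1: "theta_bound 0 R ?y (Suc m) * exp (pi * ?y / 4)
   <= exp (- 2 * pi * (?y - 1)) * exp (pi / 4) * theta_bound 0 R 1 (Suc m)" for m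
 proof -
  define D where "D = (real m + 3/2)\<^sup>2"
  define K where "K = exp ((2 * real (Suc m) + 1) * pi * (R + 1))"
  have tb: "theta_bound 0 R y (Suc m) = 2 * K * exp (- (pi * y * D))" for y
  proof -
   have "real (Suc m) + 1/2 = real m + 3/2" by simp
   thus ?thesis unfolding theta_bound_def exp_add K_def D_def by simp
  qed
  have "2 * (?y - 1) <= (D - 1/4) * (?y - 1)"
  proof (rule mult_right_mono)
   have "(3/2)\<^sup>2 <= D" unfolding D_def by (intro power_mono) auto
   thus "2 <= D - 1/4" by (simp add: power2_eq_square)
  qed (use assms in auto)
  hence 1: "pi * (2 * (?y - 1)) <= pi * ((D - 1/4) * (?y - 1))"
   by (intro mult_left_mono) auto
  have 2: "- (pi * ?y * D) + pi * ?y / 4 = - (pi * ((D - 1/4) * (?y - 1))) + pi / 4 - pi * D"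
   by (simp add: field_simps)
  have 3: "- 2 * pi * (?y - 1) + pi / 4 + - (pi * 1 * D) = - (pi * (2 * (?y - 1))) + pi / 4 - pi * D"
   by simp
  have "- (pi * ?y * D) + pi * ?y / 4 <= - 2 * pi * (?y - 1) + pi / 4 + - (pi * 1 * D)"
   unfolding 2 3 using 1 by simp
  hence "exp (- (pi * ?y * D) + pi * ?y / 4) <= exp (- 2 * pi * (?y - 1) + pi / 4 + - (pi * 1 * D))"
   by (simp only: exp_le_cancel_iff)
  hence "exp (- (pi * ?y * D)) * exp (pi * ?y / 4)
    <= exp (- 2 * pi * (?y - 1)) * exp (pi / 4) * exp (- (pi * 1 * D))"
   by (simp only: exp_add)
  moreover have "0 <= 2 * K" by (simp add: K_def)
  ultimately have "2 * K * (exp (- (pi * ?y * D)) * exp (pi * ?y / 4))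
    <= 2 * K * (exp (- 2 * pi * (?y - 1)) * exp (pi / 4) * exp (- (pi * 1 * D)))"
   by (rule mult_left_mono)
  thus ?thesis unfolding tb by (simp only: mult_ac)
 qed
 have s: "summable (%m. norm (theta_term 0 (Suc m) z tau))"
  by (rule summable_comparison_test'[OF summable_Suc_iff[THEN iffD2, OF summable_theta_bound[OF t, of 0 R]]])
   (use norm_theta_term_le[OF assms(1) order.refl] in auto)
 have "theta 0 z tau = theta_term 0 0 z tau + (\<Sum>m. theta_term 0 (Suc m) z tau)"
  unfolding theta_def using suminf_split_head[OF summable_theta[OF t, of 0 z]] by simp
 moreover have "theta_term 0 0 z tau * exp (- (of_real pi * \<i> * tau / 4)) = 2 * sin (of_real pi * z)"
  unfolding theta_term_0 by (simp add: power2_eq_square exp_minus field_simps)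
 ultimately have "theta 0 z tau * exp (- (of_real pi * \<i> * tau / 4)) - 2 * sin (of_real pi * z)
  = (\<Sum>m. theta_term 0 (Suc m) z tau) * exp (- (of_real pi * \<i> * tau / 4))"
  by (simp add: algebra_simps)
 also have "norm ... = norm (\<Sum>m. theta_term 0 (Suc m) z tau) * exp (pi * ?y / 4)"
  by (simp add: norm_mult norm_exp_eq_Re)
 also have "... <= (\<Sum>m. theta_bound 0 R ?y (Suc m)) * exp (pi * ?y / 4)"
 proof (rule mult_right_mono)
  have "norm (\<Sum>m. theta_term 0 (Suc m) z tau) <= (\<Sum>m. norm (theta_term 0 (Suc m) z tau))"
   by (rule summable_norm[OF s])
  also have "... <= (\<Sum>m. theta_bound 0 R ?y (Suc m))"
   by (intro suminf_le s norm_theta_term_le assms order.refl summable_Suc_iff[THEN iffD2] summable_theta_bound t)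
  finally show "norm (\<Sum>m. theta_term 0 (Suc m) z tau) <= (\<Sum>m. theta_bound 0 R ?y (Suc m))" .
 qed simp
 also have "... = (\<Sum>m. theta_bound 0 R ?y (Suc m) * exp (pi * ?y / 4))"
  by (rule suminf_mult2) (intro summable_Suc_iff[THEN iffD2] summable_theta_bound t)
 also have "... <= (\<Sum>m. exp (- 2 * pi * (?y - 1)) * exp (pi / 4) * theta_bound 0 R 1 (Suc m))"
  by (intro suminf_le b1 summable_mult summable_mult2 summable_Suc_iff[THEN iffD2] summable_theta_bound t) auto
 also have "... = exp (- 2 * pi * (?y - 1)) * exp (pi / 4) * (\<Sum>m. theta_bound 0 R 1 (Suc m))"
  by (rule suminf_mult) (intro summable_Suc_iff[THEN iffD2] summable_theta_bound, simp)
 also have "... <= exp (- 2 * pi * (?y - 1)) * exp (pi / 4) * suminf (theta_bound 0 R 1)"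
  using suminf_split_head[OF summable_theta_bound[of 1 0 R]]
  by (intro mult_left_mono) (auto simp: theta_bound_def)
 finally show ?thesis by (simp add: algebra_simps)
qed

lemma open_upper_half: "open {tau. Im tau > 0}"
 by (simp add: open_halfspace_Im_gt)

lemma theta_higher_deriv_tau: "Im tau > 0 ==> (deriv ^^ j) (%t. theta k z t) tau = kappa ^ j * theta (k + 2 * j) z tau"
proof (induction j arbitrary: tau)
 case (Suc j)
 have "\<forall>\<^sub>F t in nhds tau. (deriv ^^ j) (%t. theta k z t) t = kappa ^ j * theta (k + 2 * j) z t"
  using eventually_nhds_in_open[OF open_upper_half, of tau] Suc by (auto elim!: eventually_mono)
 hence "deriv ((deriv ^^ j) (%t. theta k z t)) tau = deriv (%t. kappa ^ j * theta (k + 2 * j) z t) tau"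
  by (rule deriv_cong_ev) simp
 also have "... = kappa ^ j * (kappa * theta (Suc (Suc (k + 2 * j))) z tau)"
  by (intro DERIV_imp_deriv DERIV_cmult theta_deriv_tau Suc.prems)
 finally show ?case by (simp add: algebra_simps)
qed simp

text \<open>If theta vanished for one tau and all z, so would all its z-derivatives, hence by the
  heat equation all tau-derivatives of \<open>theta 0 (1/2)\<close> at this tau. Then
  \<open>theta 0 (1/2)\<close> would vanish on the whole half-plane, against the limit
  \<open>2 sin (pi / 2) = 2\<close> at the cusp.\<close>

lemma theta_not_identically_zero:
 assumes "Im tau > 0"
 shows "\<exists>z. theta 0 z tau ~= 0"
proof (rule ccontr)
 assume "\<not> ?thesis"
 hence z0: "theta 0 z tau = 0" for z by auto
 have zk: "theta k z tau = 0" for k z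
 proof (induction k arbitrary: z)
  case (Suc k)
  have "((%w. theta k w tau) hfd 0) (at z)" by (simp add: Suc)
  thus ?case using DERIV_unique theta_deriv_z[OF assms] by blast
 qed (simp add: z0)
 have "theta 0 (1/2) t = 0" if "Im t > 0" for t
 proof (rule holomorphic_fun_eq_0_on_connected[where f="%t. theta 0 (1/2) t" and S="{t. Im t > 0}" and z=tau])
  show "(%t. theta 0 (1/2) t) holo {t. Im t > 0}"
   by (auto simp: holomorphic_on_def field_differentiable_def intro: has_field_derivative_at_within theta_deriv_tau)
  show "connected {t. Im t > 0}" by (intro convex_connected convex_halfspace_Im_gt)
  show "(deriv ^^ n) (%t. theta 0 (1/2) t) tau = 0" for n
   using theta_higher_deriv_tau[OF assms, of n 0 "1/2"] zk by simp
 qed (use assms that open_upper_half in auto)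
 hence le: "2 <= exp (pi / 4) * suminf (theta_bound 0 1 1) * exp (- 2 * pi * (y - 1))" if "y >= 1" for y
  using theta_asymptotic[of "1/2" 1 "\<i> * of_real y"] that
  by (simp add: norm_mult sin_of_real[symmetric] del: sin_of_real)
 define C where "C = exp (pi / 4) * suminf (theta_bound 0 1 1)"
 have "suminf (theta_bound 0 1 1) >= 0" by (intro suminf_nonneg summable_theta_bound) (auto simp: theta_bound_def)
 hence C: "C >= 0" by (simp add: C_def)
 \<comment> \<open>The height \<open>y = 1 + C\<close> is chosen so that the decay factor becomes
   \<open>exp (- 2 pi C)\<close>; the resulting inequality contradicts
   \<open>1 + x <= exp x\<close>.\<close>
 have "2 * exp (2 * pi * C) <= C"
  using le[of "1 + C"] C unfolding C_def[symmetric] by (simp add: exp_minus field_simps)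
 moreover have "1 + 2 * pi * C <= exp (2 * pi * C)" by (rule exp_ge_add_one_self)
 moreover have "C * 1 <= C * pi" using C pi_ge_two by (intro mult_left_mono) auto
 moreover have "2 * pi * C = 2 * (C * pi)" by simp
 ultimately have "2 + 4 * (C * pi) <= C * pi" by linarith
 moreover have "0 <= C * pi" using C by simp
 ultimately show False by linarith
qed

definition nome :: "complex => complex" where "nome tau = exp (2 * of_real pi * \<i> * tau)"

lemma norm_nome_less_1: "Im tau > 0 ==> norm (nome tau) < 1"
 by (simp add: nome_def norm_exp_eq_Re)

lemma nome_nonzero [simp]: "nome tau ~= 0" by (simp add: nome_def)

lemma nome_power: "nome tau ^ k = exp (2 * of_real pi * \<i> * (of_nat k * tau))"
 by (simp add: nome_def exp_of_nat_mult[symmetric] algebra_simps)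

lemma nome_power_neq_1:
 assumes "Im tau > 0"
 shows "nome tau ^ Suc k ~= 1"
proof
 assume "nome tau ^ Suc k = 1"
 hence "norm (nome tau) ^ Suc k = 1" by (metis norm_one norm_power)
 moreover have "norm (nome tau) ^ Suc k < 1"
  by (rule power_Suc_less_one) (use norm_nome_less_1[OF assms] in auto)
 ultimately show False by simp
qed

text \<open>With \<open>Q = nome tau ^ Suc k\<close>, \<open>X = exp (2 pi i z)\<close> and
  \<open>y = 2 sin(pi z)^2\<close>, the factor \<open>(1 - Q X)(1 - Q / X)\<close> of the Jacobi
  product equals \<open>(1 - Q)^2 (1 + c y)\<close> for this coefficient c. Dividing out
  \<open>(1 - Q)^2\<close> leaves a product that is entire in y, normalised to 1 at
  \<open>y = 0\<close>, and whose derivative there is the sum of the coefficients.\<close>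

definition theta_coeff :: "complex => nat => complex" where
 "theta_coeff tau k = 2 * nome tau ^ Suc k / (1 - nome tau ^ Suc k)\<^sup>2"

definition theta_prod :: "complex => complex => complex" where
 "theta_prod tau y = (\<Prod>k. 1 + theta_coeff tau k * y)"

lemma summable_theta_coeff: "Im tau > 0 ==> summable (%k. norm (theta_coeff tau k))"
proof -
 assume t: "Im tau > 0"
 let ?q = "norm (nome tau)"
 have q: "?q < 1" using norm_nome_less_1[OF t] .
 have B: "norm (theta_coeff tau k) <= 2 / (1 - ?q)\<^sup>2 * ?q ^ Suc k" for k
 proof -
  have "?q ^ Suc k <= ?q" using q power_decreasing[of 1 "Suc k" ?q] by simp
  hence "1 - ?q <= 1 - norm (nome tau ^ Suc k)" by (simp add: norm_power norm_mult)
  also have "... <= norm (1 - nome tau ^ Suc k)" using norm_triangle_ineq2[of 1 "nome tau ^ Suc k"] by simp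
  finally have "(1 - ?q)\<^sup>2 <= norm (1 - nome tau ^ Suc k) ^ 2" using q by (intro power_mono) auto
  hence "2 * ?q ^ Suc k / norm (1 - nome tau ^ Suc k) ^ 2 <= 2 * ?q ^ Suc k / (1 - ?q)\<^sup>2"
   using q by (intro divide_left_mono mult_pos_pos zero_less_power mult_nonneg_nonneg)
    (use nome_power_neq_1[OF t, of k] in auto)
  thus ?thesis by (simp only: theta_coeff_def norm_divide norm_mult norm_power norm_numeral) simp
 qed
 have A: "summable (%k. 2 / (1 - ?q)\<^sup>2 * ?q ^ Suc k)"
  using q by (intro summable_mult summable_Suc_iff[THEN iffD2] summable_geometric) auto
 show ?thesis
  by (rule summable_comparison_test'[OF A]) (use B in simp)
qed

lemma theta_prod_Mtest:
 assumes "Im tau > 0"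
 shows "(%y. 1 + theta_coeff tau k * y) holo A"
  "x : cball 0 r ==> norm (1 + theta_coeff tau k * x - 1) <= r * norm (theta_coeff tau k)"
  "summable (%k. r * norm (theta_coeff tau k))"
proof -
 show "(%y. 1 + theta_coeff tau k * y) holo A" by (intro holomorphic_intros)
 show "summable (%k. r * norm (theta_coeff tau k))" by (rule summable_mult[OF summable_theta_coeff[OF assms]])
 assume "x : cball 0 r"
 hence "norm (theta_coeff tau k) * norm x <= norm (theta_coeff tau k) * r" by (intro mult_left_mono) auto
 thus "norm (1 + theta_coeff tau k * x - 1) <= r * norm (theta_coeff tau k)" by (simp add: norm_mult mult.commute)
qed

lemma theta_prod_holomorphic: "Im tau > 0 ==> theta_prod tau holo A"
proof -
 assume t: "Im tau > 0"
 have "theta_prod tau field_differentiable at y" for y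
 proof -
  have "norm y + 1 > 0" using norm_ge_zero[of y] by linarith
  from prodinf_Mtest_holomorphic[where f="%k y. 1 + theta_coeff tau k * y" and z=0 and r="norm y + 1" and M="%k. (norm y + 1) * norm (theta_coeff tau k)", OF theta_prod_Mtest(1)[OF t] theta_prod_Mtest(2)[OF t] theta_prod_Mtest(3)[OF t] this]
  have "theta_prod tau holo ball 0 (norm y + 1)"
   unfolding theta_prod_def[abs_def] by simp
  thus ?thesis by (rule holomorphic_on_imp_differentiable_at) auto
 qed
 thus ?thesis by (simp add: holomorphic_on_def field_differentiable_at_within)
qed

lemma theta_prod_tendsto:
 assumes t: "Im tau > 0"
 shows "(%n. \<Prod>k<n. 1 + theta_coeff tau k * y) \<longlonglongrightarrow> theta_prod tau y"
proof -
 have "norm y + 1 > 0" using norm_ge_zero[of y] by linarith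
 from prodinf_Mtest_uniform_limit[where f="%k y. 1 + theta_coeff tau k * y" and z=0 and r="norm y + 1" and M="%k. (norm y + 1) * norm (theta_coeff tau k)", OF theta_prod_Mtest(1)[OF t] theta_prod_Mtest(2)[OF t] theta_prod_Mtest(3)[OF t] this]
 have "uniform_limit (cball 0 (norm y + 1)) (%n x. \<Prod>k<n. 1 + theta_coeff tau k * x) (theta_prod tau) sequentially"
  unfolding theta_prod_def[abs_def] .
 thus ?thesis by (rule tendsto_uniform_limitI) simp
qed

lemma theta_prod_nonzero:
 assumes t: "Im tau > 0" and "!!k. 1 + theta_coeff tau k * y ~= 0"
 shows "theta_prod tau y ~= 0"
proof -
 have "summable (%k. norm (1 + theta_coeff tau k * y - 1))"
  using summable_mult2[OF summable_theta_coeff[OF t], of "norm y"] by (simp add: norm_mult)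
 hence "convergent_prod (%k. 1 + theta_coeff tau k * y)"
  by (intro abs_convergent_prod_imp_convergent_prod summable_imp_abs_convergent_prod)
 thus ?thesis unfolding theta_prod_def using assms(2) by (intro prodinf_nonzero) auto
qed

lemma theta_prod_0 [simp]: "theta_prod tau 0 = 1"
 by (simp add: theta_prod_def)

text \<open>All factors are 1 at \<open>y = 0\<close>, so the logarithmic derivative of the product
  is its derivative.\<close>

lemma theta_prod_deriv_0: "Im tau > 0 ==> theta_coeff tau sums deriv (theta_prod tau) 0"
proof -
 assume t: "Im tau > 0"
 have d: "deriv (%y. 1 + theta_coeff tau k * y) 0 = theta_coeff tau k" for k
  by (rule DERIV_imp_deriv) (auto intro!: derivative_eq_intros)
 have e: "(%y. \<Prod>k. 1 + theta_coeff tau k * y) = theta_prod tau"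
  by (rule ext) (simp add: theta_prod_def)
 have "(%k. deriv (%y. 1 + theta_coeff tau k * y) 0 / (1 + theta_coeff tau k * 0)) sums
   (deriv (%y. \<Prod>k. 1 + theta_coeff tau k * y) 0 / (\<Prod>k. 1 + theta_coeff tau k * 0))"
  by (rule prodinf_Mtest_logderiv[where f="%k y. 1 + theta_coeff tau k * y" and z=0 and r="1" and M="%k. (1) * norm (theta_coeff tau k)", OF theta_prod_Mtest(1)[OF t] theta_prod_Mtest(2)[OF t] theta_prod_Mtest(3)[OF t]]) auto
 thus ?thesis unfolding d e by simp
qed

lemma exp_2pii_eq_1: "exp (2 * of_real pi * \<i> * w) = 1 ==> \<exists>n::int. w = of_int n"
proof -
 assume "exp (2 * of_real pi * \<i> * w) = 1"
 then obtain n :: int where "Im w = 0" "2 * pi * Re w = of_int (2 * n) * pi"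
  unfolding exp_eq_1 by auto
 hence "w = of_int n" by (simp add: complex_eq_iff)
 thus ?thesis by blast
qed

lemma theta_prod_factor:
 fixes z tau defines "X \<equiv> exp (2 * of_real pi * \<i> * z)"
 assumes "Im tau > 0"
 shows "(1 + theta_coeff tau k * (2 * sin (of_real pi * z) ^ 2)) * (1 - nome tau ^ Suc k)\<^sup>2 =
  (1 - nome tau ^ Suc k * X) * (1 - nome tau ^ Suc k / X)"
proof -
 define Q where "Q = nome tau ^ Suc k"
 have Q: "1 - Q ~= 0" using nome_power_neq_1[OF assms(2), of k] by (simp add: Q_def)
 define x where "x = exp (\<i> * (of_real pi * z))"
 have x: "x ~= 0" by (simp add: x_def)
 have X: "X = x\<^sup>2" unfolding X_def x_def by (simp add: exp_double[symmetric] mult_ac)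
 have s: "sin (of_real pi * z) = (x - 1 / x) / (2 * \<i>)"
  unfolding sin_exp_eq x_def by (simp add: exp_minus inverse_eq_divide)
 have s2: "2 * sin (of_real pi * z) ^ 2 = 1 - (x\<^sup>2 + 1 / x\<^sup>2) / 2"
  unfolding s using x by (simp add: field_simps power2_eq_square)
 have "(1 + theta_coeff tau k * (2 * sin (of_real pi * z) ^ 2)) * (1 - Q)\<^sup>2
   = (1 - Q)\<^sup>2 + 2 * Q * (2 * sin (of_real pi * z) ^ 2)"
  unfolding theta_coeff_def Q_def[symmetric] using Q by (simp add: field_simps)
 also have "... = (1 - Q * X) * (1 - Q / X)"
  unfolding s2 X using x by (simp add: field_simps power2_eq_square)
 finally show ?thesis unfolding Q_def .
qed

text \<open>Under \<open>z + tau\<close> the variable X becomes \<open>q X\<close>, so the factors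
  telescope and only boundary factors survive. They are multiplied to the two sides instead of being
  divided out, so that zeros of single factors do no harm.\<close>

lemma theta_prod_quasi_partial:
 fixes z tau defines "X \<equiv> exp (2 * of_real pi * \<i> * z)"
 assumes t: "Im tau > 0"
 shows "(1 - nome tau * X) * (1 - nome tau ^ n / X) * (\<Prod>k<n. 1 + theta_coeff tau k * (2 * sin (of_real pi * (z + tau)) ^ 2))
   = (1 - nome tau ^ Suc n * X) * (1 - 1 / X) * (\<Prod>k<n. 1 + theta_coeff tau k * (2 * sin (of_real pi * z) ^ 2))"
proof (induction n)
 case (Suc n)
 define q where "q = nome tau"
 define f where "f k z = 1 + theta_coeff tau k * (2 * sin (of_real pi * z) ^ 2)" for k z
 define A where "A = (\<Prod>k<n. f k (z + tau))"
 define B where "B = (\<Prod>k<n. f k z)"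
 define Q where "Q = (1 - q ^ Suc n)\<^sup>2"
 have Q: "Q ~= 0" using nome_power_neq_1[OF t, of n] by (simp add: Q_def q_def)
 have X0: "X ~= 0" by (simp add: X_def)
 have q0: "q ~= 0" by (simp add: q_def)
 have X': "exp (2 * of_real pi * \<i> * (z + tau)) = q * X"
  by (simp add: X_def q_def nome_def exp_add ring_distribs)
 have f1: "f n (z + tau) * Q = (1 - q ^ Suc n * (q * X)) * (1 - q ^ Suc n / (q * X))"
  using theta_prod_factor[OF t, of n "z + tau"] unfolding X' f_def Q_def q_def .
 have f2: "f n z * Q = (1 - q ^ Suc n * X) * (1 - q ^ Suc n / X)"
  using theta_prod_factor[OF t, of n z] unfolding X_def f_def Q_def q_def .
 have IH: "(1 - q * X) * (1 - q ^ n / X) * A = (1 - q ^ Suc n * X) * (1 - 1 / X) * B"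
  using Suc.IH by (simp add: A_def B_def q_def f_def)
 have qq: "q ^ Suc n / (q * X) = q ^ n / X" using q0 by simp
 have "((1 - q * X) * (1 - q ^ Suc n / X) * (A * f n (z + tau))) * Q
  = (1 - q ^ Suc n / X) * ((1 - q * X) * A) * (f n (z + tau) * Q)" by (simp add: mult_ac)
 also have "... = (1 - q ^ Suc n / X) * (1 - q ^ Suc n * (q * X)) * ((1 - q * X) * (1 - q ^ n / X) * A)"
  unfolding f1 qq by (simp add: mult_ac)
 also have "... = (1 - q ^ Suc (Suc n) * X) * (1 - 1 / X) * B * (f n z * Q)"
  unfolding IH f2 by (simp add: mult_ac)
 also have "... = ((1 - q ^ Suc (Suc n) * X) * (1 - 1 / X) * (B * f n z)) * Q"
  by (simp add: mult_ac)
 finally have "(1 - q * X) * (1 - q ^ Suc n / X) * (A * f n (z + tau)) = (1 - q ^ Suc (Suc n) * X) * (1 - 1 / X) * (B * f n z)"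
  using Q by simp
 thus ?case by (simp add: A_def B_def q_def f_def)
qed simp

lemma theta_prod_quasi:
 fixes z tau defines "X \<equiv> exp (2 * of_real pi * \<i> * z)"
 assumes t: "Im tau > 0"
 shows "(1 - nome tau * X) * theta_prod tau (2 * sin (of_real pi * (z + tau)) ^ 2)
   = (1 - 1 / X) * theta_prod tau (2 * sin (of_real pi * z) ^ 2)"
proof (rule LIMSEQ_unique)
 have q0: "(%n. nome tau ^ n) \<longlonglongrightarrow> 0" using norm_nome_less_1[OF t] by (rule LIMSEQ_power_zero)
 have "(%n. (1 - nome tau * X) * (1 - nome tau ^ n / X) * (\<Prod>k<n. 1 + theta_coeff tau k * (2 * sin (of_real pi * (z + tau)) ^ 2)))
   \<longlonglongrightarrow> (1 - nome tau * X) * (1 - 0 / X) * theta_prod tau (2 * sin (of_real pi * (z + tau)) ^ 2)"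
  by (intro tendsto_intros theta_prod_tendsto[OF t] q0) (simp add: X_def)
 thus "(%n. (1 - nome tau * X) * (1 - nome tau ^ n / X) * (\<Prod>k<n. 1 + theta_coeff tau k * (2 * sin (of_real pi * (z + tau)) ^ 2)))
   \<longlonglongrightarrow> (1 - nome tau * X) * theta_prod tau (2 * sin (of_real pi * (z + tau)) ^ 2)" by simp
 have "(%n. (1 - nome tau ^ Suc n * X) * (1 - 1 / X) * (\<Prod>k<n. 1 + theta_coeff tau k * (2 * sin (of_real pi * z) ^ 2)))
   \<longlonglongrightarrow> (1 - 0 * X) * (1 - 1 / X) * theta_prod tau (2 * sin (of_real pi * z) ^ 2)"
  by (intro tendsto_intros theta_prod_tendsto[OF t] LIMSEQ_Suc[OF q0])
 thus "(%n. (1 - nome tau * X) * (1 - nome tau ^ n / X) * (\<Prod>k<n. 1 + theta_coeff tau k * (2 * sin (of_real pi * (z + tau)) ^ 2)))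
   \<longlonglongrightarrow> (1 - 1 / X) * theta_prod tau (2 * sin (of_real pi * z) ^ 2)"
  unfolding X_def theta_prod_quasi_partial[OF t] by simp
qed

text \<open>The Jacobi product for theta, up to a factor that does not depend on z. It will be shown
  to have the multipliers of theta under \<open>z + 1\<close> and \<open>z + tau\<close>.\<close>

definition sin_prod :: "complex => complex => complex" where
 "sin_prod tau z = sin (of_real pi * z) * theta_prod tau (2 * sin (of_real pi * z) ^ 2)"

lemma one_minus_nome_exp_nonzero:
 assumes "z ~: lattice tau"
 shows "1 - nome tau ^ k * exp (2 * of_real pi * \<i> * z) ~= 0" "1 - nome tau ^ k / exp (2 * of_real pi * \<i> * z) ~= 0"
proof -
 show "1 - nome tau ^ k * exp (2 * of_real pi * \<i> * z) ~= 0"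
 proof
  assume "1 - nome tau ^ k * exp (2 * of_real pi * \<i> * z) = 0"
  hence "exp (2 * of_real pi * \<i> * (of_nat k * tau + z)) = 1"
   by (simp add: nome_power exp_add[symmetric] ring_distribs)
  then obtain n :: int where "of_nat k * tau + z = of_int n" using exp_2pii_eq_1 by blast
  hence "z = of_int n - of_int (int k) * tau" by (simp add: algebra_simps)
  hence "z : lattice tau" by (simp only:) (intro lattice_diff lattice_of_int lattice_of_int_mult)
  thus False using assms by simp
 qed
 show "1 - nome tau ^ k / exp (2 * of_real pi * \<i> * z) ~= 0"
 proof
  assume "1 - nome tau ^ k / exp (2 * of_real pi * \<i> * z) = 0"
  hence "exp (2 * of_real pi * \<i> * (of_nat k * tau - z)) = 1"
   by (simp add: nome_power exp_diff[symmetric] ring_distribs)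
  then obtain n :: int where "of_nat k * tau - z = of_int n" using exp_2pii_eq_1 by blast
  hence "z = of_int (int k) * tau - of_int n" by (simp add: algebra_simps)
  hence "z : lattice tau" by (simp only:) (intro lattice_diff lattice_of_int lattice_of_int_mult)
  thus False using assms by simp
 qed
qed

lemma sin_prod_nonzero:
 assumes t: "Im tau > 0" and z: "z ~: lattice tau"
 shows "sin_prod tau z ~= 0"
proof -
 have "sin (of_real pi * z) ~= 0"
 proof
  assume "sin (of_real pi * z) = 0"
  then obtain n :: int where "of_real pi * z = of_real (of_int n * pi)" unfolding sin_eq_0 by auto
  hence "z = of_int n" by simp
  thus False using z by simp
 qed
 moreover have "theta_prod tau (2 * sin (of_real pi * z) ^ 2) ~= 0"
 proof (rule theta_prod_nonzero[OF t])
  fix k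
  show "1 + theta_coeff tau k * (2 * (sin (complex_of_real pi * z))\<^sup>2) ~= 0"
   using theta_prod_factor[OF t, of k z] one_minus_nome_exp_nonzero[OF z, of "Suc k"] by auto
 qed
 ultimately show ?thesis by (simp add: sin_prod_def)
qed

lemma sin_prod_plus_1: "sin_prod tau (z + 1) = - sin_prod tau z"
proof -
 have "sin (of_real pi :: complex) = 0" "cos (of_real pi :: complex) = -1"
  by (simp_all flip: sin_of_real cos_of_real)
 thus ?thesis by (simp add: sin_prod_def ring_distribs sin_add)
qed

lemma sin_prod_plus_tau:
 assumes t: "Im tau > 0" and z: "z ~: lattice tau"
 shows "sin_prod tau (z + tau) = - exp (- of_real pi * \<i> * tau - 2 * of_real pi * \<i> * z) * sin_prod tau z"
proof -
 define x where "x = exp (\<i> * (of_real pi * z))"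
 define y where "y = exp (\<i> * (of_real pi * tau))"
 have nz: "x ~= 0" "y ~= 0" by (auto simp: x_def y_def)
 have X: "exp (2 * of_real pi * \<i> * z) = x\<^sup>2" unfolding x_def by (simp add: exp_double[symmetric] mult_ac)
 have q: "nome tau = y\<^sup>2" unfolding y_def nome_def by (simp add: exp_double[symmetric] mult_ac)
 have s: "sin (of_real pi * z) = (x - 1 / x) / (2 * \<i>)"
  unfolding sin_exp_eq x_def by (simp add: exp_minus inverse_eq_divide)
 have xy: "exp (\<i> * (of_real pi * (z + tau))) = x * y"
  unfolding x_def y_def by (simp add: exp_add[symmetric] ring_distribs)
 have s': "sin (of_real pi * (z + tau)) = (x * y - 1 / (x * y)) / (2 * \<i>)"
  unfolding sin_exp_eq xy[symmetric] by (simp add: exp_minus inverse_eq_divide)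
 have E: "exp (- of_real pi * \<i> * tau - 2 * of_real pi * \<i> * z) = 1 / (y * x\<^sup>2)"
  unfolding X[symmetric] y_def by (simp add: exp_diff exp_minus exp_add field_simps)
 define W where "W = theta_prod tau (2 * sin (of_real pi * z) ^ 2)"
 define W' where "W' = theta_prod tau (2 * sin (of_real pi * (z + tau)) ^ 2)"
 have P1: "sin_prod tau z = sin (of_real pi * z) * W" and P2: "sin_prod tau (z + tau) = sin (of_real pi * (z + tau)) * W'"
  by (simp_all add: sin_prod_def W_def W'_def)
 have ne: "1 - y\<^sup>2 * x\<^sup>2 ~= 0" using one_minus_nome_exp_nonzero(1)[OF z, of 1] unfolding X q by simp
 have W: "(1 - y\<^sup>2 * x\<^sup>2) * W' = (1 - 1 / x\<^sup>2) * W"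
  using theta_prod_quasi[OF t, of z] unfolding X q W_def W'_def .
 have "(x * y - 1 / (x * y)) * W' = - (1 / (x * y)) * ((1 - y\<^sup>2 * x\<^sup>2) * W')"
  using nz by (simp add: field_simps power2_eq_square)
 also have "... = - (1 / (y * x\<^sup>2)) * (x - 1 / x) * W"
  unfolding W using nz by (simp add: field_simps power2_eq_square)
 finally have "(x * y - 1 / (x * y)) * W' / (2 * \<i>) = - (1 / (y * x\<^sup>2)) * ((x - 1 / x) / (2 * \<i>) * W)" by simp
 thus ?thesis
  unfolding P1 P2 s s' E by (simp only: times_divide_eq_left times_divide_eq_right)
qed

lemma theta_prod_holomorphic_compose:
 "Im tau > 0 ==> f holo A ==> (%z. theta_prod tau (f z)) holo A"
 using holomorphic_on_compose[of f A "theta_prod tau"] theta_prod_holomorphic[of tau] by (simp add: o_def)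

lemma sin_prod_holomorphic: "Im tau > 0 ==> sin_prod tau holo A"
 unfolding sin_prod_def[abs_def] by (intro holomorphic_intros theta_prod_holomorphic_compose)

lemma theta_0_0 [simp]: "Im tau > 0 ==> theta 0 0 tau = 0"
 using theta_odd[of tau 0 0] by simp

lemma has_field_derivative_tendsto_quotient:
 assumes "(f hfd D) (at 0)" "f 0 = 0"
 shows "((%z. f z / z) \<longlongrightarrow> D) (at 0)"
 using assms by (simp add: has_field_derivative_iff)

lemma theta_lattice_zero:
 assumes t: "Im tau > 0" and s: "s : lattice tau"
 shows "theta 0 s tau = 0"
proof -
 have per: "theta 0 (z + of_int k * w) tau = 0 \<longleftrightarrow> theta 0 z tau = 0"
  if w: "!!z. theta 0 (z + w) tau = 0 \<longleftrightarrow> theta 0 z tau = 0" for w z k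
 proof (induction k rule: int_induct[where k=0])
  case (step1 i)
  thus ?case using w[of "z + of_int i * w"] by (simp add: algebra_simps)
 next
  case (step2 i)
  thus ?case using w[of "z + of_int (i - 1) * w"] by (simp add: algebra_simps)
 qed simp
 obtain a b where s: "s = of_int a + of_int b * tau" using s by (auto simp: lattice_def)
 have "theta 0 (0 + of_int a * 1 + of_int b * tau) tau = 0"
  by (subst per; (subst per)?) (use t theta_plus_1[OF t, of 0] theta_plus_tau[OF t] in auto)
 thus ?thesis by (simp add: s)
qed

text \<open>The quotient of the two sides is elliptic because the multipliers agree, and it is
  holomorphic off the lattice because \<open>sin_prod\<close> vanishes only there. Its limit at 0
  shows boundedness and fixes the constant. That constant cannot be 0, for otherwise theta would
  vanish identically in z.\<close>

theorem theta_eq_sin_prod: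
 assumes t: "Im tau > 0"
 shows "z ~: lattice tau ==> theta 0 z tau = theta 1 0 tau / of_real pi * sin_prod tau z"
  and "theta 1 0 tau ~= 0"
proof -
 define f where "f z = theta 0 z tau / sin_prod tau z" for z
 have lim: "(f \<longlongrightarrow> theta 1 0 tau / of_real pi) (at 0)"
 proof -
  have 1: "((%z. theta 0 z tau / z) \<longlongrightarrow> theta 1 0 tau) (at 0)"
   using theta_deriv_z[OF t, of 0 0] t by (intro has_field_derivative_tendsto_quotient) auto
  have "theta_prod tau field_differentiable at 0"
   using theta_prod_holomorphic[OF t, of UNIV] by (simp add: holomorphic_on_def)
  then obtain W' where W': "(theta_prod tau hfd W') (at (2 * sin (of_real pi * 0) ^ 2))"
   by (auto simp: field_differentiable_def)
  have g: "((%z. 2 * sin (of_real pi * z) ^ 2) hfd 0) (at (0::complex))"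
   by (auto intro!: derivative_eq_intros)
  note [derivative_intros] = DERIV_chain2[where f="theta_prod tau" and g="%z. 2 * sin (of_real pi * z) ^ 2", OF W' g]
  have "(sin_prod tau hfd of_real pi) (at 0)"
   unfolding sin_prod_def[abs_def] by (auto intro!: derivative_eq_intros)
  moreover have "sin_prod tau 0 = 0" by (simp add: sin_prod_def)
  ultimately have 2: "((%z. sin_prod tau z / z) \<longlongrightarrow> of_real pi) (at 0)"
   by (rule has_field_derivative_tendsto_quotient)
  have "((%z. (theta 0 z tau / z) / (sin_prod tau z / z)) \<longlongrightarrow> theta 1 0 tau / of_real pi) (at 0)"
   by (intro tendsto_divide 1 2) simp
  moreover have "\<forall>\<^sub>F z in at 0. (theta 0 z tau / z) / (sin_prod tau z / z) = f z"
   by (auto simp: eventually_at f_def intro!: exI[of _ 1])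
  ultimately show ?thesis by (rule Lim_transform_eventually)
 qed
 have "\<exists>c. \<forall>z. z ~: lattice tau --> f z = c"
 proof (rule elliptic_constant_lattice[OF t])
  show "f holo - lattice tau"
   unfolding f_def by (intro holomorphic_intros t sin_prod_holomorphic) (use sin_prod_nonzero[OF t] in auto)
  show "f (z + 1) = f z" for z by (simp add: f_def theta_plus_1[OF t] sin_prod_plus_1)
  show "f (z + tau) = f z" if "z ~: lattice tau" for z
   using that by (simp add: f_def theta_plus_tau[OF t] sin_prod_plus_tau[OF t])
  have "\<forall>\<^sub>F z in at 0. dist (f z) (theta 1 0 tau / of_real pi) < 1" using tendstoD[OF lim, of 1] by simp
  thus "\<forall>\<^sub>F z in at 0. norm (f z) <= norm (theta 1 0 tau / of_real pi) + 1"
  proof eventually_elim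
   case (elim z)
   thus ?case using norm_triangle_sub[of "f z" "theta 1 0 tau / of_real pi"] by (simp add: dist_norm)
  qed
 qed
 then obtain c where c: "!!z. z ~: lattice tau ==> f z = c" by blast
 have "(f \<longlongrightarrow> c) (at 0)"
  by (rule tendsto_eventually) (use eventually_not_lattice[OF t, of 0] in \<open>auto elim!: eventually_mono simp: c\<close>)
 hence cc: "c = theta 1 0 tau / of_real pi" using lim by (rule tendsto_unique[rotated]) simp
 show eq: "theta 0 z tau = theta 1 0 tau / of_real pi * sin_prod tau z" if "z ~: lattice tau" for z
  using c[OF that] sin_prod_nonzero[OF t that] unfolding f_def cc by (simp add: field_simps)
 show "theta 1 0 tau ~= 0"
 proof
  assume "theta 1 0 tau = 0"
  hence "theta 0 z tau = 0" for z using eq[of z] theta_lattice_zero[OF t, of z] by (cases "z : lattice tau") auto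
  thus False using theta_not_identically_zero[OF t] by auto
 qed
qed

corollary theta_eq_0_iff:
 assumes t: "Im tau > 0"
 shows "theta 0 z tau = 0 \<longleftrightarrow> z : lattice tau"
 using theta_lattice_zero[OF t, of z] theta_eq_sin_prod(1)[OF t, of z] theta_eq_sin_prod(2)[OF t] sin_prod_nonzero[OF t, of z] by (cases "z : lattice tau") auto

text \<open>The logarithmic derivative of the eta product, taken factor by factor and solved for the
  Lambert series; the summand \<open>pi i / 12\<close> comes from the exponential in front of the
  product.\<close>

lemma dedekind_eta_logderiv:
 assumes t: "Im tau > 0"
 shows "(%k. of_nat (Suc k) * nome tau ^ Suc k / (1 - nome tau ^ Suc k)) sums ((of_real pi * \<i> / 12 - g1 tau) / (2 * of_real pi * \<i>))"
proof -
 define f where "f k t = 1 - exp (2 * of_real pi * \<i> * of_nat (Suc k) * t)" for k and t :: complex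
 define r where "r = Im tau / 2"
 have r: "r > 0" using t by (simp add: r_def)
 define \<rho> where "\<rho> = exp (- 2 * pi * r)"
 have \<rho>: "0 < \<rho>" "\<rho> < 1" using r by (auto simp: \<rho>_def)
 have fn: "f k t = 1 - nome t ^ Suc k" for k t
  unfolding f_def nome_power by (simp only: mult_ac)
 have holo: "f k holo cball tau r" for k unfolding f_def[abs_def] by (intro holomorphic_intros)
 have le: "norm (f k x - 1) <= \<rho> ^ Suc k" if "x : cball tau r" for k x
 proof -
  have "Im x >= r" using that abs_Im_le_cmod[of "tau - x"] by (auto simp: dist_norm r_def)
  hence "norm (nome x) <= \<rho>" by (simp add: nome_def norm_exp_eq_Re \<rho>_def)
  hence "norm (nome x) ^ Suc k <= \<rho> ^ Suc k" by (intro power_mono) auto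
  thus ?thesis by (simp add: fn norm_power norm_mult)
 qed
 have sM: "summable (%k. \<rho> ^ Suc k)" using \<rho> by (intro summable_Suc_iff[THEN iffD2] summable_geometric) auto
 define P where "P x = (\<Prod>k. f k x)" for x
 have P: "P holo ball tau r" unfolding P_def[abs_def] by (rule prodinf_Mtest_holomorphic[OF holo le sM r])
 have fnz: "f k tau ~= 0" for k unfolding fn using nome_power_neq_1[OF t, of k] by simp
 have Pnz: "P tau ~= 0" unfolding P_def by (rule prodinf_Mtest_nonzero[OF holo le sM r fnz])
 have ld: "(%k. deriv (f k) tau / f k tau) sums (deriv P tau / P tau)"
  using prodinf_Mtest_logderiv[OF holo le sM r fnz] by (simp add: P_def[abs_def])
 have df: "deriv (f k) tau = - (2 * of_real pi * \<i>) * (of_nat (Suc k) * nome tau ^ Suc k)" for k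
 proof -
  have "(f k hfd - (2 * of_real pi * \<i> * of_nat (Suc k)) * exp (2 * of_real pi * \<i> * of_nat (Suc k) * tau)) (at tau)"
   unfolding f_def by (auto intro!: derivative_eq_intros)
  moreover have "exp (2 * of_real pi * \<i> * of_nat (Suc k) * tau) = nome tau ^ Suc k"
   unfolding nome_power by (simp only: mult_ac)
  ultimately show ?thesis by (intro DERIV_imp_deriv) (simp only: mult_ac mult_minus_left mult_minus_right)
 qed
 have eta: "dedekind_eta = (%tau. exp (of_real pi * \<i> * tau / 12) * P tau)"
  by (rule ext) (simp add: dedekind_eta_def P_def f_def)
 have "(P hfd deriv P tau) (at tau)"
  by (rule holomorphic_derivI[OF P]) (use r in auto)
 hence "((%tau. exp (of_real pi * \<i> * tau / 12) * P tau) hfd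
  exp (of_real pi * \<i> * tau / 12) * (of_real pi * \<i> / 12 * P tau + deriv P tau)) (at tau)"
  by (auto intro!: derivative_eq_intros simp: algebra_simps)
 hence "deriv dedekind_eta tau = exp (of_real pi * \<i> * tau / 12) * (of_real pi * \<i> / 12 * P tau + deriv P tau)"
  unfolding eta by (rule DERIV_imp_deriv)
 moreover have "dedekind_eta tau = exp (of_real pi * \<i> * tau / 12) * P tau" unfolding eta ..
 ultimately have "g1 tau = of_real pi * \<i> / 12 + deriv P tau / P tau"
  unfolding g1_def using Pnz by (simp add: add_divide_distrib)
 hence dP: "deriv P tau / P tau = g1 tau - of_real pi * \<i> / 12" by simp
 have "(%k. (deriv (f k) tau / f k tau) * (- 1 / (2 * of_real pi * \<i>))) sums ((deriv P tau / P tau) * (- 1 / (2 * of_real pi * \<i>)))"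
  by (rule sums_mult2[OF ld])
 moreover have "(deriv (f k) tau / f k tau) * (- 1 / (2 * of_real pi * \<i>)) = of_nat (Suc k) * nome tau ^ Suc k / (1 - nome tau ^ Suc k)" for k
  unfolding df fn by simp
 moreover have "(deriv P tau / P tau) * (- 1 / (2 * of_real pi * \<i>)) = (of_real pi * \<i> / 12 - g1 tau) / (2 * of_real pi * \<i>)"
  unfolding dP by (simp add: field_simps)
 ultimately show ?thesis by simp
qed

lemma has_sum_suminf:
 fixes f :: "nat => 'a::banach"
 assumes "summable (%n. norm (f n))"
 shows "infsum f UNIV = suminf f"
 using norm_summable_imp_has_sum[OF assms summable_sums[OF summable_norm_cancel[OF assms]]]
 by (rule infsumI)

text \<open>Both sides are the double series of \<open>b q^(a b)\<close> over
  \<open>a, b >= 1\<close>. Summing over b first uses the derivative of the geometric series,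
  summing over a first the geometric series itself. The identity joins the product for theta, which
  yields the left side, to the one for eta, which yields the right side.\<close>

lemma lambert_swap:
 fixes q :: complex
 assumes q: "norm q < 1"
 shows "(\<Sum>m. q ^ Suc m / (1 - q ^ Suc m)\<^sup>2) = (\<Sum>m. of_nat (Suc m) * q ^ Suc m / (1 - q ^ Suc m))"
proof -
 define F where "F a b = of_nat (Suc b) * q ^ (Suc a * Suc b)" for a b
 have qa: "norm (q ^ Suc a) < 1" for a
  using power_Suc_less_one[of "norm q" a] q by (cases "q = 0") (auto simp: norm_power norm_mult)
 \<comment> \<open>As \<open>(a + 1)(b + 1) >= a + b\<close> and \<open>norm q < 1\<close>, the
   double series is dominated by a product of two single convergent series.\<close>
 have nF: "norm (F a b) <= norm q ^ a * (real (Suc b) * norm q ^ b)" for a b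
 proof -
  have "norm q ^ (Suc a * Suc b) <= norm q ^ (a + b)" using q by (intro power_decreasing) auto
  hence "real (Suc b) * norm q ^ (Suc a * Suc b) <= real (Suc b) * norm q ^ (a + b)" by (intro mult_left_mono) auto
  thus ?thesis unfolding F_def norm_mult norm_power norm_of_nat by (simp add: power_add mult_ac)
 qed
 have s1: "summable (%a. norm q ^ a)" using q by (intro summable_geometric) auto
 have s2: "summable (%b. real (Suc b) * norm q ^ b)" using geometric_deriv_sums[of "norm q"] q by (auto simp: sums_iff)
 have "(%(a, b). norm q ^ a * (real (Suc b) * norm q ^ b)) summable_on UNIV \<times> UNIV"
  by (rule summable_on_SigmaI[where g="%a. norm q ^ a * (\<Sum>b. real (Suc b) * norm q ^ b)"])
   (use s1 s2 in \<open>auto intro!: norm_summable_imp_summable_on norm_summable_imp_has_sum summable_mult2 sums_mult summable_sums summable_mult simp: abs_mult\<close>)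
 hence "(%x. norm (case x of (a, b) => F a b)) summable_on UNIV \<times> UNIV"
  by (rule Infinite_Sum.abs_summable_on_comparison_test') (use nF in auto)
 hence abs: "(%(a, b). F a b) summable_on UNIV \<times> UNIV"
  by (rule abs_summable_summable)
 have inner1: "infsum (%b. F a b) UNIV = q ^ Suc a / (1 - q ^ Suc a)\<^sup>2" for a
 proof -
  have "(%b. of_nat (Suc b) * (q ^ Suc a) ^ b) sums (1 / (1 - q ^ Suc a)\<^sup>2)"
   by (rule geometric_deriv_sums[OF qa])
  hence s: "(%b. q ^ Suc a * (of_nat (Suc b) * (q ^ Suc a) ^ b)) sums (q ^ Suc a * (1 / (1 - q ^ Suc a)\<^sup>2))"
   by (rule sums_mult)
  have e: "q ^ Suc a * (of_nat (Suc b) * (q ^ Suc a) ^ b) = F a b" for b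
  proof -
   have "q ^ (Suc a * Suc b) = q ^ Suc a * (q ^ Suc a) ^ b" by (simp add: power_mult power_add power_mult_distrib)
   thus ?thesis by (simp only: F_def mult_ac)
  qed
  have "summable (%b. norm (F a b))"
   by (rule summable_comparison_test'[OF summable_mult[OF s2, of "norm q ^ a"]]) (use nF in auto)
  thus ?thesis using s unfolding e by (simp add: has_sum_suminf sums_iff)
 qed
 have inner2: "infsum (%a. F a b) UNIV = of_nat (Suc b) * q ^ Suc b / (1 - q ^ Suc b)" for b
 proof -
  have "(%a. (q ^ Suc b) ^ a) sums (1 / (1 - q ^ Suc b))"
   by (rule geometric_sums[OF qa])
  hence s: "(%a. of_nat (Suc b) * q ^ Suc b * (q ^ Suc b) ^ a) sums (of_nat (Suc b) * q ^ Suc b * (1 / (1 - q ^ Suc b)))"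
   by (rule sums_mult)
  have e: "of_nat (Suc b) * q ^ Suc b * (q ^ Suc b) ^ a = F a b" for a
  proof -
   have "q ^ (Suc a * Suc b) = q ^ Suc b * (q ^ Suc b) ^ a"
    by (metis power_Suc power_mult mult.commute)
   thus ?thesis by (simp only: F_def mult_ac)
  qed
  have "summable (%a. norm (F a b))"
   by (rule summable_comparison_test'[OF summable_mult2[OF s1, of "real (Suc b) * norm q ^ b"]]) (use nF in auto)
  thus ?thesis using s unfolding e by (simp add: has_sum_suminf sums_iff)
 qed
 have abs': "(%(b, a). F a b) summable_on UNIV \<times> UNIV"
  using abs by (subst summable_on_swap) (simp add: case_prod_unfold)
 have suminf: "infsum g UNIV = suminf g" if "g summable_on UNIV" for g :: "nat => complex"
  using has_sum_imp_sums[OF has_sum_infsum[OF that]] by (simp add: sums_iff)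
 show ?thesis
  using infsum_swap_banach[OF abs] suminf[OF summable_on_Sigma_banach[OF abs]] suminf[OF summable_on_Sigma_banach[OF abs']]
  unfolding inner1 inner2 by simp
qed

text \<open>The conclusion holds again on a neighbourhood, so the identity can be differentiated
  repeatedly.\<close>

lemma eventually_has_field_derivative_cong:
 fixes F G :: "complex => complex"
 assumes "\<forall>\<^sub>F z in nhds a. F z = G z" "!!z. (F hfd F' z) (at z)" "!!z. (G hfd G' z) (at z)"
 shows "\<forall>\<^sub>F z in nhds a. F' z = G' z"
proof -
 from assms(1) have "\<forall>\<^sub>F z in nhds a. \<forall>\<^sub>F w in nhds z. F w = G w" by (simp add: eventually_eventually)
 thus ?thesis
 proof eventually_elim
  case (elim z)
  hence "(F hfd G' z) (at z)" using assms(3)[of z] by (subst DERIV_cong_ev) auto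
  thus ?case using assms(2) DERIV_unique by blast
 qed
qed

text \<open>The third Taylor coefficient of theta at 0 ties the constant term of the logarithmic derivative to eta.\<close>

theorem theta_third_deriv:
 assumes t: "Im tau > 0"
 shows "theta 3 0 tau = 12 * of_real pi * \<i> * g1 tau * theta 1 0 tau"
proof -
 define C where "C = theta 1 0 tau / of_real pi"
 define p where "p = complex_of_real pi"
 have p0: "p ~= 0" by (simp add: p_def)
 define W where "W = theta_prod tau"
 define W1 where "W1 = deriv W"
 define W2 where "W2 = deriv W1"
 have W: "W holo UNIV" unfolding W_def by (rule theta_prod_holomorphic[OF t])
 hence W1: "W1 holo UNIV" unfolding W1_def by (rule holomorphic_deriv) auto
 hence W2: "W2 holo UNIV" unfolding W2_def by (rule holomorphic_deriv) auto
 have dW: "(W hfd W1 y) (at y)" for y unfolding W1_def using W by (intro holomorphic_derivI) auto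
 have dW1: "(W1 hfd W2 y) (at y)" for y unfolding W2_def using W1 by (intro holomorphic_derivI) auto
 obtain W3 where dW2: "!!y. (W2 hfd W3 y) (at y)" using W2 holomorphic_derivI[OF W2] by blast
 define Y where "Y z = 2 * sin (p * z) ^ 2" for z
 have dY: "(Y hfd 4 * p * sin (p * z) * cos (p * z)) (at z)" for z
  unfolding Y_def by (auto intro!: derivative_eq_intros simp: power2_eq_square)
 note [derivative_intros] = DERIV_chain2[OF dW dY] DERIV_chain2[OF dW1 dY] DERIV_chain2[OF dW2 dY] dY
 define G where "G z = - (W (Y z) + 2 * Y z * W1 (Y z)) + 4 * cos (p * z) ^ 2 * (3 * W1 (Y z) + 2 * Y z * W2 (Y z))" for z
 have dG: "\<exists>D. (G hfd D) (at z)" for z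
  unfolding G_def by (rule exI) (auto intro!: derivative_eq_intros)
 then obtain G' where dG: "!!z. (G hfd G' z) (at z)" by metis
 \<comment> \<open>The product formula, valid off the lattice, extends to 0 because both sides
   vanish there; it is now differentiated three times near 0.\<close>
 have e0: "\<forall>\<^sub>F z in nhds 0. theta 0 z tau = C * sin (p * z) * W (Y z)"
 proof -
  have "\<forall>\<^sub>F z in at 0. theta 0 z tau = C * sin (p * z) * W (Y z)"
   using eventually_not_lattice[OF t, of 0]
   by eventually_elim (simp add: theta_eq_sin_prod(1)[OF t] sin_prod_def C_def W_def Y_def p_def)
  thus ?thesis using t by (simp add: eventually_nhds_conv_at)
 qed
 have e1: "\<forall>\<^sub>F z in nhds 0. theta (Suc 0) z tau = C * p * cos (p * z) * (W (Y z) + 2 * Y z * W1 (Y z))"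
 proof (rule eventually_has_field_derivative_cong[OF e0 theta_deriv_z[OF t]])
  fix z
  show "((%z. C * sin (p * z) * W (Y z)) hfd C * p * cos (p * z) * (W (Y z) + 2 * Y z * W1 (Y z))) (at z)"
   by (auto intro!: derivative_eq_intros) (simp add: Y_def algebra_simps power2_eq_square)
 qed
 have cs: "cos (p * z) ^ 2 = 1 - sin (p * z) ^ 2" for z using sin_cos_squared_add[of "p * z"] by (simp add: algebra_simps)
 have e2: "\<forall>\<^sub>F z in nhds 0. theta (Suc (Suc 0)) z tau = C * p\<^sup>2 * sin (p * z) * G z"
 proof (rule eventually_has_field_derivative_cong[OF e1 theta_deriv_z[OF t]])
  fix z
  show "((%z. C * p * cos (p * z) * (W (Y z) + 2 * Y z * W1 (Y z))) hfd C * p\<^sup>2 * sin (p * z) * G z) (at z)"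
   by (auto intro!: derivative_eq_intros simp: G_def algebra_simps power2_eq_square)
 qed
 have e3: "\<forall>\<^sub>F z in nhds 0. theta (Suc (Suc (Suc 0))) z tau = C * p\<^sup>2 * (p * cos (p * z) * G z + sin (p * z) * G' z)"
  by (rule eventually_has_field_derivative_cong[OF e2 theta_deriv_z[OF t]])
   (auto intro!: derivative_eq_intros dG simp: algebra_simps)
 have "theta 3 0 tau = C * p ^ 3 * G 0"
  using eventually_nhds_x_imp_x[OF e3] by (simp add: eval_nat_numeral)
 also have "G 0 = - 1 + 12 * W1 0" by (simp add: G_def Y_def W_def)
 finally have 3: "theta 3 0 tau = theta 1 0 tau * p\<^sup>2 * (12 * W1 0 - 1)"
  using p0 by (simp add: C_def p_def[symmetric] power3_eq_cube power2_eq_square)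
 define S where "S = (\<Sum>m. nome tau ^ Suc m / (1 - nome tau ^ Suc m)\<^sup>2)"
 have "theta_coeff tau sums W1 0" unfolding W1_def W_def by (rule theta_prod_deriv_0[OF t])
 hence "(%k. theta_coeff tau k / 2) sums (W1 0 / 2)" by (rule sums_divide)
 hence "W1 0 / 2 = S" unfolding S_def theta_coeff_def by (simp add: sums_iff)
 hence W1S: "W1 0 = 2 * S" by simp
 have "S = (of_real pi * \<i> / 12 - g1 tau) / (2 * of_real pi * \<i>)"
  unfolding S_def lambert_swap[OF norm_nome_less_1[OF t]] using dedekind_eta_logderiv[OF t] by (simp add: sums_iff)
 hence "W1 0 = 1 / 12 - g1 tau / (p * \<i>)" unfolding W1S using p0 by (simp add: p_def field_simps)
 hence "12 * W1 0 - 1 = - (12 * g1 tau / (p * \<i>))" by simp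
 also have "... = 12 * \<i> * g1 tau / p" using p0 by (simp add: field_simps)
 finally have "12 * W1 0 - 1 = 12 * \<i> * g1 tau / p" .
 thus ?thesis unfolding 3 using p0 by (simp add: power2_eq_square p_def)
qed

text \<open>Periodicity carries the bound at a representative to its whole class modulo the lattice.
  Used for the addition theorem, whose two sides have singularities in the classes of 0 and of the
  fixed difference of the arguments.\<close>

lemma elliptic_constant_mod:
 fixes f :: "complex => complex"
 assumes tau: "Im tau > 0" and C: "finite C" and S: "S = {z. \<exists>c\<in>C. z - c : lattice tau}"
  and holo: "f holo - S"
  and f1: "!!z. z ~: S ==> f (z + 1) = f z" and ft: "!!z. z ~: S ==> f (z + tau) = f z"
  and bdd: "!!c. c : C ==> \<exists>B. \<forall>\<^sub>F z in at c. norm (f z) <= B"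
 shows "\<exists>c. \<forall>z. z ~: S --> f z = c"
proof (rule elliptic_constant[OF tau holo])
 have inv: "z + l : S \<longleftrightarrow> z : S" if "l : lattice tau" for z l
 proof -
  have "z + l - c : lattice tau \<longleftrightarrow> z - c : lattice tau" for c
   using lattice_add_iff[OF that, of "z - c"] by (simp add: algebra_simps)
  thus ?thesis by (simp add: S)
 qed
 thus "z + 1 : S \<longleftrightarrow> z : S" "z + tau : S \<longleftrightarrow> z : S" for z by auto
 have ev: "\<forall>\<^sub>F z in at a. z ~: S" for a
 proof -
  have "\<forall>\<^sub>F z in at a. \<forall>c\<in>C. z - c ~: lattice tau"
  proof (intro eventually_ball_finite C ballI)
   fix c
   have "\<forall>\<^sub>F z in at (a - c). z ~: lattice tau" by (rule eventually_not_lattice[OF tau])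
   moreover have "filterlim (%z. z - c) (at (a - c)) (at a)"
    by (intro filterlim_atI tendsto_intros) (auto simp: eventually_at_filter)
   ultimately show "\<forall>\<^sub>F z in at a. z - c ~: lattice tau" by (rule eventually_compose_filterlim)
  qed
  thus ?thesis by (simp add: S)
 qed
 thus "\<not> z islimpt S" for z by (simp add: islimpt_iff_eventually)
 have per: "f (z + l) = f z" if "l : lattice tau" "z ~: S" for z l
 proof -
  have peri: "f (z + of_int k * w) = f z" if w: "w : lattice tau" "!!k::int. of_int k * w : lattice tau"
    "!!z. z ~: S ==> f (z + w) = f z" and z: "z ~: S" for k w z
  proof (induction k rule: int_induct[where k=0])
   case (step1 i)
   have "z + of_int i * w ~: S" using inv w z by blast
   from w(3)[OF this] step1 show ?case by (simp add: algebra_simps)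
  next
   case (step2 i)
   have "z + of_int (i - 1) * w ~: S" using inv w(2) z by blast
   from w(3)[OF this] step2 show ?case by (simp add: algebra_simps)
  qed simp
  obtain a b where l: "l = of_int a + of_int b * tau" using \<open>l : lattice tau\<close> by (auto simp: lattice_def)
  have "z + of_int a * 1 ~: S" using inv[of "of_int a" z] \<open>z ~: S\<close> by simp
  hence "f (z + of_int a * 1 + of_int b * tau) = f (z + of_int a * 1)"
   by (intro peri ft) auto
  also have "... = f z" by (intro peri f1) (use \<open>z ~: S\<close> in auto)
  finally show ?thesis by (simp add: l add.assoc)
 qed
 fix s assume "s : S"
 then obtain c where c: "c : C" "s - c : lattice tau" by (auto simp: S)
 from bdd[OF c(1)] obtain B where B: "\<forall>\<^sub>F z in at c. norm (f z) <= B" by blast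
 have "\<forall>\<^sub>F z in at s. norm (f (z - (s - c))) <= B"
 proof (rule eventually_compose_filterlim[OF B])
  have "((%z. z - (s - c)) \<longlongrightarrow> s - (s - c)) (at s)" by (intro tendsto_intros)
  thus "filterlim (%z. z - (s - c)) (at c) (at s)"
   by (intro filterlim_atI) (auto simp: eventually_at_filter)
 qed
 hence "\<forall>\<^sub>F z in at s. norm (f z) <= B"
  using ev[of s]
 proof eventually_elim
  case (elim z)
  have "z - (s - c) ~: S" using inv[OF c(2), of "z - (s - c)"] elim by simp
  from per[OF c(2) this] elim show ?case by simp
 qed
 thus "\<exists>B. \<forall>\<^sub>F z in at s. norm (f z) <= B" by blast
qed (use f1 ft in auto)

section \<open>The logarithmic derivative of theta and its differential ring\<close>

definition theta_ratio :: "nat => complex => complex => complex" where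
 "theta_ratio j z tau = theta j z tau / theta 0 z tau"

text \<open>Equivalently theta does not vanish at z (\<open>gpt_theta\<close>); this is an open
  condition in z and in tau separately, which is the form in which partial derivatives use
  it.\<close>

definition gpt :: "complex => complex => bool" where
 "gpt z tau \<longleftrightarrow> Im tau > 0 & z ~: lattice tau"

lemma gpt_theta: "gpt z tau \<longleftrightarrow> Im tau > 0 & theta 0 z tau ~= 0"
 using theta_eq_0_iff by (auto simp: gpt_def)

lemma gpt_uminus [simp]: "gpt (- z) tau \<longleftrightarrow> gpt z tau"
 by (simp add: gpt_def)

lemma eventually_good_z: "gpt z tau ==> \<forall>\<^sub>F w in nhds z. gpt w tau"
 using eventually_not_lattice_nhds[of tau z] by (auto simp: gpt_def elim!: eventually_mono)

lemma eventually_good_tau: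
 assumes "gpt z tau" shows "\<forall>\<^sub>F t in nhds tau. gpt z t"
proof -
 have t: "Im tau > 0" and nz: "theta 0 z tau ~= 0" using assms by (auto simp: gpt_theta)
 have "isCont (%t. theta 0 z t) tau" using theta_deriv_tau[OF t] DERIV_isCont by blast
 hence "((%t. theta 0 z t) \<longlongrightarrow> theta 0 z tau) (nhds tau)" by (simp add: isCont_def tendsto_at_iff_tendsto_nhds)
 hence "\<forall>\<^sub>F t in nhds tau. theta 0 z t ~= 0" using nz by (rule tendsto_imp_eventually_ne)
 moreover have "\<forall>\<^sub>F t in nhds tau. Im t > 0"
  using eventually_nhds_in_open[OF open_upper_half, of tau] t by simp
 ultimately show ?thesis by eventually_elim (simp add: gpt_theta)
qed

text \<open>The differential ring generated by the \<open>theta_ratio j\<close>; the heat equation makes it closed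
 under both partial derivatives, which commute.\<close>

inductive_set theta_ring :: "(complex => complex => complex) set" where
 ratio: "theta_ratio j : theta_ring"
| const: "(%z tau. c) : theta_ring"
| add: "F : theta_ring ==> G : theta_ring ==> (%z tau. F z tau + G z tau) : theta_ring"
| mult: "F : theta_ring ==> G : theta_ring ==> (%z tau. F z tau * G z tau) : theta_ring"

lemma theta_ring_cmult: "F : theta_ring ==> (%z tau. c * F z tau) : theta_ring"
 using theta_ring.mult[OF theta_ring.const[of c]] by simp

lemma theta_ring_diff: "F : theta_ring ==> G : theta_ring ==> (%z tau. F z tau - G z tau) : theta_ring"
 using theta_ring.add[of F "%z tau. -1 * G z tau"] theta_ring_cmult[of G "-1"] by simp

lemma theta_ratio_deriv_z:
 "gpt z tau ==> ((%w. theta_ratio j w tau) hfd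
   theta_ratio (Suc j) z tau - theta_ratio j z tau * theta_ratio 1 z tau) (at z)"
 unfolding theta_ratio_def gpt_theta
 by (auto intro!: derivative_eq_intros theta_deriv_z simp: field_simps)

lemma theta_ratio_deriv_tau:
 "gpt z tau ==> ((%t. theta_ratio j z t) hfd
   kappa * (theta_ratio (Suc (Suc j)) z tau - theta_ratio j z tau * theta_ratio 2 z tau)) (at tau)"
 unfolding theta_ratio_def gpt_theta
 by (auto intro!: derivative_eq_intros theta_deriv_tau simp: field_simps eval_nat_numeral)

text \<open>\<open>F1\<close> and \<open>F2\<close> are the derivatives in z and in tau. A single
  \<open>F12\<close> serves for both mixed derivatives, which records that they coincide.\<close>

definition theta_derivs :: "(complex => complex => complex) => (complex => complex => complex) =>
  (complex => complex => complex) => (complex => complex => complex) => bool" where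
 "theta_derivs F F1 F2 F12 \<longleftrightarrow> F1 : theta_ring & F2 : theta_ring & F12 : theta_ring & (\<forall>z tau. gpt z tau -->
  ((%w. F w tau) hfd F1 z tau) (at z) &
  ((%t. F z t) hfd F2 z tau) (at tau) &
  ((%t. F1 z t) hfd F12 z tau) (at tau) &
  ((%w. F2 w tau) hfd F12 z tau) (at z))"

lemma theta_derivsD:
 assumes "theta_derivs F F1 F2 F12"
 shows "F1 : theta_ring" "F2 : theta_ring" "F12 : theta_ring"
  "!!z tau. gpt z tau ==> ((%w. F w tau) hfd F1 z tau) (at z)"
  "!!z tau. gpt z tau ==> ((%t. F z t) hfd F2 z tau) (at tau)"
  "!!z tau. gpt z tau ==> ((%t. F1 z t) hfd F12 z tau) (at tau)"
  "!!z tau. gpt z tau ==> ((%w. F2 w tau) hfd F12 z tau) (at z)"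
 using assms unfolding theta_derivs_def by blast+

lemma theta_derivs_ratio:
 "theta_derivs (theta_ratio j) (%z tau. theta_ratio (Suc j) z tau - theta_ratio j z tau * theta_ratio 1 z tau)
  (%z tau. kappa * (theta_ratio (Suc (Suc j)) z tau - theta_ratio j z tau * theta_ratio 2 z tau))
  (%z tau. kappa * ((theta_ratio (Suc (Suc (Suc j))) z tau - theta_ratio (Suc j) z tau * theta_ratio 2 z tau)
   - ((theta_ratio (Suc (Suc j)) z tau - theta_ratio j z tau * theta_ratio 2 z tau) * theta_ratio 1 z tau
     + theta_ratio j z tau * (theta_ratio (Suc (Suc 1)) z tau - theta_ratio 1 z tau * theta_ratio 2 z tau))))"
 unfolding theta_derivs_def
proof (intro conjI allI impI)
 fix z tau assume g: "gpt z tau"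
 note d = theta_ratio_deriv_z[OF g] theta_ratio_deriv_tau[OF g]
 show "((%w. theta_ratio j w tau) hfd theta_ratio (Suc j) z tau - theta_ratio j z tau * theta_ratio 1 z tau) (at z)"
  by (rule d)
 show "((%t. theta_ratio j z t) hfd kappa * (theta_ratio (Suc (Suc j)) z tau - theta_ratio j z tau * theta_ratio 2 z tau)) (at tau)"
  by (rule d)
 show "((%t. theta_ratio (Suc j) z t - theta_ratio j z t * theta_ratio 1 z t) has_field_derivative
  kappa * ((theta_ratio (Suc (Suc (Suc j))) z tau - theta_ratio (Suc j) z tau * theta_ratio 2 z tau)
   - ((theta_ratio (Suc (Suc j)) z tau - theta_ratio j z tau * theta_ratio 2 z tau) * theta_ratio 1 z tau
     + theta_ratio j z tau * (theta_ratio (Suc (Suc 1)) z tau - theta_ratio 1 z tau * theta_ratio 2 z tau)))) (at tau)"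
  by (rule derivative_eq_intros d refl)+ (simp add: algebra_simps)
 show "((%w. kappa * (theta_ratio (Suc (Suc j)) w tau - theta_ratio j w tau * theta_ratio 2 w tau)) has_field_derivative
  kappa * ((theta_ratio (Suc (Suc (Suc j))) z tau - theta_ratio (Suc j) z tau * theta_ratio 2 z tau)
   - ((theta_ratio (Suc (Suc j)) z tau - theta_ratio j z tau * theta_ratio 2 z tau) * theta_ratio 1 z tau
     + theta_ratio j z tau * (theta_ratio (Suc (Suc 1)) z tau - theta_ratio 1 z tau * theta_ratio 2 z tau)))) (at z)"
  by (rule derivative_eq_intros d refl)+ (simp add: algebra_simps eval_nat_numeral)
qed (intro theta_ring_cmult theta_ring_diff theta_ring.add theta_ring.mult theta_ring.ratio)+

lemma theta_derivs_const: "theta_derivs (%z tau. c) (%z tau. 0) (%z tau. 0) (%z tau. 0)"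
 unfolding theta_derivs_def by (auto intro: theta_ring.const)

lemma theta_derivs_add:
 assumes "theta_derivs F F1 F2 F12" "theta_derivs G G1 G2 G12"
 shows "theta_derivs (%z tau. F z tau + G z tau) (%z tau. F1 z tau + G1 z tau) (%z tau. F2 z tau + G2 z tau) (%z tau. F12 z tau + G12 z tau)"
 unfolding theta_derivs_def
 by (intro conjI allI impI theta_ring.add DERIV_add theta_derivsD[OF assms(1)] theta_derivsD[OF assms(2)])

lemma theta_derivs_mult:
 assumes F: "theta_derivs F F1 F2 F12" "F : theta_ring" and G: "theta_derivs G G1 G2 G12" "G : theta_ring"
 shows "theta_derivs (%z tau. F z tau * G z tau) (%z tau. F1 z tau * G z tau + F z tau * G1 z tau) (%z tau. F2 z tau * G z tau + F z tau * G2 z tau)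
  (%z tau. F12 z tau * G z tau + F1 z tau * G2 z tau + (F2 z tau * G1 z tau + F z tau * G12 z tau))"
 unfolding theta_derivs_def
proof (intro conjI allI impI)
 fix z tau assume g: "gpt z tau"
 note d = theta_derivsD(4-7)[OF F(1) g] theta_derivsD(4-7)[OF G(1) g]
 show "((%w. F w tau * G w tau) hfd F1 z tau * G z tau + F z tau * G1 z tau) (at z)"
  by (rule derivative_eq_intros d refl)+ (simp add: algebra_simps)
 show "((%t. F z t * G z t) hfd F2 z tau * G z tau + F z tau * G2 z tau) (at tau)"
  by (rule derivative_eq_intros d refl)+ (simp add: algebra_simps)
 show "((%t. F1 z t * G z t + F z t * G1 z t) has_field_derivative
   F12 z tau * G z tau + F1 z tau * G2 z tau + (F2 z tau * G1 z tau + F z tau * G12 z tau)) (at tau)"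
  by (rule derivative_eq_intros d refl)+ (simp add: algebra_simps)
 show "((%w. F2 w tau * G w tau + F w tau * G2 w tau) has_field_derivative
   F12 z tau * G z tau + F1 z tau * G2 z tau + (F2 z tau * G1 z tau + F z tau * G12 z tau)) (at z)"
  by (rule derivative_eq_intros d refl)+ (simp add: algebra_simps)
qed (intro theta_ring.add theta_ring.mult F(2) G(2) theta_derivsD(1-3)[OF F(1)] theta_derivsD(1-3)[OF G(1)])+

lemma theta_ring_derivs:
 assumes "F : theta_ring"
 obtains F1 F2 F12 where "theta_derivs F F1 F2 F12"
proof -
 have "\<exists>F1 F2 F12. theta_derivs F F1 F2 F12"
  using assms
  by induction (blast intro: theta_derivs_ratio theta_derivs_const theta_derivs_add theta_derivs_mult)+
 thus ?thesis using that by blast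
qed

definition dz :: "nat => (complex => complex => complex) => complex => complex => complex" where
 "dz k F z tau = (deriv ^^ k) (%w. F w tau) z"

lemma dz_0 [simp]: "dz 0 F = F" by (simp add: dz_def fun_eq_iff)

lemma dz_Suc_right:
 assumes "!!z tau. gpt z tau ==> ((%w. F w tau) hfd F1 z tau) (at z)" "gpt z tau"
 shows "dz (Suc k) F z tau = dz k F1 z tau"
proof -
 have "\<forall>\<^sub>F w in nhds z. deriv (%w. F w tau) w = F1 w tau"
  using eventually_good_z[OF assms(2)] by eventually_elim (intro DERIV_imp_deriv assms(1))
 thus ?thesis unfolding dz_def funpow_Suc_right o_def by (rule higher_deriv_cong_ev) auto
qed

lemma dz_theta_ring:
 assumes "F : theta_ring"
 obtains G where "G : theta_ring" "!!z tau. gpt z tau ==> dz k F z tau = G z tau"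
proof -
 have "\<exists>G\<in>theta_ring. \<forall>z tau. gpt z tau --> dz k F z tau = G z tau"
  using assms
 proof (induction k arbitrary: F)
  case (Suc k)
  from Suc.prems obtain F1 where F1: "F1 : theta_ring"
   "!!z tau. gpt z tau ==> ((%w. F w tau) hfd F1 z tau) (at z)"
   using theta_ring_derivs theta_derivsD(1,4) by metis
  thus ?case using Suc.IH[OF F1(1)] dz_Suc_right[of F F1, OF F1(2)] by auto
 qed auto
 thus ?thesis using that by blast
qed

lemma dz_deriv_z:
 assumes F: "F : theta_ring" and g: "gpt z tau"
 shows "((%w. dz k F w tau) hfd dz (Suc k) F z tau) (at z)"
proof -
 obtain G where G: "G : theta_ring" "!!z tau. gpt z tau ==> dz k F z tau = G z tau"
  using dz_theta_ring[OF F] by blast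
 obtain G1 where G1: "!!z tau. gpt z tau ==> ((%w. G w tau) hfd G1 z tau) (at z)"
  using theta_ring_derivs[OF G(1)] theta_derivsD(4) by metis
 have "\<forall>\<^sub>F w in nhds z. dz k F w tau = G w tau"
  using eventually_good_z[OF g] by eventually_elim (rule G(2))
 hence "((%w. dz k F w tau) hfd G1 z tau) (at z)"
  using G1[OF g] by (subst DERIV_cong_ev) auto
 thus ?thesis
  unfolding dz_def by (simp add: DERIV_imp_deriv)
qed

text \<open>Induction on k: one z-derivative is moved inside, replacing \<open>F\<close> by its
  z-derivative and \<open>G\<close> by the common mixed derivative \<open>F12\<close>.\<close>

lemma dz_deriv_tau:
 assumes F: "F : theta_ring" and G: "!!z tau. gpt z tau ==> ((%t. F z t) hfd G z tau) (at tau)"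
  and g: "gpt z tau"
 shows "((%t. dz k F z t) hfd dz k G z tau) (at tau)"
 using F G g
proof (induction k arbitrary: F G z tau)
 case (Suc k)
 obtain F1 F2 F12 where "theta_derivs F F1 F2 F12"
  using theta_ring_derivs[OF Suc.prems(1)] by metis
 note F = theta_derivsD[OF this]
 have G2: "G z tau = F2 z tau" if "gpt z tau" for z tau
  using DERIV_unique[OF Suc.prems(2)[OF that] F(5)[OF that]] .
 have "((%w. G w tau) hfd F12 z tau) (at z)" if "gpt z tau" for z tau
 proof -
  have "\<forall>\<^sub>F w in nhds z. G w tau = F2 w tau" using eventually_good_z[OF that] by eventually_elim (rule G2)
  thus ?thesis using F(7)[OF that] by (subst DERIV_cong_ev) auto
 qed
 hence "dz (Suc k) G z tau = dz k F12 z tau" using Suc.prems(3) by (rule dz_Suc_right)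
 moreover have "\<forall>\<^sub>F t in nhds tau. dz (Suc k) F z t = dz k F1 z t"
  using eventually_good_tau[OF Suc.prems(3)] by eventually_elim (rule dz_Suc_right[of F F1, OF F(4)])
 moreover have "((%t. dz k F1 z t) hfd dz k F12 z tau) (at tau)"
  by (rule Suc.IH[OF F(1) F(6) Suc.prems(3)])
 ultimately show ?case by (subst DERIV_cong_ev) auto
qed simp

lemma dz_cong:
 assumes "!!z tau. gpt z tau ==> F z tau = G z tau" "gpt z tau"
 shows "dz k F z tau = dz k G z tau"
proof -
 have "\<forall>\<^sub>F w in nhds z. F w tau = G w tau" using eventually_good_z[OF assms(2)] by eventually_elim (rule assms(1))
 thus ?thesis unfolding dz_def by (rule higher_deriv_cong_ev) auto
qed

text \<open>\<open>Zf\<close> is the z-derivative of log theta, and by the heat equation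
  \<open>kappa * Nf\<close> is the tau-derivative of log theta. \<open>Mf\<close> arises when
  \<open>Nf = Zf\<^sup>2 + Zf'\<close> is differentiated in tau: the result is
  \<open>kappa * Mf\<close>.\<close>

definition Zf :: "complex => complex => complex" where "Zf = theta_ratio 1"
definition Nf :: "complex => complex => complex" where "Nf = theta_ratio 2"
definition Mf :: "complex => complex => complex" where "Mf z tau = 2 * Zf z tau * dz 1 Nf z tau + dz 2 Nf z tau"

lemma Zf_ring [simp]: "Zf : theta_ring" and Nf_ring [simp]: "Nf : theta_ring"
 by (simp_all add: Zf_def Nf_def theta_ring.ratio)

lemma Nf_eq: "gpt z tau ==> Nf z tau = Zf z tau ^ 2 + dz 1 Zf z tau"
 using dz_Suc_right[of Zf _ z tau 0, OF theta_ratio_deriv_z[of _ _ 1, folded Zf_def]]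
 by (simp add: Zf_def Nf_def power2_eq_square eval_nat_numeral)

lemma Zf_deriv_tau: "gpt z tau ==> ((%t. Zf z t) hfd kappa * dz 1 Nf z tau) (at tau)"
proof -
 assume g: "gpt z tau"
 have "dz 1 Nf z tau = theta_ratio (Suc 2) z tau - theta_ratio 2 z tau * theta_ratio 1 z tau"
  using dz_Suc_right[of Nf _ z tau 0, OF theta_ratio_deriv_z[of _ _ 2, folded Nf_def] g] by (simp add: Nf_def)
 thus ?thesis
  using theta_ratio_deriv_tau[OF g, of 1] by (simp add: Zf_def eval_nat_numeral mult.commute)
qed

lemma dz_cmult: "F : theta_ring ==> gpt z tau ==> dz k (%z tau. c * F z tau) z tau = c * dz k F z tau"
proof (induction k arbitrary: F)
 case (Suc k)
 obtain F1 where F1: "F1 : theta_ring"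
  "!!z tau. gpt z tau ==> ((%w. F w tau) hfd F1 z tau) (at z)"
  using theta_ring_derivs[OF Suc.prems(1)] theta_derivsD(1,4) by metis
 show ?case
  using dz_Suc_right[of F F1, OF F1(2) Suc.prems(2)] dz_Suc_right[of "%z tau. c * F z tau" "%z tau. c * F1 z tau", OF DERIV_cmult[OF F1(2)] Suc.prems(2)]
   Suc.IH[OF F1(1) Suc.prems(2)] by simp
qed simp

lemma dz_dz:
 assumes "F : theta_ring" "gpt z tau"
 shows "dz k (dz j F) z tau = dz (k + j) F z tau"
 by (simp add: dz_def funpow_add o_def)

lemma dz_Zf_deriv_tau:
 assumes "gpt z tau" shows "((%t. dz k Zf z t) hfd kappa * dz (Suc k) Nf z tau) (at tau)"
proof -
 obtain G where G: "G : theta_ring" "!!z tau. gpt z tau ==> dz 1 Nf z tau = G z tau"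
  using dz_theta_ring[OF Nf_ring] by blast
 have "dz k (%z tau. kappa * dz 1 Nf z tau) z tau = dz k (%z tau. kappa * G z tau) z tau"
  by (rule dz_cong[OF _ assms]) (simp only: G)
 also have "... = kappa * dz k G z tau" by (rule dz_cmult[OF G(1) assms])
 also have "dz k G z tau = dz k (dz 1 Nf) z tau" by (rule dz_cong[OF _ assms]) (simp only: G)
 also have "... = dz (Suc k) Nf z tau" using dz_dz[OF Nf_ring assms] by simp
 finally show ?thesis using dz_deriv_tau[OF Zf_ring Zf_deriv_tau assms, of k] by simp
qed

lemma Mf_ring: obtains G where "G : theta_ring" "!!z tau. gpt z tau ==> Mf z tau = G z tau"
proof -
 obtain G1 where G1: "G1 : theta_ring" "!!z tau. gpt z tau ==> dz 1 Nf z tau = G1 z tau"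
  using dz_theta_ring[OF Nf_ring] by blast
 obtain G2 where G2: "G2 : theta_ring" "!!z tau. gpt z tau ==> dz 2 Nf z tau = G2 z tau"
  using dz_theta_ring[OF Nf_ring] by blast
 have "(%z tau. 2 * Zf z tau * G1 z tau + G2 z tau) : theta_ring"
  by (intro theta_ring.add theta_ring.mult theta_ring_cmult G1 G2 Zf_ring)
 thus ?thesis using that[of "%z tau. 2 * Zf z tau * G1 z tau + G2 z tau"] G1 G2 by (simp add: Mf_def)
qed

lemma Nf_deriv_tau:
 assumes "gpt z tau" shows "((%t. Nf z t) hfd kappa * Mf z tau) (at tau)"
proof -
 have "\<forall>\<^sub>F t in nhds tau. Nf z t = Zf z t ^ 2 + dz 1 Zf z t"
  using eventually_good_tau[OF assms] by eventually_elim (rule Nf_eq)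
 moreover have "((%t. Zf z t ^ 2 + dz 1 Zf z t) hfd kappa * Mf z tau) (at tau)"
  by (rule derivative_eq_intros Zf_deriv_tau dz_Zf_deriv_tau assms refl)+
   (simp add: Mf_def algebra_simps eval_nat_numeral)
 ultimately show ?thesis by (subst DERIV_cong_ev) auto
qed

lemma dz_Nf_deriv_tau:
 assumes "gpt z tau" shows "((%t. dz k Nf z t) hfd kappa * dz k Mf z tau) (at tau)"
proof -
 obtain G where G: "G : theta_ring" "!!z tau. gpt z tau ==> Mf z tau = G z tau"
  using Mf_ring by blast
 have "dz k (%z tau. kappa * Mf z tau) z tau = dz k (%z tau. kappa * G z tau) z tau"
  by (rule dz_cong[OF _ assms]) (simp only: G)
 also have "... = kappa * dz k G z tau" by (rule dz_cmult[OF G(1) assms])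
 also have "dz k G z tau = dz k Mf z tau" by (rule dz_cong[OF _ assms]) (simp only: G)
 finally show ?thesis using dz_deriv_tau[OF Nf_ring Nf_deriv_tau assms, of k] by simp
qed

definition quasi_factor :: "complex => complex => complex" where
 "quasi_factor z tau = exp (- of_real pi * \<i> * tau - 2 * of_real pi * \<i> * z)"

lemma theta_0_plus_tau: "Im tau > 0 ==> theta 0 (z + tau) tau = - quasi_factor z tau * theta 0 z tau"
 by (simp add: theta_plus_tau quasi_factor_def)

lemma quasi_factor_deriv:
 "((%z. quasi_factor z tau) hfd - 2 * of_real pi * \<i> * quasi_factor z tau) (at z)"
 unfolding quasi_factor_def by (auto intro!: derivative_eq_intros)

lemma theta_1_plus_tau:
 assumes t: "Im tau > 0"
 shows "theta 1 (z + tau) tau = - quasi_factor z tau * (theta 1 z tau - 2 * of_real pi * \<i> * theta 0 z tau)"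
proof -
 have "((%z. theta 0 (z + tau) tau) hfd theta (Suc 0) (z + tau) tau) (at z)"
  using theta_deriv_z[OF t, of 0 "z + tau"] by (simp add: DERIV_shift)
 moreover have "((%z. theta 0 (z + tau) tau) hfd - quasi_factor z tau * (theta (Suc 0) z tau - 2 * of_real pi * \<i> * theta 0 z tau)) (at z)"
  unfolding theta_0_plus_tau[OF t]
  by (rule derivative_eq_intros quasi_factor_deriv theta_deriv_z[OF t] refl)+ (simp add: algebra_simps)
 ultimately show ?thesis using DERIV_unique by fastforce
qed

lemma theta_2_plus_tau:
 assumes t: "Im tau > 0"
 shows "theta 2 (z + tau) tau = - quasi_factor z tau * (theta 2 z tau - 4 * of_real pi * \<i> * theta 1 z tau + (2 * of_real pi * \<i>)\<^sup>2 * theta 0 z tau)"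
proof -
 have "((%z. theta 1 (z + tau) tau) hfd theta (Suc 1) (z + tau) tau) (at z)"
  using theta_deriv_z[OF t, of 1 "z + tau"] by (simp add: DERIV_shift)
 moreover have "((%z. theta 1 (z + tau) tau) hfd
  - quasi_factor z tau * (theta (Suc 1) z tau - 4 * of_real pi * \<i> * theta (Suc 0) z tau + (2 * of_real pi * \<i>)\<^sup>2 * theta 0 z tau)) (at z)"
  unfolding theta_1_plus_tau[OF t]
  by (rule derivative_eq_intros quasi_factor_deriv theta_deriv_z[OF t] refl)+ (simp add: algebra_simps power2_eq_square)
 ultimately show ?thesis using DERIV_unique by (fastforce simp: eval_nat_numeral)
qed

lemma gpt_plus_1 [simp]: "gpt (z + 1) tau \<longleftrightarrow> gpt z tau"
 and gpt_plus_tau [simp]: "gpt (z + tau) tau \<longleftrightarrow> gpt z tau"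
 by (auto simp: gpt_def lattice_add_iff)

lemma Zf_plus_1: "gpt z tau ==> Zf (z + 1) tau = Zf z tau"
 and Nf_plus_1: "gpt z tau ==> Nf (z + 1) tau = Nf z tau"
 by (auto simp: Zf_def Nf_def theta_ratio_def gpt_def theta_plus_1)

lemma Zf_plus_tau: "gpt z tau ==> Zf (z + tau) tau = Zf z tau - 2 * of_real pi * \<i>"
 and Nf_plus_tau: "gpt z tau ==> Nf (z + tau) tau = Nf z tau - 4 * of_real pi * \<i> * Zf z tau + (2 * of_real pi * \<i>)\<^sup>2"
proof -
 assume "gpt z tau"
 hence t: "Im tau > 0" and nz: "theta 0 z tau ~= 0" by (auto simp: gpt_theta)
 have q: "quasi_factor z tau ~= 0" by (simp add: quasi_factor_def)
 have cancel: "(- q * a) / (- q * b) = a / b" if "q ~= 0" for q a b :: complex using that by simp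
 show "Zf (z + tau) tau = Zf z tau - 2 * of_real pi * \<i>"
  unfolding Zf_def theta_ratio_def theta_0_plus_tau[OF t] theta_1_plus_tau[OF t] cancel[OF q] using nz by (simp add: field_simps)
 show "Nf (z + tau) tau = Nf z tau - 4 * of_real pi * \<i> * Zf z tau + (2 * of_real pi * \<i>)\<^sup>2"
  unfolding Nf_def Zf_def theta_ratio_def theta_0_plus_tau[OF t] theta_2_plus_tau[OF t] cancel[OF q] using nz by (simp add: field_simps)
qed

lemma Zf_minus: "gpt z tau ==> Zf (- z) tau = - Zf z tau"
 and Nf_minus: "gpt z tau ==> Nf (- z) tau = Nf z tau"
 by (auto simp: Zf_def Nf_def theta_ratio_def gpt_def theta_odd)

section \<open>The addition theorem for the logarithmic derivative of theta\<close>

definition theta_const :: "complex => complex" where "theta_const tau = theta 3 0 tau / theta 1 0 tau"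

lemma theta_const_eq: "Im tau > 0 ==> theta_const tau = 12 * of_real pi * \<i> * g1 tau"
 unfolding theta_const_def using theta_third_deriv[of tau] theta_eq_sin_prod(2)[of tau] by simp

lemma Zf_times_tendsto: "Im tau > 0 ==> ((%z. Zf z tau * z) \<longlongrightarrow> 1) (at 0)"
proof -
 assume t: "Im tau > 0"
 have 1: "((%z. theta 0 z tau / z) \<longlongrightarrow> theta 1 0 tau) (at 0)"
  using theta_deriv_z[OF t, of 0 0] t by (intro has_field_derivative_tendsto_quotient) auto
 have "isCont (%z. theta 1 z tau) 0" using theta_deriv_z[OF t] DERIV_isCont by blast
 hence "((%z. theta 1 z tau / (theta 0 z tau / z)) \<longlongrightarrow> theta 1 0 tau / theta 1 0 tau) (at 0)"
  by (intro tendsto_divide 1) (auto simp: isCont_def theta_eq_sin_prod(2)[OF t, simplified])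
 thus ?thesis using theta_eq_sin_prod(2)[OF t] by (simp add: Zf_def theta_ratio_def)
qed

text \<open>Both theta and its second derivative are odd in z, so the quotient is regular at 0 and
  its value is the quotient of the first derivatives. This is the constant of the addition theorem,
  equal to \<open>12 pi i g1\<close>.\<close>

lemma Nf_tendsto: "Im tau > 0 ==> ((%z. Nf z tau) \<longlongrightarrow> theta_const tau) (at 0)"
proof -
 assume t: "Im tau > 0"
 have 1: "((%z. theta 0 z tau / z) \<longlongrightarrow> theta 1 0 tau) (at 0)"
  using theta_deriv_z[OF t, of 0 0] t by (intro has_field_derivative_tendsto_quotient) auto
 have "theta 2 0 tau = 0" using theta_odd[OF t, of 2 0] by simp
 hence 2: "((%z. theta 2 z tau / z) \<longlongrightarrow> theta 3 0 tau) (at 0)"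
  using theta_deriv_z[OF t, of 2 0] t by (intro has_field_derivative_tendsto_quotient) (auto simp: eval_nat_numeral)
 have "((%z. (theta 2 z tau / z) / (theta 0 z tau / z)) \<longlongrightarrow> theta_const tau) (at 0)"
  unfolding theta_const_def by (intro tendsto_divide 1 2 theta_eq_sin_prod(2)[OF t])
 moreover have "\<forall>\<^sub>F z in at 0. (theta 2 z tau / z) / (theta 0 z tau / z) = Nf z tau"
  by (auto simp: eventually_at Nf_def theta_ratio_def intro!: exI[of _ 1])
 ultimately show ?thesis by (rule Lim_transform_eventually)
qed

lemma Zf_deriv_z: "gpt z tau ==> ((%w. Zf w tau) hfd dz 1 Zf z tau) (at z)"
 and Nf_deriv_z: "gpt z tau ==> ((%w. Nf w tau) hfd dz 1 Nf z tau) (at z)"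
 using dz_deriv_z[of Zf z tau 0] dz_deriv_z[of Nf z tau 0] by simp_all

text \<open>The left-hand side minus the right-hand side, as a function of a for fixed a - b, is elliptic
 and has no poles; its value is the limit at a = 0.\<close>

theorem theta_addition:
 assumes "gpt a tau" "gpt b tau" "gpt (a - b) tau"
 shows "Nf a tau + Nf b tau + Nf (a - b) tau - theta_const tau
  = 2 * (Zf a tau * Zf b tau + Zf (a - b) tau * Zf a tau - Zf (a - b) tau * Zf b tau)"
proof -
 define d where "d = a - b"
 have t: "Im tau > 0" and gd: "gpt d tau" using assms by (auto simp: gpt_def d_def)
 \<comment> \<open>Terms in d alone are left out. The identity is the expanded form of the classical
   fact that \<open>(Z(p) + Z(q) + Z(s))^2 + Z'(p) + Z'(q) + Z'(s)\<close> is constant for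
   \<open>p + q + s = 0\<close>, taken at \<open>p = a\<close>, \<open>q = - b\<close>,
   \<open>s = b - a\<close>.\<close>
 define F where "F a = Nf a tau + Nf (a - d) tau - 2 * (Zf a tau * Zf (a - d) tau + Zf d tau * Zf a tau - Zf d tau * Zf (a - d) tau)" for a
 define S where "S = {z. \<exists>c\<in>{0, d}. z - c : lattice tau}"
 have S: "z ~: S \<longleftrightarrow> gpt z tau & gpt (z - d) tau" for z
  using t by (auto simp: S_def gpt_def)
 \<comment> \<open>At \<open>a = 0\<close> the simple pole of \<open>Z(a)\<close> is multiplied by
   \<open>Z(a - d) + Z(d)\<close>, which vanishes there, so the product tends to
   \<open>Z'(- d)\<close>.\<close>
 have lim0: "(F \<longlongrightarrow> theta_const tau - Nf d tau) (at 0)"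
 proof -
  have g: "gpt (0 - d) tau" using gd by simp
  have sh: "((%a. Zf (a - d) tau) hfd dz 1 Zf (0 - d) tau) (at 0)"
   "((%a. Nf (a - d) tau) hfd dz 1 Nf (0 - d) tau) (at 0)"
   using Zf_deriv_z[OF g] DERIV_shift[of "%w. Zf w tau" _ 0 "-d"] Nf_deriv_z[OF g] DERIV_shift[of "%w. Nf w tau" _ 0 "-d"] by simp_all
  from sh(1) have "((%a. Zf (a - d) tau + Zf d tau) hfd dz 1 Zf (0 - d) tau) (at 0)"
   by (auto intro!: derivative_eq_intros)
  hence 1: "((%a. (Zf (a - d) tau + Zf d tau) / a) \<longlongrightarrow> dz 1 Zf (0 - d) tau) (at 0)"
   by (rule has_field_derivative_tendsto_quotient) (simp add: Zf_minus[OF gd])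
  have c: "((%a. Zf (a - d) tau) \<longlongrightarrow> Zf (0 - d) tau) (at 0)" "((%a. Nf (a - d) tau) \<longlongrightarrow> Nf (0 - d) tau) (at 0)"
   using sh[THEN DERIV_isCont] by (simp_all add: isCont_def)
  have L1: "((%a. Nf a tau + Nf (a - d) tau - 2 * ((Zf a tau * a) * ((Zf (a - d) tau + Zf d tau) / a) - Zf d tau * Zf (a - d) tau))
   \<longlongrightarrow> theta_const tau + Nf (0 - d) tau - 2 * (1 * dz 1 Zf (0 - d) tau - Zf d tau * Zf (0 - d) tau)) (at 0)"
   by (intro tendsto_intros Nf_tendsto t Zf_times_tendsto 1 c)
  have L2: "\<forall>\<^sub>F a in at 0. Nf a tau + Nf (a - d) tau - 2 * ((Zf a tau * a) * ((Zf (a - d) tau + Zf d tau) / a) - Zf d tau * Zf (a - d) tau) = F a"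
  proof (rule eventually_mono[OF eventually_neq_at_within[of 0]])
   fix a :: complex assume a: "a ~= 0"
   have e: "(Zf a tau * a) * ((Zf (a - d) tau + Zf d tau) / a) = Zf a tau * (Zf (a - d) tau + Zf d tau)" using a by simp
   thus "Nf a tau + Nf (a - d) tau - 2 * ((Zf a tau * a) * ((Zf (a - d) tau + Zf d tau) / a) - Zf d tau * Zf (a - d) tau) = F a"
    unfolding F_def e by (simp add: algebra_simps)
  qed
  have L3: "theta_const tau + Nf (0 - d) tau - 2 * (1 * dz 1 Zf (0 - d) tau - Zf d tau * Zf (0 - d) tau) = theta_const tau - Nf d tau"
   using Nf_eq[OF g] Nf_minus[OF gd] Zf_minus[OF gd] by (simp add: power2_eq_square algebra_simps)
  from Lim_transform_eventually[OF L1 L2] show ?thesis unfolding L3 .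
 qed
 \<comment> \<open>The same cancellation at \<open>a = d\<close>, written in the variable
   \<open>b = a - d\<close>. Here the limit serves only to give boundedness; the constant is read
   off at 0.\<close>
 have limd: "\<exists>L. (F \<longlongrightarrow> L) (at d)"
 proof -
  have sh: "((%b. Zf (b + d) tau) hfd dz 1 Zf (0 + d) tau) (at 0)"
   "((%b. Nf (b + d) tau) hfd dz 1 Nf (0 + d) tau) (at 0)"
   using Zf_deriv_z[OF gd] DERIV_shift[of "%w. Zf w tau" _ 0 "d"] Nf_deriv_z[OF gd] DERIV_shift[of "%w. Nf w tau" _ 0 "d"] by simp_all
  from sh(1) have "((%b. Zf (b + d) tau - Zf d tau) hfd dz 1 Zf (0 + d) tau) (at 0)"
   by (auto intro!: derivative_eq_intros)
  hence 1: "((%b. (Zf (b + d) tau - Zf d tau) / b) \<longlongrightarrow> dz 1 Zf (0 + d) tau) (at 0)"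
   by (rule has_field_derivative_tendsto_quotient) simp
  have c: "((%b. Zf (b + d) tau) \<longlongrightarrow> Zf d tau) (at 0)" "((%b. Nf (b + d) tau) \<longlongrightarrow> Nf d tau) (at 0)"
   using sh[THEN DERIV_isCont] by (simp_all add: isCont_def)
  have "((%b. Nf (b + d) tau + Nf b tau - 2 * ((Zf b tau * b) * ((Zf (b + d) tau - Zf d tau) / b) + Zf d tau * Zf (b + d) tau))
   \<longlongrightarrow> Nf d tau + theta_const tau - 2 * (1 * dz 1 Zf (0 + d) tau + Zf d tau * Zf d tau)) (at 0)"
   by (intro tendsto_intros Nf_tendsto t Zf_times_tendsto 1 c)
  moreover have "\<forall>\<^sub>F b in at 0. Nf (b + d) tau + Nf b tau - 2 * ((Zf b tau * b) * ((Zf (b + d) tau - Zf d tau) / b) + Zf d tau * Zf (b + d) tau) = F (b + d)"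
  proof (rule eventually_mono[OF eventually_neq_at_within[of 0]])
   fix b :: complex assume b: "b ~= 0"
   have e: "(Zf b tau * b) * ((Zf (b + d) tau - Zf d tau) / b) = Zf b tau * (Zf (b + d) tau - Zf d tau)" using b by simp
   thus "Nf (b + d) tau + Nf b tau - 2 * ((Zf b tau * b) * ((Zf (b + d) tau - Zf d tau) / b) + Zf d tau * Zf (b + d) tau) = F (b + d)"
    unfolding F_def e by (simp add: algebra_simps)
  qed
  ultimately have "((%b. F (b + d)) \<longlongrightarrow> Nf d tau + theta_const tau - 2 * (1 * dz 1 Zf (0 + d) tau + Zf d tau * Zf d tau)) (at 0)"
   by (rule Lim_transform_eventually)
  thus ?thesis using LIM_offset_zero_iff[of d F] by (auto simp: add.commute)
 qed
 have bounded: "\<exists>B. \<forall>\<^sub>F z in at c. norm (F z) <= B" if L: "(F \<longlongrightarrow> L) (at c)" for c L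
 proof -
  have "\<forall>\<^sub>F z in at c. dist (F z) L < 1" using tendstoD[OF L, of 1] by simp
  hence "\<forall>\<^sub>F z in at c. norm (F z) <= norm L + 1"
  proof eventually_elim
   case (elim z)
   thus ?case using norm_triangle_sub[of "F z" L] by (simp add: dist_norm)
  qed
  thus ?thesis by blast
 qed
 have "\<exists>c. \<forall>z. z ~: S --> F z = c"
 proof (rule elliptic_constant_mod[OF t _ S_def])
  have "(F hfd (dz 1 Nf z tau + dz 1 Nf (z - d) tau - 2 * (dz 1 Zf z tau * Zf (z - d) tau + Zf z tau * dz 1 Zf (z - d) tau + Zf d tau * dz 1 Zf z tau - Zf d tau * dz 1 Zf (z - d) tau))) (at z)"
   if "z ~: S" for z
  proof -
   have g: "gpt z tau" "gpt (z - d) tau" using that by (auto simp: S)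
   have "((%w. Zf (w - d) tau) hfd dz 1 Zf (z - d) tau) (at z)"
    "((%w. Nf (w - d) tau) hfd dz 1 Nf (z - d) tau) (at z)"
    using Zf_deriv_z[OF g(2)] Nf_deriv_z[OF g(2)] DERIV_shift[of "%w. Zf w tau" _ z "-d"] DERIV_shift[of "%w. Nf w tau" _ z "-d"] by simp_all
   note d = this Zf_deriv_z[OF g(1)] Nf_deriv_z[OF g(1)]
   show ?thesis unfolding F_def[abs_def] by (rule derivative_eq_intros d refl)+ (simp add: algebra_simps)
  qed
  thus "F holo - S"
   unfolding holomorphic_on_def field_differentiable_def using has_field_derivative_at_within by blast
  show "F (z + 1) = F z" if "z ~: S" for z
  proof -
   have g: "gpt z tau" "gpt (z - d) tau" using that by (auto simp: S)
   have "z + 1 - d = z - d + 1" by simp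
   thus ?thesis unfolding F_def using g by (simp only: Zf_plus_1 Nf_plus_1)
  qed
  show "F (z + tau) = F z" if "z ~: S" for z
  proof -
   have g: "gpt z tau" "gpt (z - d) tau" using that by (auto simp: S)
   have e: "z + tau - d = z - d + tau" by simp
   show ?thesis unfolding F_def e Zf_plus_tau[OF g(1)] Nf_plus_tau[OF g(1)] Zf_plus_tau[OF g(2)] Nf_plus_tau[OF g(2)]
    by (simp add: algebra_simps power2_eq_square)
  qed
 qed (use lim0 limd bounded in auto)
 then obtain c where c: "!!z. z ~: S ==> F z = c" by blast
 have "\<forall>\<^sub>F z in at 0. gpt z tau" using eventually_not_lattice[OF t, of 0] t by (auto simp: gpt_def elim!: eventually_mono)
 moreover have "\<forall>\<^sub>F z in at 0. gpt (z - d) tau"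
 proof -
  have "\<forall>\<^sub>F w in nhds (- d). gpt w tau" by (rule eventually_good_z) (simp add: gd)
  moreover have "filterlim (%z. z - d) (nhds (- d)) (at 0)" by (auto intro!: tendsto_eq_intros)
  ultimately show ?thesis by (rule eventually_compose_filterlim)
 qed
 ultimately have "\<forall>\<^sub>F z in at 0. F z = c" by eventually_elim (use c S in auto)
 hence "(F \<longlongrightarrow> c) (at 0)" by (rule tendsto_eventually)
 hence "c = theta_const tau - Nf d tau" using lim0 by (rule tendsto_unique[rotated]) simp
 moreover have "F a = c" by (rule c) (use assms in \<open>auto simp: S d_def\<close>)
 moreover have "a - d = b" by (simp add: d_def)
 ultimately have "Nf a tau + Nf b tau - 2 * (Zf a tau * Zf b tau + Zf d tau * Zf a tau - Zf d tau * Zf b tau) = theta_const tau - Nf d tau"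
  by (simp only: F_def)
 thus ?thesis unfolding d_def[symmetric] by algebra
qed

lemma Nf_dz1: "gpt z tau ==> dz 1 Nf z tau = 2 * Zf z tau * dz 1 Zf z tau + dz 2 Zf z tau"
proof -
 assume g: "gpt z tau"
 have "((%w. Zf w tau ^ 2 + dz 1 Zf w tau) hfd 2 * Zf z tau * dz 1 Zf z tau + dz 2 Zf z tau) (at z)"
  using dz_deriv_z[OF Zf_ring g, of 1] Zf_deriv_z[OF g] by (auto intro!: derivative_eq_intros simp: eval_nat_numeral)
 moreover have "\<forall>\<^sub>F w in nhds z. Nf w tau = Zf w tau ^ 2 + dz 1 Zf w tau"
  using eventually_good_z[OF g] by eventually_elim (rule Nf_eq)
 ultimately have "((%w. Nf w tau) hfd 2 * Zf z tau * dz 1 Zf z tau + dz 2 Zf z tau) (at z)"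
  by (subst DERIV_cong_ev) auto
 thus ?thesis using Nf_deriv_z[OF g] DERIV_unique by blast
qed

text \<open>The addition theorem differentiated once and twice in b at fixed a; each derivative of a
  term in \<open>a - b\<close> brings a sign.\<close>

lemma theta_addition_derivs:
 assumes ga: "gpt a tau" and gb: "gpt b tau" and gd: "gpt (a - b) tau"
 shows "dz 1 Nf b tau - dz 1 Nf (a - b) tau = 2 * (Zf a tau * dz 1 Zf b tau - dz 1 Zf (a - b) tau * Zf a tau + dz 1 Zf (a - b) tau * Zf b tau - Zf (a - b) tau * dz 1 Zf b tau)"
  and "dz 2 Nf b tau + dz 2 Nf (a - b) tau = 2 * (Zf a tau * dz 2 Zf b tau + dz 2 Zf (a - b) tau * Zf a tau - dz 2 Zf (a - b) tau * Zf b tau + 2 * dz 1 Zf (a - b) tau * dz 1 Zf b tau - Zf (a - b) tau * dz 2 Zf b tau)"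
proof -
 have evd: "\<forall>\<^sub>F w in nhds b. gpt (a - w) tau" if "gpt (a - b) tau" for b
 proof -
  have "filterlim (%w. a - w) (nhds (a - b)) (nhds b)" by (intro tendsto_intros filterlim_ident)
  with eventually_good_z[OF that] show ?thesis by (rule eventually_compose_filterlim)
 qed
 have chain: "((%w. dz k F (a - w) tau) hfd - dz (Suc k) F (a - b) tau) (at b)"
  if "F : theta_ring" "gpt (a - b) tau" for k F b
 proof -
  have "((%w. a - w) hfd -1) (at b)" by (auto intro!: derivative_eq_intros)
  from DERIV_chain2[OF dz_deriv_z[OF that, of k] this] show ?thesis by simp
 qed
 have chain0: "((%w. F (a - w) tau) hfd - dz 1 F (a - b) tau) (at b)"
  if "F : theta_ring" "gpt (a - b) tau" for F b
  using chain[OF that, of 0] by simp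
 have D1: "dz 1 Nf b tau - dz 1 Nf (a - b) tau = 2 * (Zf a tau * dz 1 Zf b tau - dz 1 Zf (a - b) tau * Zf a tau + dz 1 Zf (a - b) tau * Zf b tau - Zf (a - b) tau * dz 1 Zf b tau)"
  if gb: "gpt b tau" and gd: "gpt (a - b) tau" for b
 proof -
  note d = Zf_deriv_z[OF gb] Nf_deriv_z[OF gb] chain0[OF Zf_ring gd] chain0[OF Nf_ring gd]
  have "((%w. Nf a tau + Nf w tau + Nf (a - w) tau - theta_const tau) hfd dz 1 Nf b tau - dz 1 Nf (a - b) tau) (at b)"
   by (rule derivative_eq_intros d refl)+ simp
  moreover have "((%w. 2 * (Zf a tau * Zf w tau + Zf (a - w) tau * Zf a tau - Zf (a - w) tau * Zf w tau)) has_field_derivative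
   2 * (Zf a tau * dz 1 Zf b tau - dz 1 Zf (a - b) tau * Zf a tau + dz 1 Zf (a - b) tau * Zf b tau - Zf (a - b) tau * dz 1 Zf b tau)) (at b)"
   by (rule derivative_eq_intros d refl)+ (simp add: algebra_simps)
  moreover have "\<forall>\<^sub>F w in nhds b. Nf a tau + Nf w tau + Nf (a - w) tau - theta_const tau = 2 * (Zf a tau * Zf w tau + Zf (a - w) tau * Zf a tau - Zf (a - w) tau * Zf w tau)"
   using eventually_good_z[OF gb] evd[OF gd] by eventually_elim (rule theta_addition[OF ga])
  ultimately show ?thesis using DERIV_unique by (subst (asm) DERIV_cong_ev[OF refl _ refl]) auto
 qed
 show "dz 1 Nf b tau - dz 1 Nf (a - b) tau = 2 * (Zf a tau * dz 1 Zf b tau - dz 1 Zf (a - b) tau * Zf a tau + dz 1 Zf (a - b) tau * Zf b tau - Zf (a - b) tau * dz 1 Zf b tau)"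
  by (rule D1[OF gb gd])
 note d = Zf_deriv_z[OF gb] chain0[OF Zf_ring gd] dz_deriv_z[OF Zf_ring gb, of 1] dz_deriv_z[OF Nf_ring gb, of 1] chain[OF Zf_ring gd, of 1] chain[OF Nf_ring gd, of 1]
 have "((%w. dz 1 Nf w tau - dz 1 Nf (a - w) tau) hfd dz 2 Nf b tau + dz 2 Nf (a - b) tau) (at b)"
  by (rule derivative_eq_intros d refl)+ (simp add: eval_nat_numeral)
 moreover have "((%w. 2 * (Zf a tau * dz 1 Zf w tau - dz 1 Zf (a - w) tau * Zf a tau + dz 1 Zf (a - w) tau * Zf w tau - Zf (a - w) tau * dz 1 Zf w tau)) has_field_derivative
  2 * (Zf a tau * dz 2 Zf b tau + dz 2 Zf (a - b) tau * Zf a tau - dz 2 Zf (a - b) tau * Zf b tau + 2 * dz 1 Zf (a - b) tau * dz 1 Zf b tau - Zf (a - b) tau * dz 2 Zf b tau)) (at b)"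
  by (rule derivative_eq_intros d refl)+ (simp add: algebra_simps eval_nat_numeral)
 moreover have "\<forall>\<^sub>F w in nhds b. dz 1 Nf w tau - dz 1 Nf (a - w) tau = 2 * (Zf a tau * dz 1 Zf w tau - dz 1 Zf (a - w) tau * Zf a tau + dz 1 Zf (a - w) tau * Zf w tau - Zf (a - w) tau * dz 1 Zf w tau)"
  using eventually_good_z[OF gb] evd[OF gd] by eventually_elim (rule D1)
 ultimately show "dz 2 Nf b tau + dz 2 Nf (a - b) tau = 2 * (Zf a tau * dz 2 Zf b tau + dz 2 Zf (a - b) tau * Zf a tau - dz 2 Zf (a - b) tau * Zf b tau + 2 * dz 1 Zf (a - b) tau * dz 1 Zf b tau - Zf (a - b) tau * dz 2 Zf b tau)"
  using DERIV_unique by (subst (asm) DERIV_cong_ev[OF refl _ refl]) auto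
qed

text \<open>The shapes needed for the pairings below. On the left stands what one theta factor
  contributes when it is evaluated at a point a belonging to z and a point b belonging to w; on the
  right a function of \<open>a - b\<close> alone multiplies terms that depend on only one of a and
  b. Since \<open>a - b = z - w\<close> for every factor, the right sides can be summed over the
  factors.\<close>

lemma theta_addition_forms:
 assumes g: "gpt a tau" "gpt b tau" "gpt (a - b) tau"
 shows theta_addition_0: "Zf a tau * Zf b tau - (Nf a tau + Nf b tau) / 2 = - Zf (a - b) tau * (Zf a tau - Zf b tau) + (Nf (a - b) tau - theta_const tau) / 2"
 and theta_addition_1: "(Zf a tau - Zf b tau) * dz 1 Zf b tau - dz 2 Zf b tau / 2 =
  dz 1 Zf (a - b) tau * (Zf a tau - Zf b tau) + Zf (a - b) tau * dz 1 Zf b tau - dz 1 Nf (a - b) tau / 2"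
 and theta_addition_2: "(Zf a tau - Zf b tau) * dz 1 Nf b tau - dz 2 Nf b tau / 2 =
  Zf (a - b) tau * dz 1 Nf b tau + dz 1 Zf (a - b) tau * (Nf a tau - Nf b tau) - dz 1 Nf (a - b) tau * Zf a tau
  + (dz 2 Nf (a - b) tau / 2 + dz 1 Zf (a - b) tau * (Nf (a - b) tau - theta_const tau))"
proof -
 define za zb zd zb1 zb2 zd1 zd2 where v: "za = Zf a tau" "zb = Zf b tau" "zd = Zf (a - b) tau"
  "zb1 = dz 1 Zf b tau" "zb2 = dz 2 Zf b tau" "zd1 = dz 1 Zf (a - b) tau" "zd2 = dz 2 Zf (a - b) tau"
 define na nb nd nb1 nb2 nd1 nd2 T where w: "na = Nf a tau" "nb = Nf b tau" "nd = Nf (a - b) tau"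
  "nb1 = dz 1 Nf b tau" "nb2 = dz 2 Nf b tau" "nd1 = dz 1 Nf (a - b) tau" "nd2 = dz 2 Nf (a - b) tau" "T = theta_const tau"
 note vw = v[symmetric] w[symmetric]
 have I: "na + nb + nd - T = 2 * (za * zb + zd * za - zd * zb)" using theta_addition[OF g] unfolding vw .
 have I1: "nb1 - nd1 = 2 * (za * zb1 - zd1 * za + zd1 * zb - zd * zb1)" using theta_addition_derivs(1)[OF g] unfolding vw .
 have I2: "nb2 + nd2 = 2 * (za * zb2 + zd2 * za - zd2 * zb + 2 * zd1 * zb1 - zd * zb2)" using theta_addition_derivs(2)[OF g] unfolding vw .
 have nb1: "nb1 = 2 * zb * zb1 + zb2" using Nf_dz1[OF g(2)] unfolding vw .
 have nd1: "nd1 = 2 * zd * zd1 + zd2" using Nf_dz1[OF g(3)] unfolding vw .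
 have nb: "nb = zb ^ 2 + zb1" using Nf_eq[OF g(2)] unfolding vw .
 show "Zf a tau * Zf b tau - (Nf a tau + Nf b tau) / 2 = - Zf (a - b) tau * (Zf a tau - Zf b tau) + (Nf (a - b) tau - theta_const tau) / 2"
  unfolding vw using I by (simp add: field_simps) algebra
 show "(Zf a tau - Zf b tau) * dz 1 Zf b tau - dz 2 Zf b tau / 2 =
  dz 1 Zf (a - b) tau * (Zf a tau - Zf b tau) + Zf (a - b) tau * dz 1 Zf b tau - dz 1 Nf (a - b) tau / 2"
  unfolding vw using I1 nb1 by (simp add: field_simps) algebra
 show "(Zf a tau - Zf b tau) * dz 1 Nf b tau - dz 2 Nf b tau / 2 =
  Zf (a - b) tau * dz 1 Nf b tau + dz 1 Zf (a - b) tau * (Nf a tau - Nf b tau) - dz 1 Nf (a - b) tau * Zf a tau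
  + (dz 2 Nf (a - b) tau / 2 + dz 1 Zf (a - b) tau * (Nf (a - b) tau - theta_const tau))"
  unfolding vw
 proof -
  have "2 * (za - zb - zd) * nb1 - (nb2 + nd2) - 2 * zd1 * (na - nb + nd - T) + 2 * nd1 * za = 0"
   using I I1 I2 nb1 nd1 nb by algebra
  moreover have "((za - zb) * nb1 - nb2 / 2) - (zd * nb1 + zd1 * (na - nb) - nd1 * za + (nd2 / 2 + zd1 * (nd - T)))
   = (2 * (za - zb - zd) * nb1 - (nb2 + nd2) - 2 * zd1 * (na - nb + nd - T) + 2 * nd1 * za) / 2"
   by (simp add: field_simps)
  ultimately show "(za - zb) * nb1 - nb2 / 2 = zd * nb1 + zd1 * (na - nb) - nd1 * za + (nd2 / 2 + zd1 * (nd - T))"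
   by simp
 qed
qed

section \<open>Lattice sums and the Weierstrass functions\<close>

lemma infsum_has_field_derivative:
 fixes f :: "'a => complex => complex"
 assumes deriv: "!!om w. om : A ==> w : cball z r ==> (f om hfd f' om w) (at w)"
  and le: "!!om w. om : A ==> w : cball z r ==> norm (f om w) <= M om" and M: "M summable_on A"
  and r: "r > 0" and w: "w : ball z r"
 shows "((%w. \<Sum>\<^sub>\<infinity>om\<in>A. f om w) hfd (\<Sum>\<^sub>\<infinity>om\<in>A. f' om w)) (at w)"
proof -
 have ul: "uniform_limit (cball z r) (%X w. \<Sum>om\<in>X. f om w) (%w. \<Sum>\<^sub>\<infinity>om\<in>A. f om w) (finite_subsets_at_top A)"
  by (rule Weierstrass_m_test_general[OF _ M]) (use le in auto)
 have ev: "\<forall>\<^sub>F X in finite_subsets_at_top A. continuous_on (cball z r) (%w. \<Sum>om\<in>X. f om w) &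
   (\<forall>w\<in>ball z r. ((%w. \<Sum>om\<in>X. f om w) hfd (\<Sum>om\<in>X. f' om w)) (at w))"
 proof (rule eventually_finite_subsets_at_top_weakI, intro conjI ballI)
  fix X assume X: "finite X" "X \<subseteq> A"
  show "continuous_on (cball z r) (%w. \<Sum>om\<in>X. f om w)"
  proof (rule continuous_on_sum)
   fix om assume "om : X"
   thus "continuous_on (cball z r) (f om)"
    using X by (intro DERIV_continuous_on[where D="f' om"] has_field_derivative_at_within[OF deriv]) auto
  qed
  fix w assume "w : ball z r"
  thus "((%w. \<Sum>om\<in>X. f om w) hfd (\<Sum>om\<in>X. f' om w)) (at w)"
   using X by (intro DERIV_sum deriv) auto
 qed
 obtain g' where g': "!!w. w : ball z r ==> ((%w. \<Sum>\<^sub>\<infinity>om\<in>A. f om w) hfd g' w) (at w) &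
   ((%X. \<Sum>om\<in>X. f' om w) \<longlongrightarrow> g' w) (finite_subsets_at_top A)"
  using has_complex_derivative_uniform_limit[OF ev ul] r by auto
 hence "((%om. f' om w) has_sum g' w) A" using w by (simp add: has_sum_def)
 hence "(\<Sum>\<^sub>\<infinity>om\<in>A. f' om w) = g' w" by (rule infsumI)
 thus ?thesis using g'[OF w] by simp
qed

lemma norm_lattice_point_ge:
 assumes t: "Im tau > 0"
 obtains de where "de > 0" "!!a b. norm (of_int a + of_int b * tau) >= de * (\<bar>real_of_int a\<bar> + \<bar>real_of_int b\<bar>)"
proof -
 define K where "K = 1 + (norm tau + 1) / Im tau"
 have K: "K > 0" using t by (simp add: K_def add_pos_nonneg)
 have "norm (of_int a + of_int b * tau) >= 1 / K * (\<bar>real_of_int a\<bar> + \<bar>real_of_int b\<bar>)" for a b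
 proof -
  define x where "x = of_int a + of_int b * tau"
  have "\<bar>real_of_int b\<bar> * Im tau <= norm x" using abs_Im_le_cmod[of x] t by (simp add: x_def abs_mult)
  hence b: "\<bar>real_of_int b\<bar> <= norm x / Im tau" using t by (simp add: field_simps)
  have "\<bar>real_of_int a\<bar> = norm (x - of_int b * tau)" by (simp add: x_def)
  also have "... <= norm x + \<bar>real_of_int b\<bar> * norm tau" using norm_triangle_ineq4[of x "of_int b * tau"] by (simp add: norm_mult)
  also have "... <= norm x + norm x / Im tau * norm tau" using b by (intro add_left_mono mult_right_mono) auto
  finally have "\<bar>real_of_int a\<bar> + \<bar>real_of_int b\<bar> <= norm x + norm x / Im tau * norm tau + norm x / Im tau" using b by linarith
  also have "... = K * norm x" using t by (simp add: K_def field_simps)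
  finally show ?thesis using K by (simp add: x_def field_simps)
 qed
 thus ?thesis using that[of "1 / K"] K by simp
qed

lemma summable_on_int_power32: "(%a::int. 1 / (1 + \<bar>real_of_int a\<bar>) powr (3/2)) summable_on UNIV"
proof -
 let ?g = "%a::int. 1 / (1 + \<bar>real_of_int a\<bar>) powr (3/2)"
 have s: "summable (%n. 1 / (1 + real n) powr (3/2))"
  using summable_Suc_iff[of "%n. real n powr (- (3/2))"] summable_real_powr_iff[of "-(3/2)"]
  by (simp add: powr_minus_divide add.commute)
 have "?g summable_on range (%n::nat. int n)"
  by (subst summable_on_reindex) (use s in \<open>auto simp: o_def inj_on_def intro!: norm_summable_imp_summable_on\<close>)
 moreover have "?g summable_on range (%n::nat. - int n)"
  by (subst summable_on_reindex) (use s in \<open>auto simp: o_def inj_on_def intro!: norm_summable_imp_summable_on\<close>)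
 ultimately have "?g summable_on (range (%n::nat. int n) \<union> range (%n::nat. - int n))"
  by (rule summable_on_union)
 moreover have "range (%n::nat. int n) \<union> range (%n::nat. - int n) = UNIV"
 proof -
  have "x : range (%n::nat. int n) \<union> range (%n::nat. - int n)" for x :: int
   by (cases x rule: int_cases2) auto
  thus ?thesis by blast
 qed
 ultimately show ?thesis by simp
qed

lemma inj_lattice_param:
 assumes "Im tau > 0" shows "inj (%(a, b). complex_of_int a + of_int b * tau)"
proof (rule injI, clarify)
 fix a b c d :: int assume e: "complex_of_int a + of_int b * tau = of_int c + of_int d * tau"
 hence "Im (complex_of_int a + of_int b * tau) = Im (of_int c + of_int d * tau)" by simp
 hence "b = d" using assms by simp
 thus "a = c & b = d" using e by simp
qed

lemma lattice_range: "lattice tau = range (%(a, b). complex_of_int a + of_int b * tau)"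
 by (auto simp: lattice_def)

text \<open>For \<open>om = a + b tau\<close> the norm is at least a fixed multiple of
  \<open>|a| + |b|\<close>, and \<open>(1 + |a|)(1 + |b|) <= (1 + |a| + |b|)^2\<close>. Hence
  \<open>norm om ^ 3\<close> dominates \<open>((1 + |a|)(1 + |b|))^(3/2)\<close> up to a constant,
  and the reciprocal of this is a product of two convergent series.\<close>

lemma lattice_summable:
 assumes t: "Im tau > 0"
 shows "(%om. 1 / norm om ^ 3) summable_on lattice tau"
proof -
 obtain de where de: "de > 0" "!!a b. norm (of_int a + of_int b * tau) >= de * (\<bar>real_of_int a\<bar> + \<bar>real_of_int b\<bar>)"
  using norm_lattice_point_ge[OF t] by blast
 let ?g = "%a::int. 1 / (1 + \<bar>real_of_int a\<bar>) powr (3/2)"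
 have "(%(a, b). ?g a * ?g b) summable_on UNIV \<times> UNIV"
 proof (rule summable_on_SigmaI[where g="%a. ?g a * infsum ?g UNIV"])
  show "((%b. case (a, b) of (a, b) => ?g a * ?g b) has_sum ?g a * infsum ?g UNIV) UNIV" for a
   unfolding prod.case by (rule has_sum_cmult_right[OF has_sum_infsum[OF summable_on_int_power32]])
  show "(%a. ?g a * infsum ?g UNIV) summable_on UNIV"
   by (rule summable_on_cmult_left[OF summable_on_int_power32])
 qed auto
 hence s: "(%x. 8 / de ^ 3 * (case x of (a, b) => ?g a * ?g b)) summable_on UNIV"
  unfolding UNIV_Times_UNIV by (rule summable_on_cmult_right)
 have le: "1 / norm (of_int a + of_int b * tau) ^ 3 <= 8 / de ^ 3 * (?g a * ?g b)" for a b
 proof (cases "a = 0 & b = 0")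
  case True
  thus ?thesis using de by simp
 next
  case False
  define A where "A = \<bar>real_of_int a\<bar>" define B where "B = \<bar>real_of_int b\<bar>"
  have AB: "A >= 0" "B >= 0" "A + B >= 1" using False by (auto simp: A_def B_def)
  have "((1 + A) powr (3/2)) * ((1 + B) powr (3/2)) <= (1 + A + B) powr (3/2) * (1 + A + B) powr (3/2)"
   using AB by (intro mult_mono powr_mono2) auto
  also have "... = (1 + A + B) ^ 3" using AB by (simp add: powr_add[symmetric] powr_numeral)
  also have "... <= (2 * (A + B)) ^ 3" using AB by (intro power_mono) auto
  also have "... <= (2 * (norm (of_int a + of_int b * tau) / de)) ^ 3"
   using AB de(1) de(2)[of a b] by (intro power_mono mult_left_mono) (auto simp: A_def B_def field_simps)
  also have "... = 8 / de ^ 3 * norm (of_int a + of_int b * tau) ^ 3" by (simp add: power_mult_distrib power_divide)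
  finally have le: "((1 + A) powr (3/2)) * ((1 + B) powr (3/2)) <= 8 / de ^ 3 * norm (of_int a + of_int b * tau) ^ 3" .
  have p: "((1 + A) powr (3/2)) * ((1 + B) powr (3/2)) > 0" using AB by (intro mult_pos_pos) auto
  with le have n: "norm (of_int a + of_int b * tau) ^ 3 > 0" using de(1) by (metis divide_pos_pos less_le_trans zero_less_mult_pos zero_less_numeral zero_less_power)
  have gen: "1 / n <= K * (1 / P * (1 / Q))" if "P * Q <= K * n" "P * Q > 0" "n > 0" for n K P Q :: real
  proof -
   have "(P * Q) / (n * (P * Q)) <= (K * n) / (n * (P * Q))"
    by (rule divide_right_mono[OF that(1)]) (use that in auto)
   moreover have "P ~= 0" "Q ~= 0" using that(2) by auto
   ultimately show ?thesis using that(3) by simp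
  qed
  show ?thesis unfolding A_def[symmetric] B_def[symmetric] by (rule gen[OF le p n])
 qed
 have "(%x. 1 / norm (case x of (a, b) => of_int a + of_int b * tau) ^ 3) summable_on (UNIV :: (int \<times> int) set)"
 proof (rule summable_on_comparison_test[OF s])
  fix x :: "int \<times> int"
  show "1 / norm (case x of (a, b) => of_int a + of_int b * tau) ^ 3 <= 8 / de ^ 3 * (case x of (a, b) => ?g a * ?g b)"
   by (cases x) (simp only: prod.case le)
 qed auto
 thus ?thesis unfolding lattice_range
  by (subst summable_on_reindex[OF inj_lattice_param[OF t]]) (simp add: o_def case_prod_unfold)
qed

text \<open>The lattice sums without the pole at 0. They are compared with the regular part of
  \<open>Z\<close> on a connected open set that contains 0, where the constants of integration are
  determined.\<close>

definition wp_reg :: "complex => complex => complex" where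
 "wp_reg z tau = (\<Sum>\<^sub>\<infinity>om\<in>lattice tau - {0}. 1 / (z - om)\<^sup>2 - 1 / om\<^sup>2)"

definition wzeta_reg :: "complex => complex => complex" where
 "wzeta_reg z tau = (\<Sum>\<^sub>\<infinity>om\<in>lattice tau - {0}. 1 / (z - om) + 1 / om + z / om\<^sup>2)"

definition wp_reg' :: "complex => complex => complex" where
 "wp_reg' z tau = (\<Sum>\<^sub>\<infinity>om\<in>lattice tau - {0}. - 2 / (z - om) ^ 3)"

lemma wp_wzeta_reg: "wp z tau = 1 / z\<^sup>2 + wp_reg z tau" "wzeta z tau = 1 / z + wzeta_reg z tau"
 by (simp_all add: wp_def wzeta_def wp_reg_def wzeta_reg_def)

text \<open>Near any point, a lattice sum splits into finitely many terms and a tail that converges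
 locally uniformly.\<close>

lemma lattice_sum_deriv:
 fixes f :: "complex => complex => complex"
 assumes t: "Im tau > 0" and A: "A \<subseteq> lattice tau" and z: "z ~: A"
  and deriv: "!!om w. om : A ==> w ~= om ==> (f om hfd f' om w) (at w)"
  and le: "!!om w. om : A ==> norm w <= norm z + 1 ==> norm om > 2 * (norm z + 1) ==> norm (f om w) <= K / norm om ^ 3"
  and le': "!!om w. om : A ==> norm w <= norm z + 1 ==> norm om > 2 * (norm z + 1) ==> norm (f' om w) <= K' / norm om ^ 3"
 shows "((%w. \<Sum>\<^sub>\<infinity>om\<in>A. f om w) hfd (\<Sum>\<^sub>\<infinity>om\<in>A. f' om z)) (at z)"
proof -
 define R where "R = norm z + 1"
 have R: "R > 0" by (simp add: R_def add_nonneg_pos)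
 define B where "B = A \<inter> cball 0 (2 * R)"
 define C where "C = A - cball 0 (2 * R)"
 have fB: "finite B" using finite_lattice_cball[OF t, of "2 * R"] A unfolding B_def by (metis Int_mono finite_subset order.refl)
 have AC: "A = B \<union> C" "B \<inter> C = {}" by (auto simp: B_def C_def)
 have sC: "(%om. k / norm om ^ 3) summable_on C" for k :: real
 proof -
  have "(%om. k * (1 / norm om ^ 3)) summable_on C"
   by (intro summable_on_cmult_right summable_on_subset_banach[OF lattice_summable[OF t]]) (use A in \<open>auto simp: C_def\<close>)
  thus ?thesis by simp
 qed
 have nC: "norm om > 2 * R" if "om : C" for om using that by (auto simp: C_def)
 have inf: "infsum (%om. g om) A = sum g B + infsum g C" if "!!om. om : C ==> norm (g om) <= k / norm om ^ 3" for g :: "complex => complex" and k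
 proof -
  have "g summable_on C"
   by (rule abs_summable_summable[OF Infinite_Sum.abs_summable_on_comparison_test'[OF sC[of k]]]) (use that in auto)
  thus ?thesis unfolding AC(1) by (subst infsum_Un_disjoint) (use fB AC in auto)
 qed
 have dC: "((%w. \<Sum>\<^sub>\<infinity>om\<in>C. f om w) hfd (\<Sum>\<^sub>\<infinity>om\<in>C. f' om z)) (at z)"
 proof (rule infsum_has_field_derivative[where z=0 and r=R and M="%om. K / norm om ^ 3"])
  fix om w :: complex assume w: "om : C" "w : cball 0 R"
  have "w ~= om" using nC[OF w(1)] w(2) R by auto
  thus "(f om hfd f' om w) (at w)" using deriv[of om w] w AC by auto
  show "norm (f om w) <= K / norm om ^ 3" by (rule le) (use w nC[OF w(1)] in \<open>auto simp: R_def C_def\<close>)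
 qed (use R sC in \<open>auto simp: R_def\<close>)
 have dB: "((%w. \<Sum>om\<in>B. f om w) hfd (\<Sum>om\<in>B. f' om z)) (at z)"
  by (intro DERIV_sum deriv) (use z in \<open>auto simp: B_def\<close>)
 have "((%w. (\<Sum>om\<in>B. f om w) + (\<Sum>\<^sub>\<infinity>om\<in>C. f om w)) hfd ((\<Sum>om\<in>B. f' om z) + (\<Sum>\<^sub>\<infinity>om\<in>C. f' om z))) (at z)"
  by (rule DERIV_add[OF dB dC])
 moreover have "\<forall>\<^sub>F w in nhds z. (\<Sum>\<^sub>\<infinity>om\<in>A. f om w) = (\<Sum>om\<in>B. f om w) + (\<Sum>\<^sub>\<infinity>om\<in>C. f om w)"
 proof (rule eventually_mono[OF eventually_nhds_in_open[of "ball 0 R" z]])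
  fix w :: complex assume "w : ball 0 R"
  thus "(\<Sum>\<^sub>\<infinity>om\<in>A. f om w) = (\<Sum>om\<in>B. f om w) + (\<Sum>\<^sub>\<infinity>om\<in>C. f om w)"
   by (intro inf[of _ K] le) (use nC in \<open>auto simp: R_def C_def\<close>)
 qed (auto simp: R_def)
 moreover have "(\<Sum>\<^sub>\<infinity>om\<in>A. f' om z) = (\<Sum>om\<in>B. f' om z) + (\<Sum>\<^sub>\<infinity>om\<in>C. f' om z)"
  by (intro inf[of _ K'] le') (use nC in \<open>auto simp: R_def C_def\<close>)
 ultimately show ?thesis by (subst DERIV_cong_ev) auto
qed

text \<open>For \<open>norm om > 2 R\<close> the distance of \<open>om\<close> from \<open>w\<close>
  is at least \<open>norm om / 2\<close>. The correction terms in the sums for zeta and for the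
  Weierstrass function cancel the leading orders, and what remains is of order
  \<open>1 / norm om ^ 3\<close>.\<close>

lemma lattice_term_bounds:
 fixes w om :: complex
 assumes w: "norm w <= R" and om: "norm om > 2 * R" and R: "R > 0"
 shows "norm (1 / (w - om) + 1 / om + w / om\<^sup>2) <= 2 * R\<^sup>2 / norm om ^ 3"
  and "norm (1 / (w - om)\<^sup>2 - 1 / om\<^sup>2) <= 12 * R / norm om ^ 3"
  and "norm (- 2 / (w - om) ^ 3) <= 16 / norm om ^ 3"
proof -
 have o0: "om ~= 0" using om R by auto
 have half: "norm om / 2 <= norm (w - om)" using norm_triangle_ineq2[of om w] w om by (simp add: norm_minus_commute)
 hence p: "norm (w - om) > 0" "w - om ~= 0" using o0 by (auto intro: less_le_trans)
 have inv: "1 / norm (w - om) <= 2 / norm om" using half p o0 by (simp add: field_simps)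
 have nw: "norm w ^ 2 <= R ^ 2" using w by (intro power_mono) auto
 have "1 / (w - om) + 1 / om + w / om\<^sup>2 = w\<^sup>2 / om\<^sup>2 * (1 / (w - om))"
  using p o0 by (simp add: field_simps power2_eq_square)
 hence "norm (1 / (w - om) + 1 / om + w / om\<^sup>2) = norm w ^ 2 / norm om ^ 2 * (1 / norm (w - om))"
  by (simp add: norm_mult norm_divide norm_power)
 also have "... <= R\<^sup>2 / norm om ^ 2 * (2 / norm om)"
  by (intro mult_mono divide_right_mono nw inv) auto
 also have "... = 2 * R\<^sup>2 / norm om ^ 3" by (simp add: power2_eq_square power3_eq_cube)
 finally show "norm (1 / (w - om) + 1 / om + w / om\<^sup>2) <= 2 * R\<^sup>2 / norm om ^ 3" .
 have "1 / q\<^sup>2 - 1 / om\<^sup>2 = (om\<^sup>2 - q\<^sup>2) / om\<^sup>2 * (1 / q) ^ 2" if "q ~= 0" for q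
  using that o0 by (simp add: diff_divide_distrib power_divide)
 from this[OF p(2)] have "1 / (w - om)\<^sup>2 - 1 / om\<^sup>2 = (om\<^sup>2 - (w - om)\<^sup>2) / om\<^sup>2 * (1 / (w - om)) ^ 2" .
 also have "om\<^sup>2 - (w - om)\<^sup>2 = w * (2 * om - w)" by (simp add: power2_eq_square algebra_simps)
 finally have "1 / (w - om)\<^sup>2 - 1 / om\<^sup>2 = w * (2 * om - w) / om\<^sup>2 * (1 / (w - om)) ^ 2" .
 hence "norm (1 / (w - om)\<^sup>2 - 1 / om\<^sup>2) = norm w * norm (2 * om - w) / norm om ^ 2 * (1 / norm (w - om)) ^ 2"
  by (simp add: norm_mult norm_divide norm_power)
 also have "... <= R * (3 * norm om) / norm om ^ 2 * (2 / norm om) ^ 2"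
 proof (intro mult_mono divide_right_mono power_mono inv w)
  have "norm (2 * om - w) <= 2 * norm om + norm w" using norm_triangle_ineq4[of "2 * om" w] by (simp add: norm_mult)
  thus "norm (2 * om - w) <= 3 * norm om" using w om norm_ge_zero[of w] by linarith
 qed (use R in auto)
 also have "... = 12 * R / norm om ^ 3" using o0 by (simp add: power2_eq_square power3_eq_cube field_simps)
 finally show "norm (1 / (w - om)\<^sup>2 - 1 / om\<^sup>2) <= 12 * R / norm om ^ 3" .
 have "norm (- 2 / (w - om) ^ 3) = 2 * (1 / norm (w - om)) ^ 3" by (simp add: norm_divide norm_power power_divide)
 also have "... <= 2 * (2 / norm om) ^ 3" by (intro mult_left_mono power_mono inv) auto
 also have "... = 16 / norm om ^ 3" by (simp add: power_divide)
 finally show "norm (- 2 / (w - om) ^ 3) <= 16 / norm om ^ 3" .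
qed

lemma wzeta_reg_deriv:
 assumes t: "Im tau > 0" and z: "z ~: lattice tau - {0}"
 shows "((%w. wzeta_reg w tau) hfd - wp_reg z tau) (at z)"
proof -
 have R: "norm z + 1 > 0" by (simp add: add_nonneg_pos)
 have "((%w. wzeta_reg w tau) hfd (\<Sum>\<^sub>\<infinity>om\<in>lattice tau - {0}. - (1 / (z - om)\<^sup>2 - 1 / om\<^sup>2))) (at z)"
  unfolding wzeta_reg_def
 proof (rule lattice_sum_deriv[OF t _ z, where K="2 * (norm z + 1)\<^sup>2" and K'="12 * (norm z + 1)"])
  fix om w :: complex assume w: "om : lattice tau - {0}"
  show "((%w. 1 / (w - om) + 1 / om + w / om\<^sup>2) hfd - (1 / (w - om)\<^sup>2 - 1 / om\<^sup>2)) (at w)" if "w ~= om"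
   using that w by (auto intro!: derivative_eq_intros simp: power2_eq_square)
  assume w': "norm w <= norm z + 1" "norm om > 2 * (norm z + 1)"
  show "norm (1 / (w - om) + 1 / om + w / om\<^sup>2) <= 2 * (norm z + 1)\<^sup>2 / norm om ^ 3"
   by (rule lattice_term_bounds(1)[OF w' R])
  show "norm (- (1 / (w - om)\<^sup>2 - 1 / om\<^sup>2)) <= 12 * (norm z + 1) / norm om ^ 3"
   unfolding norm_minus_cancel by (rule lattice_term_bounds(2)[OF w' R])
 qed auto
 thus ?thesis unfolding wp_reg_def by (simp only: infsum_uminus)
qed

lemma wp_reg_deriv:
 assumes t: "Im tau > 0" and z: "z ~: lattice tau - {0}"
 shows "((%w. wp_reg w tau) hfd wp_reg' z tau) (at z)"
 unfolding wp_reg_def wp_reg'_def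
proof -
 have R: "norm z + 1 > 0" by (simp add: add_nonneg_pos)
 show "((%w. \<Sum>\<^sub>\<infinity>om\<in>lattice tau - {0}. 1 / (w - om)\<^sup>2 - 1 / om\<^sup>2) hfd (\<Sum>\<^sub>\<infinity>om\<in>lattice tau - {0}. - 2 / (z - om) ^ 3)) (at z)"
 proof (rule lattice_sum_deriv[OF t _ z, where K'="16" and K="12 * (norm z + 1)"])
  fix om w :: complex assume w: "om : lattice tau - {0}"
  show "((%w. 1 / (w - om)\<^sup>2 - 1 / om\<^sup>2) hfd - 2 / (w - om) ^ 3) (at w)" if "w ~= om"
  proof -
   have q: "w - om ~= 0" using that by simp
   have e: "- (2 * x) / (x * x * (x * x)) = - 2 / (x * x * x)" if "x ~= 0" for x :: complex using that by simp
   have "((%w. 1 / (w - om)\<^sup>2) hfd - 2 / (w - om) ^ 3) (at w)"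
    using q e[OF q] by (auto intro!: derivative_eq_intros simp: power2_eq_square power3_eq_cube)
   from DERIV_diff[OF this DERIV_const[of "1 / om\<^sup>2"]] show ?thesis by simp
  qed
  assume w': "norm w <= norm z + 1" "norm om > 2 * (norm z + 1)"
  show "norm (- 2 / (w - om) ^ 3) <= 16 / norm om ^ 3"
   by (rule lattice_term_bounds(3)[OF w' R])
  show "norm (1 / (w - om)\<^sup>2 - 1 / om\<^sup>2) <= 12 * (norm z + 1) / norm om ^ 3"
   by (rule lattice_term_bounds(2)[OF w' R])
 qed auto
qed

text \<open>Theta divided by z, holomorphic and nonzero at 0. Its logarithmic derivative
  \<open>Zreg\<close> is therefore \<open>Z(z) - 1/z\<close> continued to 0, with poles only at the
  nonzero lattice points.\<close>

definition theta_unit :: "complex => complex => complex" where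
 "theta_unit z tau = (if z = 0 then theta 1 0 tau else theta 0 z tau / z)"

definition Zreg :: "complex => complex => complex" where
 "Zreg z tau = deriv (%w. theta_unit w tau) z / theta_unit z tau"

definition poles :: "complex => complex set" where "poles tau = lattice tau - {0}"

lemma theta_unit_holomorphic: "Im tau > 0 ==> (%z. theta_unit z tau) holo A"
proof -
 assume t: "Im tau > 0"
 have d: "deriv (%w. theta 0 w tau) 0 = theta 1 0 tau" using theta_deriv_z[OF t, of 0 0] by (simp add: DERIV_imp_deriv)
 have "(%z. if z = 0 then deriv (%w. theta 0 w tau) 0 else (theta 0 z tau - theta 0 0 tau) / (z - 0)) holo UNIV"
  by (rule pole_lemma[OF theta_holomorphic[OF t]]) auto
 also have "(%z. if z = 0 then deriv (%w. theta 0 w tau) 0 else (theta 0 z tau - theta 0 0 tau) / (z - 0)) = (%z. theta_unit z tau)"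
  using t by (auto simp: theta_unit_def d)
 finally show ?thesis by (rule holomorphic_on_subset) auto
qed

lemma theta_unit_nonzero: "Im tau > 0 ==> z ~: poles tau ==> theta_unit z tau ~= 0"
 using theta_eq_0_iff[of tau z] theta_eq_sin_prod(2)[of tau] by (auto simp: theta_unit_def poles_def)

lemma open_regular: "Im tau > 0 ==> open (- poles tau)"
proof -
 assume t: "Im tau > 0"
 have "\<not> x islimpt poles tau" for x
  using lattice_not_islimpt[OF t, of x] islimpt_subset[of x "poles tau" "lattice tau"] by (auto simp: poles_def)
 hence "closed (poles tau)" by (auto simp: closed_limpt)
 thus ?thesis by (simp add: closed_def)
qed

lemma countable_lattice: "countable (lattice tau)"
 unfolding lattice_range by (rule countable_image) auto

lemma connected_regular: "connected (- poles tau)"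
 by (intro path_connected_imp_connected path_connected_complement_countable)
  (auto simp: poles_def intro: countable_subset[OF _ countable_lattice])

lemma good_imp_regular: "gpt z tau ==> z ~: poles tau"
 by (auto simp: gpt_def poles_def)

lemma Zreg_holomorphic: "Im tau > 0 ==> (%z. Zreg z tau) holo - poles tau"
 unfolding Zreg_def
 by (intro holomorphic_intros holomorphic_deriv open_regular theta_unit_holomorphic) (auto simp: theta_unit_nonzero)

lemma Zf_eq_Zreg:
 assumes "gpt z tau" shows "Zf z tau = 1 / z + Zreg z tau"
proof -
 have t: "Im tau > 0" and z: "z ~= 0" "theta 0 z tau ~= 0" using assms by (auto simp: gpt_theta)
 have "((%w. theta 0 w tau / w) hfd (theta 1 z tau * z - theta 0 z tau) / (z * z)) (at z)"
  using z theta_deriv_z[OF t, of 0 z] by (auto intro!: derivative_eq_intros)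
 moreover have "\<forall>\<^sub>F w in nhds z. theta_unit w tau = theta 0 w tau / w"
  using t1_space_nhds[OF z(1)] by eventually_elim (simp add: theta_unit_def)
 ultimately have "((%w. theta_unit w tau) hfd (theta 1 z tau * z - theta 0 z tau) / (z * z)) (at z)"
  by (subst DERIV_cong_ev) auto
 thus ?thesis
  unfolding Zreg_def using z by (simp add: DERIV_imp_deriv theta_unit_def Zf_def theta_ratio_def field_simps)
qed

lemma eventually_good_at_0: "Im tau > 0 ==> \<forall>\<^sub>F z in at 0. gpt z tau"
 using eventually_not_lattice[of tau 0] by (auto simp: gpt_def elim!: eventually_mono)

lemma Zreg_deriv: "Im tau > 0 ==> z ~: poles tau ==> ((%z. Zreg z tau) hfd deriv (%z. Zreg z tau) z) (at z)"
 using holomorphic_derivI[OF Zreg_holomorphic open_regular] by auto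

lemma regular_0 [simp]: "0 ~: poles tau" by (simp add: poles_def)

lemma regular_uminus [simp]: "- z : poles tau \<longleftrightarrow> z : poles tau" by (auto simp: poles_def)

lemma regular_good: "Im tau > 0 ==> z ~: poles tau ==> z ~= 0 ==> gpt z tau"
 by (auto simp: gpt_def poles_def)

lemma Zreg_minus:
 assumes t: "Im tau > 0" and z: "z ~: poles tau" shows "Zreg (- z) tau = - Zreg z tau"
proof (cases "z = 0")
 case False
 hence g: "gpt z tau" using regular_good[OF t z] by simp
 thus ?thesis using Zf_eq_Zreg[OF g] Zf_eq_Zreg[of "-z" tau] Zf_minus[OF g] by simp
next
 case True
 have c: "isCont (%z. Zreg z tau) 0" using Zreg_deriv[OF t regular_0] DERIV_isCont by blast
 hence 1: "((%z. Zreg z tau) \<longlongrightarrow> Zreg 0 tau) (at 0)" by (simp add: isCont_def)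
 have "((%z. Zreg (- z) tau) \<longlongrightarrow> Zreg 0 tau) (at 0)"
  using 1 by (rule filterlim_compose) (auto intro!: filterlim_atI tendsto_eq_intros simp: eventually_at_filter)
 hence 2: "((%z. - Zreg (- z) tau) \<longlongrightarrow> - Zreg 0 tau) (at 0)" by (rule tendsto_minus)
 have "\<forall>\<^sub>F z in at 0. - Zreg (- z) tau = Zreg z tau"
  using eventually_good_at_0[OF t] by eventually_elim (use Zf_eq_Zreg Zf_minus in \<open>force\<close>)
 with 2 have "((%z. Zreg z tau) \<longlongrightarrow> - Zreg 0 tau) (at 0)" by (rule Lim_transform_eventually)
 with 1 have "Zreg 0 tau = - Zreg 0 tau" by (rule tendsto_unique[rotated]) simp
 thus ?thesis using True by simp
qed

lemma Zreg_0 [simp]: "Im tau > 0 ==> Zreg 0 tau = 0"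
 using Zreg_minus[of tau 0] by simp

lemma dz1_Zf_eq_Zreg: "gpt z tau ==> dz 1 Zf z tau = - 1 / z\<^sup>2 + deriv (%z. Zreg z tau) z"
proof -
 assume g: "gpt z tau"
 have t: "Im tau > 0" and z: "z ~= 0" using g by (auto simp: gpt_def)
 have "\<forall>\<^sub>F w in nhds z. Zf w tau = 1 / w + Zreg w tau" using eventually_good_z[OF g] by eventually_elim (rule Zf_eq_Zreg)
 moreover have "((%w. 1 / w + Zreg w tau) hfd - 1 / z\<^sup>2 + deriv (%z. Zreg z tau) z) (at z)"
  using Zreg_deriv[OF t good_imp_regular[OF g]] z by (auto intro!: derivative_eq_intros simp: power2_eq_square)
 ultimately have "((%w. Zf w tau) hfd - 1 / z\<^sup>2 + deriv (%z. Zreg z tau) z) (at z)"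
  by (subst DERIV_cong_ev) auto
 thus ?thesis using Zf_deriv_z[OF g] DERIV_unique by blast
qed

text \<open>In \<open>Nf = Z\<^sup>2 + Z'\<close> with \<open>Z = 1/z + Zreg\<close> the double
  poles cancel. The limit at 0 is \<open>2 Zreg'(0) + Zreg'(0)\<close>, and it also equals
  \<open>theta_const\<close>.\<close>

lemma deriv_Zreg_0:
 assumes t: "Im tau > 0" shows "deriv (%z. Zreg z tau) 0 = theta_const tau / 3"
proof -
 let ?v = "%z. Zreg z tau"
 have 1: "((%z. ?v z / z) \<longlongrightarrow> deriv ?v 0) (at 0)"
  using Zreg_deriv[OF t regular_0] t by (intro has_field_derivative_tendsto_quotient) auto
 have "isCont ?v 0" using Zreg_deriv[OF t regular_0] DERIV_isCont by blast
 hence 2: "(?v \<longlongrightarrow> 0) (at 0)" using t by (simp add: isCont_def)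
 have "deriv ?v holo - poles tau" by (intro holomorphic_deriv Zreg_holomorphic t open_regular)
 hence "isCont (deriv ?v) 0"
  using holomorphic_on_imp_continuous_on continuous_on_eq_continuous_at[OF open_regular[OF t]] regular_0 by blast
 hence 3: "(deriv ?v \<longlongrightarrow> deriv ?v 0) (at 0)" by (simp add: isCont_def)
 have "((%z. 2 * (?v z / z) + ?v z ^ 2 + deriv ?v z) \<longlongrightarrow> 2 * deriv ?v 0 + 0 ^ 2 + deriv ?v 0) (at 0)"
  by (intro tendsto_intros 1 2 3)
 moreover have "\<forall>\<^sub>F z in at 0. 2 * (?v z / z) + ?v z ^ 2 + deriv ?v z = Nf z tau"
  using eventually_good_at_0[OF t]
 proof eventually_elim
  case (elim z)
  hence "z ~= 0" by (auto simp: gpt_def)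
  thus ?case unfolding Nf_eq[OF elim] Zf_eq_Zreg[OF elim] dz1_Zf_eq_Zreg[OF elim] by (simp add: power2_eq_square field_simps)
 qed
 ultimately have "((%z. Nf z tau) \<longlongrightarrow> 2 * deriv ?v 0 + 0 ^ 2 + deriv ?v 0) (at 0)" by (rule Lim_transform_eventually)
 with Nf_tendsto[OF t] have "theta_const tau = 2 * deriv ?v 0 + 0 ^ 2 + deriv ?v 0" by (rule tendsto_unique[rotated]) simp
 thus ?thesis by simp
qed

lemma dz_shift:
 assumes F: "F : theta_ring" and s: "!!z. gpt (z + s) tau \<longleftrightarrow> gpt z tau"
  and sF: "!!z. gpt z tau ==> F (z + s) tau = F z tau + c" and g: "gpt z tau"
 shows "dz (Suc k) F (z + s) tau = dz (Suc k) F z tau"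
proof -
 have step: "dz (Suc k) F (z + s) tau = dz (Suc k) F z tau"
  if k: "!!z. gpt z tau ==> dz k F (z + s) tau = dz k F z tau + c" and g: "gpt z tau" for k c z
 proof -
  have "((%w. dz k F (w + s) tau) hfd dz (Suc k) F (z + s) tau) (at z)"
   using dz_deriv_z[OF F, of "z + s" tau k] s g by (simp add: DERIV_shift)
  moreover have "((%w. dz k F w tau + c) hfd dz (Suc k) F z tau) (at z)"
   using dz_deriv_z[OF F g, of k] by (auto intro!: derivative_eq_intros)
  moreover have "\<forall>\<^sub>F w in nhds z. dz k F (w + s) tau = dz k F w tau + c"
   using eventually_good_z[OF g] by eventually_elim (rule k)
  ultimately show ?thesis using DERIV_unique by (subst (asm) DERIV_cong_ev[OF refl _ refl]) auto
 qed
 show ?thesis using g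
 proof (induction k arbitrary: z)
  case 0
  show ?case by (rule step[of 0 c]) (use sF 0 in auto)
 next
  case (Suc k)
  show ?case by (rule step[of "Suc k" 0]) (use Suc in auto)
 qed
qed

text \<open>Lattice translations change \<open>Z\<close> only by additive constants, which every
  derivative removes.\<close>

lemma dz_Zf_periodic:
 assumes "gpt z tau" "s : lattice tau"
 shows "dz (Suc k) Zf (z + s) tau = dz (Suc k) Zf z tau"
proof (rule lattice_periodic[where f="%z. dz (Suc k) Zf z tau"])
 have t: "Im tau > 0" using assms by (simp add: gpt_def)
 show "dz (Suc k) Zf (z + 1) tau = dz (Suc k) Zf z tau" if "z ~: lattice tau" for z
  by (rule dz_shift[OF Zf_ring, where c=0]) (use that t in \<open>auto simp: Zf_plus_1 gpt_def lattice_add_iff\<close>)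
 show "dz (Suc k) Zf (z + tau) tau = dz (Suc k) Zf z tau" if "z ~: lattice tau" for z
  by (rule dz_shift[OF Zf_ring, where c="- 2 * of_real pi * \<i>"]) (use that t in \<open>auto simp: Zf_plus_tau gpt_def lattice_add_iff\<close>)
qed (use assms in \<open>auto simp: gpt_def\<close>)

lemma lattice_translate: "s : lattice tau ==> bij_betw (%om. om + s) (lattice tau) (lattice tau)"
 by (rule bij_betwI[where g="%om. om - s"]) (auto intro: lattice_add lattice_diff)

lemma wp_cube_summable:
 assumes t: "Im tau > 0" shows "(%om. - 2 / (z - om) ^ 3) summable_on lattice tau"
proof -
 define R where "R = norm z + 1"
 have R: "R > 0" by (simp add: R_def add_nonneg_pos)
 define C where "C = lattice tau - cball 0 (2 * R)"
 have S: "(%om. 16 * (1 / norm om ^ 3)) summable_on C"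
  by (intro summable_on_cmult_right summable_on_subset_banach[OF lattice_summable[OF t]]) (auto simp: C_def)
 have le: "norm (- 2 / (z - om) ^ 3) <= 16 * (1 / norm om ^ 3)" if "om : C" for om
  using lattice_term_bounds(3)[of z R om] R that by (auto simp: C_def R_def)
 have "(%om. - 2 / (z - om) ^ 3) summable_on C"
  by (rule abs_summable_summable[OF Infinite_Sum.abs_summable_on_comparison_test'[OF S le]])
 moreover have "(%om. - 2 / (z - om) ^ 3) summable_on (lattice tau \<inter> cball 0 (2 * R))"
  using finite_lattice_cball[OF t] by (rule summable_on_finite)
 ultimately have "(%om. - 2 / (z - om) ^ 3) summable_on (C \<union> (lattice tau \<inter> cball 0 (2 * R)))"
  by (rule summable_on_union)
 moreover have "C \<union> (lattice tau \<inter> cball 0 (2 * R)) = lattice tau" by (auto simp: C_def)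
 ultimately show ?thesis by simp
qed

lemma wp_cube_split:
 assumes t: "Im tau > 0" shows "(\<Sum>\<^sub>\<infinity>om\<in>lattice tau. - 2 / (z - om) ^ 3) = - 2 / z ^ 3 + wp_reg' z tau"
proof -
 have "(\<Sum>\<^sub>\<infinity>om\<in>{0} \<union> (lattice tau - {0}). - 2 / (z - om) ^ 3) = (\<Sum>\<^sub>\<infinity>om\<in>{0}. - 2 / (z - om) ^ 3) + wp_reg' z tau"
  unfolding wp_reg'_def
  by (rule infsum_Un_disjoint[OF summable_on_finite summable_on_subset_banach[OF wp_cube_summable[OF t]]]) auto
 moreover have "{0} \<union> (lattice tau - {0}) = lattice tau" by auto
 ultimately show ?thesis by simp
qed

lemma wp_cube_periodic:
 assumes "s : lattice tau"
 shows "(\<Sum>\<^sub>\<infinity>om\<in>lattice tau. - 2 / (z + s - om) ^ 3) = (\<Sum>\<^sub>\<infinity>om\<in>lattice tau. - 2 / (z - om) ^ 3)"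
proof -
 have "(\<Sum>\<^sub>\<infinity>om\<in>lattice tau. - 2 / (z + s - (om + s)) ^ 3) = (\<Sum>\<^sub>\<infinity>om\<in>lattice tau. - 2 / (z + s - om) ^ 3)"
  by (rule infsum_reindex_bij_betw[OF lattice_translate[OF assms]])
 thus ?thesis by simp
qed

lemma lattice_reflect: "bij_betw uminus (lattice tau - {0}) (lattice tau - {0})"
 by (rule bij_betwI[where g=uminus]) auto

lemma wzeta_reg_minus: "wzeta_reg (- z) tau = - wzeta_reg z tau"
proof -
 have "wzeta_reg (- z) tau = (\<Sum>\<^sub>\<infinity>om\<in>lattice tau - {0}. 1 / (- z - (- om)) + 1 / (- om) + (- z) / (- om)\<^sup>2)"
  unfolding wzeta_reg_def by (rule infsum_reindex_bij_betw[OF lattice_reflect, symmetric])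
 also have "... = (\<Sum>\<^sub>\<infinity>om\<in>lattice tau - {0}. - (1 / (z - om) + 1 / om + z / om\<^sup>2))"
 proof (rule infsum_cong)
  fix om
  have "1 / (- z - (- om)) = - (1 / (z - om))" by (metis minus_diff_minus minus_divide_right)
  thus "1 / (- z - (- om)) + 1 / (- om) + (- z) / (- om)\<^sup>2 = - (1 / (z - om) + 1 / om + z / om\<^sup>2)" by simp
 qed
 finally show ?thesis unfolding wzeta_reg_def by (simp only: infsum_uminus)
qed

text \<open>The second derivative of \<open>h = Zreg - wzeta_reg\<close> is elliptic without poles:
  on the side of the lattice sums this is a translation of the absolutely convergent sum of cubes.
  So h is a quadratic polynomial that vanishes at 0. It is odd, which removes the square, and its
  slope at 0 is \<open>deriv_Zreg_0\<close>.\<close>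

theorem Zreg_eq_wzeta_reg:
 assumes t: "Im tau > 0" and z: "z ~: poles tau"
 shows "Zreg z tau = wzeta_reg z tau + theta_const tau / 3 * z"
  and "deriv (%z. Zreg z tau) z = theta_const tau / 3 - wp_reg z tau"
proof -
 define W where "W = - poles tau"
 have W: "open W" "connected W" unfolding W_def using open_regular[OF t] connected_regular by auto
 define v where "v z = Zreg z tau" for z
 have v: "v holo W" unfolding v_def[abs_def] W_def by (rule Zreg_holomorphic[OF t])
 define h where "h z = v z - wzeta_reg z tau" for z
 define k where "k z = deriv v z + wp_reg z tau" for z
 define k' where "k' z = deriv (deriv v) z + wp_reg' z tau" for z
 have pz: "z ~: lattice tau - {0}" if "z : W" for z using that by (auto simp: W_def poles_def)
 have dv: "(v hfd deriv v z) (at z)" if "z : W" for z using holomorphic_derivI[OF v W(1) that] .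
 have dv': "(deriv v hfd deriv (deriv v) z) (at z)" if "z : W" for z
  using holomorphic_derivI[OF holomorphic_deriv[OF v W(1)] W(1) that] .
 have dh: "(h hfd k z) (at z)" if "z : W" for z
  unfolding h_def[abs_def] k_def using DERIV_diff[OF dv[OF that] wzeta_reg_deriv[OF t pz[OF that]]] by simp
 have dk: "(k hfd k' z) (at z)" if "z : W" for z
  unfolding k_def[abs_def] k'_def by (rule DERIV_add[OF dv'[OF that] wp_reg_deriv[OF t pz[OF that]]])
 have kh: "k holo W" using dk by (auto simp: holomorphic_on_open[OF W(1)])
 have k'k: "k' z = deriv k z" if "z : W" for z using dk[OF that] by (simp add: DERIV_imp_deriv)
 have k'h: "k' holo W" using holomorphic_deriv[OF kh W(1)] by (rule holomorphic_transform) (simp add: k'k)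
 have gW: "z : W" if "z ~: lattice tau" for z using that by (auto simp: W_def poles_def)
 have k'eq: "k' z = dz 2 Zf z tau + (\<Sum>\<^sub>\<infinity>om\<in>lattice tau. - 2 / (z - om) ^ 3)" if "z ~: lattice tau" for z
 proof -
  have g: "gpt z tau" and z0: "z ~= 0" using that t by (auto simp: gpt_def)
  have e: "x ^ 2 * x ^ 2 ~= 0 ==> 2 * x / (x ^ 2 * x ^ 2) = 2 / x ^ 3" for x :: complex by (simp add: power2_eq_square power3_eq_cube)
  have "((%w. - 1 / w\<^sup>2 + deriv v w) hfd 2 / z ^ 3 + deriv (deriv v) z) (at z)"
   using z0 e[of z] dv'[OF gW[OF that]] by (auto intro!: derivative_eq_intros simp: power2_eq_square)
  moreover have "\<forall>\<^sub>F w in nhds z. dz 1 Zf w tau = - 1 / w\<^sup>2 + deriv v w"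
   using eventually_good_z[OF g] by eventually_elim (simp only: dz1_Zf_eq_Zreg v_def[abs_def])
  ultimately have "((%w. dz 1 Zf w tau) hfd 2 / z ^ 3 + deriv (deriv v) z) (at z)"
   by (subst DERIV_cong_ev) auto
  hence "dz 2 Zf z tau = 2 / z ^ 3 + deriv (deriv v) z"
   using dz_deriv_z[OF Zf_ring g, of 1] DERIV_unique by (fastforce simp: eval_nat_numeral)
  thus ?thesis unfolding k'_def wp_cube_split[OF t] by simp
 qed
 have "\<exists>c. \<forall>z. z ~: lattice tau --> k' z = c"
 proof -
  have "0 : W" by (simp add: W_def)
  hence "isCont k' 0" using k'h W(1) holomorphic_on_imp_continuous_on continuous_on_eq_continuous_at by blast
  hence "(k' \<longlongrightarrow> k' 0) (at 0)" by (simp add: isCont_def)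
  hence "\<forall>\<^sub>F z in at 0. dist (k' z) (k' 0) < 1" by (rule tendstoD) simp
  hence bd: "\<forall>\<^sub>F z in at 0. norm (k' z) <= norm (k' 0) + 1"
  proof eventually_elim
   case (elim z)
   thus ?case using norm_triangle_sub[of "k' z" "k' 0"] by (simp add: dist_norm)
  qed
  show ?thesis
  proof (rule elliptic_constant_lattice[OF t _ _ _ bd])
   show "k' holo - lattice tau" by (rule holomorphic_on_subset[OF k'h]) (auto simp: W_def poles_def)
   have "k' (z + s) = k' z" if "z ~: lattice tau" "s : lattice tau" for z s
    using that t dz_Zf_periodic[of z tau s 1] wp_cube_periodic[OF that(2), of z]
    by (simp add: k'eq lattice_add_iff gpt_def eval_nat_numeral)
   thus "z ~: lattice tau ==> k' (z + 1) = k' z" "z ~: lattice tau ==> k' (z + tau) = k' z" for z by auto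
  qed
 qed
 then obtain c where c: "!!z. z ~: lattice tau ==> k' z = c" by blast
 have c': "k' z = c" if "z : W" for z
 proof (cases "z = 0")
  case True
  have "isCont k' 0" using k'h W(1) holomorphic_on_imp_continuous_on continuous_on_eq_continuous_at that True by blast
  hence "(k' \<longlongrightarrow> k' 0) (at 0)" by (simp add: isCont_def)
  moreover have "(k' \<longlongrightarrow> c) (at 0)"
   by (rule tendsto_eventually) (use eventually_not_lattice[OF t, of 0] in \<open>auto elim!: eventually_mono simp: c\<close>)
  ultimately show ?thesis using True tendsto_unique[of "at 0" k'] by auto
 qed (use c that in \<open>auto simp: W_def poles_def\<close>)
 have W0: "0 : W" by (simp add: W_def)
 have const: "f z = f 0" if "!!z. z : W ==> (f hfd 0) (at z)" "z : W" for f z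
 proof -
  have "f constant_on W"
  proof (rule has_field_derivative_0_imp_constant_on[OF _ W(2,1)])
   show "(f hfd 0) (at z)" if "z : W" for z using \<open>!!z. z : W ==> (f hfd 0) (at z)\<close> that by blast
  qed
  thus ?thesis using that(2) W0 by (auto simp: constant_on_def)
 qed
 have kz: "k z = c * z + k 0" if "z : W" for z
 proof -
  have "k z - c * z = k 0 - c * 0"
  proof (rule const[OF _ that])
   fix w assume "w : W"
   thus "((%z. k z - c * z) hfd 0) (at w)"
    using dk[of w] c'[of w] by (auto intro!: derivative_eq_intros)
  qed
  thus ?thesis by (simp add: algebra_simps)
 qed
 have h0: "h 0 = 0" using t by (simp add: h_def v_def wzeta_reg_def)
 have hz: "h z = c * z\<^sup>2 / 2 + k 0 * z" if "z : W" for z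
 proof -
  have "h z - (c * z\<^sup>2 / 2 + k 0 * z) = h 0 - (c * 0\<^sup>2 / 2 + k 0 * 0)"
  proof (rule const[OF _ that])
   fix w assume w: "w : W"
   show "((%z. h z - (c * z\<^sup>2 / 2 + k 0 * z)) hfd 0) (at w)"
    using dh[OF w] kz[OF w] by (auto intro!: derivative_eq_intros)
  qed
  thus ?thesis by (simp add: h0)
 qed
 have hm: "h (- z) = - h z" if "z : W" for z
  using that Zreg_minus[OF t, of z] wzeta_reg_minus[of z tau] by (simp add: h_def v_def W_def)
 have c0: "c = 0"
 proof -
  obtain w where w: "w ~: lattice tau" using eventually_happens[OF eventually_not_lattice[OF t, of 0]] by auto
  hence ww: "w : W" "- w : W" "w ~= 0" using gW by auto
  from hm[OF ww(1)] have "c * w\<^sup>2 = 0" unfolding hz[OF ww(1)] hz[OF ww(2)] by simp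
  thus ?thesis using ww by simp
 qed
 have "wp_reg 0 tau = 0" by (simp add: wp_reg_def)
 hence k0: "k 0 = theta_const tau / 3" using deriv_Zreg_0[OF t] by (simp add: k_def v_def[abs_def])
 have zW: "z : W" using z by (simp add: W_def)
 show "Zreg z tau = wzeta_reg z tau + theta_const tau / 3 * z"
  using hz[OF zW] unfolding h_def v_def k0 c0 diff_eq_eq by (simp only: mult_zero_left div_0 add_0 add.commute)
 show "deriv (%z. Zreg z tau) z = theta_const tau / 3 - wp_reg z tau"
  using kz[OF zW] unfolding k0 c0 unfolding k_def v_def[abs_def] by (simp only: mult_zero_left add_0 eq_diff_eq)
qed

corollary Zf_eq_wzeta: "gpt z tau ==> Zf z tau = wzeta z tau + theta_const tau / 3 * z"
 using Zreg_eq_wzeta_reg(1)[of tau z] Zf_eq_Zreg[of z tau] good_imp_regular[of z tau]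
 by (auto simp: wp_wzeta_reg gpt_def)

corollary wp_eq_dz1_Zf: "gpt z tau ==> wp z tau = theta_const tau / 3 - dz 1 Zf z tau"
 using Zreg_eq_wzeta_reg(2)[of tau z] dz1_Zf_eq_Zreg[of z tau] good_imp_regular[of z tau]
 by (auto simp: wp_wzeta_reg gpt_def)

section \<open>Laurent families with coefficients in a ring of functions\<close>

lemma eventually_at_nhds:
 fixes a :: "'a :: t1_space"
 assumes "\<forall>\<^sub>F z in at a. P z" shows "\<forall>\<^sub>F z in at a. \<forall>\<^sub>F w in nhds z. P w"
proof -
 obtain S where S: "open S" "a : S" "!!z. z : S ==> z ~= a ==> P z"
  using assms by (auto simp: eventually_at_topological)
 have "\<forall>\<^sub>F w in nhds z. P w" if "z : S" "z ~= a" for z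
  unfolding eventually_nhds using S that by (intro exI[of _ "S - {a}"]) (auto intro: open_delete)
 thus ?thesis using S by (auto simp: eventually_at_topological)
qed

text \<open>A ring of functions on \<open>D\<close>: values outside \<open>D\<close> do not matter.\<close>

locale function_ring =
 fixes D :: "'p set" and R :: "('p => complex) set"
 assumes const [intro, simp]: "(%x. c) : R"
  and add [intro]: "f : R ==> g : R ==> (%x. f x + g x) : R"
  and mult [intro]: "f : R ==> g : R ==> (%x. f x * g x) : R"
  and cong: "f : R ==> (!!x. x : D ==> g x = f x) ==> g : R"
begin

lemma uminus [intro]: "f : R ==> (%x. - f x) : R"
 using mult[of "%x. -1" f] by simp

lemma diff [intro]: "f : R ==> g : R ==> (%x. f x - g x) : R"
 using add[of f "%x. - g x"] uminus[of g] by simp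

lemma divide_const [intro]: "f : R ==> (%x. f x / c) : R"
 using mult[of f "%x. 1 / c"] by simp

lemma sum [intro]: "(!!i. i : I ==> f i : R) ==> (%x. \<Sum>i\<in>I. f i x) : R"
 by (induction I rule: infinite_finite_induct) auto

lemma prod [intro]: "(!!i. i : I ==> f i : R) ==> (%x. \<Prod>i\<in>I. f i x) : R"
 by (induction I rule: infinite_finite_induct) auto

lemma power [intro]: "f : R ==> (%x. f x ^ k) : R"
 by (induction k) auto

lemma fps_mult_coeff:
 assumes "!!k. (%x. fps_nth (A x) k) : R" "!!k. (%x. fps_nth (B x) k) : R"
 shows "(%x. fps_nth (A x * B x) k) : R"
 unfolding fps_mult_nth using assms by (intro sum mult)

text \<open>The recursion for the coefficients of an inverse series divides by the constant term
  only, so it stays in the ring as soon as that one reciprocal does.\<close>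

lemma fps_inverse_coeff:
 assumes A: "!!k. (%x. fps_nth (A x) k) : R" and A0: "(%x. 1 / fps_nth (A x) 0) : R"
  and nz: "!!x. x : D ==> fps_nth (A x) 0 ~= 0"
 shows "(%x. fps_nth (inverse (A x)) k) : R"
proof (induction k rule: less_induct)
 case (less k)
 show ?case
 proof (cases k)
  case 0
  thus ?thesis using A0 by (simp add: inverse_eq_divide)
 next
  case (Suc m)
  have "(%x. - (1 / fps_nth (A x) 0) * (\<Sum>i=1..k. fps_nth (A x) i * fps_nth (inverse (A x)) (k - i))) : R"
   by (intro uminus mult sum A A0 less.IH) (use Suc in auto)
  thus ?thesis
  proof (rule cong)
   fix x assume x: "x : D"
   have "fps_nth (A x * inverse (A x)) k = 0"
    using inverse_mult_eq_1'[OF nz[OF x]] Suc by simp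
   hence "fps_nth (A x) 0 * fps_nth (inverse (A x)) k + (\<Sum>i=1..k. fps_nth (A x) i * fps_nth (inverse (A x)) (k - i)) = 0"
    unfolding fps_mult_nth by (subst (asm) sum.atLeast_Suc_atMost) auto
   thus "fps_nth (inverse (A x)) k = - (1 / fps_nth (A x) 0) * (\<Sum>i=1..k. fps_nth (A x) i * fps_nth (inverse (A x)) (k - i))"
    using nz[OF x] by (simp add: field_simps add_eq_0_iff)
  qed
 qed
qed

text \<open>Families \<open>F z x\<close> that are meromorphic in \<open>z\<close> at 0, with a pole of order at most \<open>N\<close> for all
 \<open>x\<close> in \<open>D\<close> and with Laurent coefficients in \<open>R\<close>.\<close>

definition laurent_in :: "nat => ('p => complex fps) => (complex => 'p => complex) => bool" where
 "laurent_in N B F \<longleftrightarrow> (\<forall>k. (%x. fps_nth (B x) k) : R) &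
  (\<forall>x\<in>D. \<exists>h. h hfps B x & (\<forall>\<^sub>F z in at 0. F z x * z ^ N = h z))"

definition laurent :: "(complex => 'p => complex) set" where
 "laurent = {F. \<exists>N B. laurent_in N B F}"

lemma laurentE: assumes "F : laurent" obtains N B where "laurent_in N B F"
 using assms by (auto simp: laurent_def)

lemma laurentI: "laurent_in N B F ==> F : laurent"
 by (auto simp: laurent_def)

lemma laurent_const: "f : R ==> (%z. f) : laurent"
proof (rule laurentI)
 assume f: "f : R"
 have "(%x. fps_nth (fps_const (f x)) k) : R" for k using f by (cases k) auto
 thus "laurent_in 0 (%x. fps_const (f x)) (%z. f)"
  unfolding laurent_in_def using has_fps_expansion_const by fastforce
qed

text \<open>The pole bound N can be raised, so that two families can be brought to a common bound
  before they are added.\<close>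

lemma laurent_in_shift:
 assumes "laurent_in N B F" shows "laurent_in (N + M) (%x. B x * fps_X ^ M) F"
 unfolding laurent_in_def
proof (intro conjI allI ballI)
 fix k
 have "(%x. if k < M then 0 else fps_nth (B x) (k - M)) : R"
  using assms by (cases "k < M") (auto simp: laurent_in_def)
 thus "(%x. fps_nth (B x * fps_X ^ M) k) : R" by (simp add: fps_X_power_mult_right_nth)
next
 fix x assume "x : D"
 then obtain h where h: "h hfps B x" "\<forall>\<^sub>F z in at 0. F z x * z ^ N = h z"
  using assms unfolding laurent_in_def by blast
 have "(%z. h z * z ^ M) hfps B x * fps_X ^ M" by (intro fps_expansion_intros h)
 moreover have "\<forall>\<^sub>F z in at 0. F z x * z ^ (N + M) = h z * z ^ M"
  using h(2) by eventually_elim (simp add: power_add)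
 ultimately show "\<exists>h. h hfps B x * fps_X ^ M & (\<forall>\<^sub>F z in at 0. F z x * z ^ (N + M) = h z)" by blast
qed

lemma laurent_add:
 assumes "F : laurent" "G : laurent" shows "(%z x. F z x + G z x) : laurent"
proof -
 obtain N B where F: "laurent_in N B F" using laurentE[OF assms(1)] .
 obtain M C where G: "laurent_in M C G" using laurentE[OF assms(2)] .
 note F' = laurent_in_shift[OF F, of M]
 note G' = laurent_in_shift[OF G, of N, unfolded add.commute[of M N]]
 have "laurent_in (N + M) (%x. B x * fps_X ^ M + C x * fps_X ^ N) (%z x. F z x + G z x)"
  unfolding laurent_in_def
 proof (intro conjI allI ballI)
  show "(%x. fps_nth (B x * fps_X ^ M + C x * fps_X ^ N) k) : R" for k
   using F' G' unfolding laurent_in_def fps_add_nth by (intro add) blast+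
  fix x assume x: "x : D"
  obtain h where h: "h hfps B x * fps_X ^ M" "\<forall>\<^sub>F z in at 0. F z x * z ^ (N + M) = h z"
   using F' x unfolding laurent_in_def by blast
  obtain g where g: "g hfps C x * fps_X ^ N" "\<forall>\<^sub>F z in at 0. G z x * z ^ (N + M) = g z"
   using G' x unfolding laurent_in_def by blast
  have "\<forall>\<^sub>F z in at 0. (F z x + G z x) * z ^ (N + M) = h z + g z"
   using h(2) g(2) by eventually_elim (simp add: ring_distribs)
  thus "\<exists>h. h hfps B x * fps_X ^ M + C x * fps_X ^ N & (\<forall>\<^sub>F z in at 0. (F z x + G z x) * z ^ (N + M) = h z)"
   using has_fps_expansion_add[OF h(1) g(1)] by blast
 qed
 thus ?thesis by (rule laurentI)
qed

lemma laurent_mult: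
 assumes "F : laurent" "G : laurent" shows "(%z x. F z x * G z x) : laurent"
proof -
 obtain N B where F: "laurent_in N B F" using laurentE[OF assms(1)] .
 obtain M C where G: "laurent_in M C G" using laurentE[OF assms(2)] .
 have "laurent_in (N + M) (%x. B x * C x) (%z x. F z x * G z x)"
  unfolding laurent_in_def
 proof (intro conjI allI ballI)
  show "(%x. fps_nth (B x * C x) k) : R" for k
   using F G unfolding laurent_in_def by (intro fps_mult_coeff) blast+
  fix x assume x: "x : D"
  obtain h where h: "h hfps B x" "\<forall>\<^sub>F z in at 0. F z x * z ^ N = h z"
   using F x unfolding laurent_in_def by blast
  obtain g where g: "g hfps C x" "\<forall>\<^sub>F z in at 0. G z x * z ^ M = g z"
   using G x unfolding laurent_in_def by blast
  have "\<forall>\<^sub>F z in at 0. (F z x * G z x) * z ^ (N + M) = h z * g z"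
   using h(2) g(2)
  proof eventually_elim
   case (elim z)
   have "(F z x * G z x) * z ^ (N + M) = (F z x * z ^ N) * (G z x * z ^ M)" by (simp add: power_add)
   thus ?case by (simp only: elim)
  qed
  thus "\<exists>h. h hfps B x * C x & (\<forall>\<^sub>F z in at 0. (F z x * G z x) * z ^ (N + M) = h z)"
   using has_fps_expansion_mult[OF h(1) g(1)] by blast
 qed
 thus ?thesis by (rule laurentI)
qed

lemma laurent_cong:
 assumes "F : laurent" "!!x. x : D ==> \<forall>\<^sub>F z in at 0. G z x = F z x" shows "G : laurent"
proof -
 obtain N B where F: "laurent_in N B F" using laurentE[OF assms(1)] .
 have "laurent_in N B G"
  unfolding laurent_in_def
 proof (intro conjI allI ballI)
  show "(%x. fps_nth (B x) k) : R" for k using F unfolding laurent_in_def by blast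
  fix x assume x: "x : D"
  obtain h where h: "h hfps B x" "\<forall>\<^sub>F z in at 0. F z x * z ^ N = h z"
   using F x unfolding laurent_in_def by blast
  have "\<forall>\<^sub>F z in at 0. G z x * z ^ N = h z" using h(2) assms(2)[OF x] by eventually_elim simp
  thus "\<exists>h. h hfps B x & (\<forall>\<^sub>F z in at 0. G z x * z ^ N = h z)" using h(1) by blast
 qed
 thus ?thesis by (rule laurentI)
qed

lemma laurent_cmult: "F : laurent ==> (%z x. c * F z x) : laurent"
 by (rule laurent_mult[OF laurent_const]) auto

lemma laurent_uminus: "F : laurent ==> (%z x. - F z x) : laurent"
 using laurent_cmult[of F "-1"] by simp

lemma laurent_diff: "F : laurent ==> G : laurent ==> (%z x. F z x - G z x) : laurent"
 using laurent_add[of F "%z x. - G z x"] laurent_uminus[of G] by simp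

lemma laurent_sum: "(!!i. i : I ==> F i : laurent) ==> (%z x. \<Sum>i\<in>I. F i z x) : laurent"
 by (induction I rule: infinite_finite_induct) (auto intro: laurent_const laurent_add)

lemma laurent_prod: "(!!i. i : I ==> F i : laurent) ==> (%z x. \<Prod>i\<in>I. F i z x) : laurent"
 by (induction I rule: infinite_finite_induct) (auto intro: laurent_const laurent_mult)

lemma laurent_power: "F : laurent ==> (%z x. F z x ^ k) : laurent"
 by (induction k) (auto intro: laurent_const laurent_mult)

text \<open>From \<open>F z^N = h\<close> follows \<open>F' z^(N + 1) = z h' - N h\<close>, whose
  coefficients are integer multiples of those of h.\<close>

lemma laurent_deriv:
 assumes "F : laurent" shows "(%z x. deriv (%w. F w x) z) : laurent"
proof -
 obtain N B where F: "laurent_in N B F" using laurentE[OF assms] .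
 have "laurent_in (Suc N) (%x. fps_X * fps_deriv (B x) - fps_const (of_nat N) * B x) (%z x. deriv (%w. F w x) z)"
  unfolding laurent_in_def
 proof (intro conjI allI ballI)
  fix k
  have B: "(%x. fps_nth (B x) k) : R" for k using F unfolding laurent_in_def by blast
  have "(%x. of_nat k * fps_nth (B x) k - of_nat N * fps_nth (B x) k) : R" by (intro diff mult const B)
  thus "(%x. fps_nth (fps_X * fps_deriv (B x) - fps_const (of_nat N) * B x) k) : R"
   by (cases k) auto
 next
  fix x assume x: "x : D"
  obtain h where h: "h hfps B x" "\<forall>\<^sub>F z in at 0. F z x * z ^ N = h z"
   using F x unfolding laurent_in_def by blast
  have e: "(%z. z * deriv h z - of_nat N * h z) hfps fps_X * fps_deriv (B x) - fps_const (of_nat N) * B x"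
   by (intro fps_expansion_intros h)
  obtain r where r: "r > 0" "h holo ball 0 r"
   using has_fps_expansion_imp_holomorphic[OF h(1)] by (metis centre_in_ball holomorphic_on_subset open_contains_ball_eq)
  have "\<forall>\<^sub>F z in at 0. z : ball 0 r - {0}" using r(1) by (intro eventually_at_in_open) auto
  moreover have "\<forall>\<^sub>F z in at 0. \<forall>\<^sub>F w in nhds z. F w x * w ^ N = h w"
   using h(2) by (rule eventually_at_nhds)
  ultimately have "\<forall>\<^sub>F z in at 0. deriv (%w. F w x) z * z ^ Suc N = z * deriv h z - of_nat N * h z"
  proof eventually_elim
   case (elim z)
   hence z: "z ~= 0" by auto
   have dh: "(h hfd deriv h z) (at z)"
    by (rule holomorphic_derivI[OF r(2)]) (use elim in auto)
   have "\<forall>\<^sub>F w in nhds z. F w x = h w / w ^ N"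
    using elim(2) t1_space_nhds[OF z] by eventually_elim (simp add: field_simps)
   hence "deriv (%w. F w x) z = deriv (%w. h w / w ^ N) z" by (rule deriv_cong_ev) simp
   also have "... = (deriv h z * z ^ N - h z * (of_nat N * z ^ (N - 1))) / (z ^ N * z ^ N)"
    using z by (intro DERIV_imp_deriv) (auto intro!: derivative_eq_intros dh)
   finally have D: "deriv (%w. F w x) z = (deriv h z * z ^ N - h z * (of_nat N * z ^ (N - 1))) / (z ^ N * z ^ N)" .
   thus ?case
   proof (cases N)
    case (Suc m)
    have "deriv (%w. F w x) z * z ^ Suc N = (deriv h z * z ^ N - h z * (of_nat N * z ^ (N - 1))) * z / z ^ N"
     unfolding D
     using z by simp
    also have "... = (deriv h z * z * z ^ N - h z * of_nat N * z ^ N) / z ^ N"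
     unfolding Suc by (simp add: algebra_simps)
    also have "... = z * deriv h z - of_nat N * h z" using z by (simp add: diff_divide_distrib)
    finally show ?thesis .
   qed simp
  qed
  with e show "\<exists>h. h hfps fps_X * fps_deriv (B x) - fps_const (of_nat N) * B x &
    (\<forall>\<^sub>F z in at 0. deriv (%w. F w x) z * z ^ Suc N = h z)" by blast
 qed
 thus ?thesis by (rule laurentI)
qed

lemma laurent_higher_deriv:
 assumes "F : laurent" shows "(%z x. (deriv ^^ k) (%w. F w x) z) : laurent"
proof (induction k)
 case (Suc k)
 thus ?case using laurent_deriv[of "%z x. (deriv ^^ k) (%w. F w x) z"] by simp
qed (use assms in simp)

lemma laurent_taylor:
 assumes "!!x. x : D ==> (%z. F z x) analytic_on {0}" "!!k. (%x. (deriv ^^ k) (%z. F z x) 0) : R"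
 shows "F : laurent"
proof (rule laurentI)
 show "laurent_in 0 (%x. fps_expansion (%z. F z x) 0) F"
  unfolding laurent_in_def
 proof (intro conjI allI ballI)
  show "(%x. fps_nth (fps_expansion (%z. F z x) 0) k) : R" for k
   using assms(2) by (auto simp: fps_expansion_def)
  fix x assume "x : D"
  from analytic_at_imp_has_fps_expansion_0[OF assms(1)[OF this]]
  show "\<exists>h. h hfps fps_expansion (%z. F z x) 0 & (\<forall>\<^sub>F z in at 0. F z x * z ^ 0 = h z)"
   by (intro exI[of _ "%z. F z x"]) auto
 qed
qed

lemma laurent_inverse_taylor:
 assumes an: "!!x. x : D ==> (%z. u z x) analytic_on {0}" and coeff: "!!k. (%x. (deriv ^^ k) (%z. u z x) 0) : R"
  and u0: "(%x. 1 / u 0 x) : R" and nz: "!!x. x : D ==> u 0 x ~= 0"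
  and F: "!!x. x : D ==> \<forall>\<^sub>F z in at 0. F z x * z ^ N = 1 / u z x"
 shows "F : laurent"
proof (rule laurentI[of N "%x. inverse (fps_expansion (%z. u z x) 0)"])
 show "laurent_in N (%x. inverse (fps_expansion (%z. u z x) 0)) F"
  unfolding laurent_in_def
 proof (intro conjI allI ballI)
  show "(%x. fps_nth (inverse (fps_expansion (%z. u z x) 0)) k) : R" for k
   by (rule fps_inverse_coeff) (use coeff u0 nz in \<open>auto simp: fps_expansion_def\<close>)
  fix x assume x: "x : D"
  have "(%z. inverse (u z x)) hfps inverse (fps_expansion (%z. u z x) 0)"
   by (intro has_fps_expansion_inverse analytic_at_imp_has_fps_expansion_0 an x) (use nz[OF x] in \<open>simp add: fps_expansion_def\<close>)
  thus "\<exists>h. h hfps inverse (fps_expansion (%z. u z x) 0) & (\<forall>\<^sub>F z in at 0. F z x * z ^ N = h z)"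
   using F[OF x] by (auto simp: inverse_eq_divide)
 qed
qed

lemma fps_expansion_unique_at:
 assumes f: "f hfps F" and g: "g hfps G" and fg: "\<forall>\<^sub>F z in at 0. f z = g z"
 shows "F = (G :: complex fps)"
proof -
 have "f has_laurent_expansion fps_to_fls F" using f by (rule has_laurent_expansion_fps)
 moreover have "f has_laurent_expansion fps_to_fls G"
  using has_laurent_expansion_fps[OF g] has_laurent_expansion_cong[OF fg refl] by blast
 ultimately show ?thesis using has_laurent_expansion_unique fps_to_fls_eq_iff by metis
qed

text \<open>Coefficient extraction: the principal parts of \<open>f 1, ..., f n\<close> are \<open>1/z, ..., 1/z^n\<close>.\<close>

lemma laurent_extract:
 assumes F: "F : laurent"
  and f0: "!!x. x : D ==> \<forall>\<^sub>F z in at 0. f 0 z x = 1"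
  and g: "!!k x. k : {1..n} ==> x : D ==> g k x hfps G k x"
  and fg: "!!k x. k : {1..n} ==> x : D ==> \<forall>\<^sub>F z in at 0. f k z x = 1 / z ^ k + g k x z"
  and G0: "!!k. k : {1..n} ==> (%x. fps_nth (G k x) 0) : R"
  and eq: "!!x. x : D ==> \<forall>\<^sub>F z in at 0. (\<Sum>k\<le>n. f k z x * Y k x) = F z x"
  and k: "k <= n"
 shows "Y k : R"
proof -
 obtain N B where FB: "laurent_in N B F" using laurentE[OF F] .
 have B: "(%x. fps_nth (B x) k) : R" for k using FB unfolding laurent_in_def by blast
 \<comment> \<open>Multiplication by \<open>z ^ (N + n)\<close> clears all poles, so the identity on
   a punctured neighbourhood of 0 becomes one between power series.\<close>
 have id: "fps_const (Y 0 x) * fps_X ^ (N + n) + (\<Sum>k\<in>{1..n}. fps_const (Y k x) * (fps_X ^ (N + n - k) + fps_X ^ (N + n) * G k x)) = B x * fps_X ^ n"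
  if x: "x : D" for x
 proof -
  obtain h where h: "h hfps B x" "\<forall>\<^sub>F z in at 0. F z x * z ^ N = h z"
   using FB x unfolding laurent_in_def by blast
  have e1: "(%z. h z * z ^ n) hfps B x * fps_X ^ n" by (intro fps_expansion_intros h)
  have e2: "(%z. Y 0 x * z ^ (N + n) + (\<Sum>k\<in>{1..n}. Y k x * (z ^ (N + n - k) + z ^ (N + n) * g k x z))) has_fps_expansion
   fps_const (Y 0 x) * fps_X ^ (N + n) + (\<Sum>k\<in>{1..n}. fps_const (Y k x) * (fps_X ^ (N + n - k) + fps_X ^ (N + n) * G k x))"
   by (intro fps_expansion_intros g x)
  have "\<forall>\<^sub>F z in at 0. \<forall>k\<in>{1..n}. f k z x = 1 / z ^ k + g k x z"
   by (intro eventually_ball_finite ballI fg x) auto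
  with f0[OF x] eq[OF x] h(2) eventually_neq_at_within[of 0]
  have e3: "\<forall>\<^sub>F z in at 0. Y 0 x * z ^ (N + n) + (\<Sum>k\<in>{1..n}. Y k x * (z ^ (N + n - k) + z ^ (N + n) * g k x z)) = h z * z ^ n"
  proof eventually_elim
   case (elim z)
   have "h z * z ^ n = F z x * z ^ (N + n)" using elim(3) by (simp add: power_add)
   also have "F z x = (\<Sum>k\<le>n. f k z x * Y k x)" using elim(2) by simp
   also have "... = f 0 z x * Y 0 x + (\<Sum>k\<in>{1..n}. f k z x * Y k x)"
    by (simp add: sum.atMost_shift atLeastLessThanSuc_atLeastAtMost sum.atLeast1_atMost_eq)
   also have "... * z ^ (N + n) = Y 0 x * z ^ (N + n) + (\<Sum>k\<in>{1..n}. Y k x * (f k z x * z ^ (N + n)))"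
    using elim(1) by (simp add: ring_distribs sum_distrib_left sum_distrib_right mult_ac)
   also have "(\<Sum>k\<in>{1..n}. Y k x * (f k z x * z ^ (N + n))) = (\<Sum>k\<in>{1..n}. Y k x * (z ^ (N + n - k) + z ^ (N + n) * g k x z))"
   proof (rule sum.cong[OF refl])
    fix k assume k: "k : {1..n}"
    have "z ^ (N + n) = z ^ (N + n - k) * z ^ k" using k by (simp flip: power_add)
    hence "1 / z ^ k * z ^ (N + n) = z ^ (N + n - k)" using elim(4) by simp
    thus "Y k x * (f k z x * z ^ (N + n)) = Y k x * (z ^ (N + n - k) + z ^ (N + n) * g k x z)"
     using elim(5) k by (simp add: ring_distribs)
   qed
   finally show ?case by simp
  qed
  show ?thesis by (rule fps_expansion_unique_at[OF e2 e1 e3])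
 qed
 have coeff: "fps_nth (fps_const (Y 0 x) * fps_X ^ (N + n) + (\<Sum>k\<in>{1..n}. fps_const (Y k x) * (fps_X ^ (N + n - k) + fps_X ^ (N + n) * G k x))) m
  = (if m = N + n then Y 0 x else 0) + (\<Sum>k\<in>{1..n}. Y k x * ((if m = N + n - k then 1 else 0) + (if m < N + n then 0 else fps_nth (G k x) (m - (N + n)))))" for m x
  by (simp add: fps_sum_nth fps_X_power_mult_nth)
 \<comment> \<open>At degree \<open>N + n - j\<close> only the principal part of \<open>f j\<close>
   is visible, because the regular parts start at degree \<open>N + n\<close>. Degrees below n do
   not occur on the right-hand side, which explains the default value 0.\<close>
 have pos: "Y j : R" if j: "j : {1..n}" for j
 proof (rule cong)
  show "(%x. if N + n - j < n then 0 else fps_nth (B x) (N + n - j - n)) : R" using B by (cases "N + n - j < n") auto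
  fix x assume x: "x : D"
  have "fps_nth (B x * fps_X ^ n) (N + n - j) = (\<Sum>k\<in>{1..n}. Y k x * (if N + n - j = N + n - k then 1 else 0))"
   unfolding id[OF x, symmetric] coeff using j by auto
  also have "... = (\<Sum>k\<in>{1..n}. if k = j then Y j x else 0)"
   by (rule sum.cong) (use j in auto)
  also have "... = Y j x" using j by simp
  finally show "Y j x = (if N + n - j < n then 0 else fps_nth (B x) (N + n - j - n))" by (simp add: fps_X_power_mult_right_nth)
 qed
 \<comment> \<open>At degree \<open>N + n\<close> the constant terms of all regular parts enter too.
   Hence the assumption \<open>G0\<close>, and hence \<open>Y 0\<close> is obtained after the
   others.\<close>
 have "Y 0 : R"
 proof (rule cong)
  show "(%x. fps_nth (B x) N - (\<Sum>k\<in>{1..n}. Y k x * fps_nth (G k x) 0)) : R" by (intro diff sum mult B pos G0) auto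
  fix x assume x: "x : D"
  have "fps_nth (B x) N = fps_nth (B x * fps_X ^ n) (N + n)" by (simp add: fps_X_power_mult_right_nth)
  also have "... = Y 0 x + (\<Sum>k\<in>{1..n}. Y k x * fps_nth (G k x) 0)"
   unfolding id[OF x, symmetric] coeff by (auto intro!: sum.cong)
  finally show "Y 0 x = fps_nth (B x) N - (\<Sum>k\<in>{1..n}. Y k x * fps_nth (G k x) 0)" by simp
 qed
 with pos k show ?thesis by (cases "k = 0") auto
qed

text \<open>Families of Laurent series, regarded as functions of \<open>(x, z)\<close>, form a ring again, over which
 one can expand in a second variable.\<close>

definition laurent_fun :: "('p \<times> complex) set => ('p \<times> complex => complex) set" where
 "laurent_fun E = {G. \<exists>F\<in>laurent. \<forall>(x, z)\<in>E. G (x, z) = F z x}"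

lemma laurent_fun_ring: "function_ring E (laurent_fun E)"
proof
 show "(%x. c) : laurent_fun E" for c
  unfolding laurent_fun_def using laurent_const[OF const] by (intro CollectI bexI[of _ "%z x. c"]) auto
 fix f g assume f: "f : laurent_fun E"
 then obtain F where F: "F : laurent" "\<forall>(x, z)\<in>E. f (x, z) = F z x" by (auto simp: laurent_fun_def)
 show "g : laurent_fun E" if "!!x. x : E ==> g x = f x"
  unfolding laurent_fun_def using F that by (intro CollectI bexI[of _ F]) auto
 assume "g : laurent_fun E"
 then obtain G where G: "G : laurent" "\<forall>(x, z)\<in>E. g (x, z) = G z x" by (auto simp: laurent_fun_def)
 show "(%x. f x + g x) : laurent_fun E"
  unfolding laurent_fun_def using F(2) G(2) by (intro CollectI bexI[OF _ laurent_add[OF F(1) G(1)]]) fastforce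
 show "(%x. f x * g x) : laurent_fun E"
  unfolding laurent_fun_def using F(2) G(2) by (intro CollectI bexI[OF _ laurent_mult[OF F(1) G(1)]]) fastforce
qed

lemma laurent_fun_memI: "F : laurent ==> (%(x, z). F z x) : laurent_fun E"
 unfolding laurent_fun_def by auto

lemma laurent_fun_base: "f : R ==> (%(x, z). f x) : laurent_fun E"
 using laurent_fun_memI[OF laurent_const] by auto

text \<open>A family in w that does not involve z: its coefficients, read as functions of
  \<open>(x, z)\<close>, are constant in z.\<close>

lemma laurent_lift:
 assumes F: "F : laurent" and E: "!!x z. (x, z) : E ==> x : D"
 shows "(%w (x, z). F w x) : function_ring.laurent E (laurent_fun E)"
proof -
 interpret E: function_ring E "laurent_fun E" by (rule laurent_fun_ring)
 obtain N B where FB: "laurent_in N B F" using laurentE[OF F] .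
 show ?thesis
 proof (rule E.laurentI[of N "%(x, z). B x"])
  show "E.laurent_in N (%(x, z). B x) (%w (x, z). F w x)"
   unfolding E.laurent_in_def
  proof (intro conjI allI ballI)
   fix k
   have "(%x. fps_nth (B x) k) : R" using FB unfolding laurent_in_def by blast
   from laurent_fun_base[OF this] show "(%p. fps_nth (case p of (x, z) => B x) k) : laurent_fun E"
    by (simp add: case_prod_unfold)
  next
   fix p assume p: "p : E"
   obtain x z where [simp]: "p = (x, z)" by (cases p)
   have "x : D" using E p by simp
   thus "\<exists>h. h hfps (case p of (x, z) => B x) & (\<forall>\<^sub>F w in at 0. (case p of (x, z) => F w x) * w ^ N = h w)"
    using FB unfolding laurent_in_def by simp
  qed
 qed
qed

text \<open>For z off the singularities \<open>F (z - w)\<close> is analytic in w at 0, and its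
  Taylor coefficients are up to sign the derivatives of \<open>F\<close> at z, again Laurent
  families in z. This is how terms in \<open>z - w\<close> are handled: expansion in w first, with
  coefficients still to be expanded in z.\<close>

lemma laurent_diff_arg:
 assumes F: "F : laurent" and an: "!!x z. (x, z) : E ==> (%w. F w x) analytic_on {z}"
 shows "(%w (x, z). F (z - w) x) : function_ring.laurent E (laurent_fun E)"
proof -
 interpret E: function_ring E "laurent_fun E" by (rule laurent_fun_ring)
 have d: "(deriv ^^ k) (%w. F (z - w) x) 0 = (-1) ^ k * (deriv ^^ k) (%w. F w x) z"
  and a: "(%w. F (z - w) x) analytic_on {0}" if E: "(x, z) : E" for x z k
 proof -
  obtain T where T: "open T" "z : T" "(%w. F w x) holo T"
   using an[OF E] by (auto simp: analytic_at)
  define S where "S = (%w. -1 * w + z) -` T"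
  have S: "open S" unfolding S_def by (rule open_vimage[OF T(1)]) (intro continuous_intros)
  have "(deriv ^^ k) (%w. F (-1 * w + z) x) 0 = (-1) ^ k * (deriv ^^ k) (%w. F w x) (-1 * 0 + z)"
   by (rule higher_deriv_compose_linear'[OF T(3) S T(1)]) (use T(2) in \<open>auto simp: S_def\<close>)
  thus "(deriv ^^ k) (%w. F (z - w) x) 0 = (-1) ^ k * (deriv ^^ k) (%w. F w x) z" by simp
  have hs: "(%w. -1 * w + z) holo S" by (intro holomorphic_intros)
  have "(%w. F (z - w) x) holo S"
   using holomorphic_on_compose_gen[OF hs T(3)] by (simp add: o_def S_def image_vimage_subset)
  thus "(%w. F (z - w) x) analytic_on {0}"
   using S T(2) by (auto simp: analytic_at S_def)
 qed
 show ?thesis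
 proof (rule E.laurent_taylor)
  fix k
  have "(%(x, z). (-1) ^ k * (deriv ^^ k) (%w. F w x) z) : laurent_fun E"
   by (rule laurent_fun_memI[OF laurent_cmult[OF laurent_higher_deriv[OF F]]])
  thus "(%p. (deriv ^^ k) (%w. case p of (x, z) => F (z - w) x) 0) : laurent_fun E"
   by (rule E.cong) (use d in auto)
 qed (use a in auto)
qed

end

lemma higher_deriv_shift:
 assumes "f analytic_on {a}"
 shows "(deriv ^^ k) (%z. f (z + a)) 0 = (deriv ^^ k) f a" "(%z. f (z + a)) analytic_on {0}"
proof -
 obtain T where T: "open T" "a : T" "f holo T"
  using assms by (auto simp: analytic_at)
 define S where "S = (%w. 1 * w + a) -` T"
 have S: "open S" unfolding S_def by (rule open_vimage[OF T(1)]) (intro continuous_intros)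
 have "(deriv ^^ k) (%w. f (1 * w + a)) 0 = 1 ^ k * (deriv ^^ k) f (1 * 0 + a)"
  by (rule higher_deriv_compose_linear'[OF T(3) S T(1)]) (use T(2) in \<open>auto simp: S_def\<close>)
 thus "(deriv ^^ k) (%z. f (z + a)) 0 = (deriv ^^ k) f a" by simp
 have hs: "(%w. 1 * w + a) holo S" by (intro holomorphic_intros)
 have "(%w. f (w + a)) holo S"
  using holomorphic_on_compose_gen[OF hs T(3)] by (simp add: o_def S_def image_vimage_subset)
 thus "(%z. f (z + a)) analytic_on {0}"
  using S T(2) by (auto simp: analytic_at S_def)
qed

lemma theta_analytic: "Im tau > 0 ==> (%z. theta k z tau) analytic_on A"
 using theta_holomorphic[of tau k UNIV] analytic_on_open[OF open_UNIV] analytic_on_subset[OF _ subset_UNIV] by blast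

lemma theta_higher_deriv_z: "Im tau > 0 ==> (deriv ^^ j) (%z. theta k z tau) z = theta (k + j) z tau"
proof (induction j arbitrary: z)
 case (Suc j)
 have "(deriv ^^ j) (%z. theta k z tau) = (%z. theta (k + j) z tau)" using Suc by auto
 thus ?case using theta_deriv_z[OF Suc.prems, of "k + j" z] by (simp add: DERIV_imp_deriv)
qed simp

text \<open>Comparison of coefficients in \<open>z * theta_unit = theta\<close>; the quotient of
  \<open>fact (Suc k)\<close> by \<open>fact k\<close> is the denominator.\<close>

lemma theta_unit_higher_deriv:
 assumes t: "Im tau > 0"
 shows "(deriv ^^ k) (%z. theta_unit z tau) 0 = theta (Suc k) 0 tau / of_nat (Suc k)"
proof -
 define U where "U = fps_expansion (%z. theta_unit z tau) 0"
 have "(%z. theta_unit z tau) analytic_on {0}" using theta_unit_holomorphic[OF t, of UNIV] by (auto simp: analytic_at)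
 hence U: "(%z. theta_unit z tau) hfps U" unfolding U_def by (rule analytic_at_imp_has_fps_expansion_0)
 hence "(%z. z * theta_unit z tau) hfps fps_X * U" by (intro fps_expansion_intros)
 moreover have "(%z. z * theta_unit z tau) = (%z. theta 0 z tau)" using t by (auto simp: theta_unit_def)
 ultimately have "fps_nth (fps_X * U) (Suc k) = (deriv ^^ Suc k) (%z. theta 0 z tau) 0 / fact (Suc k)"
  by (simp only: fps_nth_fps_expansion)
 hence "fps_nth U k = theta (Suc k) 0 tau / fact (Suc k)" unfolding theta_higher_deriv_z[OF t] by simp
 moreover have "fps_nth U k = (deriv ^^ k) (%z. theta_unit z tau) 0 / fact k" using fps_nth_fps_expansion[OF U] .
 ultimately have "(deriv ^^ k) (%z. theta_unit z tau) 0 / fact k = (theta (Suc k) 0 tau / of_nat (Suc k)) / fact k"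
  by (simp only: fact_Suc of_nat_mult divide_divide_eq_left of_nat_fact)
 thus ?thesis by (simp only: divide_cancel_right fact_nonzero simp_thms)
qed

lemma Zf_holomorphic: "Im tau > 0 ==> (%z. Zf z tau) holo - lattice tau"
 using Zf_deriv_z closed_lattice[of tau] unfolding holomorphic_on_open[OF open_Compl[OF closed_lattice]]
 by (fastforce simp: holomorphic_on_open open_Compl gpt_def)

lemma Zf_analytic: "gpt z tau ==> (%z. Zf z tau) analytic_on {z}"
 using Zf_holomorphic[of tau] closed_lattice[of tau] by (auto simp: analytic_at gpt_def intro!: exI[of _ "- lattice tau"])

lemma Zreg_analytic: "Im tau > 0 ==> z ~: poles tau ==> (%z. Zreg z tau) analytic_on {z}"
 using Zreg_holomorphic[of tau] open_regular[of tau] by (auto simp: analytic_at intro!: exI[of _ "- poles tau"])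

context function_ring
begin

lemma laurent_theta_shift:
 assumes "!!x. x : D ==> Im (t x) > 0" "!!k. (%x. theta k (a x) (t x)) : R"
 shows "(%z x. theta j (z + a x) (t x)) : laurent"
proof (rule laurent_taylor)
 show "(%z. theta j (z + a x) (t x)) analytic_on {0}" if "x : D" for x
  by (rule higher_deriv_shift(2)[OF theta_analytic]) (use assms that in auto)
 fix k
 show "(%x. (deriv ^^ k) (%z. theta j (z + a x) (t x)) 0) : R"
  by (rule cong[OF assms(2)[of "j + k"]])
   (use assms(1) in \<open>auto simp: higher_deriv_shift(1)[OF theta_analytic] theta_higher_deriv_z\<close>)
qed

lemma laurent_inverse_theta_shift:
 assumes "!!x. x : D ==> gpt (a x) (t x)" "!!k. (%x. theta k (a x) (t x)) : R" "(%x. 1 / theta 0 (a x) (t x)) : R"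
 shows "(%z x. 1 / theta 0 (z + a x) (t x)) : laurent"
proof (rule laurent_inverse_taylor[where N=0 and u="%z x. theta 0 (z + a x) (t x)"])
 have im: "Im (t x) > 0" if "x : D" for x using assms(1)[OF that] by (simp add: gpt_def)
 show "(%z. theta 0 (z + a x) (t x)) analytic_on {0}" if "x : D" for x
  by (rule higher_deriv_shift(2)[OF theta_analytic]) (use im that in auto)
 show "(%x. (deriv ^^ k) (%z. theta 0 (z + a x) (t x)) 0) : R" for k
  by (rule cong[OF assms(2)[of k]])
   (use im in \<open>auto simp: higher_deriv_shift(1)[OF theta_analytic] theta_higher_deriv_z\<close>)
 show "theta 0 (0 + a x) (t x) ~= 0" if "x : D" for x using assms(1)[OF that] by (simp add: gpt_theta)
qed (use assms(3) in auto)

lemma laurent_inverse_theta: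
 assumes "!!x. x : D ==> Im (t x) > 0" "!!k. (%x. theta k 0 (t x)) : R" "(%x. 1 / theta 1 0 (t x)) : R"
 shows "(%z x. 1 / theta 0 z (t x)) : laurent"
proof (rule laurent_inverse_taylor[where N=1 and u="%z x. theta_unit z (t x)"])
 show "(%z. theta_unit z (t x)) analytic_on {0}" if "x : D" for x
  using theta_unit_holomorphic[OF assms(1)[OF that], of UNIV] by (auto simp: analytic_at)
 show "(%x. (deriv ^^ k) (%z. theta_unit z (t x)) 0) : R" for k
  by (rule cong[OF divide_const[OF assms(2)[of "Suc k"], of "of_nat (Suc k)"]])
   (use assms(1) in \<open>simp only: theta_unit_higher_deriv\<close>)
 show "(%x. 1 / theta_unit 0 (t x)) : R" using assms(3) by (simp add: theta_unit_def)
 show "theta_unit 0 (t x) ~= 0" if "x : D" for x using theta_unit_nonzero[OF assms(1)[OF that]] by auto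
 show "\<forall>\<^sub>F z in at 0. 1 / theta 0 z (t x) * z ^ 1 = 1 / theta_unit z (t x)" for x
  using eventually_neq_at_within[of 0] by eventually_elim (simp add: theta_unit_def)
qed

lemma laurent_Zf_theta:
 assumes "!!x. x : D ==> Im (t x) > 0" "!!k. (%x. theta k 0 (t x)) : R" "(%x. 1 / theta 1 0 (t x)) : R"
 shows "(%z x. Zf z (t x)) : laurent"
 using laurent_mult[OF laurent_theta_shift[of t "%x. 0" 1] laurent_inverse_theta[of t]] assms
 by (simp add: Zf_def theta_ratio_def)

text \<open>A converse of \<open>laurent_Zf\<close>: Laurent coefficients are unique, so those of
  any expansion of \<open>Z\<close> must be the ones of \<open>1/z + Zreg\<close>. Regularity of the
  coefficients in the parameters thus follows from the expansion of \<open>Z\<close> as a quotient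
  of thetas. The factor z in \<open>z Z = 1 + z Zreg\<close> accounts for the index
  \<open>N + m\<close>.\<close>

lemma laurent_Zf_coeffs:
 assumes "!!x. x : D ==> Im (t x) > 0" "(%z x. Zf z (t x)) : laurent"
 shows "(%x. (deriv ^^ m) (%z. Zreg z (t x)) 0) : R"
proof -
 obtain N B where FB: "laurent_in N B (%z x. Zf z (t x))" using laurentE[OF assms(2)] .
 have B: "(%x. fact m * fps_nth (B x) (N + m)) : R" using FB unfolding laurent_in_def by (intro mult const) blast
 show ?thesis
 proof (rule cong[OF B])
  fix x assume x: "x : D"
  have im: "Im (t x) > 0" using assms(1)[OF x] .
  define G where "G = fps_expansion (%z. Zreg z (t x)) 0"
  have G: "(%z. Zreg z (t x)) hfps G"
   unfolding G_def by (intro analytic_at_imp_has_fps_expansion_0 Zreg_analytic im) simp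
  obtain h where h: "h hfps B x" "\<forall>\<^sub>F z in at 0. Zf z (t x) * z ^ N = h z"
   using FB x unfolding laurent_in_def by blast
  have 1: "(%z. z ^ N * (1 + z * Zreg z (t x))) hfps fps_X ^ N * (1 + fps_X * G)"
   by (intro fps_expansion_intros G)
  have 2: "(%z. z * h z) hfps fps_X * B x" by (intro fps_expansion_intros h)
  have "\<forall>\<^sub>F z in at 0. z ^ N * (1 + z * Zreg z (t x)) = z * h z"
   using h(2) eventually_good_at_0[OF im] eventually_neq_at_within[of 0]
  proof eventually_elim
   case (elim z)
   have "z * h z = (z * Zf z (t x)) * z ^ N" using elim(1) by simp
   also have "z * Zf z (t x) = 1 + z * Zreg z (t x)"
    unfolding Zf_eq_Zreg[OF elim(2)] using elim(3) by (simp add: ring_distribs)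
   finally show ?case by simp
  qed
  from fps_expansion_unique_at[OF 1 2 this]
  have "fps_nth (fps_X ^ N * (1 + fps_X * G)) (N + Suc m) = fps_nth (fps_X * B x) (N + Suc m)" by simp
  hence "fps_nth (B x) (N + m) = fps_nth G m" by (simp add: fps_X_power_mult_nth)
  also have "... = (deriv ^^ m) (%z. Zreg z (t x)) 0 / fact m" using fps_nth_fps_expansion[OF G] .
  finally show "(deriv ^^ m) (%z. Zreg z (t x)) 0 = fact m * fps_nth (B x) (N + m)" by simp
 qed
qed

lemma laurent_inverse_arg: "(%z x. 1 / z) : laurent"
proof (rule laurentI[of 1 "%x. 1"])
 have "(%x. fps_nth 1 k) : R" for k by (cases k) auto
 moreover have "\<forall>\<^sub>F z in at 0. 1 / z * z ^ 1 = (1::complex)"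
  using eventually_neq_at_within[of 0] by eventually_elim simp
 ultimately show "laurent_in 1 (%x. 1) (%z x. 1 / z)"
  unfolding laurent_in_def using has_fps_expansion_1 by blast
qed

lemma laurent_Zf:
 assumes "!!x. x : D ==> Im (t x) > 0" "!!m. (%x. (deriv ^^ m) (%z. Zreg z (t x)) 0) : R"
 shows "(%z x. Zf z (t x)) : laurent"
proof (rule laurent_cong)
 have "(%z x. Zreg z (t x)) : laurent"
  by (rule laurent_taylor[OF Zreg_analytic assms(2)]) (use assms(1) in auto)
 thus "(%z x. 1 / z + Zreg z (t x)) : laurent" by (intro laurent_add laurent_inverse_arg)
 show "\<forall>\<^sub>F z in at 0. Zf z (t x) = 1 / z + Zreg z (t x)" if "x : D" for x
  using eventually_good_at_0[OF assms(1)[OF that]] by eventually_elim (rule Zf_eq_Zreg)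
qed

lemma laurent_Zf_shift:
 assumes "!!x. x : D ==> gpt (a x) (t x)" "!!m. (%x. dz m Zf (a x) (t x)) : R"
 shows "(%z x. Zf (z + a x) (t x)) : laurent"
proof (rule laurent_taylor)
 show "(%z. Zf (z + a x) (t x)) analytic_on {0}" if "x : D" for x
  by (rule higher_deriv_shift(2)[OF Zf_analytic[OF assms(1)[OF that]]])
 show "(%x. (deriv ^^ k) (%z. Zf (z + a x) (t x)) 0) : R" for k
  by (rule cong[OF assms(2)[of k]]) (simp add: higher_deriv_shift(1)[OF Zf_analytic[OF assms(1)]] dz_def)
qed

end

section \<open>Behaviour at the cusp and under the modular group\<close>

lemma Zf_bounded_at_cusp:
 assumes K: "compact K" "K \<inter> \<int> = {}"
 obtains B T where "T >= 1" "!!w tau. w : K ==> Im tau > T ==> gpt w tau & norm (Zf w tau) <= B"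
proof (cases "K = {}")
 case True
 thus ?thesis using that[of 1 0] by auto
next
 case False
 obtain R where R: "!!w. w : K ==> norm w <= R" using compact_imp_bounded[OF K(1)] by (auto simp: bounded_iff)
 have R0: "R >= 0" using False R norm_ge_zero order.trans by blast
 have "continuous_on K (%w. norm (2 * sin (of_real pi * w)))" by (intro continuous_intros)
 from continuous_attains_inf[OF K(1) False this] obtain w0 where w0: "w0 : K"
  "!!w. w : K ==> norm (2 * sin (of_real pi * w0)) <= norm (2 * sin (of_real pi * w))" by blast
 define de where "de = norm (2 * sin (of_real pi * w0))"
 have "sin (of_real pi * w0) ~= 0"
 proof
  assume "sin (of_real pi * w0) = 0"
  then obtain n :: int where "of_real pi * w0 = of_real (of_int n * pi)" unfolding sin_eq_0 by auto
  hence "w0 = of_int n" by simp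
  thus False using K(2) w0(1) by auto
 qed
 hence de: "de > 0" by (simp add: de_def)
 have "bounded ((%w::complex. 2 * sin (of_real pi * w)) ` cball 0 (R + 1))"
  by (intro compact_imp_bounded compact_continuous_image continuous_intros) auto
 then obtain S where "\<forall>x\<in>(%w::complex. 2 * sin (of_real pi * w)) ` cball 0 (R + 1). norm x <= S"
  unfolding bounded_iff by blast
 hence S: "!!w. norm w <= R + 1 ==> norm (2 * sin (complex_of_real pi * w)) <= S" by auto
 define C where "C = exp (pi / 4) * suminf (theta_bound 0 (R + 1) 1)"
 have "suminf (theta_bound 0 (R + 1) 1) >= 0" by (intro suminf_nonneg summable_theta_bound) (auto simp: theta_bound_def)
 hence C: "C >= 0" by (simp add: C_def)
 \<comment> \<open>Above this height the error \<open>C exp (- 2 pi (Im tau - 1))\<close> is at most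
   half of the minimum \<open>de\<close> of the norm of \<open>2 sin (pi w)\<close> on K, so theta
   stays away from 0 there. Its z-derivative is then bounded by a Cauchy estimate on unit discs,
   which is why \<open>R + 1\<close> occurs as the radius.\<close>
 define T where "T = 1 + 2 * C / de"
 define E where "E tau w = theta 0 w tau * exp (- (of_real pi * \<i> * tau / 4))" for tau w
 have err: "norm (E tau w - 2 * sin (of_real pi * w)) <= de / 2" if "norm w <= R + 1" "Im tau > T" for tau w
 proof -
  have "2 * C / de >= 0" using C de by simp
  hence t1: "Im tau >= 1" using that by (simp add: T_def)
  have "norm (E tau w - 2 * sin (of_real pi * w)) <= C * exp (- 2 * pi * (Im tau - 1))"
   using theta_asymptotic[OF that(1) t1] by (simp add: E_def C_def)
  also have "... <= de / 2"
  proof -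
   have "2 * C <= de * (Im tau - 1)" using that(2) de by (simp add: T_def field_simps)
   also have "... <= de * exp (2 * pi * (Im tau - 1))"
   proof (rule mult_left_mono)
    have "Im tau - 1 <= 2 * pi * (Im tau - 1)" using mult_right_mono[of 1 "2 * pi" "Im tau - 1"] t1 pi_ge_two by simp
    also have "... <= exp (2 * pi * (Im tau - 1))" using exp_ge_add_one_self[of "2 * pi * (Im tau - 1)"] by linarith
    finally show "Im tau - 1 <= exp (2 * pi * (Im tau - 1))" .
   qed (use de in simp)
   finally have "2 * C <= de * exp (2 * pi * (Im tau - 1))" .
   moreover define e where "e = exp (2 * pi * (Im tau - 1))"
   ultimately have ce: "2 * C <= de * e" by simp
   have e0: "e > 0" by (simp add: e_def)
   have "C * (1 / e) <= de / 2" using ce e0 by (simp add: field_simps)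
   moreover have "exp (- 2 * pi * (Im tau - 1)) = 1 / e"
    unfolding e_def using exp_minus[of "2 * pi * (Im tau - 1)"] by (simp add: inverse_eq_divide)
   ultimately show ?thesis by simp
  qed
  finally show ?thesis .
 qed
 define M where "M = S + de / 2"
 have "gpt w tau & norm (Zf w tau) <= 2 * M / de" if w: "w : K" and t: "Im tau > T" for w tau
 proof -
  have "2 * C / de >= 0" using C de by simp
  hence t0: "Im tau > 0" using t by (simp add: T_def)
  have low: "norm (E tau w) >= de / 2"
  proof -
   have "de <= norm (2 * sin (of_real pi * w))" using w0(2)[OF w] by (simp add: de_def)
   moreover have "norm (E tau w - 2 * sin (of_real pi * w)) <= de / 2" using R[OF w] by (intro err t) auto
   ultimately show ?thesis using norm_triangle_ineq2[of "2 * sin (of_real pi * w)" "E tau w"] by (simp add: norm_minus_commute)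
  qed
  hence nz: "E tau w ~= 0" using de by auto
  hence g: "gpt w tau" using t0 by (auto simp: E_def gpt_theta)
  have dE: "(E tau hfd theta 1 v tau * exp (- (of_real pi * \<i> * tau / 4))) (at v)" for v
   unfolding E_def using theta_deriv_z[OF t0, of 0 v] by (auto intro!: derivative_eq_intros)
  have hE: "E tau holo A" for A unfolding E_def by (intro holomorphic_intros t0)
  have "norm ((deriv ^^ 1) (E tau) w) <= fact 1 * M / 1 ^ 1"
  proof (rule Cauchy_inequality)
   fix v assume "norm (w - v) = 1"
   hence nv: "norm v <= R + 1" using R[OF w] norm_triangle_ineq4[of w "w - v"] by simp
   thus "norm (E tau v) <= M"
    using err[OF nv t] S[OF nv] norm_triangle_sub[of "E tau v" "2 * sin (of_real pi * v)"] by (simp add: M_def)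
  qed (auto intro!: hE holomorphic_on_imp_continuous_on)
  hence nM: "norm (theta 1 w tau * exp (- (of_real pi * \<i> * tau / 4))) <= M"
   using DERIV_imp_deriv[OF dE[of w]] by simp
  moreover have "Zf w tau = (theta 1 w tau * exp (- (of_real pi * \<i> * tau / 4))) / E tau w"
   by (simp add: Zf_def theta_ratio_def E_def)
  ultimately have "norm (Zf w tau) <= M / (de / 2)"
   unfolding norm_divide using low de nM order_trans[OF norm_ge_zero nM] by (simp only: norm_divide) (intro frac_le, auto)
  thus ?thesis using g by (simp add: mult.commute)
 qed
 thus ?thesis using that[of T "2 * M / de"] C de by (simp add: T_def)
qed

lemma Ints_shrink:
 fixes z :: complex
 assumes "z ~: \<int>" obtains r where "r > 0" "cball z r \<inter> \<int> = {}"
proof -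
 have "open (- (\<int> :: complex set))" by (simp add: open_Compl)
 then obtain r where "r > 0" "cball z r \<subseteq> - \<int>" using assms by (meson ComplI open_contains_cball)
 thus ?thesis using that by blast
qed

text \<open>Cauchy estimates on a disc around z without integers, the zeros of the limit function
  \<open>2 sin (pi z)\<close>.\<close>

lemma dz_Zf_bounded_at_cusp:
 assumes "z ~: \<int>"
 obtains B T where "!!tau. Im tau > T ==> norm (dz k Zf z tau) <= B"
proof -
 obtain r where r: "r > 0" "cball z r \<inter> \<int> = {}" using Ints_shrink[OF assms] .
 obtain B T where BT: "T >= 1" "!!w tau. w : cball z r ==> Im tau > T ==> gpt w tau & norm (Zf w tau) <= B"
  by (rule Zf_bounded_at_cusp[OF compact_cball r(2)]) blast
 have "norm (dz k Zf z tau) <= fact k * B / r ^ k" if t: "Im tau > T" for tau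
  unfolding dz_def
 proof (rule Cauchy_inequality[OF _ _ r(1)])
  have "Im tau > 0" using t BT(1) by linarith
  hence h: "(%w. Zf w tau) holo cball z r"
   by (rule holomorphic_on_subset[OF Zf_holomorphic]) (use BT(2)[OF _ t] in \<open>auto simp: gpt_def\<close>)
  thus "(%w. Zf w tau) holo ball z r" by (rule holomorphic_on_subset) auto
  show "continuous_on (cball z r) (%w. Zf w tau)" using h by (rule holomorphic_on_imp_continuous_on)
  show "norm (Zf x tau) <= B" if "norm (z - x) = r" for x
   using BT(2)[OF _ t, of x] that by (auto simp: dist_norm)
 qed
 thus ?thesis using that by blast
qed

text \<open>Cauchy estimates on the circle of radius 1/2. For \<open>Im tau > 1\<close> the closed
  disc contains no nonzero lattice point, and on the circle \<open>Zreg\<close> is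
  \<open>Z - 1/z\<close> with \<open>norm (1/z) = 2\<close>.\<close>

lemma Zreg_coeff_bounded_at_cusp:
 obtains B T where "!!tau. Im tau > T ==> norm ((deriv ^^ m) (%z. Zreg z tau) 0) <= B"
proof -
 have "sphere 0 (1/2) \<inter> (\<int> :: complex set) = {}"
 proof -
  have False if "norm (w :: complex) = 1/2" "w : \<int>" for w
  proof -
   obtain n :: int where "w = of_int n" using \<open>w : \<int>\<close> by (auto elim: Ints_cases)
   hence "\<bar>real_of_int n\<bar> = 1/2" using that(1) by (simp only: norm_of_int)
   hence "\<bar>real_of_int n\<bar> < 1" by simp
   hence "n = 0" by linarith
   thus False using \<open>\<bar>real_of_int n\<bar> = 1/2\<close> by simp
  qed
  thus ?thesis by auto
 qed
 then obtain B T where BT: "T >= 1" "!!w tau. w : sphere 0 (1/2) ==> Im tau > T ==> gpt w tau & norm (Zf w tau) <= B"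
  by (rule Zf_bounded_at_cusp[OF compact_sphere]) blast
 have "norm ((deriv ^^ m) (%z. Zreg z tau) 0) <= fact m * (B + 2) / (1/2) ^ m" if t: "Im tau > T" for tau
 proof (rule Cauchy_inequality)
  have t1: "Im tau > 1" using t BT(1) by linarith
  have "w ~: poles tau" if w: "norm w <= 1/2" for w
  proof
   assume "w : poles tau"
   then obtain a b :: int where ab: "w = of_int a + of_int b * tau" "w ~= 0" by (auto simp: poles_def lattice_def)
   have "\<bar>real_of_int b\<bar> * Im tau <= 1/2" using abs_Im_le_cmod[of w] w t1 by (simp add: ab abs_mult)
   moreover have "\<bar>real_of_int b\<bar> * 1 <= \<bar>real_of_int b\<bar> * Im tau" using t1 by (intro mult_left_mono) auto
   ultimately have "b = 0" by linarith
   hence "\<bar>real_of_int a\<bar> <= 1/2" using w ab by simp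
   hence "a = 0" by linarith
   thus False using ab \<open>b = 0\<close> by simp
  qed
  hence h: "(%w. Zreg w tau) holo cball 0 (1/2)"
   using t1 by (intro holomorphic_on_subset[OF Zreg_holomorphic]) auto
  thus "(%w. Zreg w tau) holo ball 0 (1/2)" by (rule holomorphic_on_subset) auto
  show "continuous_on (cball 0 (1/2)) (%w. Zreg w tau)" using h by (rule holomorphic_on_imp_continuous_on)
  show "norm (Zreg x tau) <= B + 2" if "norm (0 - x) = 1/2" for x
  proof -
   have x: "norm x = 1/2" using that by simp
   hence g: "gpt x tau" "norm (Zf x tau) <= B" using BT(2)[OF _ t, of x] by auto
   have "Zreg x tau = Zf x tau - 1 / x" using Zf_eq_Zreg[OF g(1)] by simp
   thus ?thesis using g(2) norm_triangle_ineq4[of "Zf x tau" "1 / x"] x by (simp add: norm_divide)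
  qed
 qed auto
 thus ?thesis using that by blast
qed

definition mobius :: "int => int => int => int => complex => complex" where
 "mobius a b c d tau = (of_int a * tau + of_int b) / (of_int c * tau + of_int d)"

lemma automorphy_nonzero:
 assumes "Im tau > 0" "a * d - b * c = (1::int)" shows "of_int c * tau + of_int d ~= 0"
proof
 assume "of_int c * tau + of_int d = 0"
 hence "Im (of_int c * tau + of_int d) = 0" "Re (of_int c * tau + of_int d) = 0" by simp_all
 hence "c = 0" "d = 0" using assms by auto
 thus False using assms by simp
qed

lemma Im_mobius:
 assumes t: "Im tau > 0" and D: "a * d - b * c = (1::int)" shows "Im (mobius a b c d tau) > 0"
proof -
 define j where "j = of_int c * tau + of_int d"
 have j: "j ~= 0" unfolding j_def by (rule automorphy_nonzero[OF assms])
 have "Im ((of_int a * tau + of_int b) * cnj j) = of_int (a * d - b * c) * Im tau"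
  by (simp add: j_def algebra_simps)
 hence "Im ((of_int a * tau + of_int b) * cnj j) > 0" unfolding D using t by simp
 moreover have "mobius a b c d tau = (of_int a * tau + of_int b) * cnj j / of_real ((norm j)\<^sup>2)"
  unfolding mobius_def j_def[symmetric] by (rule complex_div_cnj)
 ultimately show ?thesis using j by (simp only: Im_divide_of_real) simp
qed

text \<open>The numbers \<open>a tau + b\<close> and \<open>c tau + d\<close> form another basis of
  the lattice of tau, and division by the second turns it into the standard basis for the
  transformed parameter.\<close>

lemma lattice_mobius:
 assumes t: "Im tau > 0" and D: "a * d - b * c = (1::int)"
 shows "bij_betw (%om. om / (of_int c * tau + of_int d)) (lattice tau) (lattice (mobius a b c d tau))"
proof -
 define j where "j = of_int c * tau + of_int d"
 have j: "j ~= 0" unfolding j_def by (rule automorphy_nonzero[OF assms])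
 have mj: "mobius a b c d tau * j = of_int a * tau + of_int b" using j by (simp add: mobius_def j_def[symmetric])
 have 1: "om / j : lattice (mobius a b c d tau)" if "om : lattice tau" for om
 proof -
  obtain m n where om: "om = of_int m + of_int n * tau" using \<open>om : lattice tau\<close> by (auto simp: lattice_def)
  have "(of_int (m * a - n * b) + of_int (n * d - m * c) * mobius a b c d tau) * j
    = of_int (m * a - n * b) * j + of_int (n * d - m * c) * (of_int a * tau + of_int b)"
   by (simp add: ring_distribs mj mult.assoc)
  also have "... = (of_int m + of_int n * tau) * of_int (a * d - b * c)"
   unfolding j_def by (simp add: algebra_simps)
  finally have "om / j = of_int (m * a - n * b) + of_int (n * d - m * c) * mobius a b c d tau"
   using j D by (simp add: om field_simps)
  thus ?thesis unfolding lattice_def by blast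
 qed
 have 2: "om * j : lattice tau" if "om : lattice (mobius a b c d tau)" for om
 proof -
  obtain m n where om: "om = of_int m + of_int n * mobius a b c d tau" using \<open>om : lattice (mobius a b c d tau)\<close> by (auto simp: lattice_def)
  have "om * j = of_int m * j + of_int n * (of_int a * tau + of_int b)" by (simp add: om ring_distribs mj mult.assoc)
  also have "... = of_int (m * d + n * b) + of_int (m * c + n * a) * tau" unfolding j_def by (simp add: algebra_simps)
  finally show ?thesis unfolding lattice_def by blast
 qed
 show ?thesis unfolding j_def[symmetric]
  by (rule bij_betwI[where g="%om. om * j"]) (use 1 2 j in auto)
qed

lemma gpt_mobius:
 assumes t: "Im tau > 0" and D: "a * d - b * c = (1::int)"
 shows "gpt (z / (of_int c * tau + of_int d)) (mobius a b c d tau) \<longleftrightarrow> gpt z tau"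
proof -
 let ?j = "of_int c * tau + of_int d"
 have j: "?j ~= 0" by (rule automorphy_nonzero[OF assms])
 have "lattice (mobius a b c d tau) = (%om. om / ?j) ` lattice tau"
  using lattice_mobius[OF assms] by (simp add: bij_betw_def)
 thus ?thesis using t Im_mobius[OF assms] j by (auto simp: gpt_def)
qed

lemma wp_reg_mobius:
 assumes t: "Im tau > 0" and D: "a * d - b * c = (1::int)"
 shows "wp_reg (z / (of_int c * tau + of_int d)) (mobius a b c d tau) = (of_int c * tau + of_int d)\<^sup>2 * wp_reg z tau"
proof -
 define j where "j = of_int c * tau + of_int d"
 have j: "j ~= 0" unfolding j_def by (rule automorphy_nonzero[OF assms])
 have bij: "bij_betw (%om. om / j) (lattice tau - {0}) (lattice (mobius a b c d tau) - {0})"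
  by (rule bij_betw_DiffI[OF lattice_mobius[OF assms, folded j_def]]) (auto simp: bij_betw_def)
 have "wp_reg (z / j) (mobius a b c d tau) = (\<Sum>\<^sub>\<infinity>om\<in>lattice tau - {0}. 1 / (z / j - om / j)\<^sup>2 - 1 / (om / j)\<^sup>2)"
  unfolding wp_reg_def by (rule infsum_reindex_bij_betw[OF bij, symmetric])
 also have "... = (\<Sum>\<^sub>\<infinity>om\<in>lattice tau - {0}. j\<^sup>2 * (1 / (z - om)\<^sup>2 - 1 / om\<^sup>2))"
  by (rule infsum_cong) (simp add: diff_divide_distrib[symmetric] power_divide right_diff_distrib)
 also have "... = j\<^sup>2 * wp_reg z tau" unfolding wp_reg_def by (rule infsum_cmult_right')
 finally show ?thesis unfolding j_def .
qed

lemma wp_mobius: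
 assumes t: "Im tau > 0" and D: "a * d - b * c = (1::int)"
 shows "wp (z / (of_int c * tau + of_int d)) (mobius a b c d tau) = (of_int c * tau + of_int d)\<^sup>2 * wp z tau"
 unfolding wp_wzeta_reg wp_reg_mobius[OF assms] by (simp add: power_divide ring_distribs)

text \<open>The k-th derivative of \<open>wp\<close>, written through \<open>Z\<close> so that its
  regularity in both variables and its expansion at 0 are inherited from \<open>Z\<close>. The
  additive constant is lost under differentiation and thus present only for
  \<open>k = 0\<close>.\<close>

definition wp_deriv :: "nat => complex => complex => complex" where
 "wp_deriv k z tau = (if k = 0 then theta_const tau / 3 else 0) - dz (Suc k) Zf z tau"

lemma wp_holomorphic: "Im tau > 0 ==> (%z. wp z tau) holo - lattice tau"
proof -
 assume t: "Im tau > 0"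
 have "(%z. theta_const tau / 3 - dz 1 Zf z tau) holo - lattice tau"
  unfolding dz_def using Zf_holomorphic[OF t] closed_lattice[OF t] by (auto intro!: holomorphic_intros holomorphic_deriv)
 thus ?thesis by (rule holomorphic_transform) (use t in \<open>auto simp: wp_eq_dz1_Zf gpt_def\<close>)
qed

lemma wp_deriv_eq:
 assumes g: "gpt z tau" shows "wp_deriv k z tau = (deriv ^^ k) (%w. wp w tau) z"
proof -
 have "(deriv ^^ k) (%w. wp w tau) z = (deriv ^^ k) (%w. theta_const tau / 3 - dz 1 Zf w tau) z"
  using eventually_good_z[OF g] by (intro higher_deriv_cong_ev) (auto elim!: eventually_mono simp: wp_eq_dz1_Zf)
 also have "... = (deriv ^^ k) (%w. theta_const tau / 3) z - (deriv ^^ k) (%w. dz 1 Zf w tau) z"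
 proof (rule higher_deriv_diff[where S="- lattice tau"])
  have t: "Im tau > 0" using g by (simp add: gpt_def)
  show "(%w. dz 1 Zf w tau) holo - lattice tau"
   unfolding dz_def using Zf_holomorphic[OF t] closed_lattice[OF t] by (auto intro!: holomorphic_deriv)
 qed (use g closed_lattice in \<open>auto simp: gpt_def\<close>)
 also have "(deriv ^^ k) (%w. dz 1 Zf w tau) z = dz (Suc k) Zf z tau"
  by (simp add: dz_def funpow_swap1 flip: funpow.simps(2)) (simp add: funpow_Suc_right del: funpow.simps)
 finally show ?thesis by (simp add: wp_deriv_def higher_deriv_const)
qed

lemma power_scale: "j ~= 0 ==> A = (1 / j) ^ k * B \<longleftrightarrow> B = j ^ k * (A :: complex)"
 by (auto simp: power_divide)

lemma wp_deriv_mobius: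
 assumes g: "gpt z tau" and D: "a * d - b * c = (1::int)"
 shows "wp_deriv k (z / (of_int c * tau + of_int d)) (mobius a b c d tau) = (of_int c * tau + of_int d) ^ (k + 2) * wp_deriv k z tau"
proof -
 have t: "Im tau > 0" using g by (simp add: gpt_def)
 define j where "j = of_int c * tau + of_int d"
 have j: "j ~= 0" unfolding j_def by (rule automorphy_nonzero[OF t D])
 let ?tau' = "mobius a b c d tau"
 note t' = Im_mobius[OF t D]
 have gj: "gpt (w / j) ?tau' \<longleftrightarrow> gpt w tau" for w unfolding j_def by (rule gpt_mobius[OF t D])
 have "(deriv ^^ k) (%w. wp (1 / j * w) ?tau') z = (1 / j) ^ k * (deriv ^^ k) (%w. wp w ?tau') (1 / j * z)"
 proof (rule higher_deriv_compose_linear[OF wp_holomorphic[OF t']])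
  show "open (- lattice tau)" "open (- lattice ?tau')" using closed_lattice t t' by auto
  show "1 / j * w : - lattice ?tau'" if "w : - lattice tau" for w
   using gj[of w] that t t' by (simp add: gpt_def)
 qed (use g in \<open>auto simp: gpt_def\<close>)
 moreover have "(%w. wp (1 / j * w) ?tau') = (%w. j\<^sup>2 * wp w tau)"
  using wp_mobius[OF t D] by (simp add: j_def)
 moreover have "(deriv ^^ k) (%w. j\<^sup>2 * wp w tau) z = j\<^sup>2 * (deriv ^^ k) (%w. wp w tau) z"
  by (rule higher_deriv_cmult[OF wp_holomorphic[OF t]]) (use g closed_lattice[OF t] in \<open>auto simp: gpt_def\<close>)
 ultimately have "j\<^sup>2 * (deriv ^^ k) (%w. wp w tau) z = (1 / j) ^ k * (deriv ^^ k) (%w. wp w ?tau') (z / j)"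
  by simp
 hence "(deriv ^^ k) (%w. wp w ?tau') (z / j) = j ^ (k + 2) * (deriv ^^ k) (%w. wp w tau) z"
  unfolding power_scale[OF j] power_add by (simp only: mult_ac)
 thus ?thesis using wp_deriv_eq[OF g] wp_deriv_eq[of "z / j" ?tau'] gj[of z] g unfolding j_def by simp
qed

lemma Zreg_coeff_wp_reg:
 assumes t: "Im tau > 0"
 shows "(deriv ^^ Suc (Suc m)) (%z. Zreg z tau) 0 = - (deriv ^^ Suc m) (%z. wp_reg z tau) 0"
  "(%z. wp_reg z tau) holo - poles tau"
proof -
 have h: "(%z. wp_reg z tau) holo - poles tau"
  using wp_reg_deriv[OF t] open_regular[OF t] by (auto simp: holomorphic_on_open poles_def)
 thus "(%z. wp_reg z tau) holo - poles tau" .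
 have "\<forall>\<^sub>F z in nhds 0. z : - poles tau" using open_regular[OF t] by (intro eventually_nhds_in_open) auto
 hence "\<forall>\<^sub>F z in nhds 0. deriv (%z. Zreg z tau) z = theta_const tau / 3 - wp_reg z tau"
  by eventually_elim (simp add: Zreg_eq_wzeta_reg(2)[OF t])
 hence "(deriv ^^ Suc m) (deriv (%z. Zreg z tau)) 0 = (deriv ^^ Suc m) (%z. theta_const tau / 3 - wp_reg z tau) 0"
  by (rule higher_deriv_cong_ev) simp
 also have "... = (deriv ^^ Suc m) (%w. theta_const tau / 3) 0 - (deriv ^^ Suc m) (%z. wp_reg z tau) 0"
  by (rule higher_deriv_diff[where S="- poles tau"]) (use h open_regular[OF t] in auto)
 also have "(deriv ^^ Suc m) (%w. theta_const tau / 3) 0 = 0" by (simp only: higher_deriv_const) simp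
 finally show "(deriv ^^ Suc (Suc m)) (%z. Zreg z tau) 0 = - (deriv ^^ Suc m) (%z. wp_reg z tau) 0"
  by (simp only: funpow_Suc_right o_def) simp
qed

text \<open>For \<open>m >= 2\<close> the coefficient is, up to sign, a derivative of
  \<open>wp_reg\<close> at 0, an Eisenstein series of weight \<open>m + 1\<close>. For
  \<open>m = 1\<close> it is the quasi-modular \<open>theta_const / 3\<close>, a multiple of
  \<open>g1\<close>, which is why \<open>g1\<close> is adjoined as a generator of its own.\<close>

lemma Zreg_coeff_mobius:
 assumes t: "Im tau > 0" and D: "a * d - b * c = (1::int)" and m: "m >= 2"
 shows "(deriv ^^ m) (%z. Zreg z (mobius a b c d tau)) 0 = (of_int c * tau + of_int d) ^ (m + 1) * (deriv ^^ m) (%z. Zreg z tau) 0"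
proof -
 obtain k where k: "m = Suc (Suc k)" using m by (metis add_2_eq_Suc le_Suc_ex)
 define j where "j = of_int c * tau + of_int d"
 have j: "j ~= 0" unfolding j_def by (rule automorphy_nonzero[OF t D])
 let ?tau' = "mobius a b c d tau"
 note t' = Im_mobius[OF t D]
 have "lattice ?tau' = (%om. om / j) ` lattice tau"
  using lattice_mobius[OF t D] by (simp add: bij_betw_def j_def)
 hence pj: "w / j : poles ?tau' \<longleftrightarrow> w : poles tau" for w using j by (auto simp: poles_def)
 have "(deriv ^^ Suc k) (%w. wp_reg (1 / j * w) ?tau') 0 = (1 / j) ^ Suc k * (deriv ^^ Suc k) (%w. wp_reg w ?tau') (1 / j * 0)"
 proof (rule higher_deriv_compose_linear[OF Zreg_coeff_wp_reg(2)[OF t']])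
  show "open (- poles tau)" "open (- poles ?tau')" using open_regular t t' by auto
  show "1 / j * w : - poles ?tau'" if "w : - poles tau" for w using pj[of w] that by simp
 qed auto
 moreover have "(%w. wp_reg (1 / j * w) ?tau') = (%w. j\<^sup>2 * wp_reg w tau)"
  using wp_reg_mobius[OF t D] by (simp add: j_def)
 moreover have "(deriv ^^ Suc k) (%w. j\<^sup>2 * wp_reg w tau) 0 = j\<^sup>2 * (deriv ^^ Suc k) (%w. wp_reg w tau) 0"
  by (rule higher_deriv_cmult[OF Zreg_coeff_wp_reg(2)[OF t]]) (use open_regular[OF t] in auto)
 ultimately have "j\<^sup>2 * (deriv ^^ Suc k) (%w. wp_reg w tau) 0 = (1 / j) ^ Suc k * (deriv ^^ Suc k) (%w. wp_reg w ?tau') 0"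
  by (simp only: mult_zero_right)
 hence "(deriv ^^ Suc k) (%w. wp_reg w ?tau') 0 = j ^ (m + 1) * (deriv ^^ Suc k) (%w. wp_reg w tau) 0"
  unfolding power_scale[OF j] k by (simp add: power2_eq_square mult_ac del: funpow.simps)
 thus ?thesis unfolding k Zreg_coeff_wp_reg(1)[OF t] Zreg_coeff_wp_reg(1)[OF t'] by (simp add: k j_def del: funpow.simps)
qed

text \<open>Taken as a ring of coefficients, it makes the holomorphy in tau of all Laurent
  coefficients of \<open>Z\<close> an instance of \<open>laurent_Zf_coeffs\<close>.\<close>

definition tau_ring :: "(complex => complex) set" where
 "tau_ring = {f. \<forall>tau. Im tau > 0 --> f field_differentiable at tau}"

lemma tau_ring: "function_ring {tau. Im tau > 0} tau_ring"
proof
 fix f g :: "complex => complex" assume f: "f : tau_ring" and fg: "!!x. x : {tau. Im tau > 0} ==> g x = f x"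
 show "g : tau_ring"
  unfolding tau_ring_def
 proof (intro CollectI allI impI)
  fix tau :: complex assume t: "Im tau > 0"
  have "\<forall>\<^sub>F x in nhds tau. g x = f x"
   using eventually_nhds_in_open[OF open_upper_half, of tau] t fg by (auto elim!: eventually_mono)
  moreover have "f field_differentiable at tau" using f t by (simp add: tau_ring_def)
  ultimately show "g field_differentiable at tau" unfolding field_differentiable_def using DERIV_cong_ev[of tau tau g f] by blast
 qed
qed (auto simp: tau_ring_def intro: field_differentiable_add field_differentiable_mult)

lemma theta_tau_ring: "(%tau. theta k z tau) : tau_ring"
 unfolding tau_ring_def field_differentiable_def using theta_deriv_tau by blast

lemma theta_const_differentiable: "Im tau > 0 ==> theta_const field_differentiable at tau"
proof -
 assume t: "Im tau > 0"
 have "(%tau. theta_const tau) field_differentiable at tau"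
  unfolding theta_const_def using theta_tau_ring t theta_eq_sin_prod(2)[OF t]
  by (intro field_differentiable_divide) (auto simp: tau_ring_def)
 thus ?thesis by simp
qed

lemma laurent_Zf_tau: "(%z tau. Zf z tau) : function_ring.laurent {tau. Im tau > 0} tau_ring"
proof -
 have "(%tau. 1 / theta 1 0 tau) : tau_ring"
  using theta_tau_ring[of 1 0] theta_eq_sin_prod(2) unfolding tau_ring_def by (auto intro!: field_differentiable_divide)
 thus ?thesis
  using function_ring.laurent_Zf_theta[OF tau_ring, of "%tau. tau"] theta_tau_ring by simp
qed

lemma Zreg_coeff_differentiable:
 "Im tau > 0 ==> (%tau. (deriv ^^ m) (%z. Zreg z tau) 0) field_differentiable at tau"
 using function_ring.laurent_Zf_coeffs[OF tau_ring, of "%tau. tau" m] laurent_Zf_tau by (simp add: tau_ring_def)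

lemma wp_deriv_differentiable_tau:
 assumes g: "gpt z tau" shows "(%tau. wp_deriv k z tau) field_differentiable at tau"
proof -
 have t: "Im tau > 0" using g by (simp add: gpt_def)
 note theta_const_differentiable[OF t]
 moreover have "(%tau. dz (Suc k) Zf z tau) field_differentiable at tau"
  using dz_Zf_deriv_tau[OF g] field_differentiable_def by blast
 ultimately show ?thesis unfolding wp_deriv_def
  by (cases k) (auto intro!: field_differentiable_diff field_differentiable_minus field_differentiable_divide)
qed

text \<open>The order of a Jacobi form is one number for all tau, so a pole bound uniform in tau is
  required; membership in the Laurent families over \<open>tau_ring\<close> provides it.\<close>

lemma wp_deriv_pole:
 obtains l where "!!tau. Im tau > 0 ==> \<exists>h. h analytic_on {0} & (\<forall>\<^sub>F z in at 0. wp_deriv k z tau * z ^ l = h z)"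
proof -
 interpret T: function_ring "{tau. Im tau > 0}" tau_ring by (rule tau_ring)
 have "(%tau. if k = 0 then theta_const tau / 3 else 0) : tau_ring"
  using theta_const_differentiable
  by (cases "k = 0") (auto simp: tau_ring_def intro!: field_differentiable_divide)
 hence "(%z tau. wp_deriv k z tau) : T.laurent"
  unfolding wp_deriv_def dz_def by (intro T.laurent_diff T.laurent_const T.laurent_higher_deriv laurent_Zf_tau)
 then obtain N B where NB: "T.laurent_in N B (%z tau. wp_deriv k z tau)" by (rule T.laurentE)
 have "\<exists>h. h analytic_on {0} & (\<forall>\<^sub>F z in at 0. wp_deriv k z tau * z ^ N = h z)" if "Im tau > 0" for tau
  using NB that has_fps_expansion_imp_analytic_0 unfolding T.laurent_in_def by blast
 thus ?thesis using that by blast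
qed

section \<open>Jacobi forms of index 0 and the rings they generate\<close>

abbreviation tm :: "('n::finite) point => complex" where "tm x == x $ Ctau"

lemma zorder_ge_quotient:
 assumes h: "h analytic_on {z}" and ev: "\<forall>\<^sub>F y in at z. f y * (y - z) ^ l = h y"
 shows "f meromorphic_on {z}" "\<exists>\<^sub>F y in at z. f y ~= 0 ==> zorder f z >= - int l"
proof -
 have ne: "\<forall>\<^sub>F y in at z. y - z ~= 0" by (simp add: eventually_at_filter)
 have ev': "\<forall>\<^sub>F y in at z. f y = h y / (y - z) ^ l"
  using ev ne by eventually_elim (simp add: field_simps)
 have hm: "h meromorphic_on {z}" using h by (rule analytic_on_imp_meromorphic_on)
 have lm: "(%y. y - z) meromorphic_on {z}" by (intro meromorphic_intros)
 have pm: "(%y. (y - z) ^ l) meromorphic_on {z}" by (intro meromorphic_intros)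
 have "(%y. h y / (y - z) ^ l) meromorphic_on {z}" by (intro meromorphic_intros hm)
 thus "f meromorphic_on {z}" using meromorphic_on_cong[of "{z}" f "%y. h y / (y - z) ^ l" "{z}"] ev' by simp
 assume fr: "\<exists>\<^sub>F y in at z. f y ~= 0"
 have frh: "\<exists>\<^sub>F y in at z. h y ~= 0"
  by (rule frequently_rev_mp[OF fr], rule eventually_elim2[OF ev ne]) auto
 have frl: "\<exists>\<^sub>F y in at z. y - z ~= 0" using ne by (rule eventually_frequently[rotated]) simp
 have frp: "\<exists>\<^sub>F y in at z. (y - z) ^ l ~= 0"
  by (rule eventually_frequently[OF _ eventually_mono[OF ne]]) auto
 have "zorder f z = zorder (%y. h y / (y - z) ^ l) z" using ev' by (rule zorder_cong) simp
 also have "... = zorder h z - int l * zorder (%y. y - z) z"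
  by (simp add: zorder_divide[OF hm frh pm frp] zorder_power[OF lm frl])
 also have "zorder (%y. y - z) z = 1"
  by (rule zorder_eqI[where S=UNIV and g="%_. 1"]) auto
 finally show "zorder f z >= - int l" using zorder_ge_0[OF h frh] by simp
qed

lemma Vscaled_upd: "Vscaled (upd x c s) = (if c = Cw then of_nat (CARD('n) + 1) * s else Vscaled x)"
 for x :: "('n::finite) point"
 by (simp add: Vscaled_def upd_def)

lemma upd_component: "upd x c s $ c' = (if c' = c then s else x $ c')"
 by (simp add: upd_def)

lemma upd_same [simp]: "upd x c (x $ c) = x"
 by (simp add: vec_eq_iff upd_def)

text \<open>A form of index 0 that depends on \<open>(n + 1) v\<^sub>n\<^sub>+\<^sub>1\<close> and tau only.\<close>

lemma weak_jacobi_form_modular: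
 fixes f :: "complex => complex => complex"
 assumes periodic: "!!z tau om. gpt z tau ==> om : lattice tau ==> f (z + om) tau = f z tau"
  and modular: "!!z tau a b c d. gpt z tau ==> a * d - b * c = 1 ==>
   f (z / (of_int c * tau + of_int d)) (mobius a b c d tau) = (of_int c * tau + of_int d) powi k * f z tau"
  and cusp: "!!z. z ~: \<int> ==> \<exists>B T. \<forall>tau. Im tau > T --> norm (f z tau) <= B"
  and analytic: "!!z tau. gpt z tau ==> (%w. f w tau) analytic_on {z}"
  and pole: "!!tau. Im tau > 0 ==> \<exists>h. h analytic_on {0} & (\<forall>\<^sub>F z in at 0. f z tau * z ^ l = h z)"
  and differentiable: "!!z tau. gpt z tau ==> f z field_differentiable at tau"
 shows "weak_jacobi_form k (int l) 0 (%x :: ('n::finite) point. f (Vscaled x) (tm x))"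
proof -
 let ?\<phi> = "%x :: 'n point. f (Vscaled x) (tm x)"
 let ?N = "of_nat (CARD('n) + 1) :: complex"
 have reg: "gpt (Vscaled x) (tm x)" if "x : Omega_reg" for x :: "'n point"
  using that by (simp add: Omega_reg_def Omega_def gpt_def)
 have 1: "?\<phi> (perm_act w x) = ?\<phi> x" if "w permutes (UNIV - {Vlast})" for x w
 proof -
  have "w Vlast = Vlast" using that by (auto simp: permutes_def)
  thus ?thesis by (simp add: perm_act_def mk_point_def Vscaled_def vpart_def)
 qed
 have 2: "?\<phi> (lat_act p q x) = ?\<phi> x" if "x : Omega_reg" "p : Lat" "q : Lat" for x p q
 proof -
  obtain a b :: int where "p $ Vlast = of_int a" "q $ Vlast = of_int b"
   using \<open>p : Lat\<close> \<open>q : Lat\<close> unfolding Lat_def mem_Collect_eq by (metis Ints_cases)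
  hence "Vscaled (lat_act p q x) = Vscaled x + (of_int (int (CARD('n) + 1) * b) + of_int (int (CARD('n) + 1) * a) * x $ Ctau)"
   by (simp add: Vscaled_def lat_act_def mk_point_def vpart_def algebra_simps)
  moreover have "lat_act p q x $ Ctau = x $ Ctau" by (simp add: lat_act_def mk_point_def)
  moreover have "of_int (int (CARD('n) + 1) * b) + of_int (int (CARD('n) + 1) * a) * x $ Ctau : lattice (tm x)"
   unfolding lattice_def by blast
  ultimately show ?thesis using periodic[OF reg[OF that(1)]] by simp
 qed
 have 3: "?\<phi> (sl2_act a b c d x) = (of_int c * x $ Ctau + of_int d) powi k * ?\<phi> x" if "x : Omega_reg" "a * d - b * c = 1" for x a b c d
 proof -
  have "Vscaled (sl2_act a b c d x) = Vscaled x / (of_int c * x $ Ctau + of_int d)"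
   "sl2_act a b c d x $ Ctau = mobius a b c d (tm x)"
   by (simp_all add: Vscaled_def sl2_act_def Let_def mk_point_def vpart_def mobius_def)
  thus ?thesis using modular[OF reg[OF that(1)] that(2)] by simp
 qed
 have 4: "(%z. ?\<phi> (upd x c z)) field_differentiable at (x $ c) & (c = Cu --> partial c ?\<phi> x = 0)"
  if "c ~= Ctau" "c ~= Cw" for x c
  using that by (simp add: Vscaled_upd upd_component partial_def)
 have 5: "\<exists>\<epsilon>>0. \<exists>B T. \<forall>x\<in>Omega_reg. x $ Cu = x0 $ Cu & x $ Cw = x0 $ Cw & (\<forall>i. dist (x $ Cv i) (x0 $ Cv i) < \<epsilon>)
     & Im (tm x) > T --> norm (?\<phi> x) <= B" for x0 :: "'n point"
 \<comment> \<open>An integer is a lattice point for every tau, so in the first case no point of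
   \<open>Omega_reg\<close> has this value of \<open>v\<^sub>n\<^sub>+\<^sub>1\<close> and the bound
   is vacuous.\<close>
 proof (cases "Vscaled x0 : \<int>")
  case True
  have "Vscaled x0 : lattice (tm x)" for x :: "'n point"
  proof -
   obtain m where "Vscaled x0 = of_int m" using True by (auto elim: Ints_cases)
   hence "Vscaled x0 = of_int m + of_int 0 * x $ Ctau" by simp
   thus ?thesis unfolding lattice_def by blast
  qed
  hence "\<not> (x : Omega_reg & x $ Cw = x0 $ Cw)" for x :: "'n point"
   unfolding Omega_reg_def Vscaled_def by auto
  thus ?thesis by (intro exI[of _ "1::real"]) auto
 next
  case False
  then obtain B T where "\<forall>tau. Im tau > T --> norm (f (Vscaled x0) tau) <= B" using cusp by blast
  hence "\<forall>x\<in>Omega_reg. x $ Cu = x0 $ Cu & x $ Cw = x0 $ Cw & (\<forall>i. dist (x $ Cv i) (x0 $ Cv i) < 1)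
     & Im (tm x) > T --> norm (?\<phi> x) <= B" by (auto simp: Vscaled_def)
  thus ?thesis using zero_less_one by blast
 qed
 have 6: "let f = (%z. ?\<phi> (upd x Cw z)) in f meromorphic_on UNIV
    & (\<forall>z. if Vscaled (upd x Cw z) : lattice (tm x)
       then (\<exists>\<^sub>F y in at z. f y ~= 0) --> zorder f z >= - (int l + 2 * 0)
       else f analytic_on {z})" if "x : Omega" for x :: "'n point"
 proof -
  define tau where "tau = x $ Ctau"
  have t: "Im tau > 0" using that by (simp add: Omega_def tau_def)
  define F where "F z = f (?N * z) tau" for z
  have F: "(%z. ?\<phi> (upd x Cw z)) = F" by (auto simp: F_def Vscaled_upd upd_component tau_def)
  have an: "F analytic_on {z}" if "?N * z ~: lattice tau" for z
  proof -
   have "gpt (?N * z) tau" using t that by (simp add: gpt_def)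
   from analytic[OF this] have "(%w. f w tau) analytic_on (%z. ?N * z) ` {z}" by simp
   hence "((%w. f w tau) \<circ> (%z. ?N * z)) analytic_on {z}"
    by (intro analytic_on_compose analytic_intros)
   thus ?thesis unfolding F_def[abs_def] o_def .
  qed
  \<comment> \<open>By periodicity every pole is a translate of the one at 0, rescaled by the factor
    n + 1 between \<open>v\<^sub>n\<^sub>+\<^sub>1\<close> and \<open>Vscaled\<close>.\<close>
  have po: "\<exists>h. h analytic_on {z} & (\<forall>\<^sub>F y in at z. F y * (y - z) ^ l = h y)" if z: "?N * z : lattice tau" for z
  proof -
   obtain h where h: "h analytic_on {0}" "\<forall>\<^sub>F z in at 0. f z tau * z ^ l = h z" using pole[OF t] by blast
   define g where "g y = h (?N * (y - z)) / ?N ^ l" for y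
   have N: "?N ~= 0" by (metis of_nat_neq_0 Suc_eq_plus1)
   have "h \<circ> (%y. ?N * (y - z)) analytic_on {z}"
    by (intro analytic_on_compose analytic_intros) (use h in simp)
   hence "g analytic_on {z}" using N unfolding g_def[abs_def] o_def by (intro analytic_intros) auto
   moreover have "\<forall>\<^sub>F y in at z. F y * (y - z) ^ l = g y"
   proof -
    have lim: "filterlim (%y. ?N * (y - z)) (at 0) (at z)"
    proof (rule filterlim_atI)
     show "((%y. ?N * (y - z)) \<longlongrightarrow> 0) (at z)" by (auto intro!: tendsto_eq_intros)
     show "\<forall>\<^sub>F y in at z. ?N * (y - z) ~= 0" using N by (simp add: eventually_at_filter)
    qed
    have "\<forall>\<^sub>F y in at 0. y ~: lattice tau" using eventually_not_lattice[OF t] by simp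
    hence "\<forall>\<^sub>F y in at z. ?N * (y - z) ~: lattice tau" by (rule eventually_compose_filterlim[OF _ lim])
    moreover have "\<forall>\<^sub>F y in at z. f (?N * (y - z)) tau * (?N * (y - z)) ^ l = h (?N * (y - z))"
     by (rule eventually_compose_filterlim[OF h(2) lim])
    ultimately show ?thesis
    proof eventually_elim
     case (elim y)
     have "f (?N * (y - z) + ?N * z) tau = f (?N * (y - z)) tau"
      using elim(1) t z by (intro periodic) (simp_all add: gpt_def)
     moreover have "?N * (y - z) + ?N * z = ?N * y" by (simp only: ring_distribs) simp
     ultimately have "F y = f (?N * (y - z)) tau" by (simp add: F_def)
     hence "F y * (y - z) ^ l * ?N ^ l = h (?N * (y - z))" using elim(2) by (simp only: power_mult_distrib mult_ac)
     thus ?case unfolding g_def using N by (simp only: eq_divide_eq power_eq_0_iff) simp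
    qed
   qed
   ultimately show ?thesis by blast
  qed
  have "F meromorphic_on {z}" for z
   using an[of z] po[of z] zorder_ge_quotient(1) analytic_on_imp_meromorphic_on by (cases "?N * z : lattice tau") blast+
  hence "F meromorphic_on UNIV" using meromorphic_on_meromorphic_at by blast
  moreover have "zorder F z >= - int l" if "?N * z : lattice tau" "\<exists>\<^sub>F y in at z. F y ~= 0" for z
   using po[OF that(1)] zorder_ge_quotient(2)[OF _ _ that(2)] by blast
  ultimately show ?thesis unfolding Let_def F using an by (auto simp: Vscaled_upd tau_def)
 qed
 have 7: "(%z. ?\<phi> (upd x c z)) field_differentiable at (x $ c)" if "x : Omega_reg" "c : range Cv \<union> {Ctau}" for x c
 proof (cases "c = Ctau")
  case True
  thus ?thesis using differentiable[OF reg[OF that(1)]] by (simp add: Vscaled_upd upd_component)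
 next
  case False
  thus ?thesis using 4[of c x] that(2) by auto
 qed
 show ?thesis unfolding weak_jacobi_form_def using 1 2 3 4[of Cu] 5 6 7 by auto
qed

lemma wp_deriv_analytic:
 assumes "gpt z tau" shows "(%w. wp_deriv k w tau) analytic_on {z}"
proof -
 have t: "Im tau > 0" and z: "z : - lattice tau" using assms by (auto simp: gpt_def)
 have o: "open (- lattice tau)" using closed_lattice[OF t] by (rule open_Compl)
 have "(%w. wp_deriv k w tau) holo - lattice tau"
  unfolding wp_deriv_def dz_def by (intro holomorphic_intros holomorphic_higher_deriv Zf_holomorphic t o)
 thus ?thesis using o z by (meson analytic_on_open analytic_on_subset empty_subsetI insert_subset)
qed

text \<open>\<open>ring_gen\<close> by itself supplies only the integers; complex constants enter as
  Jacobi forms of weight, order and index 0.\<close>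

lemma const_in_Ering: "(%x :: ('n::finite) point. c) : Ering"
proof -
 have "\<exists>h. h analytic_on {0} & (\<forall>\<^sub>F z in at (0 :: complex). c = h z)" by (intro exI[of _ "%_. c"]) auto
 moreover have "\<exists>B. norm c <= B" by blast
 ultimately have "weak_jacobi_form 0 (int 0) 0 (%x :: 'n point. (%z tau. c) (Vscaled x) (tm x))"
  by (intro weak_jacobi_form_modular) auto
 thus ?thesis unfolding Ering_def by (intro ring_gen.gen) blast
qed

lemma wp_deriv_in_Ering: "(%x :: ('n::finite) point. wp_deriv k (Vscaled x) (tm x)) : Ering"
proof -
 obtain l where l: "!!tau. Im tau > 0 ==> \<exists>h. h analytic_on {0} & (\<forall>\<^sub>F z in at 0. wp_deriv k z tau * z ^ l = h z)"
  by (rule wp_deriv_pole[of k]) blast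
 have "weak_jacobi_form (int (k + 2)) (int l) 0 (%x :: 'n point. wp_deriv k (Vscaled x) (tm x))"
 proof (rule weak_jacobi_form_modular)
  show "\<exists>B T. \<forall>tau. Im tau > T --> norm (wp_deriv k z tau) <= B" if "z ~: \<int>" for z
  proof -
   obtain B T where 1: "!!tau. Im tau > T ==> norm (dz (Suc k) Zf z tau) <= B" by (rule dz_Zf_bounded_at_cusp[OF \<open>z ~: \<int>\<close>]) blast
   obtain B' T' where 2: "!!tau. Im tau > T' ==> norm ((deriv ^^ 1) (%z. Zreg z tau) 0) <= B'" by (rule Zreg_coeff_bounded_at_cusp) blast
   have "norm (wp_deriv k z tau) <= \<bar>B'\<bar> + B" if t: "Im tau > max T (max T' 0)" for tau
   proof -
    have "norm (if k = 0 then theta_const tau / 3 else 0) <= \<bar>B'\<bar>"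
     using 2[of tau] t deriv_Zreg_0[of tau] by auto
    thus ?thesis using 1[of tau] t norm_triangle_ineq4[of "if k = 0 then theta_const tau / 3 else 0" "dz (Suc k) Zf z tau"]
     unfolding wp_deriv_def by auto
   qed
   thus ?thesis by blast
  qed
  show "wp_deriv k (z + om) tau = wp_deriv k z tau" if "gpt z tau" "om : lattice tau" for z tau om
   using dz_Zf_periodic[OF that] by (simp add: wp_deriv_def)
  show "wp_deriv k (z / (of_int c * tau + of_int d)) (mobius a b c d tau) = (of_int c * tau + of_int d) powi int (k + 2) * wp_deriv k z tau"
   if "gpt z tau" "a * d - b * c = 1" for z tau a b c d
   using wp_deriv_mobius[OF that] by (simp only: power_int_of_nat)
 qed (use l wp_deriv_analytic wp_deriv_differentiable_tau in auto)
 thus ?thesis unfolding Ering_def by (intro ring_gen.gen) blast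
qed

lemma Zreg_coeff_in_Ering:
 assumes "m >= 2" shows "(%x :: ('n::finite) point. (deriv ^^ m) (%z. Zreg z (tm x)) 0) : Ering"
proof -
 let ?f = "%(z :: complex) tau. (deriv ^^ m) (%z. Zreg z tau) 0"
 have "weak_jacobi_form (int (m + 1)) (int 0) 0 (%x :: 'n point. ?f (Vscaled x) (tm x))"
 proof (rule weak_jacobi_form_modular)
  show "\<exists>B T. \<forall>tau. Im tau > T --> norm (?f z tau) <= B" for z
   by (rule Zreg_coeff_bounded_at_cusp[of m]) blast
  show "?f (z / (of_int c * tau + of_int d)) (mobius a b c d tau) = (of_int c * tau + of_int d) powi int (m + 1) * ?f z tau"
   if "gpt z tau" "a * d - b * c = 1" for z tau a b c d
   using Zreg_coeff_mobius[OF _ that(2) assms] that(1) by (simp only: gpt_def power_int_of_nat)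
  show "?f z field_differentiable at tau" if "gpt z tau" for z tau
   using that by (intro Zreg_coeff_differentiable) (simp add: gpt_def)
  show "\<exists>h. h analytic_on {0} & (\<forall>\<^sub>F z in at 0. ?f z tau * z ^ 0 = h z)" for tau
   by (intro exI[of _ "%_. ?f 0 tau"]) auto
 qed auto
 thus ?thesis unfolding Ering_def by (intro ring_gen.gen) (simp only: mem_Collect_eq, blast)
qed

lemma Ering_subset_Etilde: "Ering \<subseteq> Etilde"
 unfolding Etilde_def using ring_gen.gen by blast

text \<open>The coordinates are meaningful only on U, so membership is weakened to agreement on U
  with one element of the generated ring. The notion is then insensitive to values off U, as
  \<open>function_ring\<close> demands.\<close>

lemma agree_ring:
 fixes U :: "('n::finite) point set"
 assumes "Etilde \<subseteq> ring_gen G"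
 shows "function_ring U {f. \<exists>g\<in>ring_gen G. \<forall>x\<in>U. f x = g x}"
proof
 have c: "(%x. c) : ring_gen G" for c using assms Ering_subset_Etilde const_in_Ering by blast
 fix f g :: "'n point => complex"
 assume "f : {f. \<exists>g\<in>ring_gen G. \<forall>x\<in>U. f x = g x}" "g : {f. \<exists>g\<in>ring_gen G. \<forall>x\<in>U. f x = g x}"
 then obtain f' g' where *: "f' : ring_gen G" "\<forall>x\<in>U. f x = f' x" "g' : ring_gen G" "\<forall>x\<in>U. g x = g' x" by auto
 have "(%x. f' x + g' x) : ring_gen G" "(%x. f' x * g' x) : ring_gen G"
  using ring_gen.diff[OF *(1) ring_gen.diff[OF c[of 0] *(3)]] ring_gen.mult[OF *(1,3)] by simp_all
 note agree = this
 show "(%x. f x + g x) : {f. \<exists>g\<in>ring_gen G. \<forall>x\<in>U. f x = g x}"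
  unfolding mem_Collect_eq by (intro bexI[OF _ agree(1)]) (simp add: *)
 show "(%x. f x * g x) : {f. \<exists>g\<in>ring_gen G. \<forall>x\<in>U. f x = g x}"
  unfolding mem_Collect_eq by (intro bexI[OF _ agree(2)]) (simp add: *)
next
 have "(%x. c) : ring_gen G" for c using assms Ering_subset_Etilde const_in_Ering by blast
 thus "(%x. c) : {f. \<exists>g\<in>ring_gen G. \<forall>x\<in>U. f x = g x}" for c unfolding mem_Collect_eq by (intro bexI[of _ "%x. c"]) simp_all
next
 fix f g :: "'n point => complex"
 assume "f : {f. \<exists>g\<in>ring_gen G. \<forall>x\<in>U. f x = g x}" and fg: "!!x. x : U ==> g x = f x"
 then obtain f' where "f' : ring_gen G" "\<forall>x\<in>U. f x = f' x" by auto
 thus "g : {f. \<exists>g\<in>ring_gen G. \<forall>x\<in>U. f x = g x}" unfolding mem_Collect_eq by (intro bexI[of _ f']) (simp_all add: fg)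
qed

locale form_ring = function_ring U R for U :: "('n::finite) point set" and R +
 assumes regular: "U \<subseteq> Omega_reg" and Etilde_subset: "Etilde \<subseteq> R"
begin

lemma good_Vscaled: "x : U ==> gpt (Vscaled x) (tm x)"
 using regular by (auto simp: Omega_reg_def Omega_def gpt_def)

lemma Im_tau_pos: "x : U ==> Im (tm x) > 0"
 using good_Vscaled by (auto simp: gpt_def)

lemma theta_const_in: "(%x. theta_const (tm x)) : R"
proof -
 have "(%x. g1 (tm x)) : R" using Etilde_subset unfolding Etilde_def by (blast intro: ring_gen.gen)
 hence "(%x. (12 * of_real pi * \<i>) * g1 (tm x)) : R" by (rule mult[OF const])
 thus ?thesis by (rule cong) (simp add: theta_const_eq Im_tau_pos)
qed

text \<open>\<open>Z\<close> at \<open>Vscaled x\<close> is the adjoined \<open>theta_quot\<close>.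
  Its derivatives are, up to sign, derivatives of \<open>wp\<close> and hence forms, with the
  correction \<open>theta_const / 3\<close> in the first one.\<close>

lemma Zf_V_in: "(%x. dz k Zf (Vscaled x) (tm x)) : R"
proof (cases k)
 case 0
 have "theta_quot : R" using Etilde_subset unfolding Etilde_def by (blast intro: ring_gen.gen)
 thus ?thesis
  by (rule cong) (simp add: 0 dz_def Zf_def theta_ratio_def theta_quot_def theta1_eq theta1'_eq Im_tau_pos)
next
 case (Suc m)
 have "(%x. wp_deriv m (Vscaled x) (tm x)) : R"
  using wp_deriv_in_Ering Ering_subset_Etilde Etilde_subset by blast
 hence "(%x. (if m = 0 then theta_const (tm x) / 3 else 0) - wp_deriv m (Vscaled x) (tm x)) : R"
  using divide_const[OF theta_const_in, of 3] const by (cases "m = 0") (auto intro!: diff)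
 thus ?thesis by (rule cong) (simp add: Suc wp_deriv_def)
qed

lemma Zreg_coeff_in: "(%x. (deriv ^^ m) (%z. Zreg z (tm x)) 0) : R"
proof -
 consider "m = 0" | "m = 1" | "m >= 2" by linarith
 thus ?thesis
 proof cases
  case 1
  thus ?thesis using const[of 0] by (elim cong) (simp add: Zreg_0 Im_tau_pos)
 next
  case 2
  thus ?thesis using divide_const[OF theta_const_in, of 3] by (elim cong) (simp add: deriv_Zreg_0 Im_tau_pos)
 next
  case 3
  thus ?thesis using Zreg_coeff_in_Ering Ering_subset_Etilde Etilde_subset by blast
 qed
qed

end

section \<open>Partial derivatives on sets that are open along coordinate lines\<close>

definition line_open :: "('n::finite) point set => bool" where
 "line_open W \<longleftrightarrow> (\<forall>x\<in>W. \<forall>a. \<forall>\<^sub>F s in nhds (x $ a). upd x a s : W)"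

lemma line_openD: "line_open W ==> x : W ==> \<forall>\<^sub>F s in nhds (x $ a). upd x a s : W"
 by (simp add: line_open_def)

definition has_partial :: "'n flat => (('n::finite) point => complex) => complex => 'n point => bool" where
 "has_partial a f D x \<longleftrightarrow> ((%s. f (upd x a s)) hfd D) (at (x $ a))"

definition pdiff :: "(('n::finite) point => complex) => 'n point => bool" where
 "pdiff f x \<longleftrightarrow> (\<forall>a. has_partial a f (partial a f x) x)"

lemma has_partialD: "has_partial a f D x ==> partial a f x = D"
 unfolding has_partial_def partial_def by (rule DERIV_imp_deriv)

lemma pdiffI: "(!!a. has_partial a f (D a) x) ==> pdiff f x"
 unfolding pdiff_def using has_partialD by metis

lemma pdiffD: "pdiff f x ==> has_partial a f (partial a f x) x"
 by (simp add: pdiff_def)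

lemma has_partial_const: "has_partial a (%x. c) 0 x"
 by (simp add: has_partial_def)

lemma has_partial_add: "has_partial a f D x ==> has_partial a g E x ==> has_partial a (%x. f x + g x) (D + E) x"
 unfolding has_partial_def by (rule DERIV_add)

lemma has_partial_diff: "has_partial a f D x ==> has_partial a g E x ==> has_partial a (%x. f x - g x) (D - E) x"
 unfolding has_partial_def by (rule DERIV_diff)

lemma has_partial_mult:
 "has_partial a f D x ==> has_partial a g E x ==> has_partial a (%x. f x * g x) (D * g x + f x * E) x"
 unfolding has_partial_def using DERIV_mult[of "%s. f (upd x a s)" D "x $ a" UNIV "%s. g (upd x a s)" E] by (simp add: add.commute mult.commute)

lemma has_partial_cmult: "has_partial a f D x ==> has_partial a (%x. c * f x) (c * D) x"
 unfolding has_partial_def by (rule DERIV_cmult)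

lemma has_partial_sum: "(!!i. i : I ==> has_partial a (f i) (D i) x) ==> has_partial a (%x. \<Sum>i\<in>I. f i x) (\<Sum>i\<in>I. D i) x"
 unfolding has_partial_def by (rule DERIV_sum)

lemma has_partial_inverse:
 assumes "has_partial a f D x" "f x ~= 0" shows "has_partial a (%x. 1 / f x) (- D * (1 / f x)\<^sup>2) x"
 using assms unfolding has_partial_def
 by (auto intro!: derivative_eq_intros simp: power2_eq_square)

lemma has_partial_transfer:
 assumes "has_partial a f D x" "line_open W" "x : W" "!!x. x : W ==> g x = f x"
 shows "has_partial a g D x"
proof -
 have "\<forall>\<^sub>F s in nhds (x $ a). g (upd x a s) = f (upd x a s)"
  by (rule eventually_mono[OF line_openD[OF assms(2,3)]]) (rule assms(4))
 thus ?thesis using assms(1) unfolding has_partial_def by (simp add: DERIV_cong_ev)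
qed

lemma partial_cong:
 assumes "line_open W" "x : W" "!!x. x : W ==> g x = f x" shows "partial a g x = partial a f x"
proof -
 have "\<forall>\<^sub>F s in nhds (x $ a). g (upd x a s) = f (upd x a s)"
  by (rule eventually_mono[OF line_openD[OF assms(1,2)]]) (rule assms(3))
 thus ?thesis unfolding partial_def by (rule deriv_cong_ev) simp
qed

lemma has_partial_coord: "has_partial a (%x. x $ c) (if c = a then 1 else 0) x"
 unfolding has_partial_def upd_component by simp

definition lin :: "('n flat => complex) => ('n::finite) point => complex" where
 "lin l x = (\<Sum>a\<in>UNIV. l a * x $ a)"

lemma lin_upd: "lin l (upd x a s) = lin l x + l a * (s - x $ a)"
proof -
 have "lin l (upd x a s) - lin l x = (\<Sum>c\<in>UNIV. if c = a then l a * (s - x $ a) else 0)"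
  unfolding lin_def sum_subtractf[symmetric] by (intro sum.cong) (auto simp: upd_component algebra_simps)
 thus ?thesis by (simp add: algebra_simps)
qed

text \<open>All functions below depend on the coordinates through a linear form and through tau. The
  condition \<open>l Ctau = 0\<close> separates the two, so the chain rule has one term for
  each.\<close>

lemma has_partial_lin_tau:
 assumes z: "((%w. F w (tm x)) hfd F1) (at (z + lin l x))"
  and t: "((%t. F (z + lin l x) t) hfd F2) (at (tm x))" and l: "l Ctau = 0"
 shows "has_partial a (%x. F (z + lin l x) (tm x)) (l a * F1 + (if a = Ctau then F2 else 0)) x"
proof (cases "a = Ctau")
 case True
 thus ?thesis using t l by (simp add: has_partial_def lin_upd upd_component)
next
 case False
 have "((%s. F (z + (lin l x + l a * (s - x $ a))) (tm x)) hfd F1 * l a) (at (x $ a))"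
  by (rule DERIV_chain2[where f="%w. F w (tm x)" and g="%s. z + (lin l x + l a * (s - x $ a))"])
   (use z in \<open>auto intro!: derivative_eq_intros\<close>)
 thus ?thesis using False by (simp add: has_partial_def lin_upd upd_component mult.commute)
qed

text \<open>The regularity under which Hessians exist and are symmetric. It is closed under the
  operations of \<open>function_ring\<close>, so coefficients can be extracted over it.\<close>

definition sm :: "('n::finite) point set => ('n point => complex) set" where
 "sm W = {f. \<forall>x\<in>W. pdiff f x & (\<forall>b. pdiff (partial b f) x) & (\<forall>a b. partial a (partial b f) x = partial b (partial a f) x)}"

lemma smI:
 assumes W: "line_open W" and 1: "!!x a. x : W ==> has_partial a f (f' a x) x"
  and 2: "!!x a b. x : W ==> has_partial b (f' a) (f'' b a x) x"
  and sym: "!!x a b. x : W ==> f'' b a x = f'' a b x"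
 shows "f : sm W"
proof -
 have p: "has_partial b (partial a f) (f'' b a x) x" if "x : W" for x a b
  by (rule has_partial_transfer[OF 2[OF that] W that]) (rule has_partialD[OF 1])
 show ?thesis unfolding sm_def
  using pdiffI[OF 1] pdiffI[OF p] has_partialD[OF p] sym by simp
qed

lemma sm_pdiff: "f : sm W ==> x : W ==> pdiff f x"
 and sm_pdiff_partial: "f : sm W ==> x : W ==> pdiff (partial b f) x"
 and sm_sym: "f : sm W ==> x : W ==> partial a (partial b f) x = partial b (partial a f) x"
 by (auto simp: sm_def)

lemma sm_mono: "f : sm W ==> W' \<subseteq> W ==> f : sm W'"
 unfolding sm_def by blast

lemmas sm_partials = sm_pdiff[THEN pdiffD] sm_pdiff_partial[THEN pdiffD]

lemma sm_ring:
 assumes W: "line_open W" shows "function_ring W (sm W)"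
proof
 show "(%x. c) : sm W" for c
  by (rule smI[OF W, where f'="%a x. 0" and f''="%a b x. 0"]) (auto intro: has_partial_const)
 fix f g :: "'a point => complex"
 assume f: "f : sm W"
 show "g : sm W" if "!!x. x : W ==> g x = f x"
  by (rule smI[OF W, where f'="%a. partial a f" and f''="%b a. partial b (partial a f)"])
   (use f that W sm_partials[OF f] sm_sym[OF f] has_partial_transfer in blast)+
 assume g: "g : sm W"
 show "(%x. f x + g x) : sm W"
  by (rule smI[OF W, where f'="%a x. partial a f x + partial a g x" and f''="%b a x. partial b (partial a f) x + partial b (partial a g) x"])
   (auto intro!: has_partial_add sm_partials[OF f] sm_partials[OF g] arg_cong2[of _ _ _ _ "(+)"] sm_sym[OF f] sm_sym[OF g])
 show "(%x. f x * g x) : sm W"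
 proof (rule smI[OF W, where f'="%a x. partial a f x * g x + f x * partial a g x" and
    f''="%b a x. (partial b (partial a f) x * g x + partial a f x * partial b g x) + (partial b f x * partial a g x + f x * partial b (partial a g) x)"])
  fix x a b assume x: "x : W"
  show "has_partial a (%x. f x * g x) (partial a f x * g x + f x * partial a g x) x"
   by (intro has_partial_mult sm_partials[OF f] sm_partials[OF g] x)
  show "has_partial b (%x. partial a f x * g x + f x * partial a g x)
   ((partial b (partial a f) x * g x + partial a f x * partial b g x) + (partial b f x * partial a g x + f x * partial b (partial a g) x)) x"
   by (intro has_partial_add has_partial_mult sm_partials[OF f] sm_partials[OF g] x)
 qed (use sm_sym[OF f] sm_sym[OF g] in simp)
qed

lemma sm_inverse:
 assumes W: "line_open W" and f: "f : sm W" and nz: "!!x. x : W ==> f x ~= 0"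
 shows "(%x. 1 / f x) : sm W"
proof (rule smI[OF W, where f'="%a x. - partial a f x * (1 / f x)\<^sup>2" and
   f''="%b a x. - partial b (partial a f) x * (1 / f x)\<^sup>2 + partial a f x * partial b f x * (2 * (1 / f x) ^ 3)"])
 fix x a b assume x: "x : W"
 note i = has_partial_inverse[OF sm_partials(1)[OF f x] nz[OF x]]
 show "has_partial a (%x. 1 / f x) (- partial a f x * (1 / f x)\<^sup>2) x" by (rule i)
 have "has_partial b (%x. (- 1) * partial a f x * ((1 / f x) * (1 / f x)))
  ((- 1) * partial b (partial a f) x * ((1 / f x) * (1 / f x)) + (- 1) * partial a f x *
   ((- partial b f x * (1 / f x)\<^sup>2) * (1 / f x) + (1 / f x) * (- partial b f x * (1 / f x)\<^sup>2))) x"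
  by (intro has_partial_mult has_partial_cmult i sm_partials(2)[OF f x])
 thus "has_partial b (%x. - partial a f x * (1 / f x)\<^sup>2)
  (- partial b (partial a f) x * (1 / f x)\<^sup>2 + partial a f x * partial b f x * (2 * (1 / f x) ^ 3)) x"
  by (simp add: power2_eq_square power3_eq_cube algebra_simps)
qed (simp add: sm_sym[OF f] mult.commute)

lemma sm_coord: "line_open W ==> (%x. x $ c) : sm W"
 by (rule smI[where f'="%a x. if c = a then 1 else 0" and f''="%b a x. 0"]) (rule has_partial_coord has_partial_const | simp)+

lemma sm_exp_coord:
 assumes W: "line_open W" shows "(%x. exp (k * x $ c)) : sm W"
proof -
 have p: "has_partial a (%x. h * exp (k * x $ c)) (h * ((if c = a then k else 0) * exp (k * x $ c))) x" for h a x
  unfolding has_partial_def upd_component by (auto intro!: derivative_eq_intros)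
 show ?thesis
  by (rule smI[OF W, where f'="%a x. (if c = a then k else 0) * exp (k * x $ c)" and
     f''="%b a x. (if c = a then k else 0) * ((if c = b then k else 0) * exp (k * x $ c))"])
   (use p[of _ 1] p in auto)
qed

lemma sm_lin_tau:
 assumes W: "line_open W" and l: "l Ctau = 0"
  and F: "!!x. x : W ==> ((%w. F w (tm x)) hfd F1 (z + lin l x) (tm x)) (at (z + lin l x))"
   "!!x. x : W ==> ((%t. F (z + lin l x) t) hfd F2 (z + lin l x) (tm x)) (at (tm x))"
  and F1: "!!x. x : W ==> ((%w. F1 w (tm x)) hfd F11 (z + lin l x) (tm x)) (at (z + lin l x))"
   "!!x. x : W ==> ((%t. F1 (z + lin l x) t) hfd F12 (z + lin l x) (tm x)) (at (tm x))"
  and F2: "!!x. x : W ==> ((%w. F2 w (tm x)) hfd F12 (z + lin l x) (tm x)) (at (z + lin l x))"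
   "!!x. x : W ==> ((%t. F2 (z + lin l x) t) hfd F22 (z + lin l x) (tm x)) (at (tm x))"
 shows "(%x. F (z + lin l x) (tm x)) : sm W"
proof (rule smI[OF W, where f'="%a x. l a * F1 (z + lin l x) (tm x) + (if a = Ctau then 1 else 0) * F2 (z + lin l x) (tm x)" and
   f''="%b a x. l a * (l b * F11 (z + lin l x) (tm x) + (if b = Ctau then F12 (z + lin l x) (tm x) else 0))
    + (if a = Ctau then 1 else 0) * (l b * F12 (z + lin l x) (tm x) + (if b = Ctau then F22 (z + lin l x) (tm x) else 0))"])
 fix x a b assume x: "x : W"
 show "has_partial a (%x. F (z + lin l x) (tm x)) (l a * F1 (z + lin l x) (tm x) + (if a = Ctau then 1 else 0) * F2 (z + lin l x) (tm x)) x"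
  using has_partial_lin_tau[where F=F, OF F[OF x] l, of a] by (cases "a = Ctau") simp_all
 show "has_partial b (%x. l a * F1 (z + lin l x) (tm x) + (if a = Ctau then 1 else 0) * F2 (z + lin l x) (tm x))
  (l a * (l b * F11 (z + lin l x) (tm x) + (if b = Ctau then F12 (z + lin l x) (tm x) else 0))
    + (if a = Ctau then 1 else 0) * (l b * F12 (z + lin l x) (tm x) + (if b = Ctau then F22 (z + lin l x) (tm x) else 0))) x"
  by (intro has_partial_add has_partial_cmult has_partial_lin_tau[where F=F1, OF F1[OF x] l] has_partial_lin_tau[where F=F2, OF F2[OF x] l])
qed (simp add: l algebra_simps)

lemma sm_theta:
 assumes W: "line_open W" "W \<subseteq> Omega" and l: "l Ctau = 0"
 shows "(%x. theta k (z + lin l x) (tm x)) : sm W"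
proof (rule sm_lin_tau[where F="theta k" and ?F1.0="theta (Suc k)" and ?F2.0="%w t. kappa * theta (Suc (Suc k)) w t" and
   ?F11.0="theta (Suc (Suc k))" and ?F12.0="%w t. kappa * theta (Suc (Suc (Suc k))) w t" and
   ?F22.0="%w t. kappa * (kappa * theta (Suc (Suc (Suc (Suc k)))) w t)"])
 fix x assume "x : W"
 hence t: "Im (tm x) > 0" using W by (auto simp: Omega_def)
 note d = theta_deriv_z[OF t] theta_deriv_tau[OF t]
 show "((%w. theta k w (tm x)) hfd theta (Suc k) (z + lin l x) (tm x)) (at (z + lin l x))" by (rule d)
 show "((%t. theta k (z + lin l x) t) hfd kappa * theta (Suc (Suc k)) (z + lin l x) (tm x)) (at (tm x))" by (rule d)
 show "((%w. theta (Suc k) w (tm x)) hfd theta (Suc (Suc k)) (z + lin l x) (tm x)) (at (z + lin l x))" by (rule d)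
 show "((%t. theta (Suc k) (z + lin l x) t) hfd kappa * theta (Suc (Suc (Suc k))) (z + lin l x) (tm x)) (at (tm x))" by (rule d)
 show "((%w. kappa * theta (Suc (Suc k)) w (tm x)) hfd kappa * theta (Suc (Suc (Suc k))) (z + lin l x) (tm x)) (at (z + lin l x))"
  using DERIV_cmult[OF d(1)[of "Suc (Suc k)" "z + lin l x"], of kappa] by simp
 show "((%t. kappa * theta (Suc (Suc k)) (z + lin l x) t) hfd kappa * (kappa * theta (Suc (Suc (Suc (Suc k)))) (z + lin l x) (tm x))) (at (tm x))"
  by (rule DERIV_cmult[OF d(2)])
qed (use W l in auto)

lemma line_open_Int: "line_open W ==> line_open W' ==> line_open (W \<inter> W')"
 unfolding line_open_def by (auto intro: eventually_conj)

lemma line_open_open: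
 assumes "open (W :: ('n::finite) point set)" shows "line_open W"
 unfolding line_open_def
proof (intro ballI allI)
 fix x a assume x: "x : W"
 have "((%s. upd x a s) \<longlongrightarrow> x) (nhds (x $ a))"
 proof (rule vec_tendstoI)
  fix c show "((%s. upd x a s $ c) \<longlongrightarrow> x $ c) (nhds (x $ a))"
   by (cases "c = a") (simp_all add: upd_component filterlim_ident)
 qed
 thus "\<forall>\<^sub>F s in nhds (x $ a). upd x a s : W" using assms x by (simp add: tendsto_def)
qed

text \<open>Along tau theta stays nonzero by continuity in tau, along any other coordinate the
  argument stays off the closed lattice. Separate continuity of theta is all that openness along
  lines asks for.\<close>

lemma line_open_good:
 assumes l: "l Ctau = 0" shows "line_open {x. gpt (z + lin l x) (tm x)}"
 unfolding line_open_def
proof (intro ballI allI)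
 fix x a assume "x : {x. gpt (z + lin l x) (tm x)}"
 hence g: "gpt (z + lin l x) (tm x)" by simp
 show "\<forall>\<^sub>F s in nhds (x $ a). upd x a s : {x. gpt (z + lin l x) (tm x)}"
 proof (cases "a = Ctau")
  case True
  thus ?thesis using eventually_good_tau[OF g] l by (simp add: lin_upd upd_component)
 next
  case False
  have "filterlim (%s. z + (lin l x + l a * (s - x $ a))) (nhds (z + lin l x)) (nhds (x $ a))"
   by (auto intro!: tendsto_eq_intros filterlim_ident)
  from eventually_compose_filterlim[OF eventually_good_z[OF g] this] show ?thesis
   using False by (simp add: lin_upd upd_component)
 qed
qed

section \<open>The intersection form as a pairing of covectors\<close>

lemma sum_flat: "(\<Sum>a\<in>UNIV. f a) = (\<Sum>j\<in>UNIV. f (Cv j)) + f Cu + f Cw + f Ctau" for f :: "('n::finite) flat => complex"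
proof -
 have "(\<Sum>a\<in>UNIV. f a) = (\<Sum>a\<in>range Cv. f a) + (\<Sum>a\<in>{Cu, Cw, Ctau}. f a)"
  unfolding UNIV_flat by (rule sum.union_disjoint) auto
 thus ?thesis by (simp add: sum.reindex inj_on_def add.assoc)
qed

lemma sum_ambient: "(\<Sum>i\<in>UNIV - {Vlast}. f i) = (\<Sum>j\<in>UNIV. f (Low j)) + f Vn" for f :: "('n::finite) ambient => complex"
proof -
 have "UNIV - {Vlast} = range Low \<union> {Vn :: 'n ambient}" using UNIV_ambient by auto
 hence "(\<Sum>i\<in>UNIV - {Vlast}. f i) = (\<Sum>a\<in>range Low. f a) + (\<Sum>a\<in>{Vn}. f a)"
  by (simp only:) (rule sum.union_disjoint, auto)
 thus ?thesis by (simp add: sum.reindex inj_on_def)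
qed

lemma card_ambient: "(of_nat (card (UNIV - {Vlast :: ('n::finite) ambient})) :: complex) = of_nat CARD('n) + 1"
 using sum_ambient[of "%i :: 'n ambient. 1"] by simp

lemma matrix_inv_eqI:
 fixes A B :: "'a :: field ^ 'n ^ 'n"
 assumes AB: "A ** B = mat 1" shows "matrix_inv A = B"
proof -
 have "A ** B = mat 1 & B ** A = mat 1" using AB matrix_left_right_inverse by blast
 hence *: "A ** matrix_inv A = mat 1 & matrix_inv A ** A = mat 1" unfolding matrix_inv_def by (rule someI)
 have "matrix_inv A = matrix_inv A ** (A ** B)" by (simp add: AB)
 also have "... = B" using * by (simp add: matrix_mul_assoc)
 finally show ?thesis .
qed

text \<open>\<open>Amat\<close> is the identity plus the all-ones matrix J, and
  \<open>J\<^sup>2 = n J\<close>.\<close>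

lemma Amat_inv: "matrix_inv (Amat :: complex ^ ('n::finite) ^ 'n) $ i $ j = (if i = j then 1 else 0) - 1 / (of_nat CARD('n) + 1)"
proof -
 let ?N = "of_nat CARD('n) + 1 :: complex"
 have N: "?N ~= 0" using of_nat_neq_0[of "CARD('n)", where 'a=complex] by (simp add: add.commute)
 define B :: "complex ^ 'n ^ 'n" where "B = (\<chi> i j. (if i = j then 1 else 0) - 1 / ?N)"
 have e: "(\<Sum>k\<in>UNIV. (if i = k then 2 else 1) * ((if k = j then 1 else 0) - 1 / ?N)) = (if i = j then 1 else (0 :: complex))" for i j :: 'n
 proof -
  have "(\<Sum>k\<in>UNIV. (if i = k then 2 else 1) * ((if k = j then 1 else 0) - 1 / ?N))
   = (\<Sum>k\<in>UNIV. (if k = j then 1 else 0) + (if i = k then (if k = j then 1 else 0) else 0) - 1 / ?N - (if i = k then 1 / ?N else 0))"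
   by (intro sum.cong refl) auto
  also have "... = 1 + (if i = j then 1 else 0) - of_nat CARD('n) * (1 / ?N) - 1 / ?N"
   by (simp add: sum.distrib sum_subtractf)
  also have "... = 1 + (if i = j then 1 else 0) - (of_nat CARD('n) + 1) / ?N" by (simp only: add_divide_distrib) simp
  also have "... = (if i = j then 1 else 0)" using N by simp
  finally show ?thesis .
 qed
 have AB: "Amat ** B = mat 1" unfolding matrix_matrix_mult_def mat_def Amat_def B_def by (simp add: vec_eq_iff e)
 from matrix_inv_eqI[OF AB] have "matrix_inv Amat = B" .
 thus ?thesis by (simp add: B_def)
qed

definition bil :: "(('n::finite) flat => complex) => ('n flat => complex) => complex" where
 "bil p q = (\<Sum>a\<in>UNIV. \<Sum>b\<in>UNIV. gstar $ a $ b * p a * q b)"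

lemma bil_explicit:
 fixes p q :: "('n::finite) flat => complex"
 shows "bil p q = (\<Sum>i\<in>UNIV. p (Cv i) * q (Cv i)) - (\<Sum>i\<in>UNIV. p (Cv i)) * (\<Sum>i\<in>UNIV. q (Cv i)) / (of_nat CARD('n) + 1)
  - p Cw * q Cw / (of_nat CARD('n) * (of_nat CARD('n) + 1)) + p Cu * q Ctau + p Ctau * q Cu"
proof -
 let ?N = "of_nat CARD('n) + 1 :: complex"
 have 1: "(\<Sum>i\<in>UNIV. \<Sum>j\<in>UNIV. ((if i = j then 1 else 0) - 1 / ?N) * p (Cv i) * q (Cv j))
  = (\<Sum>i\<in>UNIV. p (Cv i) * q (Cv i)) - (\<Sum>i\<in>UNIV. p (Cv i)) * (\<Sum>i\<in>UNIV. q (Cv i)) / ?N"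
 proof -
  have "(\<Sum>i\<in>UNIV. \<Sum>j\<in>UNIV. ((if i = j then 1 else 0) - 1 / ?N) * p (Cv i) * q (Cv j))
   = (\<Sum>i\<in>UNIV. \<Sum>j\<in>UNIV. (if i = j then p (Cv i) * q (Cv j) else 0) - p (Cv i) * q (Cv j) / ?N)"
   by (intro sum.cong refl) (auto simp: algebra_simps)
  thus ?thesis by (simp add: sum_subtractf sum_product sum_divide_distrib)
 qed
 define g where "g = (gstar :: complex ^ 'n flat ^ 'n flat)"
 have G: "g $ Cv i $ Cv j = (if i = j then 1 else 0) - 1 / ?N" "g $ Cv i $ Cu = 0" "g $ Cv i $ Cw = 0" "g $ Cv i $ Ctau = 0"
  "g $ Cu $ Cv j = 0" "g $ Cw $ Cv j = 0" "g $ Ctau $ Cv j = 0" "g $ Cu $ Cu = 0" "g $ Cu $ Cw = 0"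
  "g $ Cu $ Ctau = 1" "g $ Cw $ Cu = 0" "g $ Cw $ Cw = - 1 / (of_nat CARD('n) * ?N)" "g $ Cw $ Ctau = 0"
  "g $ Ctau $ Cu = 1" "g $ Ctau $ Cw = 0" "g $ Ctau $ Ctau = 0" for i j :: 'n
  by (simp_all add: g_def gstar_def Amat_inv algebra_simps)
 show ?thesis unfolding bil_def sum_flat g_def[symmetric]
  by (simp only: G sum.distrib mult_zero_left mult_1 sum.neutral_const add_0_left add_0_right 1) simp
qed

lemma bil_add_left: "bil (%a. p a + p' a) q = bil p q + bil p' q"
 and bil_add_right: "bil q (%a. p a + p' a) = bil q p + bil q p'"
 and bil_scale_left: "bil (%a. c * p a) q = c * bil p q"
 and bil_scale_right: "bil q (%a. c * p a) = c * bil q p"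
 by (simp_all add: bil_def algebra_simps sum.distrib sum_distrib_left)

lemma bil_commute: "bil p q = bil q p"
 by (simp add: bil_explicit mult.commute)

text \<open>\<open>xi i\<close> is the linear form \<open>v\<^sub>n\<^sub>+\<^sub>1 - v\<^sub>i\<close>, and \<open>vform\<close> is \<open>(n + 1) v\<^sub>n\<^sub>+\<^sub>1\<close>.\<close>

definition xi :: "'n ambient => ('n::finite) flat => complex" where
 "xi i c = (case c of Cw => 1 | Cv j => (case i of Low k => if j = k then -1 else 0 | Vn => 1 | Vlast => 0) | _ => 0)"

definition vform :: "('n::finite) flat => complex" where
 "vform c = (if c = Cw then of_nat (CARD('n) + 1) else 0)"

lemma xi_tau [simp]: "xi i Ctau = 0" "xi i Cu = 0" by (simp_all add: xi_def)
lemma vform_tau [simp]: "vform Ctau = 0" "vform Cu = 0" by (simp_all add: vform_def)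

lemma lin_vform: "lin vform x = Vscaled x"
 by (simp add: lin_def vform_def Vscaled_def if_distrib if_distribR cong: if_cong)

lemma lin_zero: "lin (%_. 0) x = 0" by (simp add: lin_def)

lemma lin_xi: "i ~= Vlast ==> lin (xi i) x = x $ Cw - vpart x $ i"
 unfolding lin_def sum_flat
 by (cases i) (simp_all add: xi_def vpart_def if_distrib if_distribR sum_negf cong: if_cong)

lemma sum_xi: "(\<Sum>i\<in>UNIV - {Vlast}. xi i a) = vform a"
 unfolding sum_ambient by (cases a) (simp_all add: xi_def vform_def sum_negf if_distrib cong: if_cong)

text \<open>The shape of a logarithmic gradient of the generating quotient: \<open>c\<close> weights
  the numerator factors, \<open>d\<close> the denominator factor at \<open>z + v\<close>, and
  \<open>u\<close>, \<open>t\<close> are the components along u and tau. The factor at z alone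
  contributes only to \<open>t\<close>.\<close>

definition form :: "('n ambient => complex) => complex => complex => complex => ('n::finite) flat => complex" where
 "form c d u t a = (\<Sum>i\<in>UNIV - {Vlast}. c i * xi i a) - d * vform a + (if a = Cu then u else 0) + (if a = Ctau then t else 0)"

text \<open>It amounts to \<open>bil (xi i) (xi j) = \<delta>\<^sub>i\<^sub>j - 1/n\<close>,
  together with the fact that the \<open>xi i\<close> sum to \<open>vform\<close>.\<close>

lemma bil_form:
 fixes c c' :: "('n::finite) ambient => complex"
 shows "bil (form c d u t) (form c' d' u' t') = u * t' + t * u' + (\<Sum>i\<in>UNIV - {Vlast}. c i * c' i)
  - (sum c (UNIV - {Vlast}) - d) * (sum c' (UNIV - {Vlast}) - d') / of_nat CARD('n) - d * d'"
proof -
 define n where "n = (of_nat CARD('n) :: complex)"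
 have n: "n ~= 0" "n + 1 ~= 0" using of_nat_neq_0[of "CARD('n)", where 'a=complex] by (simp_all add: n_def add.commute)
 have v: "form c d u t (Cv i) = c Vn - c (Low i)" for c :: "'n ambient => complex" and d u t i
  unfolding form_def sum_ambient by (simp add: xi_def vform_def if_distrib if_distribR cong: if_cong)
 have w: "form c d u t Cw = (\<Sum>j\<in>UNIV. c (Low j)) + c Vn - (n + 1) * d" for c :: "'n ambient => complex" and d u t
  unfolding form_def sum_ambient by (simp add: xi_def vform_def n_def algebra_simps)
 have ut: "form c d u t Cu = u" "form c d u t Ctau = t" for c :: "'n ambient => complex" and d u t
  by (simp_all add: form_def)
 define S S' P where "S = (\<Sum>j\<in>UNIV. c (Low j))" and "S' = (\<Sum>j\<in>UNIV. c' (Low j))" and "P = (\<Sum>j\<in>UNIV. c (Low j) * c' (Low j))"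
 have 1: "(\<Sum>i\<in>UNIV. (c Vn - c (Low i)) * (c' Vn - c' (Low i))) = n * c Vn * c' Vn - c Vn * S' - c' Vn * S + P"
  by (simp add: S_def S'_def P_def n_def algebra_simps sum.distrib sum_subtractf sum_distrib_left)
 have 2: "(\<Sum>i\<in>UNIV. c Vn - c (Low i)) = n * c Vn - S" "(\<Sum>i\<in>UNIV. c' Vn - c' (Low i)) = n * c' Vn - S'"
  by (simp_all add: S_def S'_def n_def sum_subtractf)
 show ?thesis
  unfolding bil_explicit v w ut 1 2 sum_ambient n_def[symmetric] S_def[symmetric] S'_def[symmetric] P_def[symmetric]
  using n by (simp add: divide_simps) (simp add: algebra_simps)
qed

abbreviation grad :: "(('n::finite) point => complex) => 'n point => 'n flat => complex" where
 "grad f x \<equiv> %a. partial a f x"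

text \<open>The coefficients \<open>e\<close> are constants. When \<open>dir (e x) f\<close> is
  differentiated at x, the field is thus frozen at x, and \<open>grad (dir (e x) f) x\<close> is the
  Hessian of f contracted with \<open>e x\<close>.\<close>

definition dir :: "('n flat => complex) => (('n::finite) point => complex) => 'n point => complex" where
 "dir e f x = (\<Sum>c\<in>UNIV. e c * partial c f x)"

lemma bil_tau: "bil p (%a. if a = Ctau then 1 else 0) = p Cu"
 by (simp add: bil_explicit)

text \<open>Logarithmic derivatives without logarithms: for products the \<open>L\<close> are
  added.\<close>

definition log_partial :: "'n flat => (('n::finite) point => complex) => complex => 'n point => bool" where
 "log_partial a f L x \<longleftrightarrow> has_partial a f (f x * L) x"

lemma log_partial_mult: "log_partial a f L x ==> log_partial a g M x ==> log_partial a (%x. f x * g x) (L + M) x"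
 unfolding log_partial_def by (drule (1) has_partial_mult) (simp add: algebra_simps)

lemma log_partial_inverse: "log_partial a f L x ==> f x ~= 0 ==> log_partial a (%x. 1 / f x) (- L) x"
 unfolding log_partial_def by (drule (1) has_partial_inverse) (simp add: power2_eq_square)

lemma log_partial_one: "log_partial a (%x. 1) 0 x"
 unfolding log_partial_def using has_partial_const[of a 1 x] by simp

lemma log_partial_prod: "(!!i. i : I ==> log_partial a (f i) (L i) x) ==> log_partial a (%x. \<Prod>i\<in>I. f i x) (\<Sum>i\<in>I. L i) x"
 by (induction I rule: infinite_finite_induct) (auto intro: log_partial_mult log_partial_one)

lemma log_partial_power: "log_partial a f L x ==> log_partial a (%x. f x ^ k) (of_nat k * L) x"
 using log_partial_prod[of "{..<k}" a "%_. f" "%_. L" x] by simp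

lemma log_partial_theta:
 assumes g: "gpt (z + lin l x) (tm x)" and l: "l Ctau = 0"
 shows "log_partial a (%x. theta 0 (z + lin l x) (tm x))
  (l a * Zf (z + lin l x) (tm x) + (if a = Ctau then kappa * Nf (z + lin l x) (tm x) else 0)) x"
proof -
 have t: "Im (tm x) > 0" "theta 0 (z + lin l x) (tm x) ~= 0" using g by (auto simp: gpt_theta)
 show ?thesis
  using has_partial_lin_tau[where F="theta 0" and z=z and l=l and x=x and a=a, OF theta_deriv_z[OF t(1)] theta_deriv_tau[OF t(1)] l] t(2)
  by (cases "a = Ctau") (simp_all add: log_partial_def Zf_def Nf_def theta_ratio_def eval_nat_numeral algebra_simps)
qed

lemma has_partial_Zf:
 assumes g: "gpt (z + lin l x) (tm x)" and l: "l Ctau = 0"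
 shows "has_partial a (%x. dz k Zf (z + lin l x) (tm x))
  (l a * dz (Suc k) Zf (z + lin l x) (tm x) + (if a = Ctau then kappa * dz (Suc k) Nf (z + lin l x) (tm x) else 0)) x"
 by (rule has_partial_lin_tau[where F="dz k Zf", OF dz_deriv_z[OF Zf_ring g] dz_Zf_deriv_tau[OF g] l])

lemma has_partial_Nf:
 assumes g: "gpt (z + lin l x) (tm x)" and l: "l Ctau = 0"
 shows "has_partial a (%x. dz k Nf (z + lin l x) (tm x))
  (l a * dz (Suc k) Nf (z + lin l x) (tm x) + (if a = Ctau then kappa * dz k Mf (z + lin l x) (tm x) else 0)) x"
 by (rule has_partial_lin_tau[where F="dz k Nf", OF dz_deriv_z[OF Nf_ring g] dz_Nf_deriv_tau[OF g] l])

section \<open>The generating quotient and its logarithmic derivatives\<close>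

definition Lam :: "complex => ('n::finite) point => complex" where
 "Lam z x = exp (- 2 * of_real pi * \<i> * x $ Cu) * (\<Prod>i\<in>UNIV - {Vlast}. theta 0 (z + lin (xi i) x) (tm x))
  * (1 / (theta 0 z (tm x) ^ CARD('n) * theta 0 (z + Vscaled x) (tm x)))"

text \<open>No theta factor vanishes here, neither in the numerator nor in the denominator, so
  logarithmic derivatives can be written through \<open>Zf\<close> and \<open>Nf\<close>.\<close>

definition Lam_dom :: "complex => ('n::finite) point set" where
 "Lam_dom z = {x : Omega_reg. gpt z (tm x) & gpt (z + Vscaled x) (tm x)
  & (\<forall>i\<in>UNIV - {Vlast}. gpt (z + lin (xi i) x) (tm x))}"

lemma Lam_domD:
 assumes "x : Lam_dom z"
 shows "x : Omega_reg" "gpt z (tm x)" "gpt (z + lin vform x) (tm x)" "i ~= Vlast ==> gpt (z + lin (xi i) x) (tm x)"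
  "Im (tm x) > 0"
 using assms by (auto simp: Lam_dom_def lin_vform gpt_def)

lemma line_open_Omega_reg: "line_open (Omega_reg :: ('n::finite) point set)"
proof -
 have "Omega_reg = {x :: 'n point. gpt (0 + lin vform x) (tm x)}"
  by (auto simp: Omega_reg_def Omega_def gpt_def lin_vform)
 thus ?thesis using line_open_good[of "vform :: 'n flat => complex" 0] by simp
qed

lemma line_open_Lam_dom: "line_open (Lam_dom z :: ('n::finite) point set)"
proof -
 have "line_open {x :: 'n point. \<forall>i\<in>I. gpt (z + lin (xi i) x) (tm x)}" for I :: "'n ambient set"
  using line_open_good[of "xi _"] unfolding line_open_def by (auto intro!: eventually_ball_finite)
 moreover have "line_open {x :: 'n point. gpt (z + lin (%_. 0) x) (tm x)}" by (rule line_open_good) simp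
 moreover have "line_open {x :: 'n point. gpt (z + lin vform x) (tm x)}" by (rule line_open_good) simp
 ultimately have "line_open (Omega_reg \<inter> ({x :: 'n point. gpt (z + lin (%_. 0) x) (tm x)} \<inter> ({x. gpt (z + lin vform x) (tm x)}
  \<inter> {x. \<forall>i\<in>UNIV - {Vlast}. gpt (z + lin (xi i) x) (tm x)})))"
  by (intro line_open_Int line_open_Omega_reg)
 moreover have "Omega_reg \<inter> ({x :: 'n point. gpt (z + lin (%_. 0) x) (tm x)} \<inter> ({x. gpt (z + lin vform x) (tm x)}
  \<inter> {x. \<forall>i\<in>UNIV - {Vlast}. gpt (z + lin (xi i) x) (tm x)})) = Lam_dom z"
  by (auto simp: Lam_dom_def lin_zero lin_vform)
 ultimately show ?thesis by simp
qed

lemma Lam_dom_subset: "Lam_dom z \<subseteq> Omega"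
 by (auto simp: Lam_dom_def Omega_reg_def)

lemma eventually_Lam_dom: "x : Lam_dom z ==> \<forall>\<^sub>F w in nhds z. x : Lam_dom w"
proof -
 assume x: "x : Lam_dom z"
 have e: "\<forall>\<^sub>F w in nhds z. gpt (w + b) (tm x)" if "gpt (z + b) (tm x)" for b
  by (rule eventually_compose_filterlim[OF eventually_good_z[OF that]]) (intro tendsto_intros filterlim_ident)
 show ?thesis
  using e[of 0] Lam_domD[OF x] e eventually_ball_finite[of "UNIV - {Vlast}" "%w i. gpt (w + lin (xi i) x) (tm x)" "nhds z"]
  unfolding Lam_dom_def mem_Collect_eq by (auto intro!: eventually_conj simp: lin_vform)
qed

lemma Lam_sm: "Lam z : sm (Lam_dom z :: ('n::finite) point set)"
proof -
 interpret S: function_ring "Lam_dom z :: 'n point set" "sm (Lam_dom z)" by (rule sm_ring[OF line_open_Lam_dom])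
 note th = sm_theta[OF line_open_Lam_dom Lam_dom_subset, of _ 0 z]
 have "(%x. theta 0 z (tm x) ^ CARD('n) * theta 0 (z + Vscaled x) (tm x)) : sm (Lam_dom z :: 'n point set)"
  using th[of "%_. 0"] th[of vform] by (intro S.mult S.power) (auto simp: lin_zero lin_vform)
 from sm_inverse[OF line_open_Lam_dom this]
 have "(%x. 1 / (theta 0 z (tm x) ^ CARD('n) * theta 0 (z + Vscaled x) (tm x))) : sm (Lam_dom z :: 'n point set)"
  using Lam_domD(2,3) by (auto simp: gpt_theta lin_vform)
 thus ?thesis unfolding Lam_def[abs_def]
  by (intro S.mult S.prod th xi_tau sm_exp_coord[OF line_open_Lam_dom, of "- 2 * of_real pi * \<i>" Cu])
qed

abbreviation xiZ :: "nat => complex => ('n::finite) point => 'n ambient => complex" where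
 "xiZ k z x i \<equiv> dz k Zf (z + lin (xi i) x) (tm x)"

abbreviation xiN :: "nat => complex => ('n::finite) point => 'n ambient => complex" where
 "xiN k z x i \<equiv> dz k Nf (z + lin (xi i) x) (tm x)"

abbreviation xiM :: "complex => ('n::finite) point => 'n ambient => complex" where
 "xiM z x i \<equiv> Mf (z + lin (xi i) x) (tm x)"

text \<open>By the heat equation each theta factor contributes \<open>kappa * Nf\<close> to the
  logarithmic tau-derivative, so that derivative is \<open>kappa * Lam_tau\<close>.
  \<open>Lam_log\<close> is the logarithmic derivative in z.\<close>

definition Lam_tau :: "complex => ('n::finite) point => complex" where
 "Lam_tau z x = (\<Sum>i\<in>UNIV - {Vlast}. xiN 0 z x i) - of_nat CARD('n) * Nf z (tm x) - Nf (z + lin vform x) (tm x)"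

definition Lam_log :: "complex => ('n::finite) point => complex" where
 "Lam_log z x = (\<Sum>i\<in>UNIV - {Vlast}. xiZ 0 z x i) - of_nat CARD('n) * Zf z (tm x) - Zf (z + lin vform x) (tm x)"

lemma partial_Lam:
 fixes x :: "('n::finite) point"
 assumes x: "x : Lam_dom z"
 shows "partial a (Lam z) x = Lam z x * form (xiZ 0 z x) (Zf (z + lin vform x) (tm x)) (- 2 * of_real pi * \<i>) (kappa * Lam_tau z x) a"
proof -
 note g = Lam_domD[OF x]
 have e: "log_partial a (%x. exp (- 2 * of_real pi * \<i> * x $ Cu)) (if a = Cu then - 2 * of_real pi * \<i> else 0) x"
  unfolding log_partial_def has_partial_def upd_component by (auto intro!: derivative_eq_intros)
 have th: "log_partial a (%x. theta 0 (z + lin (xi i) x) (tm x))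
   (xi i a * Zf (z + lin (xi i) x) (tm x) + (if a = Ctau then kappa * Nf (z + lin (xi i) x) (tm x) else 0)) x" if "i : UNIV - {Vlast}" for i
  using that by (intro log_partial_theta g) auto
 have t0: "log_partial a (%x. theta 0 z (tm x)) (if a = Ctau then kappa * Nf z (tm x) else 0) x"
  using log_partial_theta[of z "%_. 0" x a] g by (cases "a = Ctau") (simp_all add: lin_zero)
 have tv: "log_partial a (%x. theta 0 (z + Vscaled x) (tm x))
   (vform a * Zf (z + lin vform x) (tm x) + (if a = Ctau then kappa * Nf (z + lin vform x) (tm x) else 0)) x"
  using log_partial_theta[of z vform x a] g by (simp add: lin_vform)
 have nz: "theta 0 z (tm x) ^ CARD('n) * theta 0 (z + Vscaled x) (tm x) ~= 0"
  using g by (simp add: gpt_theta lin_vform)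
 have "log_partial a (Lam z) ((if a = Cu then - 2 * of_real pi * \<i> else 0)
  + (\<Sum>i\<in>UNIV - {Vlast}. xi i a * Zf (z + lin (xi i) x) (tm x) + (if a = Ctau then kappa * Nf (z + lin (xi i) x) (tm x) else 0))
  + - (of_nat CARD('n) * (if a = Ctau then kappa * Nf z (tm x) else 0)
    + (vform a * Zf (z + lin vform x) (tm x) + (if a = Ctau then kappa * Nf (z + lin vform x) (tm x) else 0)))) x"
  (is "log_partial _ _ ?L _")
  unfolding Lam_def[abs_def]
  by (intro log_partial_mult log_partial_inverse log_partial_prod e th log_partial_power t0 tv nz)
 hence "partial a (Lam z) x = Lam z x * ?L" unfolding log_partial_def by (rule has_partialD)
 thus ?thesis
  by (cases "a = Ctau"; cases "a = Cu") (simp_all add: form_def Lam_tau_def lin_vform sum.distrib sum_distrib_left algebra_simps)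
qed

definition app :: "('n flat => complex) => (('n::finite) flat => complex) => complex" where
 "app e l = (\<Sum>c\<in>UNIV. e c * l c)"

lemma sum_app_xi: "(\<Sum>i\<in>UNIV - {Vlast}. app e (xi i)) = app e vform"
 unfolding app_def by (subst sum.swap) (simp add: sum_xi flip: sum_distrib_left)

lemma app_form: "app e (form c d u t) = (\<Sum>i\<in>UNIV - {Vlast}. app e (xi i) * c i) - app e vform * d + e Cu * u + e Ctau * t"
proof -
 have "app e (form c d u t) = (\<Sum>a\<in>UNIV. \<Sum>i\<in>UNIV - {Vlast}. e a * xi i a * c i) - app e vform * d + e Cu * u + e Ctau * t"
  by (simp add: app_def form_def ring_distribs sum.distrib sum_subtractf sum_distrib_left sum_distrib_right mult_ac if_distrib[of "%y. _ * y"] cong: if_cong)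
 thus ?thesis by (subst (asm) sum.swap) (simp add: app_def sum_distrib_right)
qed

text \<open>The logarithmic derivative of the generating quotient along the constant direction
  \<open>e\<close>; \<open>Lam_dlog'\<close> is the derivative of this in z.\<close>

definition Lam_dlog :: "('n flat => complex) => complex => ('n::finite) point => complex" where
 "Lam_dlog e z x = (\<Sum>i\<in>UNIV - {Vlast}. app e (xi i) * xiZ 0 z x i) - app e vform * Zf (z + lin vform x) (tm x)
  + e Cu * (- 2 * of_real pi * \<i>) + e Ctau * (kappa * Lam_tau z x)"

definition Lam_dlog' :: "('n flat => complex) => complex => ('n::finite) point => complex" where
 "Lam_dlog' e z x = (\<Sum>i\<in>UNIV - {Vlast}. app e (xi i) * xiZ 1 z x i) - app e vform * dz 1 Zf (z + lin vform x) (tm x)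
  + e Ctau * (kappa * ((\<Sum>i\<in>UNIV - {Vlast}. xiN 1 z x i) - of_nat CARD('n) * dz 1 Nf z (tm x) - dz 1 Nf (z + lin vform x) (tm x)))"

lemma dir_Lam:
 assumes "x : Lam_dom z" shows "dir e (Lam z) x = Lam z x * Lam_dlog e z x"
proof -
 have "dir e (Lam z) x = Lam z x * app e (form (xiZ 0 z x) (Zf (z + lin vform x) (tm x)) (- 2 * of_real pi * \<i>) (kappa * Lam_tau z x))"
  unfolding dir_def partial_Lam[OF assms] app_def sum_distrib_left by (simp only: mult_ac)
 thus ?thesis by (simp only: app_form Lam_dlog_def)
qed

lemma has_partial_Lam_dlog:
 fixes x :: "('n::finite) point"
 assumes x: "x : Lam_dom z"
 shows "has_partial a (Lam_dlog e z) (form (%i. app e (xi i) * xiZ 1 z x i + e Ctau * kappa * xiN 1 z x i)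
  (app e vform * dz 1 Zf (z + lin vform x) (tm x) + e Ctau * kappa * dz 1 Nf (z + lin vform x) (tm x)) 0
  (kappa * ((\<Sum>i\<in>UNIV - {Vlast}. app e (xi i) * xiN 1 z x i) - app e vform * dz 1 Nf (z + lin vform x) (tm x))
   + e Ctau * kappa * kappa * ((\<Sum>i\<in>UNIV - {Vlast}. xiM z x i) - of_nat CARD('n) * Mf z (tm x) - Mf (z + lin vform x) (tm x))) a) x"
proof -
 note g = Lam_domD[OF x]
 let ?I = "UNIV - {Vlast} :: 'n ambient set"
 have zi: "has_partial a (%x. xiZ 0 z x i) (xi i a * xiZ 1 z x i + (if a = Ctau then kappa * xiN 1 z x i else 0)) x" if "i : ?I" for i
  using has_partial_Zf[OF g(4) xi_tau(1), of i a 0] that by (cases "a = Ctau") simp_all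
 have zv: "has_partial a (%x. Zf (z + lin vform x) (tm x)) (vform a * dz 1 Zf (z + lin vform x) (tm x) + (if a = Ctau then kappa * dz 1 Nf (z + lin vform x) (tm x) else 0)) x"
  using has_partial_Zf[OF g(3) vform_tau(1), of a 0] by (cases "a = Ctau") simp_all
 have ni: "has_partial a (%x. xiN 0 z x i) (xi i a * xiN 1 z x i + (if a = Ctau then kappa * xiM z x i else 0)) x" if "i : ?I" for i
  using has_partial_Nf[OF g(4) xi_tau(1), of i a 0] that by (cases "a = Ctau") simp_all
 have nv: "has_partial a (%x. Nf (z + lin vform x) (tm x)) (vform a * dz 1 Nf (z + lin vform x) (tm x) + (if a = Ctau then kappa * Mf (z + lin vform x) (tm x) else 0)) x"
  using has_partial_Nf[OF g(3) vform_tau(1), of a 0] by (cases "a = Ctau") simp_all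
 have n0: "has_partial a (%x. Nf z (tm x)) (if a = Ctau then kappa * Mf z (tm x) else 0) x"
  using has_partial_Nf[of z "%_. 0" x a 0] g(2) by (cases "a = Ctau") (simp_all add: lin_zero)
 have "has_partial a (Lam_dlog e z)
  ((\<Sum>i\<in>?I. app e (xi i) * (xi i a * xiZ 1 z x i + (if a = Ctau then kappa * xiN 1 z x i else 0)))
   - app e vform * (vform a * dz 1 Zf (z + lin vform x) (tm x) + (if a = Ctau then kappa * dz 1 Nf (z + lin vform x) (tm x) else 0))
   + 0 + e Ctau * (kappa * ((\<Sum>i\<in>?I. xi i a * xiN 1 z x i + (if a = Ctau then kappa * xiM z x i else 0))
    - of_nat CARD('n) * (if a = Ctau then kappa * Mf z (tm x) else 0)
    - (vform a * dz 1 Nf (z + lin vform x) (tm x) + (if a = Ctau then kappa * Mf (z + lin vform x) (tm x) else 0))))) x"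
  unfolding Lam_dlog_def[abs_def] Lam_tau_def
  by (intro has_partial_add has_partial_diff has_partial_sum has_partial_cmult has_partial_const zi zv ni nv n0)
 thus ?thesis
  by (rule back_subst[where P="%D. has_partial a (Lam_dlog e z) D x"])
   (cases "a = Ctau", simp_all add: form_def sum.distrib sum_distrib_left algebra_simps)
qed

definition log_deriv :: "(complex => complex) => complex => complex => bool" where
 "log_deriv f L s \<longleftrightarrow> (f hfd f s * L) (at s)"

lemma log_deriv_mult: "log_deriv f L s ==> log_deriv g M s ==> log_deriv (%s. f s * g s) (L + M) s"
 unfolding log_deriv_def by (auto intro!: derivative_eq_intros simp: algebra_simps)

lemma log_deriv_inverse: "log_deriv f L s ==> f s ~= 0 ==> log_deriv (%s. 1 / f s) (- L) s"
 unfolding log_deriv_def by (auto intro!: derivative_eq_intros)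

lemma log_deriv_const: "log_deriv (%s. c) 0 s"
 unfolding log_deriv_def by simp

lemma log_deriv_prod: "(!!i. i : I ==> log_deriv (f i) (L i) s) ==> log_deriv (%s. \<Prod>i\<in>I. f i s) (\<Sum>i\<in>I. L i) s"
 by (induction I rule: infinite_finite_induct) (auto intro: log_deriv_mult log_deriv_const)

lemma log_deriv_power: "log_deriv f L s ==> log_deriv (%s. f s ^ k) (of_nat k * L) s"
 using log_deriv_prod[of "{..<k}" "%_. f" "%_. L" s] by simp

lemma log_deriv_theta: "gpt (z + b) tau ==> log_deriv (%z. theta 0 (z + b) tau) (Zf (z + b) tau) z"
 using DERIV_shift[of "%w. theta 0 w tau" "theta 1 (z + b) tau" z b] theta_deriv_z[of tau 0 "z + b"]
 by (simp add: log_deriv_def gpt_theta Zf_def theta_ratio_def)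

lemma Lam_deriv:
 fixes x :: "('n::finite) point"
 assumes x: "x : Lam_dom z"
 shows "((%z. Lam z x) hfd Lam z x * Lam_log z x) (at z)"
proof -
 note g = Lam_domD[OF x]
 have t0: "log_deriv (%z. theta 0 z (tm x)) (Zf z (tm x)) z"
  using log_deriv_theta[of z 0] g(2) by simp
 have tv: "log_deriv (%z. theta 0 (z + Vscaled x) (tm x)) (Zf (z + lin vform x) (tm x)) z"
  using log_deriv_theta g(3) by (simp add: lin_vform)
 have "log_deriv (%z. Lam z x) (0 + (\<Sum>i\<in>UNIV - {Vlast}. Zf (z + lin (xi i) x) (tm x)) + - (of_nat CARD('n) * Zf z (tm x) + Zf (z + lin vform x) (tm x))) z"
  unfolding Lam_def by (intro log_deriv_mult log_deriv_inverse log_deriv_prod log_deriv_theta log_deriv_const log_deriv_power t0 tv)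
   (use g in \<open>auto simp: gpt_theta lin_vform\<close>)
 thus ?thesis unfolding log_deriv_def Lam_log_def by (simp add: algebra_simps)
qed

lemma Lam_dlog_deriv:
 fixes x :: "('n::finite) point"
 assumes x: "x : Lam_dom z"
 shows "((%z. Lam_dlog e z x) hfd Lam_dlog' e z x) (at z)"
proof -
 note g = Lam_domD[OF x]
 have Z: "((%z. dz 0 Zf (z + b) (tm x)) hfd dz 1 Zf (z + b) (tm x)) (at z)"
  and N: "((%z. dz 0 Nf (z + b) (tm x)) hfd dz 1 Nf (z + b) (tm x)) (at z)" if "gpt (z + b) (tm x)" for b
  using DERIV_shift[of "%w. Zf w (tm x)" _ z b] DERIV_shift[of "%w. Nf w (tm x)" _ z b] Zf_deriv_z[OF that] Nf_deriv_z[OF that] by auto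
 have "((%z. Lam_dlog e z x) hfd (\<Sum>i\<in>UNIV - {Vlast}. app e (xi i) * xiZ 1 z x i) - app e vform * dz 1 Zf (z + lin vform x) (tm x) + 0
  + e Ctau * (kappa * ((\<Sum>i\<in>UNIV - {Vlast}. xiN 1 z x i) - of_nat CARD('n) * dz 1 Nf z (tm x) - dz 1 Nf (z + lin vform x) (tm x)))) (at z)"
  unfolding Lam_dlog_def Lam_tau_def
  by (intro DERIV_add DERIV_diff DERIV_sum DERIV_cmult DERIV_const Z N Z[of "lin vform x", unfolded dz_0] N[of "lin vform x", unfolded dz_0] Nf_deriv_z g) auto
 thus ?thesis by (simp add: Lam_dlog'_def)
qed

lemma dir_Lam_deriv:
 fixes x :: "('n::finite) point"
 assumes x: "x : Lam_dom z"
 shows "((%z. dir e (Lam z) x) hfd Lam z x * (Lam_log z x * Lam_dlog e z x + Lam_dlog' e z x)) (at z)"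
proof -
 have "((%z. Lam z x * Lam_dlog e z x) hfd Lam z x * (Lam_log z x * Lam_dlog e z x + Lam_dlog' e z x)) (at z)"
  using DERIV_mult[OF Lam_deriv[OF x] Lam_dlog_deriv[OF x, of e]] by (simp add: algebra_simps)
 moreover have "\<forall>\<^sub>F w in nhds z. dir e (Lam w) x = Lam w x * Lam_dlog e w x"
  using eventually_Lam_dom[OF x] by eventually_elim (rule dir_Lam)
 ultimately show ?thesis by (simp add: DERIV_cong_ev)
qed

section \<open>Closed forms for the pairings of the generating quotient\<close>

lemma form_zero: "form (%_. 0) (- 1) 0 0 = vform"
 by (simp add: form_def fun_eq_iff)

text \<open>\<open>vform\<close> is itself of the shape \<open>form\<close>, with
  \<open>c = 0\<close> and \<open>d = - 1\<close>, so \<open>bil_form\<close> applies to it.\<close>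

lemma bil_Lam_vform:
 fixes x :: "('n::finite) point"
 assumes x: "x : Lam_dom z"
 shows "bil (grad (Lam z) x) vform = Lam z x * (Zf (z + lin vform x) (tm x) - Zf z (tm x)) - Lam z x * Lam_log z x / of_nat CARD('n)"
proof -
 have n: "(of_nat CARD('n) :: complex) ~= 0" by simp
 have "bil (grad (Lam z) x) vform = Lam z x * bil (form (xiZ 0 z x) (Zf (z + lin vform x) (tm x)) (- 2 * of_real pi * \<i>) (kappa * Lam_tau z x)) (form (%_. 0) (- 1) 0 0)"
  by (simp only: partial_Lam[OF x] bil_scale_left form_zero)
 also have "... = Lam z x * (Zf (z + lin vform x) (tm x) - Zf z (tm x)) - Lam z x * Lam_log z x / of_nat CARD('n)"
  unfolding bil_form using n by (simp add: Lam_log_def field_simps)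
 finally show ?thesis .
qed

lemma partial_Lam_u: "x : Lam_dom z ==> partial Cu (Lam z) x = - 2 * of_real pi * \<i> * Lam z x"
 by (simp add: partial_Lam form_def)

text \<open>The u-component of a logarithmic gradient times the heat constant. The value -1/2 makes
  the cross terms of u and tau produce the half-sums of \<open>Nf\<close> that occur in
  \<open>theta_addition_0\<close>.\<close>

lemma two_pi_i_heat: "- 2 * of_real pi * \<i> * kappa = - 1 / 2"
 by (simp add: kappa_def field_simps)

text \<open>The arguments of corresponding theta factors in z and in w always differ by
  \<open>z - w\<close>, for the factors at the \<open>xi i\<close>, at v and at 0 alike, so one
  identity applies to all of them.\<close>

lemma good_sum_theta_addition:
 fixes x :: "('n::finite) point"
 assumes z: "x : Lam_dom z" and w: "x : Lam_dom w" and d: "gpt (z - w) (tm x)"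
  and F: "!!a b. gpt a (tm x) ==> gpt b (tm x) ==> a - b = z - w ==> F a b = (G a b :: complex)"
 shows "(\<Sum>i\<in>UNIV - {Vlast}. c i * F (z + lin (xi i) x) (w + lin (xi i) x)) = (\<Sum>i\<in>UNIV - {Vlast}. c i * G (z + lin (xi i) x) (w + lin (xi i) x))"
  "F (z + lin vform x) (w + lin vform x) = G (z + lin vform x) (w + lin vform x)" "F z w = G z w"
 using Lam_domD[OF z] Lam_domD[OF w] by (auto intro!: sum.cong F)

text \<open>The addition theorem is used n + 1 times for the numerator (\<open>S\<close>), once for
  the factor at \<open>z + v\<close> (\<open>V\<close>) and n times for the factor at z
  (\<open>Z\<close>), the latter two with the opposite sign, so the constant K cancels.
  \<open>P\<close>, \<open>A\<close>, \<open>B\<close>, \<open>NA\<close>, \<open>NB\<close> are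
  sums over the numerator factors.\<close>

lemma bil_Lam_Lam_algebra:
 fixes n :: complex
 assumes n: "n ~= 0"
  and S: "P - (NA + NB) / 2 = - Zd * (A - B) + (n + 1) * K"
  and V: "av * bv - (nav + nbv) / 2 = - Zd * (av - bv) + K"
  and Z: "zz * zw - (nz + nw) / 2 = - Zd * (zz - zw) + K"
  and L: "L = A - n * zz - av" and L': "L' = B - n * zw - bv"
 shows "- (NB - n * nw - nbv) / 2 - (NA - n * nz - nav) / 2 + P - (A - av) * (B - bv) / n - av * bv
  = - (Zd + zw) * L + (Zd - zz) * L' - L * L' / n"
proof -
 have "(A - av) * (B - bv) / n = L * L' / n + L * zw + zz * L' + n * (zz * zw)"
  using n unfolding L L' by (simp add: field_simps)
 moreover have "- (NB - n * nw - nbv) / 2 - (NA - n * nz - nav) / 2 + P - av * bv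
  = (P - (NA + NB) / 2) - (av * bv - (nav + nbv) / 2) - n * (zz * zw - (nz + nw) / 2) + n * (zz * zw)"
  by (simp add: field_simps)
 ultimately have "- (NB - n * nw - nbv) / 2 - (NA - n * nz - nav) / 2 + P - (A - av) * (B - bv) / n - av * bv
  = (- Zd * (A - B) + (n + 1) * K) - (- Zd * (av - bv) + K) - n * (- Zd * (zz - zw) + K)
   - (L * L' / n + L * zw + zz * L')"
  unfolding S V Z by (simp add: algebra_simps)
 also have "... = - Zd * (L - L') - (L * L' / n + L * zw + zz * L')"
  unfolding L L' by (simp add: algebra_simps)
 finally show ?thesis by (simp add: algebra_simps)
qed

lemma bil_Lam_Lam:
 fixes x :: "('n::finite) point"
 assumes z: "x : Lam_dom z" and w: "x : Lam_dom w" and d: "gpt (z - w) (tm x)"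
 shows "bil (grad (Lam z) x) (grad (Lam w) x) = Lam z x * Lam w x *
  (- (Zf (z - w) (tm x) + Zf w (tm x)) * Lam_log z x + (Zf (z - w) (tm x) - Zf z (tm x)) * Lam_log w x
  - Lam_log z x * Lam_log w x / of_nat CARD('n))"
proof -
 let ?t = "x $ Ctau"
 let ?I = "UNIV - {Vlast} :: 'n ambient set"
 define n where "n = (of_nat CARD('n) :: complex)"
 have n: "n ~= 0" by (simp add: n_def)
 define K where "K = (Nf (z - w) ?t - theta_const ?t) / 2"
 have th: "Zf a ?t * Zf b ?t - (Nf a ?t + Nf b ?t) / 2 = - Zf (z - w) ?t * (Zf a ?t - Zf b ?t) + K"
  if "gpt a ?t" "gpt b ?t" "a - b = z - w" for a b
  using theta_addition_0[OF that(1,2)] d that(3) by (simp add: K_def)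
 note sums = good_sum_theta_addition[OF z w d, where F="%a b. Zf a ?t * Zf b ?t - (Nf a ?t + Nf b ?t) / 2"
   and G="%a b. - Zf (z - w) ?t * (Zf a ?t - Zf b ?t) + K", OF th]
 have "(\<Sum>i\<in>?I. xiZ 0 z x i * xiZ 0 w x i) - ((\<Sum>i\<in>?I. xiN 0 z x i) + (\<Sum>i\<in>?I. xiN 0 w x i)) / 2
  = - Zf (z - w) ?t * ((\<Sum>i\<in>?I. xiZ 0 z x i) - (\<Sum>i\<in>?I. xiZ 0 w x i)) + (n + 1) * K"
 proof -
  have "(\<Sum>i\<in>?I. xiZ 0 z x i * xiZ 0 w x i) - ((\<Sum>i\<in>?I. xiN 0 z x i) + (\<Sum>i\<in>?I. xiN 0 w x i)) / 2
   = (\<Sum>i\<in>?I. xiZ 0 z x i * xiZ 0 w x i - (xiN 0 z x i + xiN 0 w x i) / 2)"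
   by (simp add: sum_subtractf sum.distrib sum_divide_distrib[symmetric])
  also have "... = (\<Sum>i\<in>?I. - Zf (z - w) ?t * (xiZ 0 z x i - xiZ 0 w x i) + K)"
   using sums(1)[of "%_. 1"] by (simp only: dz_0 mult_1)
  also have "... = - Zf (z - w) ?t * ((\<Sum>i\<in>?I. xiZ 0 z x i) - (\<Sum>i\<in>?I. xiZ 0 w x i)) + of_nat (card ?I) * K"
   by (simp only: sum.distrib sum_subtractf[symmetric] sum_distrib_left sum_constant)
  finally show ?thesis unfolding card_ambient n_def .
 qed
 from bil_Lam_Lam_algebra[OF n this sums(2) sums(3) refl refl]
 have E: "- Lam_tau w x / 2 - Lam_tau z x / 2 + (\<Sum>i\<in>?I. xiZ 0 z x i * xiZ 0 w x i)
   - ((\<Sum>i\<in>?I. xiZ 0 z x i) - Zf (z + lin vform x) ?t) * ((\<Sum>i\<in>?I. xiZ 0 w x i) - Zf (w + lin vform x) ?t) / n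
   - Zf (z + lin vform x) ?t * Zf (w + lin vform x) ?t
  = - (Zf (z - w) ?t + Zf w ?t) * Lam_log z x + (Zf (z - w) ?t - Zf z ?t) * Lam_log w x - Lam_log z x * Lam_log w x / n"
  by (simp only: Lam_tau_def Lam_log_def n_def)
 have h: "- 2 * of_real pi * \<i> * (kappa * y) = - y / 2" for y
  using two_pi_i_heat by (metis mult.assoc mult_minus_left mult_1 times_divide_eq_left)
 have "bil (grad (Lam z) x) (grad (Lam w) x) = Lam z x * (Lam w x * bil
   (form (xiZ 0 z x) (Zf (z + lin vform x) (tm x)) (- 2 * of_real pi * \<i>) (kappa * Lam_tau z x))
   (form (xiZ 0 w x) (Zf (w + lin vform x) (tm x)) (- 2 * of_real pi * \<i>) (kappa * Lam_tau w x)))"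
  by (simp only: partial_Lam[OF z] partial_Lam[OF w] bil_scale_left bil_scale_right)
 also have "... = Lam z x * Lam w x * (- Lam_tau w x / 2 - Lam_tau z x / 2 + (\<Sum>i\<in>?I. xiZ 0 z x i * xiZ 0 w x i)
   - ((\<Sum>i\<in>?I. xiZ 0 z x i) - Zf (z + lin vform x) ?t) * ((\<Sum>i\<in>?I. xiZ 0 w x i) - Zf (w + lin vform x) ?t) / n
   - Zf (z + lin vform x) ?t * Zf (w + lin vform x) ?t)"
  unfolding bil_form h mult.commute[of "kappa * _"] n_def by (simp add: algebra_simps)
 finally show ?thesis unfolding E unfolding n_def .
qed

text \<open>The same cancellation one derivative further: \<open>D\<close> occurs n + 1 times with
  each sign. The term \<open>n1d / 2 * ev\<close> drops out because the weights
  \<open>app e (xi i)\<close> sum to \<open>ev\<close>, the weight of the factor at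
  \<open>z + v\<close>.\<close>

lemma bil_Lam_dlog_algebra:
 fixes n :: complex
 assumes n: "n ~= 0"
  and S1: "Q1 - E1 / 2 = z1d * (SA - SB) + zd * C1 - n1d / 2 * ev"
  and V1: "av * z1v - n1v / 2 = z1d * (av - bv) + zd * z1v - n1d / 2"
  and S2: "Q2 - SM / 2 = zd * C2 + z1d * (NA - NB) - n1d * A + (n + 1) * D"
  and V2: "av * n1v - mv / 2 = zd * n1v + z1d * (nav - nbv) - n1d * av + D"
  and Z2: "zz * n1w - mw / 2 = zd * n1w + z1d * (nz - nw) - n1d * zz + D"
  and L: "L = A - n * zz - av"
 shows "- (E1 - ev * n1v) / 2 - k * et / 2 * (SM - n * mw - mv) + (Q1 + k * et * Q2)
  - (A - av) * (C1 + k * et * C2 - (ev * z1v + et * k * n1v)) / n - av * (ev * z1v + et * k * n1v)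
  = z1d * ((SA - ev * av + eu + et * (k * (NA - n * nz - nav))) - (SB - ev * bv + eu + et * (k * (NB - n * nw - nbv))))
   + (zd - zz - L / n) * (C1 - ev * z1v + et * (k * (C2 - n * n1w - n1v))) - k * (n1d + n1w) * L * et"
proof -
 have AL: "(A - av) * y / n = L * y / n + zz * y" for y using n unfolding L by (simp add: field_simps)
 have "- (E1 - ev * n1v) / 2 - k * et / 2 * (SM - n * mw - mv) + (Q1 + k * et * Q2) - av * (ev * z1v + et * k * n1v)
  = (Q1 - E1 / 2) - ev * (av * z1v - n1v / 2) + k * et * ((Q2 - SM / 2) - (av * n1v - mv / 2) - n * (zz * n1w - mw / 2)) + k * et * n * zz * n1w"
  by (simp add: field_simps)
 also have "... = (z1d * (SA - SB) + zd * C1 - n1d / 2 * ev) - ev * (z1d * (av - bv) + zd * z1v - n1d / 2)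
  + k * et * ((zd * C2 + z1d * (NA - NB) - n1d * A + (n + 1) * D) - (zd * n1v + z1d * (nav - nbv) - n1d * av + D)
    - n * (zd * n1w + z1d * (nz - nw) - n1d * zz + D)) + k * et * n * zz * n1w"
  unfolding S1 V1 S2 V2 Z2 ..
 also have "... = z1d * ((SA - ev * av + et * (k * (NA - n * nz - nav))) - (SB - ev * bv + et * (k * (NB - n * nw - nbv))))
   + zd * (C1 - ev * z1v + et * (k * (C2 - n * n1w - n1v))) - k * et * n1d * L + k * et * n * zz * n1w"
  unfolding L by (simp add: field_simps)
 finally have *: "- (E1 - ev * n1v) / 2 - k * et / 2 * (SM - n * mw - mv) + (Q1 + k * et * Q2) - av * (ev * z1v + et * k * n1v)
  = z1d * ((SA - ev * av + et * (k * (NA - n * nz - nav))) - (SB - ev * bv + et * (k * (NB - n * nw - nbv))))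
   + zd * (C1 - ev * z1v + et * (k * (C2 - n * n1w - n1v))) - k * et * n1d * L + k * et * n * zz * n1w" .
 define X where "X = - (E1 - ev * n1v) / 2 - k * et / 2 * (SM - n * mw - mv) + (Q1 + k * et * Q2) - av * (ev * z1v + et * k * n1v)"
 define Y where "Y = C1 + k * et * C2 - (ev * z1v + et * k * n1v)"
 define DL where "DL = C1 - ev * z1v + et * (k * (C2 - n * n1w - n1v))"
 define q where "q = L / n"
 define R where "R = z1d * ((SA - ev * av + et * (k * (NA - n * nz - nav))) - (SB - ev * bv + et * (k * (NB - n * nw - nbv))))"
 have X: "X = R + zd * DL - k * et * n1d * L + k * et * n * zz * n1w" using * by (simp only: X_def R_def DL_def)
 have Y: "Y = DL + k * et * n * n1w" by (simp add: Y_def DL_def algebra_simps)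
 have LY: "L * Y / n = q * DL + L * (k * et * n1w)" unfolding Y using n by (simp add: q_def field_simps)
 have "- (E1 - ev * n1v) / 2 - k * et / 2 * (SM - n * mw - mv) + (Q1 + k * et * Q2)
  - (A - av) * (C1 + k * et * C2 - (ev * z1v + et * k * n1v)) / n - av * (ev * z1v + et * k * n1v) = X - (A - av) * Y / n"
  by (simp only: X_def Y_def diff_diff_eq) (simp only: add.commute)
 also have "... = R + (zd - zz - q) * DL - k * (n1d + n1w) * L * et"
  unfolding AL LY X by (simp add: Y algebra_simps)
 finally show ?thesis unfolding R_def q_def DL_def by simp
qed

lemma bil_Lam_dlog:
 fixes x :: "('n::finite) point"
 assumes z: "x : Lam_dom z" and w: "x : Lam_dom w" and d: "gpt (z - w) (tm x)"
 shows "bil (grad (Lam z) x) (grad (Lam_dlog e w) x) = Lam z x *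
  (dz 1 Zf (z - w) (tm x) * (Lam_dlog e z x - Lam_dlog e w x)
  + (Zf (z - w) (tm x) - Zf z (tm x) - Lam_log z x / of_nat CARD('n)) * Lam_dlog' e w x
  - kappa * (dz 1 Nf (z - w) (tm x) + dz 1 Nf w (tm x)) * Lam_log z x * e Ctau)"
proof -
 let ?t = "x $ Ctau"
 let ?I = "UNIV - {Vlast} :: 'n ambient set"
 define n where "n = (of_nat CARD('n) :: complex)"
 have n: "n ~= 0" by (simp add: n_def)
 define ev et where "ev = app e vform" and "et = e Ctau"
 define D where "D = dz 2 Nf (z - w) ?t / 2 + dz 1 Zf (z - w) ?t * (Nf (z - w) ?t - theta_const ?t)"
 have th1: "Zf a ?t * dz 1 Zf b ?t - dz 1 Nf b ?t / 2 = dz 1 Zf (z - w) ?t * (Zf a ?t - Zf b ?t) + Zf (z - w) ?t * dz 1 Zf b ?t - dz 1 Nf (z - w) ?t / 2"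
  if "gpt a ?t" "gpt b ?t" "a - b = z - w" for a b
 proof -
  have "Zf a ?t * dz 1 Zf b ?t - dz 1 Nf b ?t / 2 = (Zf a ?t - Zf b ?t) * dz 1 Zf b ?t - dz 2 Zf b ?t / 2"
   unfolding Nf_dz1[OF that(2)] by (simp add: field_simps)
  thus ?thesis using theta_addition_1[OF that(1,2)] d that(3) by (simp only:)
 qed
 have th2: "Zf a ?t * dz 1 Nf b ?t - Mf b ?t / 2 = Zf (z - w) ?t * dz 1 Nf b ?t + dz 1 Zf (z - w) ?t * (Nf a ?t - Nf b ?t) - dz 1 Nf (z - w) ?t * Zf a ?t + D"
  if "gpt a ?t" "gpt b ?t" "a - b = z - w" for a b
 proof -
  have "Zf a ?t * dz 1 Nf b ?t - Mf b ?t / 2 = (Zf a ?t - Zf b ?t) * dz 1 Nf b ?t - dz 2 Nf b ?t / 2"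
   unfolding Mf_def by (simp add: field_simps)
  thus ?thesis using theta_addition_2[OF that(1,2)] d that(3) by (simp only: D_def)
 qed
 note s1 = good_sum_theta_addition[OF z w d, where F="%a b. Zf a ?t * dz 1 Zf b ?t - dz 1 Nf b ?t / 2", OF th1]
 note s2 = good_sum_theta_addition[OF z w d, where F="%a b. Zf a ?t * dz 1 Nf b ?t - Mf b ?t / 2", OF th2]
 define c where "c i = app e (xi i)" for i :: "'n ambient"
 have cs: "sum c ?I = ev" unfolding c_def ev_def by (rule sum_app_xi)
 have S1: "(\<Sum>i\<in>?I. c i * (xiZ 0 z x i * xiZ 1 w x i)) - (\<Sum>i\<in>?I. c i * xiN 1 w x i) / 2
  = dz 1 Zf (z - w) ?t * ((\<Sum>i\<in>?I. c i * xiZ 0 z x i) - (\<Sum>i\<in>?I. c i * xiZ 0 w x i)) + Zf (z - w) ?t * (\<Sum>i\<in>?I. c i * xiZ 1 w x i) - dz 1 Nf (z - w) ?t / 2 * ev"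
 proof -
  have "(\<Sum>i\<in>?I. c i * (xiZ 0 z x i * xiZ 1 w x i)) - (\<Sum>i\<in>?I. c i * xiN 1 w x i) / 2
   = (\<Sum>i\<in>?I. c i * (xiZ 0 z x i * xiZ 1 w x i - xiN 1 w x i / 2))"
   by (simp add: right_diff_distrib sum_subtractf sum_divide_distrib)
  also have "... = (\<Sum>i\<in>?I. c i * (dz 1 Zf (z - w) ?t * (xiZ 0 z x i - xiZ 0 w x i) + Zf (z - w) ?t * xiZ 1 w x i - dz 1 Nf (z - w) ?t / 2))"
   using s1(1)[of c] by (simp only: dz_0)
  also have "... = dz 1 Zf (z - w) ?t * ((\<Sum>i\<in>?I. c i * xiZ 0 z x i) - (\<Sum>i\<in>?I. c i * xiZ 0 w x i)) + Zf (z - w) ?t * (\<Sum>i\<in>?I. c i * xiZ 1 w x i) - dz 1 Nf (z - w) ?t / 2 * sum c ?I"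
   by (simp add: ring_distribs sum.distrib sum_subtractf sum_distrib_left sum_distrib_right mult_ac)
  finally show ?thesis unfolding cs .
 qed
 have S2: "(\<Sum>i\<in>?I. xiZ 0 z x i * xiN 1 w x i) - (\<Sum>i\<in>?I. xiM w x i) / 2
  = Zf (z - w) ?t * (\<Sum>i\<in>?I. xiN 1 w x i) + dz 1 Zf (z - w) ?t * ((\<Sum>i\<in>?I. xiN 0 z x i) - (\<Sum>i\<in>?I. xiN 0 w x i)) - dz 1 Nf (z - w) ?t * (\<Sum>i\<in>?I. xiZ 0 z x i) + (n + 1) * D"
 proof -
  have "(\<Sum>i\<in>?I. xiZ 0 z x i * xiN 1 w x i) - (\<Sum>i\<in>?I. xiM w x i) / 2 = (\<Sum>i\<in>?I. xiZ 0 z x i * xiN 1 w x i - xiM w x i / 2)"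
   by (simp add: sum_subtractf sum_divide_distrib)
  also have "... = (\<Sum>i\<in>?I. Zf (z - w) ?t * xiN 1 w x i + dz 1 Zf (z - w) ?t * (xiN 0 z x i - xiN 0 w x i) - dz 1 Nf (z - w) ?t * xiZ 0 z x i + D)"
   using s2(1)[of "%_. 1"] by (simp only: dz_0 mult_1)
  also have "... = Zf (z - w) ?t * (\<Sum>i\<in>?I. xiN 1 w x i) + dz 1 Zf (z - w) ?t * ((\<Sum>i\<in>?I. xiN 0 z x i) - (\<Sum>i\<in>?I. xiN 0 w x i)) - dz 1 Nf (z - w) ?t * (\<Sum>i\<in>?I. xiZ 0 z x i) + of_nat (card ?I) * D"
   by (simp add: ring_distribs sum.distrib sum_subtractf sum_distrib_left)
  finally show ?thesis unfolding card_ambient n_def .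
 qed
 note alg = bil_Lam_dlog_algebra[where k=kappa and et=et and eu="e Cu * (- 2 * of_real pi * \<i>)", OF n S1 s1(2) S2 s2(2) s2(3) refl]
 have h: "- 2 * of_real pi * \<i> * (kappa * y) = - y / 2" for y
  using two_pi_i_heat by (metis mult.assoc mult_minus_left mult_1 times_divide_eq_left)
 let ?c = "%i. c i * xiZ 1 w x i + et * kappa * xiN 1 w x i"
 let ?d = "ev * dz 1 Zf (w + lin vform x) ?t + et * kappa * dz 1 Nf (w + lin vform x) ?t"
 let ?T = "kappa * ((\<Sum>i\<in>?I. c i * xiN 1 w x i) - ev * dz 1 Nf (w + lin vform x) ?t)
   + et * kappa * kappa * ((\<Sum>i\<in>?I. xiM w x i) - n * Mf w ?t - Mf (w + lin vform x) ?t)"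
 have uT': "- 2 * of_real pi * \<i> * (kappa * T + et * kappa * kappa * T') = - T / 2 - kappa * et / 2 * T'" for T T'
 proof -
  have eq: "kappa * T + et * kappa * kappa * T' = kappa * (T + et * kappa * T')" by (simp add: algebra_simps)
  show ?thesis unfolding eq h by (simp add: field_simps)
 qed
 have uT: "- 2 * of_real pi * \<i> * ?T = - ((\<Sum>i\<in>?I. c i * xiN 1 w x i) - ev * dz 1 Nf (w + lin vform x) ?t) / 2
   - kappa * et / 2 * ((\<Sum>i\<in>?I. xiM w x i) - n * Mf w ?t - Mf (w + lin vform x) ?t)"
  by (rule uT')
 have cc: "(\<Sum>i\<in>?I. xiZ 0 z x i * ?c i) = (\<Sum>i\<in>?I. c i * (xiZ 0 z x i * xiZ 1 w x i)) + kappa * et * (\<Sum>i\<in>?I. xiZ 0 z x i * xiN 1 w x i)"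
  by (simp add: ring_distribs sum.distrib sum_distrib_left mult_ac)
 have sc: "sum ?c ?I = (\<Sum>i\<in>?I. c i * xiZ 1 w x i) + kappa * et * (\<Sum>i\<in>?I. xiN 1 w x i)"
  by (simp add: sum.distrib sum_distrib_left mult_ac)
 have "grad (Lam_dlog e w) x = form ?c ?d 0 ?T"
  by (rule ext, rule has_partialD, unfold c_def ev_def et_def n_def, rule has_partial_Lam_dlog[OF w])
 hence "bil (grad (Lam z) x) (grad (Lam_dlog e w) x) = Lam z x * bil
   (form (xiZ 0 z x) (Zf (z + lin vform x) (tm x)) (- 2 * of_real pi * \<i>) (kappa * Lam_tau z x)) (form ?c ?d 0 ?T)"
  by (simp only: partial_Lam[OF z] bil_scale_left)
 also have "bil (form (xiZ 0 z x) (Zf (z + lin vform x) (tm x)) (- 2 * of_real pi * \<i>) (kappa * Lam_tau z x)) (form ?c ?d 0 ?T)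
  = - ((\<Sum>i\<in>?I. c i * xiN 1 w x i) - ev * dz 1 Nf (w + lin vform x) ?t) / 2
   - kappa * et / 2 * ((\<Sum>i\<in>?I. xiM w x i) - n * Mf w ?t - Mf (w + lin vform x) ?t)
   + ((\<Sum>i\<in>?I. c i * (xiZ 0 z x i * xiZ 1 w x i)) + kappa * et * (\<Sum>i\<in>?I. xiZ 0 z x i * xiN 1 w x i))
   - ((\<Sum>i\<in>?I. xiZ 0 z x i) - Zf (z + lin vform x) ?t) * ((\<Sum>i\<in>?I. c i * xiZ 1 w x i) + kappa * et * (\<Sum>i\<in>?I. xiN 1 w x i) - ?d) / n
   - Zf (z + lin vform x) ?t * ?d"
  unfolding bil_form uT cc sc n_def[symmetric] by simp
 also have "... = dz 1 Zf (z - w) ?t * (Lam_dlog e z x - Lam_dlog e w x)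
  + (Zf (z - w) ?t - Zf z ?t - Lam_log z x / n) * Lam_dlog' e w x
  - kappa * (dz 1 Nf (z - w) ?t + dz 1 Nf w ?t) * Lam_log z x * et"
  unfolding Lam_dlog_def Lam_dlog'_def Lam_tau_def Lam_log_def n_def[symmetric] ev_def[symmetric] et_def[symmetric] c_def[symmetric] dz_0
  using alg unfolding dz_0 .
 finally show ?thesis unfolding n_def et_def .
qed

section \<open>The partial fraction expansion and its first and second derivatives\<close>

lemma higher_deriv_recip: "z ~= 0 ==> (deriv ^^ m) (%z. 1 / z) z = (- 1) ^ m * fact m / z ^ Suc m" for z :: complex
proof (induction m arbitrary: z)
 case (Suc m)
 have "\<forall>\<^sub>F w in nhds z. w ~= 0" using Suc.prems by (rule t1_space_nhds)
 hence "deriv ((deriv ^^ m) (%z. 1 / z)) z = deriv (%w. (- 1) ^ m * fact m / w ^ Suc m) z"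
  by (intro deriv_cong_ev) (auto elim!: eventually_mono simp: Suc.IH)
 also have "(%w. (- 1) ^ m * fact m / w ^ Suc m) = (%w :: complex. ((- 1) ^ m * fact m) * inverse (w ^ Suc m))"
  by (simp only: divide_inverse)
 also have "deriv ... z = ((- 1) ^ m * fact m) * - (inverse (z ^ Suc m) * (of_nat (Suc m) * z ^ m) * inverse (z ^ Suc m))"
  using DERIV_power[OF DERIV_ident, of "Suc m" z UNIV] Suc.prems
  by (intro DERIV_imp_deriv DERIV_cmult DERIV_inverse') (simp_all del: power_Suc of_nat_Suc)
 also have "... = (- 1) ^ Suc m * fact (Suc m) / z ^ Suc (Suc m)" using Suc.prems by (simp add: field_simps)
 finally show ?case by simp
qed simp

lemma dz_Zf_eq_Zreg:
 assumes g: "gpt z tau"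
 shows "dz m Zf z tau = (- 1) ^ m * fact m / z ^ Suc m + (deriv ^^ m) (%z. Zreg z tau) z"
proof -
 have t: "Im tau > 0" "z ~: lattice tau" using g by (auto simp: gpt_def)
 have z: "z ~= 0" "z ~: poles tau" using t(2) by (auto simp: poles_def)
 have "dz m Zf z tau = (deriv ^^ m) (%z. 1 / z + Zreg z tau) z"
  unfolding dz_def using eventually_good_z[OF g] by (intro higher_deriv_cong_ev) (auto elim!: eventually_mono simp: Zf_eq_Zreg)
 also have "... = (deriv ^^ m) (%z. 1 / z) z + (deriv ^^ m) (%z. Zreg z tau) z"
 proof (rule higher_deriv_add[where S="- insert 0 (poles tau)"])
  show "open (- insert 0 (poles tau))" using open_regular[OF t(1)] by (metis closed_insert closed_def)
  show "(%z. Zreg z tau) holo - insert 0 (poles tau)"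
   by (rule holomorphic_on_subset[OF Zreg_holomorphic[OF t(1)]]) auto
 qed (use z in \<open>auto intro!: holomorphic_intros\<close>)
 finally show ?thesis using higher_deriv_recip[OF z(1)] by simp
qed

lemma Zreg_higher_fps:
 assumes "Im tau > 0" shows "(%z. (deriv ^^ m) (%z. Zreg z tau) z) hfps fps_expansion ((deriv ^^ m) (%z. Zreg z tau)) 0"
proof (rule analytic_at_imp_has_fps_expansion_0)
 show "(deriv ^^ m) (%z. Zreg z tau) analytic_on {0}"
  using holomorphic_higher_deriv[OF Zreg_holomorphic[OF assms] open_regular[OF assms]] open_regular[OF assms] analytic_at regular_0 by blast
qed

text \<open>Chosen so that \<open>cfac k\<close> times the derivative of order \<open>k - 1\<close>
  of \<open>1/z\<close> is \<open>1/z^k\<close>.\<close>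

definition cfac :: "nat => complex" where
 "cfac k = (- 1) ^ (k - 1) / fact (k - 1)"

text \<open>The coefficient of \<open>\<phi>\<^sub>k\<close> (of \<open>t\<^sup>0\<close> for \<open>k = 0\<close>) in the partial fraction expansion, with \<open>v = (n + 1) v\<^sub>n\<^sub>+\<^sub>1\<close>;
 its principal part at 0 is \<open>1 / z\<^sup>k\<close>. The names of the derivatives list the variables \<open>v\<close> and \<open>tau\<close>.\<close>

definition fc :: "nat => complex => complex => complex => complex" where
 "fc k z v t = (if k = 0 then 1 else cfac k * dz (k - 1) Zf z t - (if k = 1 then Zf (z + v) t else 0))"

definition fcV :: "nat => complex => complex => complex => complex" where
 "fcV k z v t = - (if k = 1 then dz 1 Zf (z + v) t else 0)"

definition fcT :: "nat => complex => complex => complex => complex" where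
 "fcT k z v t = (if k = 0 then 0 else cfac k * (kappa * dz k Nf z t) - (if k = 1 then kappa * dz 1 Nf (z + v) t else 0))"

definition fcVV :: "nat => complex => complex => complex => complex" where
 "fcVV k z v t = - (if k = 1 then dz 2 Zf (z + v) t else 0)"

definition fcVT :: "nat => complex => complex => complex => complex" where
 "fcVT k z v t = - (if k = 1 then kappa * dz 2 Nf (z + v) t else 0)"

definition fcTT :: "nat => complex => complex => complex => complex" where
 "fcTT k z v t = (if k = 0 then 0 else cfac k * (kappa * (kappa * dz k Mf z t)) - (if k = 1 then kappa * (kappa * dz 1 Mf (z + v) t) else 0))"

lemma fc_derivs:
 assumes z: "gpt z t" and v: "gpt (z + v) t"
 shows "((%v. fc k z v t) hfd fcV k z v t) (at v)" (is ?A) "((%t. fc k z v t) hfd fcT k z v t) (at t)" (is ?B)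
  "((%v. fcV k z v t) hfd fcVV k z v t) (at v)" (is ?C) "((%t. fcV k z v t) hfd fcVT k z v t) (at t)" (is ?D)
  "((%v. fcT k z v t) hfd fcVT k z v t) (at v)" (is ?E) "((%t. fcT k z v t) hfd fcTT k z v t) (at t)" (is ?F)
proof -
 have sh: "((%v. dz j F (z + v) t) hfd dz (Suc j) F (z + v) t) (at v)" if "F : theta_ring" for j F
  using DERIV_shift[of "%w. dz j F w t" "dz (Suc j) F (z + v) t" v z] dz_deriv_z[OF that v] by (simp add: add.commute)
 note d = dz_Zf_deriv_tau[OF z] dz_Nf_deriv_tau[OF z] dz_Zf_deriv_tau[OF v] dz_Nf_deriv_tau[OF v] sh[OF Zf_ring] sh[OF Nf_ring]
 consider "k = 0" | "k = 1" | "k >= 2" by linarith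
 hence "?A & ?B & ?C & ?D & ?E & ?F" (is ?thesis)
 proof cases
  case 1
  thus ?thesis
   by (simp add: fc_def fcV_def fcT_def fcVV_def fcVT_def fcTT_def)
 next
  case 2
  have "cfac 1 = 1" by (simp add: cfac_def)
  with 2 d(1)[of 0] d(2)[of 1] d(3)[of 0] d(3)[of 1] d(4)[of 1] d(5)[of 0] d(5)[of 1] d(6)[of 1]
  show ?thesis
   by (simp add: fc_def fcV_def fcT_def fcVV_def fcVT_def fcTT_def eval_nat_numeral)
    (auto intro!: derivative_eq_intros)
 next
  case 3
  hence k: "Suc (k - 1) = k" "k ~= 0" "k ~= 1" by auto
  note e = DERIV_cmult[OF d(1)[of "k - 1"], of "cfac k"] DERIV_cmult[OF DERIV_cmult[OF d(2)[of k], of kappa], of "cfac k"]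
  show ?thesis
   using e k by (simp add: fc_def fcV_def fcT_def fcVV_def fcVT_def fcTT_def)
 qed
 thus ?A ?B ?C ?D ?E ?F by blast+
qed

context function_ring
begin

text \<open>The principal part of \<open>fc k\<close> is exactly \<open>1/z^k\<close>, and the
  constant terms of the regular parts are multiples of Taylor coefficients of \<open>Zreg\<close>
  and, for \<open>k = 1\<close>, also involve \<open>Z(v)\<close>. These are the only functions
  whose membership has to be known for the extraction.\<close>

lemma extract_coefficients:
 assumes gp: "!!x. x : D ==> gpt (v x) (t x)"
  and Zr: "!!m. (%x. (deriv ^^ m) (%z. Zreg z (t x)) 0) : R" and Zv: "(%x. Zf (v x) (t x)) : R"
  and F: "F : laurent" and eq: "!!x. x : D ==> \<forall>\<^sub>F z in at 0. (\<Sum>k\<le>n. fc k z (v x) (t x) * Y k x) = F z x" and k: "k <= n"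
 shows "Y k : R"
proof (rule laurent_extract[OF F, where f="%k z x. fc k z (v x) (t x)"])
 have t: "Im (t x) > 0" if "x : D" for x using gp[OF that] by (simp add: gpt_def)
 define G where "G k x = fps_const (cfac k) * fps_expansion ((deriv ^^ (k - 1)) (%z. Zreg z (t x))) 0
   - fps_const (if k = 1 then 1 else 0) * fps_expansion (%z. Zf (z + v x) (t x)) 0" for k x
 show "(%x. fps_nth (G k x) 0) : R" for k
  unfolding G_def by (auto simp: fps_expansion_def intro!: diff mult Zr Zr[of 0, simplified] Zv)
 fix k x assume k: "k : {1..n}" and x: "x : D"
 have an: "(%z. Zf (z + v x) (t x)) analytic_on {0}" by (rule higher_deriv_shift(2)[OF Zf_analytic[OF gp[OF x]]])
 show "(%z. cfac k * (deriv ^^ (k - 1)) (%z. Zreg z (t x)) z - (if k = 1 then 1 else 0) * Zf (z + v x) (t x)) hfps G k x"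
  unfolding G_def by (intro fps_expansion_intros Zreg_higher_fps t x analytic_at_imp_has_fps_expansion_0 an)
 have nz: "\<forall>\<^sub>F z in at (0 :: complex). z ~= 0" by (simp add: eventually_at_filter)
 show "\<forall>\<^sub>F z in at 0. fc k z (v x) (t x) = 1 / z ^ k + (cfac k * (deriv ^^ (k - 1)) (%z. Zreg z (t x)) z - (if k = 1 then 1 else 0) * Zf (z + v x) (t x))"
  using eventually_good_at_0[OF t[OF x]] nz
 proof eventually_elim
  case (elim z)
  obtain j where j: "k = Suc j" using k by (cases k) auto
  have "(- 1) ^ j * (- 1) ^ j = (1 :: complex)" by (simp flip: power_mult_distrib)
  hence "cfac k * ((- 1) ^ (k - 1) * fact (k - 1) / z ^ Suc (k - 1)) = 1 / z ^ k"
   by (simp add: cfac_def j)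
  thus ?case using k unfolding fc_def dz_Zf_eq_Zreg[OF elim(1)] ring_distribs by (cases "k = 1") (simp_all add: cfac_def)
 qed
qed (use eq k in \<open>auto simp: fc_def\<close>)

end

text \<open>The coefficients with respect to the \<open>fc k\<close>. Passing from zeta and
  \<open>wp\<close> to \<open>Z\<close> shifts multiples of \<open>\<phi>\<^sub>1\<close> and
  \<open>\<phi>\<^sub>2\<close> into the constant term, which thereby becomes
  \<open>t\<^sup>0\<close>.\<close>

definition psi :: "(nat => ('n::finite) point => complex) => nat => 'n point => complex" where
 "psi \<phi> k x = (if k = 0 then \<phi> 0 x + theta_quot x * \<phi> 1 x + 4 * of_real pi * \<i> * g1 (tm x) * \<phi> 2 x else \<phi> k x)"

lemma theta_quot_eq: "x : Omega ==> theta_quot x = Zf (Vscaled x) (tm x)"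
 by (simp add: theta_quot_def Zf_def theta_ratio_def theta1_eq theta1'_eq Omega_def)

lemma sum_split_01:
 fixes f :: "nat => complex"
 assumes "n >= 1" shows "(\<Sum>k\<le>n. f k) = f 0 + f 1 + (\<Sum>k=2..n. f k)"
proof -
 have "{..n} = insert 0 (insert 1 {2..n})" using assms by auto
 thus ?thesis by (simp add: add.assoc)
qed

text \<open>Since \<open>wp = theta_const / 3 - Z'\<close> and
  \<open>theta_const / 3 = 4 pi i g1\<close>, the \<open>\<phi>\<^sub>2\<close> term of
  \<open>t\<^sup>0\<close> appears. In the combination of three zetas the linear corrections cancel
  because \<open>z - (z + v) + v = 0\<close>, and \<open>Z(v)\<close> is the theta quotient in front
  of \<open>\<phi>\<^sub>1\<close>.\<close>

lemma Lam_expansion: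
 fixes x :: "('n::finite) point"
 assumes phi: "phi_identity \<phi>" and x: "x : Omega_reg" and z: "gpt z (tm x)" and v: "gpt (z + Vscaled x) (tm x)"
 shows "Lam z x = (\<Sum>k\<le>CARD('n). fc k z (Vscaled x) (tm x) * psi \<phi> k x)"
proof -
 let ?t = "x $ Ctau" and ?V = "Vscaled x" and ?n = "CARD('n)"
 have t: "Im ?t > 0" using z by (simp add: gpt_def)
 have xO: "x : Omega" using x by (simp add: Omega_reg_def)
 have V: "gpt ?V ?t" using x by (simp add: Omega_reg_def Omega_def gpt_def)
 have n1: "?n >= 1" by (simp add: Suc_leI)
 have "(\<Prod>i\<in>UNIV - {Vlast}. theta1 (z - vpart x $ i + x $ Cw) ?t) = (\<Prod>i\<in>UNIV - {Vlast}. theta 0 (z + lin (xi i) x) ?t)"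
  by (rule prod.cong) (auto simp: theta1_eq[OF t] lin_xi algebra_simps)
 hence L: "Lam z x = exp (- 2 * of_real pi * \<i> * x $ Cu) * (\<Prod>i\<in>UNIV - {Vlast}. theta1 (z - vpart x $ i + x $ Cw) ?t)
  / (theta1 z ?t ^ ?n * theta1 (z + ?V) ?t)"
  by (simp add: Lam_def theta1_eq[OF t])
 define c where "c = theta_const ?t / 3"
 have summand: "(- 1) ^ k / fact (k - 1) * \<phi> k x * (deriv ^^ (k - 2)) (%w. wp w ?t) z = fc k z ?V ?t * psi \<phi> k x + (if k = 2 then c * \<phi> 2 x else 0)"
  if "k : {2..?n}" for k
 proof -
  obtain j where j: "k = Suc (Suc j)" using \<open>k : {2..?n}\<close> by (metis add_2_eq_Suc atLeastAtMost_iff le_Suc_ex)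
  have "(deriv ^^ (k - 2)) (%w. wp w ?t) z = (if j = 0 then c else 0) - dz (Suc j) Zf z ?t"
   using wp_deriv_eq[OF z, of j] unfolding j wp_deriv_def c_def by simp
  note E = this
  show ?thesis unfolding E by (cases "j = 0") (simp_all add: j fc_def psi_def cfac_def numeral_2_eq_2 algebra_simps)
 qed
 have "Lam z x = (\<Sum>k=2..?n. (- 1) ^ k / fact (k - 1) * \<phi> k x * (deriv ^^ (k - 2)) (%w. wp w ?t) z)
  + \<phi> 1 x * (wzeta z ?t - wzeta (z + ?V) ?t + wzeta ?V ?t) + \<phi> 0 x"
  unfolding L using phi x z v unfolding phi_identity_def Let_def by (simp add: gpt_def)
 also have "(\<Sum>k=2..?n. (- 1) ^ k / fact (k - 1) * \<phi> k x * (deriv ^^ (k - 2)) (%w. wp w ?t) z)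
  = (\<Sum>k=2..?n. fc k z ?V ?t * psi \<phi> k x) + (\<Sum>k=2..?n. if k = 2 then c * \<phi> 2 x else 0)"
  unfolding sum.distrib[symmetric] by (rule sum.cong[OF refl summand])
 \<comment> \<open>For \<open>n = 1\<close> the sum is empty, and \<open>\<phi> 2\<close> vanishes
   by the convention for indices above n.\<close>
 also have "(\<Sum>k=2..?n. if k = 2 then c * \<phi> 2 x else 0) = c * \<phi> 2 x"
  using phi unfolding phi_identity_def by auto
 also have "wzeta z ?t - wzeta (z + ?V) ?t + wzeta ?V ?t = Zf z ?t - Zf (z + ?V) ?t + Zf ?V ?t"
  unfolding Zf_eq_wzeta[OF z] Zf_eq_wzeta[OF v] Zf_eq_wzeta[OF V] by (simp add: algebra_simps)
 finally show ?thesis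
  unfolding sum_split_01[OF n1] theta_quot_eq[OF xO, symmetric]
  by (simp add: psi_def fc_def cfac_def c_def theta_const_eq[OF t] algebra_simps)
qed

lemma eventually_Lam_dom_at_0:
 fixes x :: "('n::finite) point"
 assumes x: "x : Omega_reg" shows "\<forall>\<^sub>F z in at 0. x : Lam_dom z"
proof -
 have t: "Im (tm x) > 0" using x by (simp add: Omega_reg_def Omega_def)
 have e: "\<forall>\<^sub>F z in at 0. gpt (z + b) (tm x)" for b
 proof -
  have "filterlim (%z. z + b) (at b) (at 0)"
   by (rule filterlim_atI) (auto intro!: tendsto_eq_intros simp: eventually_at_filter)
  from eventually_compose_filterlim[OF eventually_not_lattice[OF t, of b] this] show ?thesis
   using t by (simp add: gpt_def)
 qed
 show ?thesis
  using e[of 0] e[of "Vscaled x"] eventually_ball_finite[of "UNIV - {Vlast}" "%z i. gpt (z + lin (xi i) x) (tm x)" "at 0"] e x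
  unfolding Lam_dom_def mem_Collect_eq by (auto intro!: eventually_conj)
qed

text \<open>The \<open>\<phi>\<^sub>k\<close> are given only through the identity in z. Their
  differentiability is obtained by extracting them over the ring \<open>sm Omega_reg\<close>, over
  which the quotient of thetas is a Laurent family.\<close>

lemma psi_sm:
 fixes \<phi> :: "nat => ('n::finite) point => complex"
 assumes phi: "phi_identity \<phi>" and k: "k <= CARD('n)"
 shows "psi \<phi> k : sm Omega_reg"
proof -
 let ?O = "Omega_reg :: 'n point set"
 interpret S: function_ring ?O "sm ?O" by (rule sm_ring[OF line_open_Omega_reg])
 have sub: "?O \<subseteq> Omega" by (auto simp: Omega_reg_def)
 have im: "Im (tm x) > 0" if "x : ?O" for x using that by (simp add: Omega_reg_def Omega_def)
 have gV: "gpt (Vscaled x) (tm x)" if "x : ?O" for x using that by (simp add: Omega_reg_def Omega_def gpt_def)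
 note th = sm_theta[OF line_open_Omega_reg sub, of _ _ 0]
 have th0: "(%x. theta j 0 (tm x)) : sm ?O" for j using th[of "%_. 0"] by (simp add: lin_zero)
 have thV: "(%x. theta j (Vscaled x) (tm x)) : sm ?O" for j using th[of vform] by (simp add: lin_vform)
 have thx: "(%x. theta j (lin (xi i) x) (tm x)) : sm ?O" for i j using th[of "xi i"] by simp
 have i0: "(%x. 1 / theta 1 0 (tm x)) : sm ?O"
  by (rule sm_inverse[OF line_open_Omega_reg th0]) (use theta_eq_sin_prod(2)[OF im] in auto)
 have iV: "(%x. 1 / theta 0 (Vscaled x) (tm x)) : sm ?O"
  by (rule sm_inverse[OF line_open_Omega_reg thV]) (use gV in \<open>auto simp: gpt_theta\<close>)
 have "Zf (Vscaled x) (tm x) = theta 1 (Vscaled x) (tm x) * (1 / theta 0 (Vscaled x) (tm x))" for x :: "'n point"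
  by (simp add: Zf_def theta_ratio_def)
 hence ZV: "(%x. Zf (Vscaled x) (tm x)) : sm ?O" using S.mult[OF thV[of 1] iV] by simp
 have Zr: "(%x. (deriv ^^ m) (%z. Zreg z (tm x)) 0) : sm ?O" for m
  by (rule S.laurent_Zf_coeffs[OF im S.laurent_Zf_theta[OF im th0 i0]])
 have "(%z x. exp (- 2 * of_real pi * \<i> * x $ Cu) * (\<Prod>i\<in>UNIV - {Vlast}. theta 0 (z + lin (xi i) x) (tm x))
  * ((1 / theta 0 z (tm x)) ^ CARD('n) * (1 / theta 0 (z + Vscaled x) (tm x)))) : S.laurent"
  by (intro S.laurent_mult S.laurent_prod S.laurent_power S.laurent_const S.laurent_theta_shift S.laurent_inverse_theta
     S.laurent_inverse_theta_shift sm_exp_coord line_open_Omega_reg im gV th0 thV thx i0 iV)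
 hence F: "(%z x. Lam z x) : S.laurent"
  unfolding Lam_def by (simp add: power_divide)
 show ?thesis
 proof (rule S.extract_coefficients[OF gV Zr ZV F _ k])
  fix x :: "'n point" assume x: "x : ?O"
  show "\<forall>\<^sub>F z in at 0. (\<Sum>k\<le>CARD('n). fc k z (Vscaled x) (tm x) * psi \<phi> k x) = Lam z x"
   using eventually_Lam_dom_at_0[OF x]
   by eventually_elim (rule Lam_expansion[OF phi x, symmetric], auto simp: Lam_dom_def)
 qed
qed

text \<open>With \<open>LamT\<close>, the part of the gradient that stems from the explicit
  dependence of the \<open>fc k\<close> on v and tau.\<close>

definition LamV :: "(nat => ('n::finite) point => complex) => complex => 'n point => complex" where
 "LamV \<phi> z x = (\<Sum>k\<le>CARD('n). fcV k z (Vscaled x) (tm x) * psi \<phi> k x)"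

definition LamT :: "(nat => ('n::finite) point => complex) => complex => 'n point => complex" where
 "LamT \<phi> z x = (\<Sum>k\<le>CARD('n). fcT k z (Vscaled x) (tm x) * psi \<phi> k x)"

lemma has_partial_fc:
 fixes x :: "('n::finite) point"
 assumes "x : Lam_dom z"
 shows "has_partial a (%x. fc k z (Vscaled x) (tm x)) (vform a * fcV k z (Vscaled x) (tm x) + (if a = Ctau then fcT k z (Vscaled x) (tm x) else 0)) x" (is ?A)
  "has_partial a (%x. fcV k z (Vscaled x) (tm x)) (vform a * fcVV k z (Vscaled x) (tm x) + (if a = Ctau then fcVT k z (Vscaled x) (tm x) else 0)) x" (is ?B)
  "has_partial a (%x. fcT k z (Vscaled x) (tm x)) (vform a * fcVT k z (Vscaled x) (tm x) + (if a = Ctau then fcTT k z (Vscaled x) (tm x) else 0)) x" (is ?C)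
proof -
 note d = fc_derivs[of z "x $ Ctau" "lin vform x" k, OF Lam_domD(2,3)[OF assms]]
 have d0: "((%v. f v) hfd D) (at (0 + lin vform x))" if "(f hfd D) (at (lin vform x))" for f D
  using that by simp
 show ?A ?B ?C
  using has_partial_lin_tau[where F="fc k z" and z=0 and l=vform and x=x and a=a, OF d0[OF d(1)] _ vform_tau(1)] d(2)
   has_partial_lin_tau[where F="fcV k z" and z=0 and l=vform and x=x and a=a, OF d0[OF d(3)] _ vform_tau(1)] d(4)
   has_partial_lin_tau[where F="fcT k z" and z=0 and l=vform and x=x and a=a, OF d0[OF d(5)] _ vform_tau(1)] d(6)
  by (simp_all only: add_0 lin_vform)
qed

lemma grad_Lam_expansion:
 fixes x :: "('n::finite) point"
 assumes phi: "phi_identity \<phi>" and x: "x : Lam_dom z"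
 shows "partial a (Lam z) x = (\<Sum>k\<le>CARD('n). fc k z (Vscaled x) (tm x) * partial a (psi \<phi> k) x)
  + LamV \<phi> z x * vform a + (if a = Ctau then LamT \<phi> z x else 0)"
proof -
 note xr = Lam_domD(1)[OF x]
 have "partial a (Lam z) x = partial a (%x. \<Sum>k\<le>CARD('n). fc k z (Vscaled x) (tm x) * psi \<phi> k x) x"
  by (rule partial_cong[OF line_open_Lam_dom x], rule Lam_expansion[OF phi]) (auto simp: Lam_dom_def)
 also have "... = (\<Sum>k\<le>CARD('n). (vform a * fcV k z (Vscaled x) (tm x) + (if a = Ctau then fcT k z (Vscaled x) (tm x) else 0)) * psi \<phi> k x
   + fc k z (Vscaled x) (tm x) * partial a (psi \<phi> k) x)"
  by (intro has_partialD has_partial_sum has_partial_mult has_partial_fc(1)[OF x] sm_partials(1)[OF psi_sm[OF phi] xr]) simp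
 also have "... = (\<Sum>k\<le>CARD('n). fc k z (Vscaled x) (tm x) * partial a (psi \<phi> k) x)
  + LamV \<phi> z x * vform a + (if a = Ctau then LamT \<phi> z x else 0)"
  by (cases "a = Ctau") (simp_all add: LamV_def LamT_def sum.distrib sum_distrib_left sum_distrib_right algebra_simps)
 finally show ?thesis .
qed

text \<open>Second-order terms of the expansion: the coefficients contribute through their derivatives along \<open>e\<close>.\<close>

lemma grad_dir_Lam_expansion:
 fixes x :: "('n::finite) point"
 assumes phi: "phi_identity \<phi>" and x: "x : Lam_dom z"
 shows "partial a (dir e (Lam z)) x = (\<Sum>k\<le>CARD('n).
  fc k z (Vscaled x) (tm x) * partial a (dir e (psi \<phi> k)) x
  + dir e (psi \<phi> k) x * (vform a * fcV k z (Vscaled x) (tm x) + (if a = Ctau then fcT k z (Vscaled x) (tm x) else 0))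
  + (app e vform * fcV k z (Vscaled x) (tm x) + e Ctau * fcT k z (Vscaled x) (tm x)) * partial a (psi \<phi> k) x
  + psi \<phi> k x * (app e vform * (vform a * fcVV k z (Vscaled x) (tm x) + (if a = Ctau then fcVT k z (Vscaled x) (tm x) else 0))
    + e Ctau * (vform a * fcVT k z (Vscaled x) (tm x) + (if a = Ctau then fcTT k z (Vscaled x) (tm x) else 0))))"
proof -
 let ?f = "%k x. fc k z (Vscaled x) (tm x)" and ?fV = "%k x. fcV k z (Vscaled x) (tm x)" and ?fT = "%k x. fcT k z (Vscaled x) (tm x)"
 have e: "dir e (Lam z) y = (\<Sum>k\<le>CARD('n). ?f k y * dir e (psi \<phi> k) y + (app e vform * ?fV k y + e Ctau * ?fT k y) * psi \<phi> k y)"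
  if y: "y : Lam_dom z" for y :: "'n point"
 proof -
  have "dir e (Lam z) y = (\<Sum>a\<in>UNIV. \<Sum>k\<le>CARD('n). e a * (?f k y * partial a (psi \<phi> k) y)) + LamV \<phi> z y * app e vform + e Ctau * LamT \<phi> z y"
   unfolding dir_def grad_Lam_expansion[OF phi y]
   by (simp add: ring_distribs sum.distrib sum_distrib_left app_def mult_ac if_distrib[of "%y. _ * y"] cong: if_cong)
  thus ?thesis
   by (subst (asm) sum.swap) (simp add: dir_def LamV_def LamT_def sum.distrib sum_distrib_left sum_distrib_right algebra_simps)
 qed
 note p = sm_partials[OF psi_sm[OF phi] Lam_domD(1)[OF x]]
 have pd: "has_partial a (dir e (psi \<phi> k)) (partial a (dir e (psi \<phi> k)) x) x" if "k <= CARD('n)" for k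
 proof -
  have "has_partial a (dir e (psi \<phi> k)) (\<Sum>c\<in>UNIV. e c * partial a (partial c (psi \<phi> k)) x) x"
   unfolding dir_def[abs_def] by (intro has_partial_sum has_partial_cmult p(2) that)
  thus ?thesis using has_partialD by metis
 qed
 have "partial a (dir e (Lam z)) x = partial a (%y. \<Sum>k\<le>CARD('n). ?f k y * dir e (psi \<phi> k) y + (app e vform * ?fV k y + e Ctau * ?fT k y) * psi \<phi> k y) x"
  by (rule partial_cong[OF line_open_Lam_dom x e])
 also have "... = (\<Sum>k\<le>CARD('n).
  ((vform a * fcV k z (Vscaled x) (tm x) + (if a = Ctau then fcT k z (Vscaled x) (tm x) else 0)) * dir e (psi \<phi> k) x
   + ?f k x * partial a (dir e (psi \<phi> k)) x)
  + ((app e vform * (vform a * fcVV k z (Vscaled x) (tm x) + (if a = Ctau then fcVT k z (Vscaled x) (tm x) else 0))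
    + e Ctau * (vform a * fcVT k z (Vscaled x) (tm x) + (if a = Ctau then fcTT k z (Vscaled x) (tm x) else 0))) * psi \<phi> k x
   + (app e vform * ?fV k x + e Ctau * ?fT k x) * partial a (psi \<phi> k) x))"
  by (intro has_partialD has_partial_sum has_partial_add has_partial_mult has_partial_cmult has_partial_fc[OF x] pd p(1)) simp_all
 finally show ?thesis by (simp add: algebra_simps)
qed

lemma bil_zero_right: "bil p (%a. 0) = 0" by (simp add: bil_def)

lemma bil_sum_right: "bil p (%a. \<Sum>k\<in>K. g k a) = (\<Sum>k\<in>K. bil p (g k))"
 by (induction K rule: infinite_finite_induct) (simp_all add: bil_zero_right bil_add_right)

abbreviation dtau :: "('n::finite) flat => complex" where
 "dtau a \<equiv> (if a = Ctau then 1 else 0)"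

lemma bil_tau_right: "bil p (%a. if a = Ctau then y else 0) = y * p Cu"
 by (simp add: bil_explicit)

lemma bil_scale_right': "bil q (%a. p a * c) = c * bil q p"
 using bil_scale_right[of q c p] by (simp add: mult.commute)

lemma bil_dtau_left: "bil (%a. dtau a) q = q Cu"
 using bil_tau[of q] bil_commute by metis

lemma bil_grad_Lam:
 fixes x :: "('n::finite) point"
 assumes phi: "phi_identity \<phi>" and x: "x : Lam_dom z"
 shows "bil (grad (Lam z) x) q = (\<Sum>k\<le>CARD('n). fc k z (Vscaled x) (tm x) * bil (grad (psi \<phi> k) x) q) + LamV \<phi> z x * bil vform q + LamT \<phi> z x * q Cu"
proof -
 have "grad (Lam z) x = (%a. (\<Sum>k\<le>CARD('n). fc k z (Vscaled x) (tm x) * partial a (psi \<phi> k) x) + (LamV \<phi> z x * vform a + LamT \<phi> z x * dtau a))"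
  by (rule ext) (simp add: grad_Lam_expansion[OF phi x])
 hence "bil (grad (Lam z) x) q = bil q (%a. (\<Sum>k\<le>CARD('n). fc k z (Vscaled x) (tm x) * partial a (psi \<phi> k) x) + (LamV \<phi> z x * vform a + LamT \<phi> z x * dtau a))"
  by (simp only: bil_commute[of _ q])
 thus ?thesis
  by (simp only: bil_add_right bil_sum_right bil_scale_right bil_tau) (simp only: bil_commute[of q] add.assoc)
qed

lemma dir_Lam_expansion:
 fixes x :: "('n::finite) point"
 assumes phi: "phi_identity \<phi>" and x: "x : Lam_dom z"
 shows "dir e (Lam z) x = (\<Sum>k\<le>CARD('n). fc k z (Vscaled x) (tm x) * dir e (psi \<phi> k) x) + LamV \<phi> z x * app e vform + LamT \<phi> z x * e Ctau"
proof -
 have "dir e (Lam z) x = (\<Sum>a\<in>UNIV. \<Sum>k\<le>CARD('n). e a * (fc k z (Vscaled x) (tm x) * partial a (psi \<phi> k) x)) + LamV \<phi> z x * app e vform + LamT \<phi> z x * e Ctau"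
  unfolding dir_def grad_Lam_expansion[OF phi x]
  by (simp add: ring_distribs sum.distrib sum_distrib_left app_def mult_ac if_distrib[of "%y. _ * y"] cong: if_cong)
 thus ?thesis by (subst (asm) sum.swap) (simp add: dir_def sum_distrib_left mult_ac)
qed

text \<open>The second-order terms of one summand in which at least one derivative falls on
  \<open>fc k\<close>. The arguments after \<open>t\<close> are the coefficient, its derivative
  along e, the values of e on v and on tau, and the pairings of a covector with
  \<open>vform\<close>, with the differential of tau and with the gradient of the
  coefficient.\<close>

definition fc_rest :: "nat => complex => complex => complex => complex => complex => complex => complex => complex => complex => complex => complex" where
 "fc_rest k z v t y dy ev et pv pu py = dy * (fcV k z v t * pv + fcT k z v t * pu) + (ev * fcV k z v t + et * fcT k z v t) * py
  + y * (ev * (fcVV k z v t * pv + fcVT k z v t * pu) + et * (fcVT k z v t * pv + fcTT k z v t * pu))"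

lemma bil_grad_dir_Lam:
 fixes x :: "('n::finite) point"
 assumes phi: "phi_identity \<phi>" and x: "x : Lam_dom z"
 shows "bil p (grad (dir e (Lam z)) x) = (\<Sum>k\<le>CARD('n). fc k z (Vscaled x) (tm x) * bil p (grad (dir e (psi \<phi> k)) x))
  + (\<Sum>k\<le>CARD('n). fc_rest k z (Vscaled x) (tm x) (psi \<phi> k x) (dir e (psi \<phi> k) x) (app e vform) (e Ctau) (bil p vform) (p Cu) (bil p (grad (psi \<phi> k) x)))"
 unfolding grad_dir_Lam_expansion[OF phi x] bil_sum_right sum.distrib[symmetric]
 by (rule sum.cong[OF refl])
  (simp only: bil_add_right bil_scale_right bil_scale_right' bil_tau_right fc_rest_def, simp add: algebra_simps)

section \<open>The pairings as identities between Laurent series\<close>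

abbreviation Lam' :: "complex => ('n::finite) point => complex" where
 "Lam' z x \<equiv> deriv (%z. Lam z x) z"

abbreviation dLam' :: "('n flat => complex) => complex => ('n::finite) point => complex" where
 "dLam' e z x \<equiv> deriv (%z. dir e (Lam z) x) z"

lemmas Lam'_eq = DERIV_imp_deriv[OF Lam_deriv]
lemmas dLam'_eq = DERIV_imp_deriv[OF dir_Lam_deriv]

text \<open>Once \<open>Lam * Lam_log\<close> is recognised as the z-derivative of
  \<open>Lam\<close>, the right-hand side is a polynomial in Laurent families, with no logarithmic
  derivative of \<open>Lam\<close> left.\<close>

lemma Lam_Lam_series:
 fixes x :: "('n::finite) point"
 assumes z: "x : Lam_dom z" and w: "x : Lam_dom w" and d: "gpt (z - w) (tm x)"
 shows "bil (grad (Lam z) x) (grad (Lam w) x) =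
  - (Zf (z - w) (tm x) + Zf w (tm x)) * Lam' z x * Lam w x + (Zf (z - w) (tm x) - Zf z (tm x)) * Lam z x * Lam' w x
  - Lam' z x * Lam' w x / of_nat CARD('n)"
 unfolding bil_Lam_Lam[OF assms] Lam'_eq[OF z] Lam'_eq[OF w] by (simp add: algebra_simps)

lemma grad_dir_Lam:
 fixes x :: "('n::finite) point"
 assumes x: "x : Lam_dom z"
 shows "partial a (dir e (Lam z)) x = Lam_dlog e z x * partial a (Lam z) x + Lam z x * partial a (Lam_dlog e z) x"
proof -
 have "partial a (dir e (Lam z)) x = partial a (%x. Lam z x * Lam_dlog e z x) x"
  by (rule partial_cong[OF line_open_Lam_dom x dir_Lam])
 also have "... = partial a (Lam z) x * Lam_dlog e z x + Lam z x * partial a (Lam_dlog e z) x"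
  using has_partial_Lam_dlog[OF x, of a e] has_partialD[OF has_partial_Lam_dlog[OF x, of a e]]
  by (intro has_partialD has_partial_mult sm_partials(1)[OF Lam_sm x]) simp
 finally show ?thesis by (simp add: mult.commute)
qed

lemma Lam_dir_Lam_series:
 fixes x :: "('n::finite) point"
 assumes z: "x : Lam_dom z" and w: "x : Lam_dom w" and d: "gpt (z - w) (tm x)"
 shows "bil (grad (Lam z) x) (grad (dir e (Lam w)) x) =
  (Zf (z - w) (tm x) - Zf z (tm x)) * Lam z x * dLam' e w x - Lam' z x * dLam' e w x / of_nat CARD('n)
  - (Zf (z - w) (tm x) + Zf w (tm x)) * Lam' z x * dir e (Lam w) x
  + dz 1 Zf (z - w) (tm x) * (dir e (Lam z) x * Lam w x - Lam z x * dir e (Lam w) x)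
  - kappa * (dz 1 Nf (z - w) (tm x) + dz 1 Nf w (tm x)) * Lam' z x * Lam w x * e Ctau"
proof -
 have "bil (grad (Lam z) x) (grad (dir e (Lam w)) x)
  = Lam_dlog e w x * bil (grad (Lam z) x) (grad (Lam w) x) + Lam w x * bil (grad (Lam z) x) (grad (Lam_dlog e w) x)"
  unfolding grad_dir_Lam[OF w] bil_add_right bil_scale_right ..
 thus ?thesis
  unfolding bil_Lam_Lam[OF assms] bil_Lam_dlog[OF assms] Lam'_eq[OF z] Lam'_eq[OF w] dLam'_eq[OF w] dir_Lam[OF z] dir_Lam[OF w]
  by (simp add: algebra_simps add_divide_distrib diff_divide_distrib)
qed

lemma vform_Lam_series:
 fixes x :: "('n::finite) point"
 assumes z: "x : Lam_dom z"
 shows "bil (grad (Lam z) x) vform = Lam z x * (Zf (z + Vscaled x) (tm x) - Zf z (tm x)) - Lam' z x / of_nat CARD('n)"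
 unfolding bil_Lam_vform[OF z] Lam'_eq[OF z] lin_vform ..

lemma vform_dir_Lam_series:
 fixes x :: "('n::finite) point"
 assumes z: "x : Lam_dom z"
 shows "bil vform (grad (dir e (Lam z)) x) = dir e (Lam z) x * (Zf (z + Vscaled x) (tm x) - Zf z (tm x)) - dLam' e z x / of_nat CARD('n)
  + Lam z x * (app e vform * dz 1 Zf (z + Vscaled x) (tm x) + e Ctau * kappa * dz 1 Nf (z + Vscaled x) (tm x))
  - Lam z x * (kappa * e Ctau * dz 1 Nf z (tm x))"
proof -
 define n where "n = (of_nat CARD('n) :: complex)"
 have n: "n ~= 0" by (simp add: n_def)
 let ?I = "UNIV - {Vlast} :: 'n ambient set"
 define c1 c2 where "c1 = (\<Sum>i\<in>?I. app e (xi i) * xiZ 1 z x i)" and "c2 = (\<Sum>i\<in>?I. xiN 1 z x i)"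
 define d where "d = app e vform * dz 1 Zf (z + Vscaled x) (tm x) + e Ctau * kappa * dz 1 Nf (z + Vscaled x) (tm x)"
 have s: "(\<Sum>i\<in>?I. app e (xi i) * xiZ 1 z x i + e Ctau * kappa * xiN 1 z x i) = c1 + e Ctau * kappa * c2"
  by (simp add: c1_def c2_def sum.distrib sum_distrib_left)
 have "bil (form (%_. 0) (- 1) 0 0) (grad (Lam_dlog e z) x) = d - (c1 + e Ctau * kappa * c2 - d) / n"
  unfolding has_partialD[OF has_partial_Lam_dlog[OF z]] bil_form lin_vform s d_def[symmetric] n_def[symmetric]
  using n by (simp add: field_simps)
 moreover have "Lam_dlog' e z x = c1 + e Ctau * kappa * c2 - d - n * (kappa * e Ctau * dz 1 Nf z (tm x))"
  by (simp add: Lam_dlog'_def c1_def c2_def d_def lin_vform n_def algebra_simps)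
 hence "(c1 + e Ctau * kappa * c2 - d) / n = Lam_dlog' e z x / n + kappa * e Ctau * dz 1 Nf z (tm x)"
  using n by (simp add: field_simps)
 ultimately have g: "bil vform (grad (Lam_dlog e z) x) = d - Lam_dlog' e z x / n - kappa * e Ctau * dz 1 Nf z (tm x)"
  by (simp only: form_zero diff_diff_eq)
 have "bil vform (grad (dir e (Lam z)) x) = Lam_dlog e z x * bil (grad (Lam z) x) vform + Lam z x * bil vform (grad (Lam_dlog e z) x)"
  unfolding grad_dir_Lam[OF z] bil_add_right bil_scale_right bil_commute[of vform "grad (Lam z) x"] ..
 thus ?thesis
  unfolding g bil_Lam_vform[OF z] dLam'_eq[OF z] dir_Lam[OF z] lin_vform d_def[symmetric] n_def[symmetric]
  by (simp add: algebra_simps add_divide_distrib diff_divide_distrib)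
qed

lemma partial_u_dir_Lam:
 fixes x :: "('n::finite) point"
 assumes z: "x : Lam_dom z"
 shows "partial Cu (dir e (Lam z)) x = - 2 * of_real pi * \<i> * dir e (Lam z) x"
 unfolding grad_dir_Lam[OF z] partial_Lam_u[OF z] dir_Lam[OF z] has_partialD[OF has_partial_Lam_dlog[OF z]]
 by (simp add: form_def)

lemma deriv_funpow_shift: "(deriv ^^ k) (%w. f (w + a)) z = (deriv ^^ k) f (z + a)" for z :: complex
proof (induction k arbitrary: z)
 case (Suc k)
 have "deriv ((deriv ^^ k) (%w. f (w + a))) z = deriv (%z. (deriv ^^ k) f (z + a)) z" by (simp add: Suc.IH[abs_def])
 also have "... = deriv ((deriv ^^ k) f) (z + a)" by (simp add: deriv_def DERIV_shift)
 finally show ?case by simp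
qed simp

lemma dz_add_arg: "dz k F (z + a) t = (deriv ^^ k) (%w. F (w + a) t) z"
 by (simp add: dz_def deriv_funpow_shift[of k "%w. F w t"])

section \<open>Extraction of the pairings of the expansion coefficients\<close>

locale jacobi_ring = form_ring U R for U :: "('n::finite) point set" and R +
 fixes \<phi> :: "nat => 'n point => complex"
 assumes phi: "phi_identity \<phi>" and psi_in: "k <= CARD('n) ==> psi \<phi> k : R"
begin

lemma reg: "x : U ==> x : Omega_reg" using regular by blast

lemma dz_Zf_laurent: "(%z x. dz k Zf z (tm x)) : laurent"
 unfolding dz_def by (intro laurent_higher_deriv laurent_Zf Im_tau_pos Zreg_coeff_in)

lemma Zf_laurent: "(%z x. Zf z (tm x)) : laurent"
 using dz_Zf_laurent[of 0] by simp

lemma dz_Nf_laurent: "(%z x. dz k Nf z (tm x)) : laurent"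
 unfolding dz_def
proof (rule laurent_higher_deriv, rule laurent_cong)
 show "(%z x. Zf z (tm x) ^ 2 + dz 1 Zf z (tm x)) : laurent" by (intro laurent_add laurent_power Zf_laurent dz_Zf_laurent)
 show "\<forall>\<^sub>F z in at 0. Nf z (tm x) = Zf z (tm x) ^ 2 + dz 1 Zf z (tm x)" if "x : U" for x
  using eventually_good_at_0[OF Im_tau_pos[OF that]] by eventually_elim (rule Nf_eq)
qed

lemma dz_Mf_laurent: "(%z x. dz k Mf z (tm x)) : laurent"
proof -
 have "(%z x. 2 * Zf z (tm x) * dz 1 Nf z (tm x) + dz 2 Nf z (tm x)) : laurent"
  by (intro laurent_add laurent_mult laurent_const const Zf_laurent dz_Nf_laurent)
 from laurent_higher_deriv[OF this, of k] show ?thesis by (simp only: dz_def[of k] Mf_def)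
qed

lemma ZfV_laurent: "(%z x. dz k Zf (z + Vscaled x) (tm x)) : laurent"
 unfolding dz_add_arg by (intro laurent_higher_deriv laurent_Zf_shift good_Vscaled Zf_V_in)

lemma eventually_dom: "x : U ==> \<forall>\<^sub>F z in at 0. x : Lam_dom z"
 by (rule eventually_Lam_dom_at_0[OF reg])

lemma NfV_laurent: "(%z x. dz k Nf (z + Vscaled x) (tm x)) : laurent"
proof -
 have "(%z x. Nf (z + Vscaled x) (tm x)) : laurent"
 proof (rule laurent_cong)
  show "(%z x. dz 0 Zf (z + Vscaled x) (tm x) ^ 2 + dz 1 Zf (z + Vscaled x) (tm x)) : laurent"
   by (intro laurent_add laurent_power ZfV_laurent)
  show "\<forall>\<^sub>F z in at 0. Nf (z + Vscaled x) (tm x) = dz 0 Zf (z + Vscaled x) (tm x) ^ 2 + dz 1 Zf (z + Vscaled x) (tm x)" if "x : U" for x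
   using eventually_dom[OF that] by eventually_elim (simp only: dz_0, rule Nf_eq, simp add: Lam_dom_def)
 qed
 from laurent_higher_deriv[OF this, of k] show ?thesis by (simp only: dz_add_arg)
qed

lemma MfV_laurent: "(%z x. dz k Mf (z + Vscaled x) (tm x)) : laurent"
proof -
 have "(%z x. 2 * dz 0 Zf (z + Vscaled x) (tm x) * dz 1 Nf (z + Vscaled x) (tm x) + dz 2 Nf (z + Vscaled x) (tm x)) : laurent"
  by (intro laurent_add laurent_mult laurent_const const ZfV_laurent NfV_laurent)
 hence "(%z x. Mf (z + Vscaled x) (tm x)) : laurent" by (simp only: Mf_def dz_0)
 from laurent_higher_deriv[OF this, of k] show ?thesis by (simp only: dz_add_arg)
qed

lemma fc_laurent:
 "(%z x. fc k z (Vscaled x) (tm x)) : laurent" "(%z x. fcV k z (Vscaled x) (tm x)) : laurent"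
 "(%z x. fcT k z (Vscaled x) (tm x)) : laurent" "(%z x. fcVV k z (Vscaled x) (tm x)) : laurent"
 "(%z x. fcVT k z (Vscaled x) (tm x)) : laurent" "(%z x. fcTT k z (Vscaled x) (tm x)) : laurent"
proof -
 note l = dz_Zf_laurent dz_Nf_laurent dz_Mf_laurent ZfV_laurent NfV_laurent MfV_laurent ZfV_laurent[of 0, unfolded dz_0] Zf_laurent laurent_const[OF const]
 show "(%z x. fc k z (Vscaled x) (tm x)) : laurent"
  unfolding fc_def by (cases "k = 0"; cases "k = 1") ((intro laurent_diff laurent_mult l | simp)+)
 show "(%z x. fcV k z (Vscaled x) (tm x)) : laurent"
  unfolding fcV_def by (cases "k = 1") ((intro laurent_uminus l | simp)+)
 show "(%z x. fcT k z (Vscaled x) (tm x)) : laurent"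
  unfolding fcT_def by (cases "k = 0"; cases "k = 1") ((intro laurent_diff laurent_mult l | simp)+)
 show "(%z x. fcVV k z (Vscaled x) (tm x)) : laurent"
  unfolding fcVV_def by (cases "k = 1") ((intro laurent_uminus l | simp)+)
 show "(%z x. fcVT k z (Vscaled x) (tm x)) : laurent"
  unfolding fcVT_def by (cases "k = 1") ((intro laurent_uminus laurent_mult l | simp)+)
 show "(%z x. fcTT k z (Vscaled x) (tm x)) : laurent"
  unfolding fcTT_def by (cases "k = 0"; cases "k = 1") ((intro laurent_diff laurent_mult l | simp)+)
qed

lemma Lam_laurent: "(%z x. Lam z x) : laurent"
proof (rule laurent_cong)
 show "(%z x. \<Sum>k\<le>CARD('n). fc k z (Vscaled x) (tm x) * psi \<phi> k x) : laurent"
  by (intro laurent_sum laurent_mult laurent_const psi_in fc_laurent) simp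
 show "\<forall>\<^sub>F z in at 0. Lam z x = (\<Sum>k\<le>CARD('n). fc k z (Vscaled x) (tm x) * psi \<phi> k x)" if "x : U" for x
  using eventually_dom[OF that] by eventually_elim (rule Lam_expansion[OF phi], auto simp: Lam_dom_def)
qed

lemma LamV_laurent: "(%z x. LamV \<phi> z x) : laurent" and LamT_laurent: "(%z x. LamT \<phi> z x) : laurent"
 unfolding LamV_def LamT_def by (intro laurent_sum laurent_mult laurent_const psi_in fc_laurent; simp)+

lemma expand_in:
 assumes "F : laurent" "!!x. x : U ==> \<forall>\<^sub>F z in at 0. (\<Sum>k\<le>CARD('n). fc k z (Vscaled x) (tm x) * Y k x) = F z x" "k <= CARD('n)"
 shows "Y k : R"
 by (rule extract_coefficients[OF good_Vscaled Zreg_coeff_in Zf_V_in[of 0, unfolded dz_0] assms])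

text \<open>The simplest case of the method: a derivative of the expansion is again an expansion in
  the \<open>fc k\<close>, with the wanted functions as coefficients. For the derivative in u the
  explicit terms \<open>LamV\<close> and \<open>LamT\<close> do not contribute, and the left side is
  a multiple of \<open>Lam\<close>.\<close>

lemma partial_u_psi_in: "k <= CARD('n) ==> (%x. partial Cu (psi \<phi> k) x) : R"
proof (rule expand_in)
 show "(%z x. - 2 * of_real pi * \<i> * Lam z x) : laurent" by (intro laurent_mult laurent_const const Lam_laurent)
 show "\<forall>\<^sub>F z in at 0. (\<Sum>k\<le>CARD('n). fc k z (Vscaled x) (tm x) * partial Cu (psi \<phi> k) x) = - 2 * of_real pi * \<i> * Lam z x" if "x : U" for x
  using eventually_dom[OF that]
 proof eventually_elim
  case (elim z)
  show ?case using grad_Lam_expansion[OF phi elim, of Cu] partial_Lam_u[OF elim] by simp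
 qed
qed

lemma bil_psi_vform_in: "k <= CARD('n) ==> (%x. bil (grad (psi \<phi> k) x) vform) : R"
proof (rule expand_in)
 show "(%z x. Lam z x * (dz 0 Zf (z + Vscaled x) (tm x) - Zf z (tm x)) - Lam' z x * (1 / of_nat CARD('n)) - LamV \<phi> z x * bil vform (vform :: 'n flat => complex)) : laurent"
  by (intro laurent_mult laurent_diff laurent_const const Lam_laurent laurent_deriv ZfV_laurent Zf_laurent LamV_laurent)
 show "\<forall>\<^sub>F z in at 0. (\<Sum>k\<le>CARD('n). fc k z (Vscaled x) (tm x) * bil (grad (psi \<phi> k) x) vform)
  = Lam z x * (dz 0 Zf (z + Vscaled x) (tm x) - Zf z (tm x)) - Lam' z x * (1 / of_nat CARD('n)) - LamV \<phi> z x * bil vform (vform :: 'n flat => complex)" if "x : U" for x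
  using eventually_dom[OF that]
 proof eventually_elim
  case (elim z)
  show ?case using bil_grad_Lam[OF phi elim, of vform] vform_Lam_series[OF elim] by (simp add: algebra_simps)
 qed
qed

text \<open>The domain for the first extraction, the one in w: z is a parameter kept off the
  singularities, and the coefficients lie in \<open>laurent_fun pairs\<close>.\<close>

definition pairs :: "('n point \<times> complex) set" where
 "pairs = {p. fst p : U & fst p : Lam_dom (snd p)}"

sublocale P: function_ring pairs "laurent_fun pairs" by (rule laurent_fun_ring)

lemma fst_in: "f : R ==> (%p. f (fst p)) : laurent_fun pairs"
 using laurent_fun_base[of f pairs] by (simp add: case_prod_unfold)

lemma family_in: "F : laurent ==> (%p. F (snd p) (fst p)) : laurent_fun pairs"
 using laurent_fun_memI[of F pairs] by (simp add: case_prod_unfold)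

lemma lift: "F : laurent ==> (%w p. F w (fst p)) : P.laurent"
 using laurent_lift[of F pairs] by (simp add: case_prod_unfold pairs_def)

lemma lift_diff:
 assumes "F : laurent" "!!p. p : pairs ==> (%w. F w (fst p)) analytic_on {snd p}"
 shows "(%w p. F (snd p - w) (fst p)) : P.laurent"
proof -
 have "(%w. F w x) analytic_on {z}" if "(x, z) : pairs" for x z using assms(2)[OF that] by simp
 from laurent_diff_arg[OF assms(1) this] show ?thesis by (simp add: case_prod_unfold)
qed

lemma pairs_good: "p : pairs ==> gpt (snd p) (fst p $ Ctau)"
 by (simp add: pairs_def Lam_dom_def)

lemma pair_extract:
 assumes F: "F : P.laurent" and eq: "!!p. p : pairs ==> \<forall>\<^sub>F w in at 0. (\<Sum>k\<le>CARD('n). fc k w (Vscaled (fst p)) (fst p $ Ctau) * Y k p) = F w p"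
  and k: "k <= CARD('n)"
 shows "Y k : laurent_fun pairs"
 by (rule P.extract_coefficients[OF _ fst_in[OF Zreg_coeff_in] fst_in[OF Zf_V_in[of 0, unfolded dz_0]] F eq k])
  (auto simp: pairs_def good_Vscaled)

lemma eventually_pair:
 assumes "p : pairs" shows "\<forall>\<^sub>F w in at 0. fst p : Lam_dom w & gpt (snd p - w) (fst p $ Ctau)"
proof -
 have "filterlim (%w. snd p - w) (nhds (snd p)) (at 0)" by (auto intro!: tendsto_eq_intros)
 from eventually_compose_filterlim[OF eventually_good_z[OF pairs_good[OF assms]] this]
 show ?thesis using eventually_dom[of "fst p"] assms by (auto simp: pairs_def intro: eventually_conj)
qed

text \<open>A function on pairs that is a Laurent family yields, by a second extraction, elements of the ring.\<close>

lemma second_extract: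
 assumes H: "H : laurent_fun pairs" and F: "F : laurent"
  and eq: "!!p. p : pairs ==> (\<Sum>k\<le>CARD('n). fc k (snd p) (Vscaled (fst p)) (fst p $ Ctau) * Y k (fst p)) = H p - F (snd p) (fst p)"
  and k: "k <= CARD('n)"
 shows "Y k : R"
proof -
 obtain G where G: "G : laurent" "!!x z. (x, z) : pairs ==> H (x, z) = G z x"
  using H unfolding laurent_fun_def by auto
 show ?thesis
 proof (rule expand_in[OF laurent_diff[OF G(1) F] _ k])
  show "\<forall>\<^sub>F z in at 0. (\<Sum>k\<le>CARD('n). fc k z (Vscaled x) (tm x) * Y k x) = G z x - F z x" if x: "x : U" for x
   using eventually_dom[OF x]
  proof eventually_elim
   case (elim z)
   have "(x, z) : pairs" using x elim by (simp add: pairs_def)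
   thus ?case using eq[of "(x, z)"] G(2) by simp
  qed
 qed
qed

lemma dz_Zf_analytic: "gpt z t ==> (%w. dz k Zf w t) analytic_on {z}"
 and dz_Nf_analytic: "gpt z t ==> (%w. dz k Nf w t) analytic_on {z}"
proof -
 assume g: "gpt z t"
 have t: "Im t > 0" "z : - lattice t" using g by (auto simp: gpt_def)
 have o: "open (- lattice t)" using closed_lattice[OF t(1)] by (rule open_Compl)
 have "(%w. dz k F w t) holo - lattice t" if "F : theta_ring" for F
  using dz_deriv_z[OF that] t(1) unfolding holomorphic_on_open[OF o] gpt_def by blast
 thus "(%w. dz k Zf w t) analytic_on {z}" "(%w. dz k Nf w t) analytic_on {z}"
  using o t(2) by (meson Zf_ring Nf_ring analytic_at)+
qed

lemma diff_lift:
 "(%w p. dz k Zf (snd p - w) (fst p $ Ctau)) : P.laurent" "(%w p. dz k Nf (snd p - w) (fst p $ Ctau)) : P.laurent"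
 by (rule lift_diff[OF dz_Zf_laurent dz_Zf_analytic[OF pairs_good]] lift_diff[OF dz_Nf_laurent dz_Nf_analytic[OF pairs_good]], assumption)+

text \<open>First of two extractions. The gradient of \<open>Lam z\<close> is paired with the
  expansion of \<open>Lam w\<close>; the explicit terms involve only the pairings of
  \<open>Lam z\<close> with \<open>vform\<close> and with the differential of tau, which are known
  in closed form and moved to the other side.\<close>

lemma bil_Lam_psi_in:
 assumes k: "k <= CARD('n)"
 shows "(%p. bil (grad (Lam (snd p)) (fst p)) (grad (psi \<phi> k) (fst p))) : laurent_fun pairs"
proof (rule pair_extract[OF _ _ k])
 let ?F = "%w p. - (dz 0 Zf (snd p - w) (fst p $ Ctau) + Zf w (fst p $ Ctau)) * Lam' (snd p) (fst p) * Lam w (fst p)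
   + (dz 0 Zf (snd p - w) (fst p $ Ctau) - Zf (snd p) (fst p $ Ctau)) * Lam (snd p) (fst p) * Lam' w (fst p)
  - Lam' (snd p) (fst p) * Lam' w (fst p) * (1 / of_nat CARD('n))
  - LamV \<phi> w (fst p) * (Lam (snd p) (fst p) * (dz 0 Zf (snd p + Vscaled (fst p)) (fst p $ Ctau) - Zf (snd p) (fst p $ Ctau)) - Lam' (snd p) (fst p) * (1 / of_nat CARD('n)))
  - LamT \<phi> w (fst p) * (- 2 * of_real pi * \<i> * Lam (snd p) (fst p))"
 note z = family_in[OF Lam_laurent] family_in[OF laurent_deriv[OF Lam_laurent]] family_in[OF Zf_laurent] family_in[OF ZfV_laurent[of 0]]
 note w = lift[OF Lam_laurent] lift[OF laurent_deriv[OF Lam_laurent]] lift[OF Zf_laurent] lift[OF LamV_laurent] lift[OF LamT_laurent]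
 show "?F : P.laurent"
  by (intro P.laurent_add P.laurent_diff P.laurent_mult P.laurent_uminus diff_lift w
   P.laurent_const[OF z(1)] P.laurent_const[OF z(2)] P.laurent_const[OF z(3)] P.laurent_const[OF z(4)] P.laurent_const[OF P.const])
 show "\<forall>\<^sub>F w in at 0. (\<Sum>k\<le>CARD('n). fc k w (Vscaled (fst p)) (fst p $ Ctau) * bil (grad (Lam (snd p)) (fst p)) (grad (psi \<phi> k) (fst p))) = ?F w p"
  if p: "p : pairs" for p
  using eventually_pair[OF p]
 proof eventually_elim
  case (elim w)
  obtain x z where [simp]: "p = (x, z)" by (cases p)
  have z: "x : Lam_dom z" and w: "x : Lam_dom w" and d: "gpt (z - w) (tm x)" using p elim by (auto simp: pairs_def)
  show ?case
   using bil_grad_Lam[OF phi w, of "grad (Lam z) x"] Lam_Lam_series[OF z w d] vform_Lam_series[OF z] partial_Lam_u[OF z]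
   by (simp add: bil_commute[of "grad (psi \<phi> _) x" "grad (Lam z) x"] bil_commute[of vform "grad (Lam z) x"] bil_commute[of "grad (Lam w) x" "grad (Lam z) x"] algebra_simps)
 qed
qed

lemma bil_psi_psi_in:
 assumes k: "k <= CARD('n)" and l: "l <= CARD('n)"
 shows "(%x. bil (grad (psi \<phi> k) x) (grad (psi \<phi> l) x)) : R"
proof (rule second_extract[OF bil_Lam_psi_in[OF l] _ _ k])
 show "(%z x. LamV \<phi> z x * bil (grad (psi \<phi> l) x) vform + LamT \<phi> z x * partial Cu (psi \<phi> l) x) : laurent"
  by (intro laurent_add laurent_mult laurent_const LamV_laurent LamT_laurent bil_psi_vform_in partial_u_psi_in l)
 fix p assume p: "p : pairs"
 obtain x z where [simp]: "p = (x, z)" by (cases p)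
 have z: "x : Lam_dom z" using p by (auto simp: pairs_def)
 show "(\<Sum>k\<le>CARD('n). fc k (snd p) (Vscaled (fst p)) (fst p $ Ctau) * bil (grad (psi \<phi> k) (fst p)) (grad (psi \<phi> l) (fst p)))
  = bil (grad (Lam (snd p)) (fst p)) (grad (psi \<phi> l) (fst p)) - (LamV \<phi> (snd p) (fst p) * bil (grad (psi \<phi> l) (fst p)) vform + LamT \<phi> (snd p) (fst p) * partial Cu (psi \<phi> l) (fst p))"
  using bil_grad_Lam[OF phi z, of "grad (psi \<phi> l) x"] by (simp add: bil_commute[of vform] algebra_simps)
qed

end

context jacobi_ring
begin

lemma fc_rest_laurent:
 assumes "y : R" "dy : R" "ev : R" "et : R" "pv : R" "pu : R" "py : R"
 shows "(%z x. fc_rest k z (Vscaled x) (tm x) (y x) (dy x) (ev x) (et x) (pv x) (pu x) (py x)) : laurent"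
 unfolding fc_rest_def using assms by (intro laurent_add laurent_mult fc_laurent laurent_const)

lemma fc_rest_pair_laurent:
 assumes "y : R" "dy : R" "ev : R" "et : R" "pv : laurent_fun pairs" "pu : laurent_fun pairs" "py : laurent_fun pairs"
 shows "(%w p. fc_rest k w (Vscaled (fst p)) (fst p $ Ctau) (y (fst p)) (dy (fst p)) (ev (fst p)) (et (fst p)) (pv p) (pu p) (py p)) : P.laurent"
 unfolding fc_rest_def using assms by (intro P.laurent_add P.laurent_mult lift fc_laurent P.laurent_const fst_in)

text \<open>A direction field is controlled through its values on v, on tau and on the
  \<open>psi \<phi> k\<close>; by \<open>dir_Lam_expansion\<close> they determine its value on the
  generating quotient.\<close>

context
 fixes e :: "'n point => 'n flat => complex"
 assumes eV: "(%x. app (e x) vform) : R" and eT: "(%x. e x Ctau) : R"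
  and ePsi: "!!k. k <= CARD('n) ==> (%x. dir (e x) (psi \<phi> k) x) : R"
begin

lemma dir_Lam_laurent: "(%z x. dir (e x) (Lam z) x) : laurent"
proof (rule laurent_cong)
 show "(%z x. (\<Sum>k\<le>CARD('n). fc k z (Vscaled x) (tm x) * dir (e x) (psi \<phi> k) x) + LamV \<phi> z x * app (e x) vform + LamT \<phi> z x * e x Ctau) : laurent"
  by (intro laurent_add laurent_sum laurent_mult laurent_const ePsi eV eT fc_laurent LamV_laurent LamT_laurent) simp
 show "\<forall>\<^sub>F z in at 0. dir (e x) (Lam z) x = (\<Sum>k\<le>CARD('n). fc k z (Vscaled x) (tm x) * dir (e x) (psi \<phi> k) x)
  + LamV \<phi> z x * app (e x) vform + LamT \<phi> z x * e x Ctau" if "x : U" for x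
  using eventually_dom[OF that] by eventually_elim (rule dir_Lam_expansion[OF phi])
qed

lemma dLam'_laurent: "(%z x. dLam' (e x) z x) : laurent"
 by (rule laurent_deriv[OF dir_Lam_laurent])

lemma partial_u_dir_psi_in: "k <= CARD('n) ==> (%x. partial Cu (dir (e x) (psi \<phi> k)) x) : R"
proof (rule expand_in)
 let ?r = "%k z x. fc_rest k z (Vscaled x) (tm x) (psi \<phi> k x) (dir (e x) (psi \<phi> k) x) (app (e x) vform) (e x Ctau) 0 0 (partial Cu (psi \<phi> k) x)"
 show "(%z x. - 2 * of_real pi * \<i> * dir (e x) (Lam z) x - (\<Sum>k\<le>CARD('n). ?r k z x)) : laurent"
  by (intro laurent_diff laurent_sum laurent_mult laurent_const const dir_Lam_laurent fc_rest_laurent psi_in ePsi eV eT partial_u_psi_in; simp)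
 show "\<forall>\<^sub>F z in at 0. (\<Sum>k\<le>CARD('n). fc k z (Vscaled x) (tm x) * partial Cu (dir (e x) (psi \<phi> k)) x)
   = - 2 * of_real pi * \<i> * dir (e x) (Lam z) x - (\<Sum>k\<le>CARD('n). ?r k z x)" if "x : U" for x
  using eventually_dom[OF that]
 proof eventually_elim
  case (elim z)
  show ?case using bil_grad_dir_Lam[OF phi elim, of "%a. dtau a" "e x"] partial_u_dir_Lam[OF elim, of "e x"]
   unfolding bil_dtau_left vform_tau by (simp add: algebra_simps)
 qed
qed

lemma vform_dir_psi_in: "k <= CARD('n) ==> (%x. bil vform (grad (dir (e x) (psi \<phi> k)) x)) : R"
proof (rule expand_in)
 let ?r = "%k z x. fc_rest k z (Vscaled x) (tm x) (psi \<phi> k x) (dir (e x) (psi \<phi> k) x) (app (e x) vform) (e x Ctau)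
  (bil vform (vform :: 'n flat => complex)) 0 (bil (grad (psi \<phi> k) x) vform)"
 let ?F = "%z x. dir (e x) (Lam z) x * (dz 0 Zf (z + Vscaled x) (tm x) - Zf z (tm x)) - dLam' (e x) z x * (1 / of_nat CARD('n))
  + Lam z x * (app (e x) vform * dz 1 Zf (z + Vscaled x) (tm x) + e x Ctau * kappa * dz 1 Nf (z + Vscaled x) (tm x))
  - Lam z x * (kappa * e x Ctau * dz 1 Nf z (tm x)) - (\<Sum>k\<le>CARD('n). ?r k z x)"
 show "?F : laurent"
  by (intro laurent_diff laurent_add laurent_sum laurent_mult laurent_const[OF const] laurent_const[OF eV] laurent_const[OF eT] dir_Lam_laurent dLam'_laurent
    fc_rest_laurent psi_in ePsi eV eT bil_psi_vform_in const Lam_laurent ZfV_laurent Zf_laurent NfV_laurent dz_Nf_laurent; simp)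
 show "\<forall>\<^sub>F z in at 0. (\<Sum>k\<le>CARD('n). fc k z (Vscaled x) (tm x) * bil vform (grad (dir (e x) (psi \<phi> k)) x)) = ?F z x" if "x : U" for x
  using eventually_dom[OF that]
 proof eventually_elim
  case (elim z)
  show ?case using bil_grad_dir_Lam[OF phi elim, of vform "e x"] vform_dir_Lam_series[OF elim, of "e x"]
   unfolding vform_tau dz_0 by (simp add: bil_commute[of vform "grad (psi \<phi> _) x"] algebra_simps)
 qed
qed

text \<open>The first extraction for Hessians. The pairing of \<open>Lam z\<close> with the Hessian
  of \<open>Lam w\<close> has the closed form \<open>Lam_dir_Lam_series\<close>; the terms
  \<open>fc_rest\<close> to be subtracted contain first-order pairings only, among them those of
  \<open>bil_Lam_psi_in\<close>.\<close>

lemma bil_Lam_dir_psi_in: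
 assumes k: "k <= CARD('n)"
 shows "(%p. bil (grad (Lam (snd p)) (fst p)) (grad (dir (e (fst p)) (psi \<phi> k)) (fst p))) : laurent_fun pairs"
proof (rule pair_extract[OF _ _ k])
 let ?r = "%k w p. fc_rest k w (Vscaled (fst p)) (fst p $ Ctau) (psi \<phi> k (fst p)) (dir (e (fst p)) (psi \<phi> k) (fst p)) (app (e (fst p)) vform) (e (fst p) Ctau)
  (Lam (snd p) (fst p) * (dz 0 Zf (snd p + Vscaled (fst p)) (fst p $ Ctau) - Zf (snd p) (fst p $ Ctau)) - Lam' (snd p) (fst p) * (1 / of_nat CARD('n)))
  (- 2 * of_real pi * \<i> * Lam (snd p) (fst p)) (bil (grad (Lam (snd p)) (fst p)) (grad (psi \<phi> k) (fst p)))"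
 let ?F = "%w p. (dz 0 Zf (snd p - w) (fst p $ Ctau) - Zf (snd p) (fst p $ Ctau)) * Lam (snd p) (fst p) * dLam' (e (fst p)) w (fst p)
  - Lam' (snd p) (fst p) * dLam' (e (fst p)) w (fst p) * (1 / of_nat CARD('n))
  - (dz 0 Zf (snd p - w) (fst p $ Ctau) + Zf w (fst p $ Ctau)) * Lam' (snd p) (fst p) * dir (e (fst p)) (Lam w) (fst p)
  + dz 1 Zf (snd p - w) (fst p $ Ctau) * (dir (e (fst p)) (Lam (snd p)) (fst p) * Lam w (fst p) - Lam (snd p) (fst p) * dir (e (fst p)) (Lam w) (fst p))
  - kappa * (dz 1 Nf (snd p - w) (fst p $ Ctau) + dz 1 Nf w (fst p $ Ctau)) * Lam' (snd p) (fst p) * Lam w (fst p) * e (fst p) Ctau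
  - (\<Sum>k\<le>CARD('n). ?r k w p)"
 note z = family_in[OF Lam_laurent] family_in[OF laurent_deriv[OF Lam_laurent]] family_in[OF Zf_laurent] family_in[OF ZfV_laurent[of 0]]
  family_in[OF dir_Lam_laurent] fst_in[OF eT]
 note w = lift[OF Lam_laurent] lift[OF dLam'_laurent] lift[OF dir_Lam_laurent] lift[OF Zf_laurent] lift[OF dz_Nf_laurent]
 have r: "?r k : P.laurent" if "k <= CARD('n)" for k
  by (rule fc_rest_pair_laurent[OF psi_in ePsi eV eT P.diff[OF P.mult[OF z(1) P.diff[OF z(4,3)]] P.mult[OF z(2) P.const]] P.mult[OF P.const z(1)] bil_Lam_psi_in])
   (use that in auto)
 show "?F : P.laurent"
  by (intro P.laurent_diff P.laurent_add P.laurent_sum P.laurent_mult diff_lift w P.laurent_const[OF z(1)] P.laurent_const[OF z(2)] P.laurent_const[OF z(3)]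
    P.laurent_const[OF z(5)] P.laurent_const[OF z(6)] P.laurent_const[OF P.const] r) simp
 show "\<forall>\<^sub>F w in at 0. (\<Sum>k\<le>CARD('n). fc k w (Vscaled (fst p)) (fst p $ Ctau) * bil (grad (Lam (snd p)) (fst p)) (grad (dir (e (fst p)) (psi \<phi> k)) (fst p))) = ?F w p"
  if p: "p : pairs" for p
  using eventually_pair[OF p]
 proof eventually_elim
  case (elim w)
  obtain x z where [simp]: "p = (x, z)" by (cases p)
  have z: "x : Lam_dom z" and w: "x : Lam_dom w" and d: "gpt (z - w) (tm x)" using p elim by (auto simp: pairs_def)
  have v: "Lam z x * (Zf (z + Vscaled x) (tm x) - Zf z (tm x)) - Lam' z x * (1 / of_nat CARD('n)) = bil (grad (Lam z) x) vform"
   "- 2 * of_real pi * \<i> * Lam z x = partial Cu (Lam z) x"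
   using vform_Lam_series[OF z] partial_Lam_u[OF z] by simp_all
  show ?case
   unfolding \<open>p = (x, z)\<close> fst_conv snd_conv dz_0 v
   using bil_grad_dir_Lam[OF phi w, of "grad (Lam z) x" "e x"] unfolding Lam_dir_Lam_series[OF z w d]
   by (simp add: algebra_simps)
 qed
qed

lemma bil_psi_dir_psi_in:
 assumes k: "k <= CARD('n)" and l: "l <= CARD('n)"
 shows "(%x. bil (grad (psi \<phi> k) x) (grad (dir (e x) (psi \<phi> l)) x)) : R"
proof (rule second_extract[OF bil_Lam_dir_psi_in[OF l] _ _ k])
 show "(%z x. LamV \<phi> z x * bil vform (grad (dir (e x) (psi \<phi> l)) x) + LamT \<phi> z x * partial Cu (dir (e x) (psi \<phi> l)) x) : laurent"
  by (intro laurent_add laurent_mult laurent_const LamV_laurent LamT_laurent vform_dir_psi_in partial_u_dir_psi_in l)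
 fix p assume p: "p : pairs"
 obtain x z where [simp]: "p = (x, z)" by (cases p)
 have z: "x : Lam_dom z" using p by (auto simp: pairs_def)
 show "(\<Sum>k\<le>CARD('n). fc k (snd p) (Vscaled (fst p)) (fst p $ Ctau) * bil (grad (psi \<phi> k) (fst p)) (grad (dir (e (fst p)) (psi \<phi> l)) (fst p)))
  = bil (grad (Lam (snd p)) (fst p)) (grad (dir (e (fst p)) (psi \<phi> l)) (fst p)) - (LamV \<phi> (snd p) (fst p) * bil vform (grad (dir (e (fst p)) (psi \<phi> l)) (fst p))
    + LamT \<phi> (snd p) (fst p) * partial Cu (dir (e (fst p)) (psi \<phi> l)) (fst p))"
  using bil_grad_Lam[OF phi z, of "grad (dir (e x) (psi \<phi> l)) x"] by (simp add: algebra_simps)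
qed

end

end

section \<open>The Leibniz rule for gradients and Hessians\<close>

lemma sm_dir: "f : sm W ==> x : W ==> has_partial a (dir e f) (partial a (dir e f) x) x"
proof -
 assume f: "f : sm W" "x : W"
 have "has_partial a (dir e f) (\<Sum>c\<in>UNIV. e c * partial a (partial c f) x) x"
  unfolding dir_def[abs_def] by (intro has_partial_sum has_partial_cmult sm_partials(2)[OF f])
 thus ?thesis using has_partialD by metis
qed

lemma dir_cong:
 assumes "line_open W" "x : W" "!!x. x : W ==> g x = f x" shows "dir e g x = dir e f x"
proof -
 have "partial c g x = partial c f x" for c by (rule partial_cong[OF assms])
 thus ?thesis by (simp add: dir_def)
qed

lemma grad_dir_cong:
 assumes "line_open W" "x : W" "!!x. x : W ==> g x = f x" shows "partial a (dir e g) x = partial a (dir e f) x"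
 by (rule partial_cong[OF assms(1,2) dir_cong[OF assms(1) _ assms(3)]])

lemma dir_add: "f : sm W ==> g : sm W ==> x : W ==> dir e (%x. f x + g x) x = dir e f x + dir e g x"
 unfolding dir_def
 by (simp add: has_partialD[OF has_partial_add[OF sm_partials(1) sm_partials(1)]] ring_distribs sum.distrib)

lemma grad_dir_add:
 "line_open W ==> f : sm W ==> g : sm W ==> x : W ==> partial a (dir e (%x. f x + g x)) x = partial a (dir e f) x + partial a (dir e g) x"
 by (subst partial_cong[OF _ _ dir_add]) (auto intro!: has_partialD has_partial_add sm_dir)

lemma dir_mult: "f : sm W ==> g : sm W ==> x : W ==> dir e (%x. f x * g x) x = dir e f x * g x + f x * dir e g x"
 unfolding dir_def
 by (simp add: has_partialD[OF has_partial_mult[OF sm_partials(1) sm_partials(1)]] ring_distribs sum.distrib sum_distrib_left sum_distrib_right mult_ac)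

lemma grad_dir_mult:
 assumes "line_open W" "f : sm W" "g : sm W" "x : W"
 shows "partial a (dir e (%x. f x * g x)) x = partial a (dir e f) x * g x + dir e f x * partial a g x + (partial a f x * dir e g x + f x * partial a (dir e g) x)"
proof -
 have "partial a (dir e (%x. f x * g x)) x = partial a (%x. dir e f x * g x + f x * dir e g x) x"
  by (rule partial_cong[OF assms(1,4) dir_mult[OF assms(2,3)]])
 also have "... = partial a (dir e f) x * g x + dir e f x * partial a g x + (partial a f x * dir e g x + f x * partial a (dir e g) x)"
  by (intro has_partialD has_partial_add has_partial_mult sm_dir[OF assms(2,4)] sm_dir[OF assms(3,4)] sm_partials(1)[OF assms(2,4)] sm_partials(1)[OF assms(3,4)])
 finally show ?thesis .
qed

text \<open>\<open>q\<close> and \<open>q2\<close> play the roles of the first and second derivative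
  of h with respect to y, given only through the gradients. This form covers reciprocals and
  continuous branches of roots alike.\<close>

lemma has_partial_chain:
 assumes h: "!!x a. x : W ==> has_partial a h (q x * partial a y x) x" and q: "!!x a. x : W ==> has_partial a q (q2 x * partial a y x) x"
  and W: "line_open W" and y: "y : sm W"
 shows "h : sm W" "!!x. x : W ==> dir e h x = q x * dir e y x"
  "!!x. x : W ==> partial a (dir e h) x = q2 x * partial a y x * dir e y x + q x * partial a (dir e y) x"
proof -
 show "h : sm W"
  by (rule smI[OF W, where f'="%a x. q x * partial a y x" and f''="%b a x. q2 x * partial b y x * partial a y x + q x * partial b (partial a y) x"])
   (rule h, assumption, intro has_partial_mult q sm_partials(2)[OF y], assumption+, simp add: sm_sym[OF y])
 show d: "dir e h x = q x * dir e y x" if "x : W" for x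
  unfolding dir_def has_partialD[OF h[OF that]] by (simp add: sum_distrib_left mult_ac)
 show "partial a (dir e h) x = q2 x * partial a y x * dir e y x + q x * partial a (dir e y) x" if "x : W" for x
 proof -
  have "partial a (dir e h) x = partial a (%x. q x * dir e y x) x" by (rule partial_cong[OF W that d])
  also have "... = q2 x * partial a y x * dir e y x + q x * partial a (dir e y) x"
   by (intro has_partialD has_partial_mult q sm_dir[OF y] that)
  finally show ?thesis .
 qed
qed

locale leibniz = function_ring U R for U :: "('n::finite) point set" and R +
 fixes E :: "'g => 'n point => 'n flat => complex"
 assumes lo: "line_open U"
begin

text \<open>The Hessian of a product contains products of first derivatives, so derivatives along
  the fields E must lie in the ring before \<open>compat\<close> can be closed under
  multiplication.\<close>

definition good :: "('n point => complex) => bool" where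
 "good f \<longleftrightarrow> f : sm U & f : R & (\<forall>g. (%x. dir (E g x) f x) : R)"

text \<open>Closure of \<open>compat\<close> under products is the Leibniz rule for the intersection form and its
 Christoffel symbols.\<close>

definition compat :: "('n point => complex) => ('n point => complex) => bool" where
 "compat f s \<longleftrightarrow> (%x. bil (grad f x) (grad s x)) : R & (\<forall>g. (%x. bil (grad f x) (grad (dir (E g x) s) x)) : R)
  & (\<forall>g. (%x. bil (grad s x) (grad (dir (E g x) f) x)) : R)"

lemma compat_sym: "compat f s ==> compat s f"
 unfolding compat_def by (simp add: bil_commute[of "grad f _" "grad s _"])

sublocale S: function_ring U "sm U" by (rule sm_ring[OF lo])

lemma dir_const: "dir e (%x. c) x = 0" "partial a (dir e (%x. c)) x = 0" "partial a (%x. c) x = 0"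
 by (simp_all add: dir_def partial_def)

lemma good_const: "good (%x. c)"
 unfolding good_def dir_const by simp

lemma compat_const: "compat (%x. c) s"
 unfolding compat_def dir_const by (simp add: bil_zero_right bil_commute[of "%a. 0"])

lemma good_add: assumes "good f" "good g" shows "good (%x. f x + g x)"
 using assms unfolding good_def by (auto intro: cong[OF add] dir_add)

lemma compat_add:
 assumes f: "good f" "compat f s" and g: "good g" "compat g s" shows "compat (%x. f x + g x) s"
proof -
 have fg: "f : sm U" "g : sm U" using f g by (auto simp: good_def)
 note p = has_partialD[OF has_partial_add[OF sm_partials(1)[OF fg(1)] sm_partials(1)[OF fg(2)]]]
 show ?thesis unfolding compat_def
 proof (intro conjI allI)
  show "(%x. bil (grad (%x. f x + g x) x) (grad s x)) : R"
   by (rule cong[OF add]) (use f g in \<open>auto simp: compat_def p bil_add_left\<close>)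
  show "(%x. bil (grad (%x. f x + g x) x) (grad (dir (E e x) s) x)) : R" for e
   by (rule cong[OF add[of "%x. bil (grad f x) (grad (dir (E e x) s) x)" "%x. bil (grad g x) (grad (dir (E e x) s) x)"]])
    (use f g in \<open>auto simp: compat_def p bil_add_left\<close>)
  show "(%x. bil (grad s x) (grad (dir (E e x) (%x. f x + g x)) x)) : R" for e
   by (rule cong[OF add[of "%x. bil (grad s x) (grad (dir (E e x) f) x)" "%x. bil (grad s x) (grad (dir (E e x) g) x)"]])
    (use f g in \<open>auto simp: compat_def grad_dir_add[OF lo fg] bil_add_right\<close>)
 qed
qed

lemma good_mult: assumes "good f" "good g" shows "good (%x. f x * g x)"
 using assms unfolding good_def
 by (auto intro: cong[OF add[OF mult mult]] dir_mult)

lemma compat_mult: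
 assumes f: "good f" "compat f s" and g: "good g" "compat g s" shows "compat (%x. f x * g x) s"
proof -
 have fg: "f : sm U" "g : sm U" "f : R" "g : R" "(%x. dir (E e x) f x) : R" "(%x. dir (E e x) g x) : R" for e
  using f g by (auto simp: good_def)
 have c: "(%x. bil (grad f x) (grad s x)) : R" "(%x. bil (grad g x) (grad s x)) : R"
  "(%x. bil (grad f x) (grad (dir (E e x) s) x)) : R" "(%x. bil (grad g x) (grad (dir (E e x) s) x)) : R"
  "(%x. bil (grad s x) (grad (dir (E e x) f) x)) : R" "(%x. bil (grad s x) (grad (dir (E e x) g) x)) : R" for e
  using f g by (auto simp: compat_def)
 have l: "bil (grad (%x. f x * g x) x) q = bil (grad f x) q * g x + f x * bil (grad g x) q" if "x : U" for x q
 proof -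
  have "grad (%x. f x * g x) x = (%a. g x * partial a f x + f x * partial a g x)"
   by (rule ext) (simp add: has_partialD[OF has_partial_mult[OF sm_partials(1)[OF fg(1) that] sm_partials(1)[OF fg(2) that]]] mult.commute)
  thus ?thesis unfolding bil_add_left bil_scale_left by (simp only: bil_add_left bil_scale_left mult.commute)
 qed
 show ?thesis unfolding compat_def
 proof (intro conjI allI)
  show "(%x. bil (grad (%x. f x * g x) x) (grad s x)) : R"
   by (rule cong[OF add[OF mult[OF c(1) fg(4)] mult[OF fg(3) c(2)]]]) (rule l)
  show "(%x. bil (grad (%x. f x * g x) x) (grad (dir (E e x) s) x)) : R" for e
   by (rule cong[OF add[OF mult[OF c(3) fg(4)] mult[OF fg(3) c(4)]]]) (rule l)
  show "(%x. bil (grad s x) (grad (dir (E e x) (%x. f x * g x)) x)) : R" for e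
  proof (rule cong[OF add[OF add[OF mult[OF fg(4) c(5)] mult[OF fg(5) c(2)]] add[OF mult[OF fg(6) c(1)] mult[OF fg(3) c(6)]]]])
   fix x assume x: "x : U"
   have "grad (dir (E e x) (%x. f x * g x)) x = (%a. (g x * partial a (dir (E e x) f) x + dir (E e x) f x * partial a g x)
    + (dir (E e x) g x * partial a f x + f x * partial a (dir (E e x) g) x))"
    by (rule ext) (simp add: grad_dir_mult[OF lo fg(1,2) x] mult_ac)
   thus "bil (grad s x) (grad (dir (E e x) (%x. f x * g x)) x) = g x * bil (grad s x) (grad (dir (E e x) f) x) + dir (E e x) f x * bil (grad g x) (grad s x)
    + (dir (E e x) g x * bil (grad f x) (grad s x) + f x * bil (grad s x) (grad (dir (E e x) g) x))"
    by (simp only: bil_add_right bil_scale_right bil_commute[of "grad s x" "grad g x"] bil_commute[of "grad s x" "grad f x"])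
  qed
 qed
qed

lemma good_cong: assumes f: "good f" and fg: "!!x. x : U ==> g x = f x" shows "good g"
 unfolding good_def
proof (intro conjI allI)
 show "g : sm U" by (rule S.cong) (use f fg in \<open>auto simp: good_def\<close>)
 show "g : R" by (rule cong) (use f fg in \<open>auto simp: good_def\<close>)
 show "(%x. dir (E e x) g x) : R" for e
  by (rule cong[of "%x. dir (E e x) f x"]) (use f dir_cong[OF lo _ fg] in \<open>auto simp: good_def\<close>)
qed

lemma compat_cong: assumes f: "compat f s" and fg: "!!x. x : U ==> g x = f x" shows "compat g s"
 unfolding compat_def
proof (intro conjI allI)
 show "(%x. bil (grad g x) (grad s x)) : R"
  by (rule cong[of "%x. bil (grad f x) (grad s x)"]) (use f partial_cong[OF lo _ fg] in \<open>auto simp: compat_def\<close>)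
 show "(%x. bil (grad g x) (grad (dir (E e x) s) x)) : R" for e
  by (rule cong[of "%x. bil (grad f x) (grad (dir (E e x) s) x)"]) (use f partial_cong[OF lo _ fg] in \<open>auto simp: compat_def\<close>)
 show "(%x. bil (grad s x) (grad (dir (E e x) g) x)) : R" for e
  by (rule cong[of "%x. bil (grad s x) (grad (dir (E e x) f) x)"]) (use f grad_dir_cong[OF lo _ fg] in \<open>auto simp: compat_def\<close>)
qed

lemma good_ring: "function_ring U {f. good f}"
 by unfold_locales (auto intro: good_const good_add good_mult good_cong)

text \<open>As a \<open>function_ring\<close> this set can be substituted in every lemma that is
  stated for an arbitrary ring; in that way the passage between the \<open>\<phi>\<^sub>k\<close>
  and the \<open>t\<^sup>\<alpha>\<close> carries compatibility along.\<close>

lemma compat_ring: "function_ring U {f. good f & (\<forall>s\<in>S. compat f s)}"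
 by unfold_locales (auto intro: good_const good_add good_mult good_cong compat_const compat_add compat_mult compat_cong)

lemma chain:
 assumes h: "!!x a. x : U ==> has_partial a h (q x * partial a y x) x" and q: "!!x a. x : U ==> has_partial a q (q2 x * partial a y x) x"
  and R: "h : R" "q : R" "q2 : R" and y: "good y"
 shows "good h" "compat y s ==> compat h s"
proof -
 have ys: "y : sm U" "(%x. dir (E e x) y x) : R" for e using y by (auto simp: good_def)
 have ch1: "h : sm U" by (rule has_partial_chain(1)[OF h q lo ys(1)])
 have ch2: "dir e h x = q x * dir e y x" if "x : U" for x e by (rule has_partial_chain(2)[OF h q lo ys(1) that])
 have ch3: "partial a (dir e h) x = q2 x * partial a y x * dir e y x + q x * partial a (dir e y) x" if "x : U" for x a e
  by (rule has_partial_chain(3)[OF h q lo ys(1) that])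
 show "good h" unfolding good_def using ch1 R ys by (auto intro: cong[OF mult] ch2)
 assume c: "compat y s"
 have l: "bil (grad h x) p = q x * bil (grad y x) p" if "x : U" for x p
  by (simp only: has_partialD[OF h[OF that]] bil_scale_left)
 show "compat h s" unfolding compat_def
 proof (intro conjI allI)
  show "(%x. bil (grad h x) (grad s x)) : R"
   by (rule cong[OF mult[of q "%x. bil (grad y x) (grad s x)"]]) (use c R l in \<open>auto simp: compat_def\<close>)
  show "(%x. bil (grad h x) (grad (dir (E e x) s) x)) : R" for e
   by (rule cong[OF mult[of q "%x. bil (grad y x) (grad (dir (E e x) s) x)"]]) (use c R l in \<open>auto simp: compat_def\<close>)
  show "(%x. bil (grad s x) (grad (dir (E e x) h) x)) : R" for e
  proof (rule cong[OF add[OF mult[OF mult[of q2 "%x. dir (E e x) y x"]] mult[of q]]])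
   fix x assume x: "x : U"
   have "grad (dir (E e x) h) x = (%a. (q2 x * dir (E e x) y x) * partial a y x + q x * partial a (dir (E e x) y) x)"
    by (rule ext) (simp add: ch3[OF x] mult_ac)
   thus "bil (grad s x) (grad (dir (E e x) h) x) = q2 x * dir (E e x) y x * bil (grad y x) (grad s x) + q x * bil (grad s x) (grad (dir (E e x) y) x)"
    by (simp only: bil_add_right bil_scale_right bil_commute[of "grad s x" "grad y x"])
  qed (use c R ys in \<open>auto simp: compat_def\<close>)
 qed
qed

end

section \<open>The triangular relation between the \<open>\<phi>\<^sub>k\<close> and the
  \<open>t\<^sup>\<alpha>\<close>\<close>

lemma compositions_part_le:
 assumes "is : compositions d s" "i : set is" shows "1 <= i" "i <= s" "d >= 2 ==> i < s"
proof -
 show "1 <= i" using assms by (auto simp: compositions_def)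
 obtain ys zs where yz: "is = ys @ i # zs" using split_list[OF assms(2)] by blast
 have s: "s = sum_list ys + i + sum_list zs" using assms(1) by (simp add: compositions_def yz)
 thus "i <= s" by simp
 \<comment> \<open>A second part leaves strictly less than s for i. With
   \<open>s = n - \<alpha>\<close> the index \<open>n - i\<close> then exceeds
   \<open>\<alpha>\<close>, which makes the relation triangular.\<close>
 assume d: "d >= 2"
 have "length ys + length zs >= 1" using assms(1) d by (simp add: compositions_def yz)
 moreover have "length ys <= sum_list ys" "length zs <= sum_list zs"
  using assms(1) sum_list_mono[of ys "%_. 1" "%i. i"] sum_list_mono[of zs "%_. 1" "%i. i"]
  by (auto simp: compositions_def yz sum_list_triv)
 ultimately show "i < s" using s by linarith
qed

lemma compositions_0: "compositions 0 s = (if s = 0 then {[]} else {})"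
 by (auto simp: compositions_def)

lemma compositions_1: "s >= 1 ==> compositions 1 s = {[s]}"
 by (auto simp: compositions_def length_Suc_conv)

text \<open>The part of \<open>t\<^sup>\<alpha>\<close> that involves only \<open>\<phi>\<^sub>k\<close> with \<open>k > \<alpha>\<close>.\<close>

definition trest :: "(nat => ('n::finite) point => complex) => nat => 'n point => complex" where
 "trest \<phi> \<alpha> x = (\<Sum>d=2..CARD('n) - \<alpha>. (of_nat (CARD('n) + 1 - \<alpha>) / of_nat CARD('n) gchoose d)
  * (\<Sum>is\<in>compositions d (CARD('n) - \<alpha>). \<Prod>i\<leftarrow>is. \<phi> (CARD('n) - i) x * (1 / \<phi> CARD('n) x)))"

lemma tfun_top: "tfun \<phi> r CARD('n) x = of_nat CARD('n) * r x" for x :: "('n::finite) point"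
 by (simp add: tfun_def Let_def compositions_0)

text \<open>The term \<open>d = 0\<close> vanishes because \<open>n - \<alpha> > 0\<close>. The term
  \<open>d = 1\<close> is \<open>\<phi>\<^sub>\<alpha> / \<phi>\<^sub>n\<close> times
  \<open>(n + 1 - \<alpha>) / n\<close>, a factor that cancels the prefactor of
  \<open>t\<^sup>\<alpha>\<close>. The terms with \<open>d >= 2\<close> form
  \<open>trest\<close>.\<close>

lemma tfun_below:
 fixes x :: "('n::finite) point"
 assumes a: "1 <= \<alpha>" "\<alpha> < CARD('n)"
 shows "tfun \<phi> r \<alpha> x = r x ^ (CARD('n) + 1 - \<alpha>) * (\<phi> \<alpha> x * (1 / \<phi> CARD('n) x)
  + of_nat CARD('n) / of_nat (CARD('n) + 1 - \<alpha>) * trest \<phi> \<alpha> x)"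
proof -
 let ?n = "CARD('n)"
 define m where "m = ?n - \<alpha>"
 define e where "e = (of_nat (?n + 1 - \<alpha>) / of_nat ?n :: complex)"
 have m: "m >= 1" "?n - m = \<alpha>" using a by (auto simp: m_def)
 have "?n + 1 - \<alpha> ~= 0" using a by simp
 hence "(of_nat (?n + 1 - \<alpha>) :: complex) ~= 0" by (simp only: of_nat_eq_0_iff not_False_eq_True)
 hence e: "of_nat ?n / of_nat (?n + 1 - \<alpha>) * e = 1" unfolding e_def by (simp del: of_nat_diff)
 define F where "F d = (e gchoose d) * (\<Sum>is\<in>compositions d m. \<Prod>i\<leftarrow>is. \<phi> (?n - i) x / \<phi> ?n x)" for d
 have "(\<Sum>d=0..m. F d) = (\<Sum>d\<le>m. F d)" by (simp add: atMost_atLeast0)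
 also have "... = F 0 + F 1 + (\<Sum>d=2..m. F d)" by (rule sum_split_01[OF m(1)])
 also have "F 0 = 0" using m by (simp add: F_def compositions_0)
 also have "F 1 = e * (\<phi> \<alpha> x * (1 / \<phi> ?n x))"
  unfolding F_def compositions_1[OF m(1)] using m(2) by simp
 also have "(\<Sum>d=2..m. F d) = trest \<phi> \<alpha> x" by (simp add: F_def trest_def m_def e_def)
 finally have S: "(\<Sum>d=0..m. F d) = e * (\<phi> \<alpha> x * (1 / \<phi> ?n x)) + trest \<phi> \<alpha> x" by simp
 have "tfun \<phi> r \<alpha> x = of_nat ?n / of_nat (?n + 1 - \<alpha>) * r x ^ (?n + 1 - \<alpha>) * (\<Sum>d=0..m. F d)"
  using a by (simp add: tfun_def Let_def F_def m_def e_def)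
 also have "... = r x ^ (?n + 1 - \<alpha>) * ((of_nat ?n / of_nat (?n + 1 - \<alpha>) * e) * (\<phi> \<alpha> x * (1 / \<phi> ?n x)) + of_nat ?n / of_nat (?n + 1 - \<alpha>) * trest \<phi> \<alpha> x)"
  unfolding S by (simp only: ring_distribs mult_ac)
 finally show ?thesis unfolding e by simp
qed

context function_ring
begin

lemma prod_list: "(!!i. i : set is ==> f i : R) ==> (%x. \<Prod>i\<leftarrow>is. f i x) : R"
 by (induction "is") auto

end

lemma trest_in:
 fixes \<phi> :: "nat => ('n::finite) point => complex"
 assumes R: "function_ring D R" and p: "!!k. \<alpha> < k ==> k <= CARD('n) ==> \<phi> k : R" and i: "(%x. 1 / \<phi> CARD('n) x) : R"
 shows "(%x. trest \<phi> \<alpha> x) : R"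
proof -
 interpret function_ring D R by (rule R)
 show ?thesis unfolding trest_def
 proof (intro sum mult const prod_list i p)
  fix d "is" j assume "d : {2..CARD('n) - \<alpha>}" "is : compositions d (CARD('n) - \<alpha>)" "j : set is"
  thus "\<alpha> < CARD('n) - j" "CARD('n) - j <= CARD('n)" using compositions_part_le[of "is" d "CARD('n) - \<alpha>" j] by auto
 qed
qed

text \<open>The ring is arbitrary because two different ones are substituted: the twice
  differentiable functions, and the good functions compatible with a fixed partner.\<close>

lemma tfun_in:
 fixes \<phi> :: "nat => ('n::finite) point => complex"
 assumes R: "function_ring D R" and p: "!!k. 1 <= k ==> k <= CARD('n) ==> \<phi> k : R" and i: "(%x. 1 / \<phi> CARD('n) x) : R" and r: "r : R"
  and a: "1 <= \<alpha>" "\<alpha> <= CARD('n)"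
 shows "tfun \<phi> r \<alpha> : R"
proof -
 interpret function_ring D R by (rule R)
 show ?thesis
 proof (cases "\<alpha> = CARD('n)")
  case True
  show ?thesis unfolding True tfun_top[abs_def] by (intro mult const r)
 next
  case False
  hence "\<alpha> < CARD('n)" using a by simp
  from tfun_below[OF a(1) this] have "tfun \<phi> r \<alpha> = (%x. r x ^ (CARD('n) + 1 - \<alpha>) * (\<phi> \<alpha> x * (1 / \<phi> CARD('n) x)
  + of_nat CARD('n) / of_nat (CARD('n) + 1 - \<alpha>) * trest \<phi> \<alpha> x))" by (intro ext)
  moreover have "... : R" by (intro mult add power const r i p trest_in[OF R] a) (use a in auto)
  ultimately show ?thesis by simp
 qed
qed

text \<open>From \<open>t\<^sup>n = n r\<close> come r, its reciprocal and
  \<open>\<phi>\<^sub>n = r\<^sup>n\<close>. The others follow by induction downwards from n: in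
  \<open>tfun_below\<close> the function \<open>\<phi>\<^sub>\<alpha>\<close> occurs linearly with a
  factor whose reciprocal is in the ring, and everything else has a larger index.\<close>

lemma phi_from_t:
 fixes \<phi> :: "nat => ('n::finite) point => complex"
 assumes R: "function_ring D R" and t: "!!\<alpha>. 1 <= \<alpha> ==> \<alpha> <= CARD('n) ==> tfun \<phi> r \<alpha> : R" and it: "(%x. 1 / tfun \<phi> r CARD('n) x) : R"
  and r: "!!x. x : D ==> r x ^ CARD('n) = \<phi> CARD('n) x" and nz: "!!x. x : D ==> \<phi> CARD('n) x ~= 0"
 shows "r : R" "(%x. 1 / \<phi> CARD('n) x) : R" "1 <= k ==> k <= CARD('n) ==> \<phi> k : R"
proof -
 interpret function_ring D R by (rule R)
 have r0: "r x ~= 0" if "x : D" for x using r[OF that] nz[OF that] by (auto simp: power_0_left)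
 have n1: "1 <= CARD('n)" by (simp add: Suc_leI)
 show rR: "r : R"
  by (rule cong[OF divide_const[OF t[OF n1 order_refl], of "of_nat CARD('n)"]]) (simp add: tfun_top)
 have ir: "(%x. 1 / r x) : R"
  by (rule cong[OF mult[OF const[of "of_nat CARD('n)"] it]]) (simp add: tfun_top)
 show ip: "(%x. 1 / \<phi> CARD('n) x) : R"
  by (rule cong[OF power[OF ir, of "CARD('n)"]]) (simp add: power_divide r)
 have pn: "\<phi> CARD('n) : R" by (rule cong[OF power[OF rR, of "CARD('n)"]]) (simp add: r)
 have "\<forall>\<alpha>. 1 <= \<alpha> --> \<alpha> <= CARD('n) --> CARD('n) - \<alpha> = m --> \<phi> \<alpha> : R" for m
 proof (induction m rule: less_induct)
  case (less m)
  show ?case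
  proof (intro allI impI)
   fix \<alpha> assume a: "1 <= \<alpha>" "\<alpha> <= CARD('n)" "CARD('n) - \<alpha> = m"
   show "\<phi> \<alpha> : R"
   proof (cases "\<alpha> = CARD('n)")
    case True
    thus ?thesis using pn by simp
   next
    case False
    hence a': "\<alpha> < CARD('n)" using a by simp
    have IH: "\<phi> j : R" if "\<alpha> < j" "j <= CARD('n)" for j
    proof -
     have "CARD('n) - j < m" "1 <= j" using that a by auto
     thus ?thesis using less.IH that(2) by blast
    qed
    let ?c = "of_nat CARD('n) / of_nat (CARD('n) + 1 - \<alpha>) :: complex"
    have "(%x. \<phi> CARD('n) x * (tfun \<phi> r \<alpha> x * (1 / r x) ^ (CARD('n) + 1 - \<alpha>) - ?c * trest \<phi> \<alpha> x)) : R"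
     by (intro mult diff power const pn ir t a trest_in[OF R] IH ip)
    thus ?thesis
    proof (rule cong)
     fix x assume x: "x : D"
     define s where "s = r x ^ (CARD('n) + 1 - \<alpha>)"
     have s: "s ~= 0" using r0[OF x] by (simp add: s_def)
     have "(1 / r x) ^ (CARD('n) + 1 - \<alpha>) = 1 / s" by (simp add: s_def power_divide)
     thus "\<phi> \<alpha> x = \<phi> CARD('n) x * (tfun \<phi> r \<alpha> x * (1 / r x) ^ (CARD('n) + 1 - \<alpha>) - ?c * trest \<phi> \<alpha> x)"
      unfolding tfun_below[OF a(1) a'] s_def[symmetric] using s nz[OF x] by simp
    qed
   qed
  qed
 qed
 thus "1 <= k ==> k <= CARD('n) ==> \<phi> k : R" by blast
qed

text \<open>In \<open>f s - f a = (g s - g a) * S s\<close> the factor \<open>S\<close> is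
  continuous at a with the nonzero value \<open>n g(a)^(n - 1)\<close>, so the difference quotients
  can be divided. Writing the result as \<open>g / f * D / n\<close> uses \<open>g^n = f\<close> and
  keeps only functions that are known to lie in the ring.\<close>

lemma root_has_derivative:
 fixes f g :: "complex => complex"
 assumes g: "isCont g a" and fg: "\<forall>\<^sub>F s in nhds a. g s ^ n = f s" and f: "(f hfd D) (at a)"
  and nz: "f a ~= 0" and n: "n >= 1"
 shows "(g hfd g a * (1 / f a) * (D / of_nat n)) (at a)"
proof -
 define S where "S s = (\<Sum>i<n. g a ^ (n - Suc i) * g s ^ i)" for s
 have fa: "g a ^ n = f a" using fg by (rule eventually_nhds_x_imp_x)
 have ga: "g a ~= 0" using fa nz n by (auto simp: power_0_left)
 have Sa: "S a = of_nat n * g a ^ (n - 1)"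
  unfolding S_def by (subst sum.cong[OF refl, of _ _ "%_. g a ^ (n - 1)"]) (auto simp flip: power_add)
 hence S0: "S a ~= 0" using ga n by simp
 have St: "(S \<longlongrightarrow> S a) (at a)" unfolding S_def using g by (intro tendsto_intros) (auto simp: isCont_def)
 have "((%s. (f s - f a) / (s - a)) \<longlongrightarrow> D) (at a)" using f by (simp add: has_field_derivative_iff)
 from tendsto_divide[OF this St S0] have "((%s. (f s - f a) / (s - a) / S s) \<longlongrightarrow> D / S a) (at a)" .
 moreover have "\<forall>\<^sub>F s in at a. (f s - f a) / (s - a) / S s = (g s - g a) / (s - a)"
 proof -
  have "\<forall>\<^sub>F s in at a. S s ~= 0" using St S0 by (rule tendsto_imp_eventually_ne)
  moreover have "\<forall>\<^sub>F s in at a. g s ^ n = f s" using fg by (simp add: eventually_nhds_conv_at)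
  ultimately show ?thesis
  proof eventually_elim
   case (elim s)
   have "f s - f a = (g s - g a) * S s"
    unfolding elim(2)[symmetric] fa[symmetric] S_def by (rule power_diff_sumr2)
   thus ?case using elim(1) by simp
  qed
 qed
 ultimately have "((%s. (g s - g a) / (s - a)) \<longlongrightarrow> D / S a) (at a)" by (rule Lim_transform_eventually)
 moreover have "D / S a = g a * (1 / f a) * (D / of_nat n)"
 proof -
  have "g a ^ n = g a * g a ^ (n - 1)" using n by (cases n) auto
  thus ?thesis unfolding Sa fa[symmetric] using ga by simp
 qed
 ultimately show ?thesis by (simp add: has_field_derivative_iff)
qed

lemma has_partial_root:
 fixes r y :: "('n::finite) point => complex"
 assumes U: "open U" "x : U" and r: "continuous_on U r" "!!x. x : U ==> r x ^ n = y x" and y: "has_partial a y D x" "y x ~= 0" and n: "n >= 1"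
 shows "has_partial a r (r x * (1 / y x) * (1 / of_nat n) * D) x"
proof -
 have "isCont (%s. r (upd x a s)) (x $ a)"
 proof -
  have lim: "((%s. upd x a s) \<longlongrightarrow> x) (at (x $ a))"
  proof (rule vec_tendstoI)
   fix c show "((%s. upd x a s $ c) \<longlongrightarrow> x $ c) (at (x $ a))"
    by (cases "c = a") (simp_all add: upd_component)
  qed
  have "isCont r x" using r(1) U continuous_on_eq_continuous_at by blast
  from isCont_tendsto_compose[OF this lim] show ?thesis unfolding isCont_def by simp
 qed
 moreover have "\<forall>\<^sub>F s in nhds (x $ a). r (upd x a s) ^ n = y (upd x a s)"
  using line_openD[OF line_open_open[OF U(1)] U(2), of a] by eventually_elim (rule r(2))
 ultimately have "((%s. r (upd x a s)) hfd r (upd x a (x $ a)) * (1 / y (upd x a (x $ a))) * (D / of_nat n)) (at (x $ a))"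
  using y n unfolding has_partial_def by (intro root_has_derivative) auto
 thus ?thesis unfolding has_partial_def by simp
qed

lemma has_partial_root_factor:
 fixes r y :: "('n::finite) point => complex"
 assumes U: "open U" "x : U" and r: "continuous_on U r" "!!x. x : U ==> r x ^ n = y x" and y: "has_partial a y D x" "y x ~= 0" and n: "n >= 1"
 shows "has_partial a (%x. r x * (1 / y x) * (1 / of_nat n)) (r x * (1 / y x) * (1 / y x) * ((1 / of_nat n) * (1 / of_nat n) - (1 / of_nat n)) * D) x"
 using has_partial_mult[OF has_partial_mult[OF has_partial_root[OF assms] has_partial_inverse[OF y]] has_partial_const[of a "1 / of_nat n" x]]
 by (simp add: algebra_simps power2_eq_square)

context leibniz
begin

lemma inverse:
 assumes y: "good y" and nz: "!!x. x : U ==> y x ~= 0" and R: "(%x. 1 / y x) : R"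
 shows "good (%x. 1 / y x)" "compat y s ==> compat (%x. 1 / y x) s"
proof -
 have ys: "y : sm U" using y by (simp add: good_def)
 have h: "has_partial a (%x. 1 / y x) (- ((1 / y x) * (1 / y x)) * partial a y x) x" if "x : U" for a x
  using has_partial_inverse[OF sm_partials(1)[OF ys that] nz[OF that]] by (simp add: power2_eq_square mult.commute)
 have q: "has_partial a (%x. - ((1 / y x) * (1 / y x))) (2 * ((1 / y x) * (1 / y x) * (1 / y x)) * partial a y x) x" if "x : U" for a x
  using has_partial_cmult[OF has_partial_mult[OF h[OF that] h[OF that]], of a "- 1"] by (simp add: algebra_simps)
 note c = chain[OF h q R _ _ y]
 show "good (%x. 1 / y x)" by (rule c(1)) (assumption | intro uminus mult R const)+
 show "compat y s ==> compat (%x. 1 / y x) s" by (rule c(2)) (assumption | intro uminus mult R const)+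
qed

lemma root:
 assumes U: "open U" and r: "continuous_on U r" "!!x. x : U ==> r x ^ n = y x" and y: "good y" and nz: "!!x. x : U ==> y x ~= 0" and n: "n >= 1"
  and R: "(%x. 1 / y x) : R" "r : R"
 shows "compat y s ==> compat r s"
proof -
 have ys: "y : sm U" using y by (simp add: good_def)
 have h: "has_partial a r (r x * (1 / y x) * (1 / of_nat n) * partial a y x) x" if "x : U" for a x
  by (rule has_partial_root[OF U that r sm_partials(1)[OF ys that] nz[OF that] n])
 have q: "has_partial a (%x. r x * (1 / y x) * (1 / of_nat n)) (r x * (1 / y x) * (1 / y x) * ((1 / of_nat n) * (1 / of_nat n) - (1 / of_nat n)) * partial a y x) x" if "x : U" for a x
  by (rule has_partial_root_factor[OF U that r sm_partials(1)[OF ys that] nz[OF that] n])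
 assume "compat y s"
 thus "compat r s" by (rule chain(2)[OF h q R(2) _ _ y, rotated -1]) (assumption | intro mult R const)+
qed

end

unbundle no fps_syntax

section \<open>Christoffel symbols of a constant metric in new coordinates\<close>

definition basis :: "'n flat => ('n::finite) flat => complex" where
 "basis a b = (if b = a then 1 else 0)"

lemma bil_basis: "bil p q = (\<Sum>a\<in>UNIV. bil p (basis a) * q a)"
proof -
 have "q = (%b. \<Sum>a\<in>UNIV. q a * basis a b)" by (simp add: basis_def fun_eq_iff if_distrib[of "%y. _ * y"] cong: if_cong)
 hence "bil p q = bil p (%b. \<Sum>a\<in>UNIV. q a * basis a b)" by simp
 also have "... = (\<Sum>a\<in>UNIV. bil p (basis a) * q a)" by (simp only: bil_sum_right bil_scale_right mult.commute)
 finally show ?thesis .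
qed

text \<open>\<open>dual a\<close> represents evaluation at \<open>a\<close>: its values are the entries of the inverse of \<open>gstar\<close>.\<close>

definition dual :: "'n flat => ('n::finite) flat => complex" where
 "dual a b = (case (a, b) of (Cv i, Cv j) => if i = j then 2 else 1
  | (Cw, Cw) => - of_nat CARD('n) * (of_nat CARD('n) + 1) | (Cu, Ctau) => 1 | (Ctau, Cu) => 1 | _ => 0)"

lemma dual_sym: "dual a b = dual b a"
 by (auto simp: dual_def split: flat.splits)

lemma bil_dual: "bil p (dual a) = p a" for p :: "('n::finite) flat => complex"
proof -
 have N: "of_nat CARD('n) + 1 ~= (0 :: complex)" "of_nat CARD('n) ~= (0 :: complex)"
  using of_nat_neq_0[of "CARD('n)", where 'a=complex] by (simp_all add: add.commute)
 show ?thesis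
 proof (cases a)
  case (Cv i)
  have "(\<Sum>j\<in>UNIV. p (Cv j) * (if i = j then 2 else 1)) = (\<Sum>j\<in>UNIV. p (Cv j) + (if i = j then p (Cv j) else 0))"
   by (intro sum.cong) auto
  hence 1: "(\<Sum>j\<in>UNIV. p (Cv j) * (if i = j then 2 else 1)) = (\<Sum>j\<in>UNIV. p (Cv j)) + p (Cv i)" by (simp add: sum.distrib)
  have "(\<Sum>j\<in>UNIV. (if i = j then 2 else 1)) = (\<Sum>j\<in>UNIV. 1 + (if i = j then 1 else (0 :: complex)))"
   by (intro sum.cong) auto
  hence 2: "(\<Sum>j\<in>UNIV. (if i = j then 2 else 1)) = of_nat CARD('n) + (1 :: complex)" by (simp add: sum.distrib)
  show ?thesis unfolding bil_explicit Cv using N by (simp add: dual_def 1 2)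
 qed (use N in \<open>simp_all add: bil_explicit dual_def\<close>)
qed

locale coordinates =
 fixes U :: "('n::finite) point set" and X :: "'n coord => 'n point => complex"
 assumes lo: "line_open U" and X: "X \<alpha> : sm U" and inv: "x : U ==> invertible (jac X x)"
begin

abbreviation frame :: "'n coord => 'n point => 'n flat => complex" where
 "frame \<gamma> x a \<equiv> matrix_inv (jac X x) $ a $ \<gamma>"

abbreviation gc :: "'n coord => 'n coord => 'n point => complex" where
 "gc \<alpha> \<beta> x \<equiv> bil (grad (X \<alpha>) x) (grad (X \<beta>) x)"

lemma gcon_eq: "gcon X x $ \<alpha> $ \<beta> = gc \<alpha> \<beta> x"
 by (simp add: gcon_def bil_def)

lemma frame_inverse:
 assumes "x : U"
 shows "(\<Sum>a\<in>UNIV. partial a (X \<alpha>) x * frame \<gamma> x a) = (if \<alpha> = \<gamma> then 1 else 0)"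
  "(\<Sum>\<gamma>\<in>UNIV. frame \<gamma> x a * partial b (X \<gamma>) x) = (if a = b then 1 else 0)"
proof -
 have "jac X x ** matrix_inv (jac X x) = mat 1 & matrix_inv (jac X x) ** jac X x = mat 1"
  unfolding matrix_inv_def by (rule someI_ex) (use inv[OF assms] in \<open>simp add: invertible_def\<close>)
 hence "(jac X x ** matrix_inv (jac X x)) $ \<alpha> $ \<gamma> = mat 1 $ \<alpha> $ \<gamma>" "(matrix_inv (jac X x) ** jac X x) $ a $ b = mat 1 $ a $ b" by simp_all
 thus "(\<Sum>a\<in>UNIV. partial a (X \<alpha>) x * frame \<gamma> x a) = (if \<alpha> = \<gamma> then 1 else 0)"
  "(\<Sum>\<gamma>\<in>UNIV. frame \<gamma> x a * partial b (X \<gamma>) x) = (if a = b then 1 else 0)"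
  by (simp_all add: matrix_matrix_mult_def mat_def jac_def)
qed

lemma sum_bil_frame:
 assumes "x : U" shows "(\<Sum>\<gamma>\<in>UNIV. bil p (grad (X \<gamma>) x) * frame \<gamma> x a) = bil p (basis a)"
proof -
 have "(\<Sum>\<gamma>\<in>UNIV. bil p (grad (X \<gamma>) x) * frame \<gamma> x a) = bil p (%b. \<Sum>\<gamma>\<in>UNIV. frame \<gamma> x a * partial b (X \<gamma>) x)"
  by (simp only: bil_sum_right bil_scale_right) (simp only: mult.commute)
 thus ?thesis unfolding frame_inverse(2)[OF assms] by (simp add: basis_def[abs_def] eq_commute)
qed

text \<open>The inverse \<open>M\<close> is exhibited: it is the metric \<open>dual\<close> of the
  flat coordinates evaluated on the coordinate fields.\<close>

lemma gcon_inverse: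
 assumes x: "x : U"
 shows "gcon X x ** gcov X x = mat 1" "gcov X x ** gcon X x = mat 1" "det (gcon X x) ~= 0"
proof -
 define M :: "complex ^ 'n coord ^ 'n coord" where "M = (\<chi> de \<gamma>. \<Sum>a\<in>UNIV. frame de x a * (\<Sum>b\<in>UNIV. dual a b * frame \<gamma> x b))"
 have key: "(\<Sum>de\<in>UNIV. gc \<alpha> de x * (\<Sum>a\<in>UNIV. frame de x a * (\<Sum>b\<in>UNIV. dual a b * frame \<gamma> x b))) = (if \<alpha> = \<gamma> then 1 else 0)" for \<alpha> \<gamma>
 proof -
  let ?D = "%a. \<Sum>b\<in>UNIV. dual a b * frame \<gamma> x b"
  have "(\<Sum>de\<in>UNIV. gc \<alpha> de x * (\<Sum>a\<in>UNIV. frame de x a * ?D a)) = (\<Sum>de\<in>UNIV. \<Sum>a\<in>UNIV. gc \<alpha> de x * frame de x a * ?D a)"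
   by (simp add: sum_distrib_left mult.assoc)
  also have "... = (\<Sum>a\<in>UNIV. (\<Sum>de\<in>UNIV. gc \<alpha> de x * frame de x a) * ?D a)"
   by (subst sum.swap) (simp only: sum_distrib_right)
  also have "... = (\<Sum>a\<in>UNIV. bil (grad (X \<alpha>) x) (basis a) * ?D a)" by (simp only: sum_bil_frame[OF x])
  also have "... = bil (grad (X \<alpha>) x) ?D" by (rule bil_basis[symmetric])
  also have "bil (grad (X \<alpha>) x) ?D = (\<Sum>b\<in>UNIV. frame \<gamma> x b * partial b (X \<alpha>) x)"
  proof -
   have "?D = (%a. \<Sum>b\<in>UNIV. frame \<gamma> x b * dual b a)" by (rule ext) (simp only: dual_sym mult.commute)
   thus ?thesis
    by (simp only: bil_sum_right bil_scale_right bil_dual)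
  qed
  also have "... = (if \<alpha> = \<gamma> then 1 else 0)" using frame_inverse(1)[OF x, of \<alpha> \<gamma>] by (simp only: mult.commute)
  finally show ?thesis .
 qed
 have "gcon X x ** M = mat 1"
  by (simp only: vec_eq_iff matrix_matrix_mult_def mat_def M_def gcon_eq vec_lambda_beta key) simp
 hence "gcon X x ** M = mat 1" "gcov X x = M" unfolding gcov_def by (auto intro: matrix_inv_eqI)
 thus 1: "gcon X x ** gcov X x = mat 1" by simp
 thus "gcov X x ** gcon X x = mat 1" using matrix_left_right_inverse by blast
 have "det (gcon X x) * det (gcov X x) = 1" using 1 by (metis det_mul det_I)
 thus "det (gcon X x) ~= 0" by auto
qed

lemma gc_gcov:
 assumes x: "x : U"
 shows "(\<Sum>de\<in>UNIV. gc \<alpha> de x * gcov X x $ de $ \<gamma>) = (if \<alpha> = \<gamma> then 1 else 0)"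
  "(\<Sum>de\<in>UNIV. gcov X x $ \<alpha> $ de * gc de \<gamma> x) = (if \<alpha> = \<gamma> then 1 else 0)"
proof -
 have "(gcon X x ** gcov X x) $ \<alpha> $ \<gamma> = mat 1 $ \<alpha> $ \<gamma>" "(gcov X x ** gcon X x) $ \<alpha> $ \<gamma> = mat 1 $ \<alpha> $ \<gamma>"
  using gcon_inverse[OF x] by simp_all
 thus "(\<Sum>de\<in>UNIV. gc \<alpha> de x * gcov X x $ de $ \<gamma>) = (if \<alpha> = \<gamma> then 1 else 0)"
  "(\<Sum>de\<in>UNIV. gcov X x $ \<alpha> $ de * gc de \<gamma> x) = (if \<alpha> = \<gamma> then 1 else 0)"
  by (simp_all add: matrix_matrix_mult_def mat_def gcon_eq)
qed

text \<open>Index raising: the coordinate fields are combinations, with coefficients from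
  \<open>gcov\<close>, of the vectors dual to the gradients of the coordinates.\<close>

lemma frame_eq:
 assumes x: "x : U"
 shows "frame \<gamma> x a = (\<Sum>de\<in>UNIV. bil (grad (X de) x) (basis a) * gcov X x $ de $ \<gamma>)"
proof -
 have "bil (grad (X de) x) (basis a) = (\<Sum>\<epsilon>\<in>UNIV. frame \<epsilon> x a * gc \<epsilon> de x)" for de
  unfolding sum_bil_frame[OF x, symmetric] by (simp only: bil_commute[of "grad (X de) x"] mult.commute)
 hence "(\<Sum>de\<in>UNIV. bil (grad (X de) x) (basis a) * gcov X x $ de $ \<gamma>) = (\<Sum>de\<in>UNIV. \<Sum>\<epsilon>\<in>UNIV. frame \<epsilon> x a * (gc \<epsilon> de x * gcov X x $ de $ \<gamma>))"
  by (simp only: sum_distrib_right mult.assoc)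
 also have "... = (\<Sum>\<epsilon>\<in>UNIV. frame \<epsilon> x a * (\<Sum>de\<in>UNIV. gc \<epsilon> de x * gcov X x $ de $ \<gamma>))"
  by (subst sum.swap) (simp only: sum_distrib_left)
 also have "... = frame \<gamma> x a" unfolding gc_gcov(1)[OF x] by (simp add: if_distrib[of "%y. _ * y"] cong: if_cong)
 finally show ?thesis ..
qed

lemma has_partial_gc:
 assumes x: "x : U"
 shows "has_partial a (gc \<alpha> \<beta>) (bil (%c. partial a (partial c (X \<alpha>)) x) (grad (X \<beta>) x) + bil (grad (X \<alpha>) x) (%c. partial a (partial c (X \<beta>)) x)) x"
proof -
 have "has_partial a (gc \<alpha> \<beta>) (\<Sum>b\<in>UNIV. \<Sum>c\<in>UNIV. (gstar $ b $ c * partial a (partial b (X \<alpha>)) x) * partial c (X \<beta>) x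
  + (gstar $ b $ c * partial b (X \<alpha>) x) * partial a (partial c (X \<beta>)) x) x"
  unfolding bil_def by (intro has_partial_sum has_partial_mult has_partial_cmult sm_partials(2)[OF X x])
 thus ?thesis by (simp add: bil_def sum.distrib)
qed

lemma has_partial_prod: "(!!i. i : I ==> \<exists>D. has_partial a (f i) D x) ==> \<exists>D. has_partial a (%x. \<Prod>i\<in>I. f i x) D x" for f :: "'i => 'n point => complex"
proof (induction I rule: infinite_finite_induct)
 case (insert i I)
 obtain D where D: "has_partial a (f i) D x" using insert.prems by blast
 obtain D' where D': "has_partial a (%x. \<Prod>i\<in>I. f i x) D' x" using insert.IH insert.prems by blast
 note D D'
 from has_partial_mult[OF this] show ?case using insert by auto
qed (auto intro!: exI has_partial_const)

lemma has_partial_det: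
 fixes M :: "'n point => complex ^ 'm ^ 'm"
 assumes "!!i j. \<exists>D. has_partial a (%x. M x $ i $ j) D x"
 shows "\<exists>D. has_partial a (%x. det (M x)) D x"
proof -
 have "\<exists>D. has_partial a (%x. \<Prod>i\<in>UNIV. M x $ i $ p i) D x" for p by (rule has_partial_prod) (rule assms)
 then obtain D where "!!p. has_partial a (%x. \<Prod>i\<in>UNIV. M x $ i $ p i) (D p) x" by metis
 hence "has_partial a (%x. \<Sum>p\<in>{p. p permutes UNIV}. of_int (sign p) * (\<Prod>i\<in>UNIV. M x $ i $ p i)) (\<Sum>p\<in>{p. p permutes UNIV}. of_int (sign p) * D p) x"
  by (intro has_partial_sum has_partial_cmult)
 thus ?thesis unfolding det_def by blast
qed

text \<open>Cramer's rule writes an entry of the inverse as a quotient of determinants, and these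
  are polynomials in the entries of \<open>gcon\<close>.\<close>

lemma pdiff_gcov:
 assumes x: "x : U" shows "has_partial a (%y. gcov X y $ de $ \<gamma>) (partial a (%y. gcov X y $ de $ \<gamma>) x) x"
proof -
 let ?N = "%y. (\<chi> i j. if j = de then (if i = \<gamma> then 1 else 0) else gcon X y $ i $ j) :: complex ^ 'n coord ^ 'n coord"
 have e: "gcov X y $ de $ \<gamma> = det (?N y) * (1 / det (gcon X y))" if y: "y : U" for y
 proof -
  have "gcon X y *v (\<chi> k. gcov X y $ k $ \<gamma>) = (\<chi> i. if i = \<gamma> then 1 else 0)"
   by (simp add: vec_eq_iff matrix_vector_mult_def gcon_eq gc_gcov(1)[OF y])
  hence "(\<chi> k. gcov X y $ k $ \<gamma>) = (\<chi> k. det (\<chi> i j. if j = k then (\<chi> i. if i = \<gamma> then 1 else 0) $ i else gcon X y $ i $ j) / det (gcon X y))"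
   by (simp only: cramer[OF gcon_inverse(3)[OF y]])
  hence "(\<chi> k. gcov X y $ k $ \<gamma>) $ de = (\<chi> k. det (\<chi> i j. if j = k then (\<chi> i. if i = \<gamma> then 1 else 0) $ i else gcon X y $ i $ j) / det (gcon X y)) $ de"
   by (simp only:)
  thus ?thesis by (simp only: vec_lambda_beta times_divide_eq_right mult_1_right)
 qed
 have g: "\<exists>D. has_partial a (%y. gcon X y $ i $ j) D x" for i j unfolding gcon_eq using has_partial_gc[OF x] by blast
 have "\<exists>D. has_partial a (%y. ?N y $ i $ j) D x" for i j
  using g[of i j] has_partial_const by (cases "j = de") auto
 from has_partial_det[OF this] obtain D1 where D1: "has_partial a (%y. det (?N y)) D1 x" by blast
 obtain D2 where D2: "has_partial a (%y. det (gcon X y)) D2 x" using has_partial_det[OF g] by blast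
 note q = has_partial_mult[OF D1 has_partial_inverse[OF D2 gcon_inverse(3)[OF x]]]
 have "\<exists>D. has_partial a (%y. gcov X y $ de $ \<gamma>) D x"
  by (rule exI, rule has_partial_transfer[OF q lo x]) (rule e)
 then obtain D where D: "has_partial a (%y. gcov X y $ de $ \<gamma>) D x" by blast
 show ?thesis using D by (simp only: has_partialD[OF D])
qed

text \<open>The derivative of \<open>gcon ** gcov = mat 1\<close>.\<close>

lemma dcoord_gcov:
 assumes x: "x : U"
 shows "(\<Sum>de\<in>UNIV. gc \<beta> de x * dcoord X \<sigma> (%y. gcov X y $ de $ \<gamma>) x) = - (\<Sum>de\<in>UNIV. dcoord X \<sigma> (gc \<beta> de) x * gcov X x $ de $ \<gamma>)"
proof -
 have 0: "(\<Sum>de\<in>UNIV. partial a (gc \<beta> de) x * gcov X x $ de $ \<gamma> + gc \<beta> de x * partial a (%y. gcov X y $ de $ \<gamma>) x) = 0" for a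
 proof -
  have "partial a (%y. \<Sum>de\<in>UNIV. gc \<beta> de y * gcov X y $ de $ \<gamma>) x = (\<Sum>de\<in>UNIV. partial a (gc \<beta> de) x * gcov X x $ de $ \<gamma> + gc \<beta> de x * partial a (%y. gcov X y $ de $ \<gamma>) x)"
   using has_partial_gc[OF x, THEN has_partialD] has_partial_gc[OF x]
   by (intro has_partialD has_partial_sum has_partial_mult pdiff_gcov[OF x]) simp
  moreover have "partial a (%y. \<Sum>de\<in>UNIV. gc \<beta> de y * gcov X y $ de $ \<gamma>) x = partial a (%y. if \<beta> = \<gamma> then 1 else 0) x"
   by (rule partial_cong[OF lo x gc_gcov(1)])
  ultimately show ?thesis by (simp add: partial_def)
 qed
 have "(\<Sum>de\<in>UNIV. gc \<beta> de x * dcoord X \<sigma> (%y. gcov X y $ de $ \<gamma>) x) + (\<Sum>de\<in>UNIV. dcoord X \<sigma> (gc \<beta> de) x * gcov X x $ de $ \<gamma>)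
  = (\<Sum>de\<in>UNIV. \<Sum>a\<in>UNIV. frame \<sigma> x a * (partial a (gc \<beta> de) x * gcov X x $ de $ \<gamma> + gc \<beta> de x * partial a (%y. gcov X y $ de $ \<gamma>) x))"
  by (simp add: dcoord_def sum_distrib_left sum_distrib_right sum.distrib algebra_simps)
 also have "... = (\<Sum>a\<in>UNIV. frame \<sigma> x a * 0)"
  by (subst sum.swap) (simp only: sum_distrib_left[symmetric] 0)
 finally show ?thesis by (simp add: add_eq_0_iff)
qed

text \<open>The Hessian of \<open>X \<beta>\<close> evaluated on the vectors dual to the gradients
  of \<open>X \<alpha>\<close> and \<open>X de\<close>; hence symmetric in the two outer
  indices.\<close>

definition T :: "'n coord => 'n coord => 'n coord => 'n point => complex" where
 "T \<alpha> \<beta> de x = bil (grad (X \<alpha>) x) (%a. bil (%c. partial a (partial c (X \<beta>)) x) (grad (X de) x))"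

lemma T_expand: "T \<alpha> \<beta> de x = (\<Sum>a\<in>UNIV. \<Sum>c\<in>UNIV. bil (grad (X \<alpha>) x) (basis a) * bil (grad (X de) x) (basis c) * partial a (partial c (X \<beta>)) x)"
proof -
 have "bil (%c. partial a (partial c (X \<beta>)) x) (grad (X de) x) = (\<Sum>c\<in>UNIV. bil (grad (X de) x) (basis c) * partial a (partial c (X \<beta>)) x)" for a
  by (subst bil_commute) (rule bil_basis)
 thus ?thesis unfolding T_def by (subst bil_basis) (simp only: sum_distrib_left mult.assoc)
qed

lemma T_sym:
 assumes "x : U" shows "T \<alpha> \<beta> de x = T de \<beta> \<alpha> x"
 unfolding T_expand by (subst sum.swap) (simp only: sm_sym[OF X assms] mult.commute[of "bil (grad (X \<alpha>) x) _"])

lemma bil_grad_gc: "x : U ==> bil (grad (X \<alpha>) x) (grad (gc \<beta> de) x) = T \<alpha> \<beta> de x + T \<alpha> de \<beta> x"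
 unfolding has_partialD[OF has_partial_gc] bil_add_right T_def by (simp only: bil_commute[of "grad (X \<beta>) x"])

lemma sum_gc_dcoord:
 assumes x: "x : U" shows "(\<Sum>\<sigma>\<in>UNIV. gc \<alpha> \<sigma> x * dcoord X \<sigma> f x) = bil (grad (X \<alpha>) x) (grad f x)"
proof -
 have "(\<Sum>\<sigma>\<in>UNIV. gc \<alpha> \<sigma> x * dcoord X \<sigma> f x) = (\<Sum>\<sigma>\<in>UNIV. \<Sum>a\<in>UNIV. gc \<alpha> \<sigma> x * frame \<sigma> x a * partial a f x)"
  by (simp add: dcoord_def sum_distrib_left mult.assoc)
 also have "... = (\<Sum>a\<in>UNIV. bil (grad (X \<alpha>) x) (basis a) * partial a f x)"
  by (subst sum.swap) (simp only: sum_distrib_right[symmetric] sum_bil_frame[OF x])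
 finally show ?thesis by (simp only: bil_basis[symmetric])
qed

lemma dcoord_frame:
 assumes x: "x : U" shows "dcoord X \<gamma> f x = (\<Sum>de\<in>UNIV. bil (grad (X de) x) (grad f x) * gcov X x $ de $ \<gamma>)"
proof -
 have "dcoord X \<gamma> f x = (\<Sum>a\<in>UNIV. \<Sum>de\<in>UNIV. bil (grad (X de) x) (basis a) * partial a f x * gcov X x $ de $ \<gamma>)"
  unfolding dcoord_def frame_eq[OF x] sum_distrib_right by (simp only: mult_ac)
 also have "... = (\<Sum>de\<in>UNIV. bil (grad (X de) x) (grad f x) * gcov X x $ de $ \<gamma>)"
  by (subst sum.swap) (simp only: sum_distrib_right[symmetric] bil_basis[of _ "grad f x", symmetric])
 finally show ?thesis .
qed

text \<open>The pairing is flat in the original coordinates, so the contravariant Christoffel symbols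
 are given by the second derivatives of the new coordinate functions.\<close>

theorem christoffel_eq:
 assumes x: "x : U"
 shows "christoffel X \<alpha> \<beta> \<gamma> x = bil (grad (X \<alpha>) x) (grad (dir (frame \<gamma> x) (X \<beta>)) x)"
proof -
 let ?G = "gcov X x" and ?d = "%\<sigma> f. dcoord X \<sigma> f x"
 \<comment> \<open>Contraction with \<open>gcon\<close> turns a derivative of \<open>gcov\<close>
   into minus a derivative of \<open>gcon\<close>, and this derivative is a sum of two values of
   \<open>T\<close>. The three terms of the Levi-Civita formula are treated one after the
   other.\<close>
 have t1: "(\<Sum>\<sigma>\<in>UNIV. \<Sum>de\<in>UNIV. gc \<alpha> \<sigma> x * (gc \<beta> de x * ?d \<sigma> (%y. gcov X y $ de $ \<gamma>))) = - (\<Sum>de\<in>UNIV. (T \<alpha> \<beta> de x + T \<alpha> de \<beta> x) * ?G $ de $ \<gamma>)" for \<alpha> \<beta>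
 proof -
  have "(\<Sum>\<sigma>\<in>UNIV. \<Sum>de\<in>UNIV. gc \<alpha> \<sigma> x * (gc \<beta> de x * ?d \<sigma> (%y. gcov X y $ de $ \<gamma>)))
   = - (\<Sum>\<sigma>\<in>UNIV. \<Sum>de\<in>UNIV. gc \<alpha> \<sigma> x * ?d \<sigma> (gc \<beta> de) * ?G $ de $ \<gamma>)"
   by (simp only: sum_distrib_left[symmetric] dcoord_gcov[OF x]) (simp add: sum_negf sum_distrib_left mult.assoc)
  also have "... = - (\<Sum>de\<in>UNIV. bil (grad (X \<alpha>) x) (grad (gc \<beta> de) x) * ?G $ de $ \<gamma>)"
   by (subst sum.swap) (simp only: sum_distrib_right[symmetric] sum_gc_dcoord[OF x])
  finally show ?thesis by (simp only: bil_grad_gc[OF x])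
 qed
 have t2: "(\<Sum>\<sigma>\<in>UNIV. \<Sum>de\<in>UNIV. gc \<alpha> \<sigma> x * (gc \<beta> de x * ?d \<gamma> (%y. gcov X y $ de $ \<sigma>))) = - (\<Sum>de\<in>UNIV. (T de \<alpha> \<beta> x + T de \<beta> \<alpha> x) * ?G $ de $ \<gamma>)"
 proof -
  have "(\<Sum>\<sigma>\<in>UNIV. \<Sum>de\<in>UNIV. gc \<alpha> \<sigma> x * (gc \<beta> de x * ?d \<gamma> (%y. gcov X y $ de $ \<sigma>)))
   = - (\<Sum>\<sigma>\<in>UNIV. \<Sum>de\<in>UNIV. ?d \<gamma> (gc \<beta> de) * (?G $ de $ \<sigma> * gc \<sigma> \<alpha> x))"
  proof -
   have "(\<Sum>\<sigma>\<in>UNIV. \<Sum>de\<in>UNIV. gc \<alpha> \<sigma> x * (gc \<beta> de x * ?d \<gamma> (%y. gcov X y $ de $ \<sigma>)))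
    = (\<Sum>\<sigma>\<in>UNIV. \<Sum>de\<in>UNIV. gc \<sigma> \<alpha> x * (gc \<beta> de x * ?d \<gamma> (%y. gcov X y $ de $ \<sigma>)))"
    by (rule sum.cong[OF refl], rule sum.cong[OF refl], rule arg_cong2[OF bil_commute refl, where f="(*)"])
   thus ?thesis
    by (simp only: sum_distrib_left[symmetric] dcoord_gcov[OF x]) (simp add: sum_negf sum_distrib_left mult_ac)
  qed
  also have "... = - (\<Sum>de\<in>UNIV. ?d \<gamma> (gc \<beta> de) * (if de = \<alpha> then 1 else 0))"
   by (subst sum.swap) (simp only: sum_distrib_left[symmetric] gc_gcov(2)[OF x])
  also have "... = - ?d \<gamma> (gc \<beta> \<alpha>)" by (simp add: if_distrib[of "%y. _ * y"] cong: if_cong)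
  finally show ?thesis unfolding dcoord_frame[OF x] bil_grad_gc[OF x] by (simp add: add.commute)
 qed
 have t3: "(\<Sum>\<sigma>\<in>UNIV. \<Sum>de\<in>UNIV. gc \<alpha> \<sigma> x * (gc \<beta> de x * ?d de (%y. gcov X y $ \<sigma> $ \<gamma>))) = - (\<Sum>de\<in>UNIV. (T \<beta> \<alpha> de x + T \<beta> de \<alpha> x) * ?G $ de $ \<gamma>)"
  unfolding t1[symmetric] by (subst sum.swap) (simp only: mult.left_commute)
 have "christoffel X \<alpha> \<beta> \<gamma> x = - (1/2) * ((\<Sum>\<sigma>\<in>UNIV. \<Sum>de\<in>UNIV. gc \<alpha> \<sigma> x * (gc \<beta> de x * ?d \<sigma> (%y. gcov X y $ de $ \<gamma>)))
  + (\<Sum>\<sigma>\<in>UNIV. \<Sum>de\<in>UNIV. gc \<alpha> \<sigma> x * (gc \<beta> de x * ?d \<gamma> (%y. gcov X y $ de $ \<sigma>)))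
  - (\<Sum>\<sigma>\<in>UNIV. \<Sum>de\<in>UNIV. gc \<alpha> \<sigma> x * (gc \<beta> de x * ?d de (%y. gcov X y $ \<sigma> $ \<gamma>))))"
  unfolding christoffel_def levi_civita_def gcon_eq sum.distrib[symmetric] sum_subtractf[symmetric] sum_distrib_left sum_negf[symmetric]
  by (intro sum.cong refl) (simp add: algebra_simps)
 \<comment> \<open>Six values of \<open>T\<close> are left. By symmetry in the outer indices four of
   them cancel in pairs, and the remaining two are equal, which uses up the factor 1/2.\<close>
 also have "... = (\<Sum>de\<in>UNIV. T \<alpha> \<beta> de x * ?G $ de $ \<gamma>)"
 proof -
  have "1/2 * ((T \<alpha> \<beta> de x + T \<alpha> de \<beta> x) + (T de \<alpha> \<beta> x + T de \<beta> \<alpha> x) - (T \<beta> \<alpha> de x + T \<beta> de \<alpha> x)) = T \<alpha> \<beta> de x" for de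
   using T_sym[OF x, of \<alpha> de \<beta>] T_sym[OF x, of de \<alpha> \<beta>] T_sym[OF x, of de \<beta> \<alpha>] by simp
  hence "(\<Sum>de\<in>UNIV. T \<alpha> \<beta> de x * ?G $ de $ \<gamma>)
   = (\<Sum>de\<in>UNIV. 1/2 * ((T \<alpha> \<beta> de x + T \<alpha> de \<beta> x) + (T de \<alpha> \<beta> x + T de \<beta> \<alpha> x) - (T \<beta> \<alpha> de x + T \<beta> de \<alpha> x)) * ?G $ de $ \<gamma>)" by (simp only:)
  also have "... = 1/2 * ((\<Sum>de\<in>UNIV. (T \<alpha> \<beta> de x + T \<alpha> de \<beta> x) * ?G $ de $ \<gamma>) + (\<Sum>de\<in>UNIV. (T de \<alpha> \<beta> x + T de \<beta> \<alpha> x) * ?G $ de $ \<gamma>)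
   - (\<Sum>de\<in>UNIV. (T \<beta> \<alpha> de x + T \<beta> de \<alpha> x) * ?G $ de $ \<gamma>))"
   by (simp only: sum.distrib[symmetric] sum_subtractf[symmetric] sum_distrib_left) (intro sum.cong refl, simp add: algebra_simps)
  finally have F: "(\<Sum>de\<in>UNIV. T \<alpha> \<beta> de x * ?G $ de $ \<gamma>) = ..." .
  have neg: "- (1/2) * (- A + - B - - C) = 1/2 * (A + B - C)" for A B C :: complex by (simp add: field_simps)
  show ?thesis unfolding t1 t2 t3 F by (rule neg)
 qed
 also have "... = (\<Sum>a\<in>UNIV. \<Sum>c\<in>UNIV. bil (grad (X \<alpha>) x) (basis a) * (frame \<gamma> x c * partial a (partial c (X \<beta>)) x))"
 proof -
  have "(\<Sum>de\<in>UNIV. T \<alpha> \<beta> de x * ?G $ de $ \<gamma>) = (\<Sum>de\<in>UNIV. \<Sum>a\<in>UNIV. \<Sum>c\<in>UNIV. bil (grad (X \<alpha>) x) (basis a) * (bil (grad (X de) x) (basis c) * ?G $ de $ \<gamma> * partial a (partial c (X \<beta>)) x))"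
   unfolding T_expand sum_distrib_right by (simp only: mult_ac)
  also have "... = (\<Sum>a\<in>UNIV. \<Sum>c\<in>UNIV. \<Sum>de\<in>UNIV. bil (grad (X \<alpha>) x) (basis a) * (bil (grad (X de) x) (basis c) * ?G $ de $ \<gamma> * partial a (partial c (X \<beta>)) x))"
   by (subst sum.swap, rule sum.cong[OF refl], rule sum.swap)
  finally show ?thesis unfolding frame_eq[OF x] by (simp only: sum_distrib_left[symmetric] sum_distrib_right[symmetric])
 qed
 also have "... = bil (grad (X \<alpha>) x) (grad (dir (frame \<gamma> x) (X \<beta>)) x)"
 proof -
  have "partial a (dir (frame \<gamma> x) (X \<beta>)) x = (\<Sum>c\<in>UNIV. frame \<gamma> x c * partial a (partial c (X \<beta>)) x)" for a
   unfolding dir_def[abs_def] by (intro has_partialD has_partial_sum has_partial_cmult sm_partials(2)[OF X x])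
  thus ?thesis unfolding bil_basis[of _ "grad (dir (frame \<gamma> x) (X \<beta>)) x"] by (simp only: sum_distrib_left)
 qed
 finally show ?thesis .
qed

end

section \<open>The coordinates t, \<open>v\<^sub>n\<^sub>+\<^sub>1\<close>, \<open>\<tau>\<close>
  and the conclusion\<close>

lemma partial_coord: "partial a (%x. x $ c) x = (if c = a then 1 else 0)"
 by (rule has_partialD[OF has_partial_coord])

lemma dir_coord: "dir e (%x. x $ c) = (%x. e c)"
 by (rule ext) (simp add: dir_def partial_coord if_distrib[of "%y. _ * y"] cong: if_cong)

lemma grad_dir_coord: "partial a (dir e (%x. x $ c)) x = 0"
 unfolding dir_coord by (simp add: partial_def)

lemma grad_w: "grad (%x :: ('n::finite) point. x $ Cw) x = (%a. 1 / of_nat (CARD('n) + 1) * vform a)"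
proof
 fix a
 have "of_nat (CARD('n) + 1) ~= (0 :: complex)" by (simp only: of_nat_eq_0_iff)
 thus "partial a (%x :: 'n point. x $ Cw) x = 1 / of_nat (CARD('n) + 1) * vform a"
  by (simp add: partial_coord vform_def)
qed

lemma grad_tau: "grad (%x :: ('n::finite) point. x $ Ctau) x = (%a. dtau a)"
 by (rule ext) (simp add: partial_coord eq_commute)

lemma app_vform: "app e vform = of_nat (CARD('n) + 1) * e Cw" for e :: "('n::finite) flat => complex"
 by (simp add: app_def vform_def if_distrib[of "%y. _ * y"] cong: if_cong)

theorem lemma1p5:
 fixes num :: "('n::finite) option \<Rightarrow> nat"
  and \<phi> :: "nat \<Rightarrow> 'n point \<Rightarrow> complex"
  and r :: "'n point \<Rightarrow> complex"
  and U :: "'n point set"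
 assumes num: "bij_betw num UNIV {0..CARD('n)}"
  and phi: "phi_identity \<phi>"
  and U: "open U" "U \<subseteq> Omega_reg"
  and branch: "continuous_on U r" "\<And>x. x \<in> U \<Longrightarrow> r x ^ CARD('n) = \<phi> CARD('n) x"
  and nonzero: "\<And>x. x \<in> U \<Longrightarrow> \<phi> CARD('n) x \<noteq> 0"
  and coordinates: "\<And>x. x \<in> U \<Longrightarrow> invertible (jac (tcoord num \<phi> r) x)"
 shows "(\<forall>\<alpha> \<beta>. \<exists>f\<in>Tring \<phi> r. \<forall>x\<in>U. gcon (tcoord num \<phi> r) x $ \<alpha> $ \<beta> = f x)
   \<and> (\<forall>\<alpha> \<beta> \<gamma>. \<exists>f\<in>Tring \<phi> r. \<forall>x\<in>U. christoffel (tcoord num \<phi> r) \<alpha> \<beta> \<gamma> x = f x)"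
proof -
 let ?n = "CARD('n)"
 define X where "X = tcoord num \<phi> r"
 define R where "R = {f. \<exists>g\<in>Tring \<phi> r. \<forall>x\<in>U. f x = g x}"
 have n1: "1 <= ?n" by (simp add: Suc_leI)
 have lo: "line_open U" by (rule line_open_open[OF U(1)])
 have Tring_R: "Tring \<phi> r \<subseteq> R" unfolding R_def by blast
 have Etilde_Tring: "Etilde \<subseteq> Tring \<phi> r" unfolding Tring_def by (auto intro: ring_gen.gen)
 have ring: "function_ring U R" unfolding R_def Tring_def by (rule agree_ring) (use Etilde_Tring in \<open>simp add: Tring_def\<close>)
 interpret F: form_ring U R
  by (rule form_ring.intro[OF ring form_ring_axioms.intro]) (use U(2) Etilde_Tring Tring_R in auto)
 \<comment> \<open>Column \<open>\<gamma>\<close> of the inverse Jacobian is the coordinate field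
   belonging to \<open>X \<gamma>\<close>.\<close>
 define E where "E \<gamma> x a = matrix_inv (jac X x) $ a $ \<gamma>" for \<gamma> x a
 interpret L: leibniz U R E by (rule leibniz.intro[OF ring leibniz_axioms.intro[OF lo]])
 have r0: "r x ~= 0" if "x : U" for x using branch(2)[OF that] nonzero[OF that] by (auto simp: power_0_left)

 have psi_sm: "psi \<phi> k : sm U" if "k <= ?n" for k by (rule sm_mono[OF psi_sm[OF phi that] U(2)])
 have phi_sm: "\<phi> k : sm U" if "1 <= k" "k <= ?n" for k
  using psi_sm[OF that(2)] that(1) by (simp add: psi_def[abs_def])
 have iphi_sm: "(%x. 1 / \<phi> ?n x) : sm U" by (rule sm_inverse[OF lo phi_sm[OF n1 order_refl] nonzero])
 \<comment> \<open>The branch is assumed continuous; that it is twice differentiable follows from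
   \<open>r\<^sup>n = \<phi>\<^sub>n\<close> with \<open>\<phi>\<^sub>n\<close> nonzero.\<close>
 have r_sm: "r : sm U"
 proof (rule has_partial_chain(1)[OF _ _ lo phi_sm[OF n1 order_refl]])
  note y = sm_partials(1)[OF phi_sm[OF n1 order_refl]]
  show "x : U ==> has_partial a r (r x * (1 / \<phi> ?n x) * (1 / of_nat ?n) * partial a (\<phi> ?n) x) x" for a x
   by (rule has_partial_root[OF U(1) _ branch y nonzero n1])
  show "x : U ==> has_partial a (%x. r x * (1 / \<phi> ?n x) * (1 / of_nat ?n))
   (r x * (1 / \<phi> ?n x) * (1 / \<phi> ?n x) * ((1 / of_nat ?n) * (1 / of_nat ?n) - 1 / of_nat ?n) * partial a (\<phi> ?n) x) x" for a x
   by (rule has_partial_root_factor[OF U(1) _ branch y nonzero n1])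
 qed
 have t0: "tfun \<phi> r 0 = psi \<phi> 0" by (rule ext) (simp add: tfun_def psi_def Let_def)
 have t_sm: "tfun \<phi> r \<alpha> : sm U" if "\<alpha> <= ?n" for \<alpha>
  using tfun_in[of U "sm U" \<phi> r \<alpha>, OF sm_ring[OF lo] phi_sm iphi_sm r_sm _ that] psi_sm[of 0] t0 by (cases "\<alpha> = 0") auto
 have num_le: "num i <= ?n" for i using num by (auto simp: bij_betw_def)
 have X_t: "X (XT i) = tfun \<phi> r (num i)" for i by (simp add: X_def tcoord_def[abs_def])
 have X_V: "X XV = (%x. x $ Cw)" and X_Tau: "X XTau = (%x. x $ Ctau)" by (simp_all add: X_def tcoord_def[abs_def])
 have X_sm: "X \<alpha> : sm U" for \<alpha>
  using t_sm[OF num_le] sm_coord[OF lo] by (cases \<alpha>) (simp_all add: X_t X_V X_Tau)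
 interpret C: coordinates U X
  by (rule coordinates.intro[OF lo X_sm]) (use coordinates in \<open>simp add: X_def\<close>)
 have frame: "C.frame \<gamma> x = E \<gamma> x" for \<gamma> x by (rule ext) (simp only: E_def)
 \<comment> \<open>Coordinate fields take the values 0 and 1 on the coordinates. The ring membership
   of all other frame derivatives is derived from these values.\<close>
 have dX: "dir (E \<gamma> x) (X \<alpha>) x = (if \<alpha> = \<gamma> then 1 else 0)" if "x : U" for x \<alpha> \<gamma>
  using C.frame_inverse(1)[OF that, of \<alpha> \<gamma>] by (simp add: dir_def E_def mult.commute)
 have dX_R: "(%x. dir (E \<gamma> x) (X \<alpha>) x) : R" for \<alpha> \<gamma>
  by (rule F.cong[OF F.const[of "if \<alpha> = \<gamma> then 1 else 0"] dX])

 have t_good: "L.good (tfun \<phi> r \<alpha>)" if "\<alpha> <= ?n" for \<alpha>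
 proof -
  have "\<alpha> : range num" using num that by (simp add: bij_betw_def)
  then obtain i where "num i = \<alpha>" by blast
  hence "X (XT i) = tfun \<phi> r \<alpha>" by (simp add: X_t)
  moreover have "tfun \<phi> r \<alpha> : R" using that Tring_R by (auto simp: Tring_def intro!: ring_gen.gen)
  ultimately show ?thesis using dX_R[of _ "XT i"] X_sm[of "XT i"] by (simp add: L.good_def)
 qed
 have it_good: "L.good (%x. 1 / tfun \<phi> r ?n x)"
 proof (rule L.inverse(1)[OF t_good[OF order_refl]])
  show "(%x. 1 / tfun \<phi> r ?n x) : R" using Tring_R by (auto simp: Tring_def intro!: ring_gen.gen)
 qed (simp add: tfun_top r0)
 \<comment> \<open>The Hessian extraction requires the frame derivatives of the
   \<open>\<phi>\<^sub>k\<close>, while only those of the \<open>t\<^sup>\<alpha>\<close> are known.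
   Applying \<open>phi_from_t\<close> over the ring of good functions expresses the
   \<open>\<phi>\<^sub>k\<close> through the \<open>t\<^sup>\<alpha>\<close> and transfers the
   property.\<close>
 have "r : {f. L.good f}"
  by (rule phi_from_t(1)[where D=U and \<phi>=\<phi>, OF L.good_ring]) (use t_good it_good branch(2) nonzero in simp_all)
 moreover have "(%x. 1 / \<phi> ?n x) : {f. L.good f}"
  by (rule phi_from_t(2)[where D=U and r=r, OF L.good_ring]) (use t_good it_good branch(2) nonzero in simp_all)
 moreover have "\<phi> k : {f. L.good f}" if "1 <= k" "k <= ?n" for k
  by (rule phi_from_t(3)[where D=U and r=r, OF L.good_ring]) (use t_good it_good branch(2) nonzero that in simp_all)
 ultimately have from_t: "L.good r" "L.good (%x. 1 / \<phi> ?n x)" "!!k. 1 <= k ==> k <= ?n ==> L.good (\<phi> k)" by simp_all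
 have psi_good: "L.good (psi \<phi> k)" if "k <= ?n" for k
  using from_t(3)[of k] that t_good[of 0] t0 by (cases "k = 0") (simp_all add: psi_def[abs_def])
 have psi_R: "psi \<phi> k : R" "(%x. dir (E \<gamma> x) (psi \<phi> k) x) : R" if "k <= ?n" for k \<gamma>
  using psi_good[OF that] by (auto simp: L.good_def)
 interpret J: jacobi_ring U R \<phi>
  by (rule jacobi_ring.intro[OF F.form_ring_axioms jacobi_ring_axioms.intro[OF phi psi_R(1)]])
 have eV: "(%x. app (E \<gamma> x) vform) : R" for \<gamma>
  using F.mult[OF F.const[of "of_nat (?n + 1)"] dX_R[of \<gamma> XV]] by (simp only: app_vform X_V dir_coord)
 have eT: "(%x. E \<gamma> x Ctau) : R" for \<gamma> using dX_R[of \<gamma> XTau] by (simp only: X_Tau dir_coord)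

 let ?w = "%x :: 'n point. x $ Cw" and ?tau = "%x :: 'n point. x $ Ctau"
 have psi_psi: "L.compat (psi \<phi> k) (psi \<phi> l)" if "k <= ?n" "l <= ?n" for k l
  unfolding L.compat_def using that by (intro conjI allI J.bil_psi_psi_in J.bil_psi_dir_psi_in[OF eV eT psi_R(2)])
 have psi_w: "L.compat (psi \<phi> k) ?w" if "k <= ?n" for k
  unfolding L.compat_def grad_dir_coord grad_w bil_scale_left bil_scale_right bil_zero_right
  using that by (intro conjI allI F.mult F.const J.bil_psi_vform_in J.vform_dir_psi_in[OF eV eT psi_R(2)])
 have psi_tau: "L.compat (psi \<phi> k) ?tau" if "k <= ?n" for k
  unfolding L.compat_def grad_dir_coord grad_tau bil_dtau_left bil_tau bil_zero_right
  using that by (intro conjI allI F.const J.partial_u_psi_in J.partial_u_dir_psi_in[OF eV eT psi_R(2)])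
 have wt: "L.compat ?w ?w" "L.compat ?w ?tau" "L.compat ?tau ?tau"
  unfolding L.compat_def grad_dir_coord grad_tau grad_w bil_zero_right bil_scale_left bil_scale_right by simp_all

 \<comment> \<open>With a fixed partner s, compatibility passes from the
   \<open>\<phi>\<^sub>k\<close> to the \<open>t\<^sup>\<alpha>\<close>. It is applied first with
   the \<open>\<phi>\<^sub>k\<close> as partners, and then, after exchanging the arguments, with the
   \<open>t\<^sup>\<alpha>\<close>.\<close>
 have t_compat: "L.compat (tfun \<phi> r \<alpha>) s" if \<alpha>: "\<alpha> <= ?n" and s: "!!k. k <= ?n ==> L.compat (psi \<phi> k) s" for \<alpha> s
 proof (cases "\<alpha> = 0")
  case True
  thus ?thesis using s[of 0] t0 by simp
 next
  case False
  have phi_s: "L.compat (\<phi> k) s" if "1 <= k" "k <= ?n" for k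
   using s[OF that(2)] that(1) by (simp add: psi_def[abs_def])
  have iphi_R: "(%x. 1 / \<phi> ?n x) : R" and r_R: "r : R" using from_t(1,2) by (auto simp: L.good_def)
  have phi_good: "L.good (\<phi> ?n)" by (rule from_t(3)[OF n1 order_refl])
  have "tfun \<phi> r \<alpha> : {f. L.good f & (\<forall>s\<in>{s}. L.compat f s)}"
  proof (rule tfun_in[of U, OF L.compat_ring _ _ _ _ \<alpha>])
   show "\<phi> k : {f. L.good f & (\<forall>s\<in>{s}. L.compat f s)}" if "1 <= k" "k <= ?n" for k
    using from_t(3)[OF that] phi_s[OF that] by simp
   show "(%x. 1 / \<phi> ?n x) : {f. L.good f & (\<forall>s\<in>{s}. L.compat f s)}"
    using from_t(2) L.inverse(2)[OF phi_good nonzero iphi_R phi_s[OF n1 order_refl]] by simp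
   show "r : {f. L.good f & (\<forall>s\<in>{s}. L.compat f s)}"
    using from_t(1) L.root[OF U(1) branch phi_good nonzero n1 iphi_R r_R phi_s[OF n1 order_refl]] by simp
  qed (use False in simp)
  thus ?thesis by simp
 qed
 have psi_t: "L.compat (psi \<phi> k) (tfun \<phi> r \<alpha>)" if "k <= ?n" "\<alpha> <= ?n" for k \<alpha>
  by (rule L.compat_sym, rule t_compat[OF that(2)]) (rule psi_psi[OF _ that(1)])
 have compat: "L.compat (X \<alpha>) (X \<beta>)" for \<alpha> \<beta>
 proof -
  note tt = t_compat[OF num_le psi_t[OF _ num_le]] and tw = t_compat[OF num_le psi_w] and ttau = t_compat[OF num_le psi_tau]
  show ?thesis
   by (cases \<alpha>; cases \<beta>) (simp_all add: X_t X_V X_Tau tt tw ttau wt L.compat_sym[OF tw] L.compat_sym[OF ttau] L.compat_sym[OF wt(2)])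
 qed
 have "(%x. gcon X x $ \<alpha> $ \<beta>) : R" for \<alpha> \<beta>
  unfolding C.gcon_eq using compat[of \<alpha> \<beta>] by (simp add: L.compat_def)
 moreover have "(%x. christoffel X \<alpha> \<beta> \<gamma> x) : R" for \<alpha> \<beta> \<gamma>
 proof (rule F.cong)
  show "(%x. bil (grad (X \<alpha>) x) (grad (dir (E \<gamma> x) (X \<beta>)) x)) : R" using compat[of \<alpha> \<beta>] by (simp add: L.compat_def)
  show "christoffel X \<alpha> \<beta> \<gamma> x = bil (grad (X \<alpha>) x) (grad (dir (E \<gamma> x) (X \<beta>)) x)" if "x : U" for x
   using C.christoffel_eq[OF that, of \<alpha> \<beta> \<gamma>] unfolding frame .
 qed
 ultimately show ?thesis unfolding R_def X_def[symmetric] mem_Collect_eq by blast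
qed

end
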